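(* Let $\Phi$ be an irreducible root system of exceptional type with simple roots $\Pi$ and positive roots $\Phi^+$, and let $\mathcal{I}$ be an ideal of $\Phi^+$. Then $\mathcal{I}(t)=\prod_{i=1}^{s}(1+t+\cdots+t^{m_i^\mathcal{I}})$, with the possible exception of the case when $\Phi$ is of type $E_8$ and $\mathcal{I}$ is one of $6178$ particular ideals.
   Context: Heights $\mathrm{ht}(\sum_{\alpha\in\Pi}c_\alpha\alpha)=\sum c_\alpha$. An ideal of $\Phi^+$ is $\mathcal{I}\subseteq\Phi^+$ with $\alpha\in\mathcal{I},\beta\in\Phi^+,\alpha+\beta\in\Phi^+\Rightarrow\alpha+\beta\in\mathcal{I}$; $\mathcal{I}^c=\Phi^+\setminus\mathcal{I}$. Ideal exponents: $\lambda_i=|\{\alpha\in\mathcal{I}^c:\mathrm{ht}\alpha=i\}|$, $s=\lambda_1$, $m_i^\mathcal{I}=|\{j:\lambda_j\ge s-i+1\}|$ ($1\le i\le s$). For $R\subseteq\Phi^+$, $S\subseteq R$ is $R$-closed if $\alpha,\beta\in S$, $\alpha+\beta\in R$ imply $\alpha+\beta\in S$; $S\subseteq\mathcal{I}^c$ is of Weyl type for $\mathcal{I}$ if both $S$ and $\mathcal{I}^c\setminus S$ are $\mathcal{I}^c$-closed; the Poincaré polynomial of $\mathcal{I}$ is $\mathcal{I}(t)=\sum_S t^{|S|}$ over all $S$ of Weyl type for $\mathcal{I}$. *)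

theory Defs
  imports "HOL-Analysis.Analysis" "HOL-Computational_Algebra.Polynomial"
begin

definition cartan_number :: "'a::euclidean_space \<Rightarrow> 'a \<Rightarrow> real" where
  "cartan_number \<alpha> \<beta> = 2 * (\<alpha> \<bullet> \<beta>) / (\<beta> \<bullet> \<beta>)"

text \<open>Root systems are crystallographic and reduced, and they span the ambient space.\<close>

definition root_system :: "'a::euclidean_space set \<Rightarrow> bool" where
  "root_system \<Phi> \<longleftrightarrow>
     finite \<Phi> \<and> 0 \<notin> \<Phi> \<and> span \<Phi> = UNIV \<and>
     (\<forall>\<alpha>\<in>\<Phi>. \<forall>\<beta>\<in>\<Phi>. \<beta> - cartan_number \<beta> \<alpha> *\<^sub>R \<alpha> \<in> \<Phi>) \<and>
     (\<forall>\<alpha>\<in>\<Phi>. \<forall>\<beta>\<in>\<Phi>. cartan_number \<beta> \<alpha> \<in> \<int>) \<and>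
     (\<forall>\<alpha>\<in>\<Phi>. \<forall>c. c *\<^sub>R \<alpha> \<in> \<Phi> \<longrightarrow> c = 1 \<or> c = -1)"

definition irreducible_root_system :: "'a::euclidean_space set \<Rightarrow> bool" where
  "irreducible_root_system \<Phi> \<longleftrightarrow>
     root_system \<Phi> \<and> \<Phi> \<noteq> {} \<and>
     \<not> (\<exists>A B. A \<noteq> {} \<and> B \<noteq> {} \<and> A \<union> B = \<Phi> \<and> A \<inter> B = {} \<and> (\<forall>\<alpha>\<in>A. \<forall>\<beta>\<in>B. \<alpha> \<bullet> \<beta> = 0))"

definition simple_roots :: "'a::euclidean_space set \<Rightarrow> 'a set \<Rightarrow> bool" where
  "simple_roots \<Phi> \<Delta> \<longleftrightarrow>
     \<Delta> \<subseteq> \<Phi> \<and> independent \<Delta> \<and> span \<Delta> = UNIV \<and>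
     (\<forall>\<alpha>\<in>\<Phi>. (\<forall>\<beta>\<in>\<Delta>. representation \<Delta> \<alpha> \<beta> \<in> \<int>) \<and>
       ((\<forall>\<beta>\<in>\<Delta>. representation \<Delta> \<alpha> \<beta> \<ge> 0) \<or> (\<forall>\<beta>\<in>\<Delta>. representation \<Delta> \<alpha> \<beta> \<le> 0)))"

definition positive_roots :: "'a::euclidean_space set \<Rightarrow> 'a set \<Rightarrow> 'a set" where
  "positive_roots \<Phi> \<Delta> = {\<alpha>\<in>\<Phi>. \<forall>\<beta>\<in>\<Delta>. representation \<Delta> \<alpha> \<beta> \<ge> 0}"

definition ht :: "'a::euclidean_space set \<Rightarrow> 'a \<Rightarrow> real" where
  "ht \<Delta> \<alpha> = (\<Sum>\<beta>\<in>\<Delta>. representation \<Delta> \<alpha> \<beta>)"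

datatype exceptional_type = E6 | E7 | E8 | F4 | G2

text \<open>Bourbaki's labelling; the entry in row \<open>i\<close> and column \<open>j\<close> is
  \<open>cartan_number \<alpha>\<^sub>i \<alpha>\<^sub>j\<close>. In \<open>F4\<close> the first two simple roots are the long ones,
  in \<open>G2\<close> the second one is.\<close>

fun cartan_matrix :: "exceptional_type \<Rightarrow> int list list" where
  "cartan_matrix E6 =
    [[ 2, 0,-1, 0, 0, 0],
     [ 0, 2, 0,-1, 0, 0],
     [-1, 0, 2,-1, 0, 0],
     [ 0,-1,-1, 2,-1, 0],
     [ 0, 0, 0,-1, 2,-1],
     [ 0, 0, 0, 0,-1, 2]]"
| "cartan_matrix E7 =
    [[ 2, 0,-1, 0, 0, 0, 0],
     [ 0, 2, 0,-1, 0, 0, 0],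
     [-1, 0, 2,-1, 0, 0, 0],
     [ 0,-1,-1, 2,-1, 0, 0],
     [ 0, 0, 0,-1, 2,-1, 0],
     [ 0, 0, 0, 0,-1, 2,-1],
     [ 0, 0, 0, 0, 0,-1, 2]]"
| "cartan_matrix E8 =
    [[ 2, 0,-1, 0, 0, 0, 0, 0],
     [ 0, 2, 0,-1, 0, 0, 0, 0],
     [-1, 0, 2,-1, 0, 0, 0, 0],
     [ 0,-1,-1, 2,-1, 0, 0, 0],
     [ 0, 0, 0,-1, 2,-1, 0, 0],
     [ 0, 0, 0, 0,-1, 2,-1, 0],
     [ 0, 0, 0, 0, 0,-1, 2,-1],
     [ 0, 0, 0, 0, 0, 0,-1, 2]]"
| "cartan_matrix F4 =
    [[ 2,-1, 0, 0],
     [-1, 2,-2, 0],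
     [ 0,-1, 2,-1],
     [ 0, 0,-1, 2]]"
| "cartan_matrix G2 =
    [[ 2,-1],
     [-3, 2]]"

definition of_exceptional_type :: "'a::euclidean_space set \<Rightarrow> exceptional_type \<Rightarrow> bool" where
  "of_exceptional_type \<Delta> X \<longleftrightarrow>
     (\<exists>\<alpha>s. distinct \<alpha>s \<and> set \<alpha>s = \<Delta> \<and> length \<alpha>s = length (cartan_matrix X) \<and>
       (\<forall>i<length \<alpha>s. \<forall>j<length \<alpha>s.
          cartan_number (\<alpha>s ! i) (\<alpha>s ! j) = of_int (cartan_matrix X ! i ! j)))"

text \<open>In what follows \<open>P\<close> is the set of positive roots.\<close>

definition root_ideal :: "'a::euclidean_space set \<Rightarrow> 'a set \<Rightarrow> bool" where
  "root_ideal P I \<longleftrightarrow>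
     I \<subseteq> P \<and> (\<forall>\<alpha>\<in>I. \<forall>\<beta>\<in>P. \<alpha> + \<beta> \<in> P \<longrightarrow> \<alpha> + \<beta> \<in> I)"

definition height_count :: "'a::euclidean_space set \<Rightarrow> 'a set \<Rightarrow> 'a set \<Rightarrow> nat \<Rightarrow> nat" where
  "height_count \<Delta> P I i = card {\<alpha> \<in> P - I. ht \<Delta> \<alpha> = real i}"

text \<open>Meaningful for \<open>1 \<le> i \<le> height_count \<Delta> P I 1\<close>; in that range the subtraction does
  not truncate.\<close>

definition ideal_exponent :: "'a::euclidean_space set \<Rightarrow> 'a set \<Rightarrow> 'a set \<Rightarrow> nat \<Rightarrow> nat" where
  "ideal_exponent \<Delta> P I i =
     card {j. 1 \<le> j \<and> height_count \<Delta> P I j \<ge> height_count \<Delta> P I 1 - i + 1}"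

definition closed_in :: "'a::euclidean_space set \<Rightarrow> 'a set \<Rightarrow> bool" where
  "closed_in R S \<longleftrightarrow>
     S \<subseteq> R \<and> (\<forall>\<alpha>\<in>S. \<forall>\<beta>\<in>S. \<alpha> + \<beta> \<in> R \<longrightarrow> \<alpha> + \<beta> \<in> S)"

definition weyl_type :: "'a::euclidean_space set \<Rightarrow> 'a set \<Rightarrow> 'a set \<Rightarrow> bool" where
  "weyl_type P I S \<longleftrightarrow>
     S \<subseteq> P - I \<and> closed_in (P - I) S \<and> closed_in (P - I) ((P - I) - S)"

definition ideal_poincare :: "'a::euclidean_space set \<Rightarrow> 'a set \<Rightarrow> int poly" where
  "ideal_poincare P I = (\<Sum>S | weyl_type P I S. monom 1 (card S))"

end

(* Passing to complements, an ideal becomes a lower set R of positive roots, and its Poincare polynomial F(R) counts the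
   subsets of R that are closed and coclosed in R. If R0 < R1 < R2 are lower sets, R1 = R0 + {g}, R2 = R1 + {b} with
   b = g + a the reflection of g in a simple root a, and R0 is stable under that reflection, then (1 + t) F(R1) = F(R2) + t F(R0);
   the product over the exponents satisfies the same relation. If the roots of R that involve a simple root d have
   coefficient 1 at d and pairwise differ by roots, then F(R) = F(R - M) (1 + t + ... + t^|M|) for the set M of these roots. If R is
   stable under the simple reflections in J, then F(R) is the product of F of the part of R spanned by J and a polynomial that
   can be evaluated directly. In each exceptional type finitely many applications of these three rules settle all lower sets,
   except those in E8 that contain four particular roots. *)
theory Submission
  imports Defs "HOL-Library.Multiset"
begin

section \<open>Root systems with a base\<close>

text \<open>The Poincare polynomials and the products over the exponents obey the same relations, so
  their difference, the defect, obeys homogeneous linear relations over the integral domain of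
  integer polynomials. Lower sets linked by these relations have defects that are multiples of one
  unknown X, and one direct evaluation at a nonzero multiple forces X = 0. This keeps the
  computation feasible: a whole family of lower sets costs a single evaluation. The coatom rule at a
  simple root is blocked once the layer over it contains two roots whose difference is not a root.
  The four roots of E8 are two such pairs: 1234 and 1345 over \<alpha>_1, with difference \<alpha>_2
  - \<alpha>_5, and 245678 and 345678 over \<alpha>_8, with difference \<alpha>_2 - \<alpha>_3. A
  lower set containing both pairs escapes the rule at \<alpha>_1 and at \<alpha>_8. The constant
  6178 is taken from the statement. Membership in the exceptional set does not mean that the formula
  fails: fewer sets remain unsettled, and the set is filled up to the prescribed size.\<close>

locale based_root_system =
  fixes \<Phi> \<Delta> :: "'a::euclidean_space set"
  assumes root_system: "root_system \<Phi>" and simple: "simple_roots \<Phi> \<Delta>"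
begin

abbreviation P where "P \<equiv> positive_roots \<Phi> \<Delta>"
abbreviation coord where "coord \<equiv> representation \<Delta>"

definition rfl :: "'a \<Rightarrow> 'a \<Rightarrow> 'a" where
  "rfl \<delta> x = x - cartan_number x \<delta> *\<^sub>R \<delta>"

definition le :: "'a \<Rightarrow> 'a \<Rightarrow> bool" where
  "le x y \<longleftrightarrow> (\<forall>\<delta>\<in>\<Delta>. coord x \<delta> \<le> coord y \<delta>)"

text \<open>Complements of ideals in the sense of \<open>root_ideal\<close>, hence phrased with sums
  of positive roots; \<open>lower_le\<close> shows that they are down-sets for the coefficientwise
  root order \<open>le\<close>.\<close>

definition lower :: "'a set \<Rightarrow> bool" where
  "lower R \<longleftrightarrow> R \<subseteq> P \<and> (\<forall>x\<in>P. \<forall>y\<in>P. x + y \<in> R \<longrightarrow> x \<in> R)"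

lemma finite_roots: "finite \<Phi>" and forget_coeffs_not_root: "0 \<notin> \<Phi>"
  using root_system by (auto simp: root_system_def)

lemma finite_P [simp]: "finite P"
  using finite_roots by (auto simp: positive_roots_def)

lemma indep: "independent \<Delta>" and span_simple [simp]: "span \<Delta> = UNIV" and simple_root: "\<Delta> \<subseteq> \<Phi>"
  using simple by (auto simp: simple_roots_def)

lemma finite_simple [simp]: "finite \<Delta>"
  using finite_roots simple_root finite_subset by blast

lemma coord_add: "coord (x + y) \<delta> = coord x \<delta> + coord y \<delta>"
  and coord_diff: "coord (x - y) \<delta> = coord x \<delta> - coord y \<delta>"
  and coord_scale: "coord (a *\<^sub>R x) \<delta> = a * coord x \<delta>"
  and coord_minus: "coord (- x) \<delta> = - coord x \<delta>"
  by (simp_all add: real_vector.representation_add real_vector.representation_diff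
      real_vector.representation_scale real_vector.representation_neg indep)

lemma coord_zero: "coord 0 \<delta> = 0"
  by (simp add: real_vector.representation_zero)

lemma coord_simple: "\<beta> \<in> \<Delta> \<Longrightarrow> coord \<beta> \<delta> = (if \<delta> = \<beta> then 1 else 0)"
  by (simp add: real_vector.representation_basis indep)

lemma sum_coord: "(\<Sum>\<delta>\<in>\<Delta>. coord x \<delta> *\<^sub>R \<delta>) = x"
  by (rule real_vector.sum_representation_eq) (use indep in auto)

lemma coord_eqI: "(\<And>\<delta>. \<delta> \<in> \<Delta> \<Longrightarrow> coord x \<delta> = coord y \<delta>) \<Longrightarrow> x = y"
  by (metis (no_types, lifting) sum.cong sum_coord)

lemma coord_sum: "coord (\<Sum>i\<in>A. f i) \<delta> = (\<Sum>i\<in>A. coord (f i) \<delta>)"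
  by (induction A rule: infinite_finite_induct) (auto simp: coord_zero coord_add)

lemma coord_Ints: "x \<in> \<Phi> \<Longrightarrow> \<delta> \<in> \<Delta> \<Longrightarrow> coord x \<delta> \<in> \<int>"
  using simple by (auto simp: simple_roots_def)

lemma P_root: "x \<in> P \<Longrightarrow> x \<in> \<Phi>"
  by (auto simp: positive_roots_def)

lemma P_coord: "x \<in> P \<Longrightarrow> \<delta> \<in> \<Delta> \<Longrightarrow> coord x \<delta> \<ge> 0"
  by (auto simp: positive_roots_def)

lemma P_coord_pos: "x \<in> P \<Longrightarrow> \<delta> \<in> \<Delta> \<Longrightarrow> coord x \<delta> \<noteq> 0 \<Longrightarrow> coord x \<delta> \<ge> 1"
  using P_coord[of x \<delta>] coord_Ints[OF P_root, of x \<delta>] Ints_nonzero_abs_ge1[of "coord x \<delta>"] by auto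

lemma refl_root: "\<alpha> \<in> \<Phi> \<Longrightarrow> \<beta> \<in> \<Phi> \<Longrightarrow> rfl \<alpha> \<beta> \<in> \<Phi>"
  using root_system by (auto simp: root_system_def rfl_def)

lemma cartan_Ints: "\<alpha> \<in> \<Phi> \<Longrightarrow> \<beta> \<in> \<Phi> \<Longrightarrow> cartan_number \<beta> \<alpha> \<in> \<int>"
  using root_system by (auto simp: root_system_def)

lemma root_multiple: "\<alpha> \<in> \<Phi> \<Longrightarrow> c *\<^sub>R \<alpha> \<in> \<Phi> \<Longrightarrow> c = 1 \<or> c = -1"
  using root_system by (auto simp: root_system_def)

lemma root_nonzero: "\<alpha> \<in> \<Phi> \<Longrightarrow> \<alpha> \<noteq> 0"
  using forget_coeffs_not_root by auto

lemma root_inner_pos: "\<alpha> \<in> \<Phi> \<Longrightarrow> \<alpha> \<bullet> \<alpha> > 0"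
  using root_nonzero by auto

lemma cartan_self: "\<alpha> \<in> \<Phi> \<Longrightarrow> cartan_number \<alpha> \<alpha> = 2"
  using root_nonzero by (auto simp: cartan_number_def)

lemma root_minus: "\<alpha> \<in> \<Phi> \<Longrightarrow> - \<alpha> \<in> \<Phi>"
  using refl_root[of \<alpha> \<alpha>] by (simp add: rfl_def cartan_self scaleR_2)

lemma rfl_rfl: "\<alpha> \<in> \<Phi> \<Longrightarrow> rfl \<alpha> (rfl \<alpha> x) = x"
  using root_nonzero[of \<alpha>]
  by (simp add: rfl_def cartan_number_def inner_diff_left algebra_simps flip: scaleR_left_distrib scaleR_left_diff_distrib)

lemma rfl_add: "rfl \<alpha> (x + y) = rfl \<alpha> x + rfl \<alpha> y"
  by (simp add: rfl_def cartan_number_def inner_add_left algebra_simps add_divide_distrib)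

lemma rfl_self: "\<alpha> \<in> \<Phi> \<Longrightarrow> rfl \<alpha> \<alpha> = - \<alpha>"
  by (simp add: rfl_def cartan_self scaleR_2)

lemma rfl_diff: "rfl \<alpha> (x - y) = rfl \<alpha> x - rfl \<alpha> y"
  by (metis add_diff_cancel_right' diff_add_cancel rfl_add)

lemma rfl_eq_iff: "\<alpha> \<in> \<Phi> \<Longrightarrow> rfl \<alpha> x = rfl \<alpha> y \<longleftrightarrow> x = y"
  by (metis rfl_rfl)

text \<open>Both Cartan numbers are positive integers. If one of them is 1, the difference is up to
  sign the reflection of a root; if both are at least 2, the squared length of the difference is at
  most 0.\<close>

lemma root_diff:
  assumes "\<alpha> \<in> \<Phi>" "\<beta> \<in> \<Phi>" "\<alpha> \<bullet> \<beta> > 0" "\<alpha> \<noteq> \<beta>"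
  shows "\<alpha> - \<beta> \<in> \<Phi>"
proof -
  let ?p = "cartan_number \<alpha> \<beta>" and ?q = "cartan_number \<beta> \<alpha>"
  have a: "\<alpha> \<bullet> \<alpha> > 0" and b: "\<beta> \<bullet> \<beta> > 0"
    using assms root_inner_pos by auto
  have p: "?p > 0" and q: "?q > 0"
    using a b assms by (auto simp: cartan_number_def inner_commute)
  obtain i j where ij: "?p = of_int i" "?q = of_int j"
    using cartan_Ints[OF assms(1,2)] cartan_Ints[OF assms(2,1)] by (elim Ints_cases) auto
  have "i > 0" "j > 0" using p q ij by auto
  consider "i = 1" | "j = 1" | "i \<ge> 2" "j \<ge> 2" using \<open>i > 0\<close> \<open>j > 0\<close> by linarith
  then show ?thesis
  proof cases
    case 1
    then show ?thesis using refl_root[OF assms(2,1)] ij by (simp add: rfl_def)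
  next
    case 2
    then show ?thesis using root_minus[OF refl_root[OF assms(1,2)]] ij by (simp add: rfl_def)
  next
    case 3
    let ?s = "\<alpha> \<bullet> \<beta>"
    have "of_int i * (\<beta> \<bullet> \<beta>) = 2 * ?s" "of_int j * (\<alpha> \<bullet> \<alpha>) = 2 * ?s"
      using a b by (simp_all add: cartan_number_def inner_commute flip: ij)
    moreover have "of_int i * (\<beta> \<bullet> \<beta>) \<ge> 2 * (\<beta> \<bullet> \<beta>)" "of_int j * (\<alpha> \<bullet> \<alpha>) \<ge> 2 * (\<alpha> \<bullet> \<alpha>)"
      using 3 a b by (intro mult_right_mono; simp)+
    ultimately have le: "\<beta> \<bullet> \<beta> \<le> ?s" "\<alpha> \<bullet> \<alpha> \<le> ?s"
      by linarith+
    have "(\<alpha> - \<beta>) \<bullet> (\<alpha> - \<beta>) = \<alpha> \<bullet> \<alpha> + \<beta> \<bullet> \<beta> - 2 * ?s"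
      by (simp add: inner_diff_left inner_diff_right inner_commute)
    then have "(\<alpha> - \<beta>) \<bullet> (\<alpha> - \<beta>) \<le> 0"
      using le by linarith
    then show ?thesis using assms(4) by (metis inner_ge_zero inner_eq_zero_iff order_antisym right_minus_eq)
  qed
qed

lemma root_add:
  assumes "\<alpha> \<in> \<Phi>" "\<beta> \<in> \<Phi>" "\<alpha> \<bullet> \<beta> < 0" "\<alpha> \<noteq> - \<beta>"
  shows "\<alpha> + \<beta> \<in> \<Phi>"
  using root_diff[of \<alpha> "- \<beta>"] assms root_minus by simp

lemma simple_P: "\<delta> \<in> \<Delta> \<Longrightarrow> \<delta> \<in> P"
  using simple_root by (auto simp: positive_roots_def coord_simple)

lemma simple_Phi: "\<delta> \<in> \<Delta> \<Longrightarrow> \<delta> \<in> \<Phi>"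
  using simple_root by auto

lemma root_cases: "x \<in> \<Phi> \<Longrightarrow> x \<in> P \<or> - x \<in> P"
  using simple root_minus[of x] by (auto simp: simple_roots_def positive_roots_def coord_minus)

lemma P_not_minus: "x \<in> P \<Longrightarrow> - x \<notin> P"
proof
  assume x: "x \<in> P" "- x \<in> P"
  have "x = 0"
    by (rule coord_eqI) (use P_coord[OF x(1)] P_coord[OF x(2)] in \<open>fastforce simp: coord_minus coord_zero\<close>)
  then show False using x P_root root_nonzero by blast
qed

lemma P_add: "x \<in> P \<Longrightarrow> y \<in> P \<Longrightarrow> x + y \<in> \<Phi> \<Longrightarrow> x + y \<in> P"
  by (auto simp: positive_roots_def coord_add)

lemma P_nonzero: "x \<in> P \<Longrightarrow> x \<noteq> 0"
  using P_root root_nonzero by blast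

lemma P_coord_one:
  assumes "x \<in> \<Phi>" "\<delta> \<in> \<Delta>" "coord x \<delta> > 0"
  shows "x \<in> P"
  using root_cases[OF assms(1)] P_coord[of "- x" \<delta>] assms by (auto simp: coord_minus)

text \<open>A positive root supported on \<delta> alone is a multiple of \<delta>, hence \<delta>
  itself because the system is reduced. The second coordinate later certifies positivity after x has
  been changed by a multiple of \<delta>.\<close>

lemma P_other_coord:
  assumes "x \<in> P" "\<delta> \<in> \<Delta>" "x \<noteq> \<delta>"
  obtains \<epsilon> where "\<epsilon> \<in> \<Delta>" "\<epsilon> \<noteq> \<delta>" "coord x \<epsilon> > 0"
proof (rule ccontr)
  assume a: "\<not> thesis"
  note obt = that
  have "\<not> coord x \<epsilon> > 0" if "\<epsilon> \<in> \<Delta>" "\<epsilon> \<noteq> \<delta>" for \<epsilon>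
    using a obt that by blast
  then have z: "coord x \<epsilon> = 0" if "\<epsilon> \<in> \<Delta>" "\<epsilon> \<noteq> \<delta>" for \<epsilon>
    using P_coord[OF assms(1) that(1)] that by fastforce
  have x: "x = coord x \<delta> *\<^sub>R \<delta>"
    by (rule coord_eqI) (use z assms(2) in \<open>auto simp: coord_scale coord_simple\<close>)
  then have "coord x \<delta> = 1 \<or> coord x \<delta> = -1"
    using root_multiple[OF simple_Phi[OF assms(2)]] P_root[OF assms(1)] by metis
  then show False
    using x assms P_coord[OF assms(1,2)] by auto
qed

lemma coord_rfl: "\<delta> \<in> \<Delta> \<Longrightarrow> \<epsilon> \<noteq> \<delta> \<Longrightarrow> coord (rfl \<delta> x) \<epsilon> = coord x \<epsilon>"
  by (simp add: rfl_def coord_diff coord_scale coord_simple)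

text \<open>The reflection alters only the coordinate at \<delta>, so a positive coordinate
  elsewhere survives and fixes the sign of the image.\<close>

lemma rfl_P:
  assumes "\<delta> \<in> \<Delta>" "x \<in> P" "x \<noteq> \<delta>"
  shows "rfl \<delta> x \<in> P" "rfl \<delta> x \<noteq> \<delta>"
proof -
  obtain \<epsilon> where e: "\<epsilon> \<in> \<Delta>" "\<epsilon> \<noteq> \<delta>" "coord x \<epsilon> > 0"
    using P_other_coord[of x \<delta>] assms by blast
  show "rfl \<delta> x \<in> P"
    using P_coord_one[OF refl_root[OF simple_Phi P_root] e(1)] assms e coord_rfl by auto
  show "rfl \<delta> x \<noteq> \<delta>"
    using e coord_rfl[of \<delta> \<epsilon> x] assms(1) coord_simple[of \<delta> \<epsilon>] by auto
qed

lemma P_diff_simple: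
  assumes "\<delta> \<in> \<Delta>" "x \<in> P" "x \<noteq> \<delta>" "x - \<delta> \<in> \<Phi>"
  shows "x - \<delta> \<in> P"
proof -
  obtain \<epsilon> where "\<epsilon> \<in> \<Delta>" "\<epsilon> \<noteq> \<delta>" "coord x \<epsilon> > 0"
    using P_other_coord[of x \<delta>] assms by blast
  then show ?thesis
    using P_coord_one[OF assms(4), of \<epsilon>] assms(1) by (auto simp: coord_diff coord_simple)
qed

lemma simple_not_sum:
  assumes "\<delta> \<in> \<Delta>" "x \<in> P" "y \<in> P" shows "x + y \<noteq> \<delta>"
proof
  assume e: "x + y = \<delta>"
  have "x \<noteq> \<delta>" using e P_nonzero[OF assms(3)] by auto
  then obtain \<epsilon> where "\<epsilon> \<in> \<Delta>" "\<epsilon> \<noteq> \<delta>" "coord x \<epsilon> > 0"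
    using P_other_coord[of x \<delta>] assms by blast
  moreover have "coord x \<epsilon> + coord y \<epsilon> = coord \<delta> \<epsilon>" by (simp add: e flip: coord_add)
  ultimately show False using P_coord[OF assms(3), of \<epsilon>] assms(1) by (simp add: coord_simple)
qed

lemma double_not_root: "x \<in> \<Phi> \<Longrightarrow> x + x \<notin> \<Phi>"
  using root_multiple[of x 2] by (auto simp: scaleR_2)

section \<open>Height and the root order\<close>

lemma le_refl [simp]: "le x x" by (simp add: le_def)

lemma le_trans: "le x y \<Longrightarrow> le y z \<Longrightarrow> le x z"
  by (force simp: le_def)

lemma le_add_right: "y \<in> P \<Longrightarrow> le x (x + y)"
  by (auto simp: le_def coord_add P_coord)

lemma ht_add: "ht \<Delta> (x + y) = ht \<Delta> x + ht \<Delta> y"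
  and ht_diff: "ht \<Delta> (x - y) = ht \<Delta> x - ht \<Delta> y"
  by (simp_all add: ht_def coord_add coord_diff sum.distrib sum_subtractf)

lemma ht_simple: "\<delta> \<in> \<Delta> \<Longrightarrow> ht \<Delta> \<delta> = 1"
  by (simp add: ht_def coord_simple)

lemma ht_Ints: "x \<in> \<Phi> \<Longrightarrow> ht \<Delta> x \<in> \<int>"
  by (auto simp: ht_def intro!: Ints_sum coord_Ints)

lemma ht_pos: "x \<in> P \<Longrightarrow> ht \<Delta> x \<ge> 1"
proof -
  assume x: "x \<in> P"
  obtain \<delta> where d: "\<delta> \<in> \<Delta>" "coord x \<delta> \<noteq> 0"
    using coord_eqI[of x 0] P_nonzero[OF x] by (auto simp: coord_zero)
  have "1 \<le> coord x \<delta>" using P_coord_pos x d by auto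
  also have "\<dots> \<le> ht \<Delta> x"
    unfolding ht_def by (rule member_le_sum) (use d x P_coord in auto)
  finally show ?thesis .
qed

lemma ht_natE:
  assumes "x \<in> P" obtains k :: nat where "ht \<Delta> x = real k" "k \<ge> 1"
proof -
  have "ht \<Delta> x \<in> \<int>" "ht \<Delta> x \<ge> 1" using assms ht_Ints P_root ht_pos by auto
  then obtain i where i: "ht \<Delta> x = of_int i" "i \<ge> 1" by (auto elim!: Ints_cases)
  show ?thesis by (rule that[of "nat i"]) (use i in auto)
qed

text \<open>Write d = y - x. As d has positive squared length, some simple root \<delta> with
  positive coefficient in d has positive inner product with d, so y pairs positively or x pairs
  negatively with \<delta>. In the first case y can come down by \<delta>, in the second x can go
  up; which of them occurs cannot be prescribed.\<close>

lemma le_step: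
  assumes "x \<in> P" "y \<in> P" "le x y" "x \<noteq> y"
  obtains (down) \<delta> where "\<delta> \<in> \<Delta>" "coord x \<delta> < coord y \<delta>" "y - \<delta> \<in> P" "le x (y - \<delta>)"
  | (up) \<delta> where "\<delta> \<in> \<Delta>" "coord x \<delta> < coord y \<delta>" "x + \<delta> \<in> P" "le (x + \<delta>) y"
proof -
  let ?d = "y - x"
  have "0 < ?d \<bullet> ?d" using assms(4) by simp
  also have "?d \<bullet> ?d = (\<Sum>\<delta>\<in>\<Delta>. coord ?d \<delta> * (\<delta> \<bullet> ?d))"
    by (subst (1) sum_coord[of ?d, symmetric]) (simp add: inner_sum_left)
  finally obtain \<delta> where d: "\<delta> \<in> \<Delta>" "coord ?d \<delta> * (\<delta> \<bullet> ?d) > 0"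
    by (metis (no_types, lifting) linorder_not_less sum_nonpos)
  have "coord ?d \<delta> \<ge> 0" using assms(3) d(1) by (simp add: le_def coord_diff)
  then have pos: "coord x \<delta> < coord y \<delta>" "\<delta> \<bullet> ?d > 0"
    using d(2) by (auto simp: zero_less_mult_iff coord_diff)
  have int: "coord x \<delta> + 1 \<le> coord y \<delta>"
    using coord_Ints[OF P_root[OF assms(1)] d(1)] coord_Ints[OF P_root[OF assms(2)] d(1)] pos(1)
    by (auto elim!: Ints_cases)
  consider "y \<bullet> \<delta> > 0" | "x \<bullet> \<delta> < 0"
    using pos(2) by (force simp: inner_diff_right inner_commute)
  then show thesis
  proof cases
    case 1
    have "y \<noteq> \<delta>"
    proof
      assume y: "y = \<delta>"
      have "coord x \<epsilon> = 0" if "\<epsilon> \<in> \<Delta>" for \<epsilon>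
        using assms(3) int P_coord[OF assms(1) that] that d(1) y
        by (cases "\<epsilon> = \<delta>") (force simp: le_def coord_simple)+
      then have "x = 0" using coord_eqI[of x 0] by (simp add: coord_zero)
      then show False using P_nonzero assms by blast
    qed
    then have "y - \<delta> \<in> P"
      using P_diff_simple[OF d(1) assms(2)] root_diff[OF P_root simple_Phi 1] assms d(1) by blast
    moreover have "le x (y - \<delta>)"
      using assms(3) int d(1) by (auto simp: le_def coord_diff coord_simple)
    ultimately show thesis using down d(1) pos(1) by blast
  next
    case 2
    have "x \<noteq> - \<delta>" using P_not_minus[of \<delta>] simple_P[OF d(1)] assms(1) by auto
    then have "x + \<delta> \<in> P"
      using P_add[OF assms(1) simple_P[OF d(1)]] root_add[OF P_root simple_Phi 2] assms d(1) by blast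
    moreover have "le (x + \<delta>) y"
      using assms(3) int d(1) by (auto simp: le_def coord_add coord_simple)
    ultimately show thesis using up d(1) pos(1) by blast
  qed
qed

lemma le_ht: "le x y \<Longrightarrow> ht \<Delta> x \<le> ht \<Delta> y"
  by (auto simp: ht_def le_def intro: sum_mono)

text \<open>Induction on the height difference along \<open>le_step\<close>: coming down from y
  stays in R by definition, while going up from x reaches R by induction, and then one simple root
  is removed again.\<close>

lemma lower_le:
  assumes "lower R" "y \<in> R" "x \<in> P" "le x y"
  shows "x \<in> R"
proof -
  have "\<And>x y. x \<in> P \<Longrightarrow> y \<in> R \<Longrightarrow> le x y \<Longrightarrow> ht \<Delta> y - ht \<Delta> x \<le> real k \<Longrightarrow> x \<in> R" for k
  proof (induction k)
    case 0
    then have "x = y" using coord_eqI[of x y] 0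
    proof -
      have "y \<in> P" using 0 assms(1) by (auto simp: lower_def)
      show ?thesis
      proof (rule ccontr)
        assume "x \<noteq> y"
        then consider \<delta> where "\<delta> \<in> \<Delta>" "le x (y - \<delta>)" | \<delta> where "\<delta> \<in> \<Delta>" "le (x + \<delta>) y"
          using le_step[OF 0(1) \<open>y \<in> P\<close> 0(3)] by metis
        then show False
          using le_ht[of x] le_ht[of _ y] 0(4) by cases (fastforce simp: ht_add ht_diff ht_simple)+
      qed
    qed
    then show ?case using 0 by simp
  next
    case (Suc k)
    have y: "y \<in> P" using Suc.prems assms(1) by (auto simp: lower_def)
    show ?case
    proof (cases "x = y")
      case False
      from Suc.prems(1) y Suc.prems(3) False show ?thesis
      proof (cases rule: le_step)
        case (down \<delta>)
        have "y - \<delta> \<in> R"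
          using assms(1) down simple_P[OF down(1)] Suc.prems(2) unfolding lower_def
          by (metis diff_add_cancel)
        then show ?thesis
          using Suc.IH[of x "y - \<delta>"] Suc.prems down by (simp add: ht_diff ht_simple)
      next
        case (up \<delta>)
        have "x + \<delta> \<in> R" using Suc.IH[of "x + \<delta>" y] Suc.prems up by (simp add: ht_add ht_simple)
        then show ?thesis using assms(1) simple_P[OF up(1)] Suc.prems(1) by (auto simp: lower_def)
      qed
    qed (use Suc in simp)
  qed
  moreover obtain k where "ht \<Delta> y - ht \<Delta> x \<le> real k" using real_arch_simple by blast
  ultimately show ?thesis using assms by blast
qed

lemma lower_P: "lower R \<Longrightarrow> x \<in> R \<Longrightarrow> x \<in> P"
  by (auto simp: lower_def)

lemma lower_addD:
  assumes "lower R" "x \<in> P" "y \<in> P" "x + y \<in> R" shows "x \<in> R" "y \<in> R"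
  using assms unfolding lower_def by (blast, metis add.commute)

lemma lower_finite: "lower R \<Longrightarrow> finite R"
  by (auto simp: lower_def intro: finite_subset[OF _ finite_P])

lemma lower_iff_ideal: "R \<subseteq> P \<Longrightarrow> lower R \<longleftrightarrow> root_ideal P (P - R)"
  by (auto simp: lower_def root_ideal_def)

lemma P_minus_simple:
  assumes "x \<in> P" "x \<notin> \<Delta>"
  obtains \<delta> where "\<delta> \<in> \<Delta>" "x - \<delta> \<in> P" "coord x \<delta> > 0" "x \<bullet> \<delta> > 0"
proof -
  have "0 < x \<bullet> x" using P_nonzero[OF assms(1)] by simp
  also have "x \<bullet> x = (\<Sum>\<delta>\<in>\<Delta>. coord x \<delta> * (\<delta> \<bullet> x))"
    by (subst (1) sum_coord[of x, symmetric]) (simp add: inner_sum_left)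
  finally obtain \<delta> where d: "\<delta> \<in> \<Delta>" "coord x \<delta> * (\<delta> \<bullet> x) > 0"
    by (metis (no_types, lifting) linorder_not_less sum_nonpos)
  then have pos: "coord x \<delta> > 0" "x \<bullet> \<delta> > 0"
    using P_coord[OF assms(1) d(1)] by (auto simp: zero_less_mult_iff inner_commute)
  have "x - \<delta> \<in> P"
    using P_diff_simple[OF d(1) assms(1)] root_diff[OF P_root simple_Phi pos(2)] assms d(1) by blast
  then show thesis using that d(1) pos by blast
qed

text \<open>Another walk along \<open>le_step\<close>. Applied between a simple root and a root
  above it, it makes the heights in a layer an interval starting at 1.\<close>

lemma exists_between_ht:
  assumes "x \<in> P" "y \<in> P" "le x y" "ht \<Delta> x \<le> real h" "real h \<le> ht \<Delta> y"
  obtains z where "z \<in> P" "le x z" "le z y" "ht \<Delta> z = real h"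
proof -
  have "\<And>x y. x \<in> P \<Longrightarrow> y \<in> P \<Longrightarrow> le x y \<Longrightarrow> ht \<Delta> x \<le> real h \<Longrightarrow> real h \<le> ht \<Delta> y \<Longrightarrow>
      ht \<Delta> y - ht \<Delta> x \<le> real k \<Longrightarrow> \<exists>z\<in>P. le x z \<and> le z y \<and> ht \<Delta> z = real h" for k
  proof (induction k)
    case 0
    then show ?case by (intro bexI[of _ x]) auto
  next
    case (Suc k)
    show ?case
    proof (cases "ht \<Delta> x = h \<or> ht \<Delta> y = h")
      case True
      then show ?thesis
        using bexI[of _ x P] bexI[of _ y P] Suc.prems(1-3) le_refl by metis
    next
      case False
      then have lt: "ht \<Delta> x + 1 \<le> h" "h + 1 \<le> ht \<Delta> y"
        using Suc.prems(4,5) ht_natE[OF Suc.prems(1)] ht_natE[OF Suc.prems(2)]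
        by (metis Suc_eq_plus1 Suc_leI nat_less_le of_nat_1 of_nat_add of_nat_le_iff)+
      then have "x \<noteq> y" by auto
      from Suc.prems(1-3) this show ?thesis
      proof (cases rule: le_step)
        case (down \<delta>)
        have "le (y - \<delta>) y" using le_add_right[OF simple_P[OF down(1)], of "y - \<delta>"] by simp
        have "\<exists>z\<in>P. le x z \<and> le z (y - \<delta>) \<and> ht \<Delta> z = real h"
          using Suc.IH[of x "y - \<delta>"] Suc.prems down lt by (simp add: ht_diff ht_simple)
        then show ?thesis
          using \<open>le (y - \<delta>) y\<close> le_trans by blast
      next
        case (up \<delta>)
        have "le x (x + \<delta>)" using le_add_right[OF simple_P[OF up(1)]] by simp
        have "\<exists>z\<in>P. le (x + \<delta>) z \<and> le z y \<and> ht \<Delta> z = real h"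
          using Suc.IH[of "x + \<delta>" y] Suc.prems up lt by (simp add: ht_add ht_simple)
        then show ?thesis
          using \<open>le x (x + \<delta>)\<close> le_trans by blast
      qed
    qed
  qed
  moreover obtain k where "ht \<Delta> y - ht \<Delta> x \<le> real k" using real_arch_simple by blast
  ultimately show thesis using assms that by blast
qed

end

section \<open>The modular law\<close>

text \<open>For \<open>R\<close> the set of all positive roots these are the inversion sets of the
  elements of the Weyl group.\<close>

definition compatible :: "'a::euclidean_space set \<Rightarrow> 'a set set" where
  "compatible R = {S. S \<subseteq> R \<and> closed_in R S \<and> closed_in R (R - S)}"

definition poincare :: "'a::euclidean_space set \<Rightarrow> int poly" where
  "poincare R = (\<Sum>S\<in>compatible R. monom 1 (card S))"

lemma ideal_poincare_eq: "ideal_poincare P I = poincare (P - I)"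
  unfolding ideal_poincare_def poincare_def compatible_def weyl_type_def by simp

text \<open>For \<beta> placed on top of a lower set R, a decomposition inside S forces \<beta> into
  every compatible extension of S, and one inside \<open>R - S\<close> forces it out.\<close>

definition forced_in :: "'a::ab_group_add set \<Rightarrow> 'a \<Rightarrow> bool" where
  "forced_in S \<beta> \<longleftrightarrow> (\<exists>x\<in>S. \<exists>y\<in>S. x + y = \<beta>)"

lemma compatibleI:
  assumes "S \<subseteq> R" "\<And>x y. x \<in> S \<Longrightarrow> y \<in> S \<Longrightarrow> x + y \<in> R \<Longrightarrow> x + y \<in> S"
    "\<And>x y. x \<in> R \<Longrightarrow> x \<notin> S \<Longrightarrow> y \<in> R \<Longrightarrow> y \<notin> S \<Longrightarrow> x + y \<in> R \<Longrightarrow> x + y \<notin> S"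
  shows "S \<in> compatible R"
  using assms by (auto simp: compatible_def closed_in_def)

lemma compatibleD:
  assumes "S \<in> compatible R"
  shows "S \<subseteq> R" "\<And>x y. x \<in> S \<Longrightarrow> y \<in> S \<Longrightarrow> x + y \<in> R \<Longrightarrow> x + y \<in> S"
    "\<And>x y. x \<in> R \<Longrightarrow> x \<notin> S \<Longrightarrow> y \<in> R \<Longrightarrow> y \<notin> S \<Longrightarrow> x + y \<in> R \<Longrightarrow> x + y \<notin> S"
  using assms by (auto simp: compatible_def closed_in_def)

lemma compatible_compl: "S \<in> compatible R \<Longrightarrow> R - S \<in> compatible R"
  by (auto simp: compatible_def double_diff)

lemma finite_compatible: "finite R \<Longrightarrow> finite (compatible R)"
  by (rule finite_subset[of _ "Pow R"]) (auto simp: compatible_def)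

lemma compatible_empty: "compatible {} = {{}}"
  by (auto simp: compatible_def closed_in_def)

lemma poincare_empty: "poincare {} = 1"
  by (simp add: poincare_def compatible_empty)

context based_root_system
begin

text \<open>A root added on top of a lower set cannot be forced both into a compatible set and into its
  complement; hence a compatible set extends in one or two ways.\<close>

lemma no_conflict:
  assumes R: "lower R" "\<beta> \<in> P" and S: "S \<in> compatible R"
    and "forced_in S \<beta>" "forced_in (R - S) \<beta>"
  shows False
proof -
  \<comment> \<open>Roots x and z on different sides with positive inner product differ by a root of
    R up to sign. This difference lies on the side of the larger of the two, and moving it across x
    + y = z + w drags w or y to the wrong side.\<close>
  have key: False
    if x: "x \<in> S" "y \<in> S" "z \<in> R - S" "w \<in> R - S" "x + y = \<beta>" "z + w = \<beta>" "x \<bullet> z > 0" for x y z w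
  proof -
    have inR: "x \<in> R" "y \<in> R" "z \<in> R" "w \<in> R" using x compatibleD(1)[OF S] by auto
    note inP = inR[THEN lower_P[OF R(1)]]
    have "x \<noteq> z" using x by auto
    then have "x - z \<in> \<Phi>" using root_diff x(7) inP P_root by blast
    then consider "x - z \<in> P" | "z - x \<in> P" using root_cases[of "x - z"] by auto
    then show False
    proof cases
      case 1
      have u: "x - z \<in> R" using lower_addD(1)[OF R(1) 1 inP(3)] inR by simp
      then have "x - z \<in> S"
        using compatibleD(3)[OF S u _ inR(3)] x inR by auto
      moreover have w: "y + (x - z) = w" using x by (simp add: algebra_simps)
      ultimately have "w \<in> S"
        using compatibleD(2)[OF S x(2), of "x - z"] inR by auto
      then show False using x by auto
    next
      case 2
      have u: "z - x \<in> R" using lower_addD(1)[OF R(1) 2 inP(1)] inR by simp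
      then have "z - x \<notin> S"
        using compatibleD(2)[OF S _ x(1), of "z - x"] x inR by auto
      moreover have w: "w + (z - x) = y" using x by (simp add: algebra_simps)
      ultimately have "y \<notin> S"
        using compatibleD(3)[OF S inR(4) _ u] x inR by auto
      then show False using x by auto
    qed
  qed
  obtain x y z w where x: "x \<in> S" "y \<in> S" "z \<in> R - S" "w \<in> R - S" "x + y = \<beta>" "z + w = \<beta>"
    using assms unfolding forced_in_def by blast
  \<comment> \<open>This is the squared length of \<beta>, so one of the four mixed products is
    positive.\<close>
  have "(x + y) \<bullet> (z + w) > 0" using P_nonzero[OF R(2)] x by simp
  then consider "x \<bullet> z > 0" | "x \<bullet> w > 0" | "y \<bullet> z > 0" | "y \<bullet> w > 0"
    by (simp add: inner_add_left inner_add_right) linarith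
  then show False
    using key[of x y z w] key[of x y w z] key[of y x z w] key[of y x w z] x
    by (metis add.commute)
qed

lemma lower_insert_not_sum:
  assumes "lower R" "\<beta> \<notin> R" "\<beta> \<in> P" "x \<in> insert \<beta> R"
  shows "\<beta> + x \<notin> insert \<beta> R" "x + \<beta> \<notin> insert \<beta> R"
proof -
  have x: "x \<in> P" using assms lower_P by auto
  then have "\<beta> + x \<noteq> \<beta>" using P_nonzero by auto
  moreover have "\<beta> + x \<notin> R" using lower_addD(1)[OF assms(1,3) x] assms(2) by auto
  ultimately show "\<beta> + x \<notin> insert \<beta> R" "x + \<beta> \<notin> insert \<beta> R"
    by (auto simp: add.commute)
qed

text \<open>\<beta> is never a summand within \<open>insert \<beta> R\<close>, so the only new
  conditions concern the decompositions of \<beta> itself.\<close>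

lemma compatible_insert_iff:
  assumes R: "lower R" "\<beta> \<notin> R" "\<beta> \<in> P" and S: "\<beta> \<notin> S"
  shows "S \<in> compatible (insert \<beta> R) \<longleftrightarrow> S \<in> compatible R \<and> \<not> forced_in S \<beta>" (is ?A)
    and "insert \<beta> S \<in> compatible (insert \<beta> R) \<longleftrightarrow> S \<in> compatible R \<and> \<not> forced_in (R - S) \<beta>" (is ?B)
proof -
  note ns = lower_insert_not_sum[OF R]
  show ?A
    unfolding compatible_def closed_in_def forced_in_def using S R(2) ns
    by (auto; metis insertI1 insertI2 Diff_iff insert_iff subset_iff)
  show ?B
    unfolding compatible_def closed_in_def forced_in_def using S R(2) ns
    by (auto; metis insertI1 insertI2 Diff_iff insert_iff subset_iff)
qed

text \<open>The summand \<open>f\<close> is arbitrary because the modular law applies the lemma once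
  more to the weights that \<open>poincare_insert\<close> produces.\<close>

lemma sum_compatible_insert:
  assumes R: "lower R" "\<beta> \<notin> R" "\<beta> \<in> P"
  shows "(\<Sum>S\<in>compatible (insert \<beta> R). f S) = (\<Sum>S\<in>compatible R.
     (if forced_in (R - S) \<beta> then 0 else f (insert \<beta> S)) + (if forced_in S \<beta> then 0 else f S :: int poly))"
proof -
  let ?A = "{S \<in> compatible R. \<not> forced_in (R - S) \<beta>}" and ?B = "{S \<in> compatible R. \<not> forced_in S \<beta>}"
  have nin: "\<beta> \<notin> S" if "S \<in> compatible R" for S
    using that R(2) by (auto simp: compatible_def)
  have "S \<in> compatible (insert \<beta> R) \<longleftrightarrow> S \<in> insert \<beta> ` ?A \<union> ?B" for S
  proof (cases "\<beta> \<in> S")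
    case True
    then have "S = insert \<beta> (S - {\<beta>})" by auto
    then have "S \<in> compatible (insert \<beta> R) \<longleftrightarrow> S - {\<beta>} \<in> ?A"
      using compatible_insert_iff(2)[OF R, of "S - {\<beta>}"] by auto
    also have "\<dots> \<longleftrightarrow> S \<in> insert \<beta> ` ?A"
    proof
      assume "S - {\<beta>} \<in> ?A"
      then show "S \<in> insert \<beta> ` ?A" using \<open>S = insert \<beta> (S - {\<beta>})\<close> by (metis imageI)
    next
      assume "S \<in> insert \<beta> ` ?A"
      then obtain S' where "S' \<in> ?A" "S = insert \<beta> S'" by blast
      then show "S - {\<beta>} \<in> ?A" using nin[of S'] by auto
    qed
    finally show ?thesis using True nin by auto
  next
    case False
    then show ?thesis using compatible_insert_iff(1)[OF R False] by auto
  qed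
  then have eq: "compatible (insert \<beta> R) = insert \<beta> ` ?A \<union> ?B" by blast
  have fin: "finite (compatible R)" using finite_compatible lower_finite R(1) by blast
  have inj: "inj_on (insert \<beta>) ?A"
    by (rule inj_onI) (metis (mono_tags, lifting) insert_ident mem_Collect_eq nin)
  have "(\<Sum>S\<in>compatible (insert \<beta> R). f S) = (\<Sum>S\<in>insert \<beta> ` ?A. f S) + (\<Sum>S\<in>?B. f S)"
    unfolding eq by (rule sum.union_disjoint) (use fin nin in auto)
  also have "(\<Sum>S\<in>insert \<beta> ` ?A. f S) = (\<Sum>S\<in>?A. f (insert \<beta> S))"
    by (rule sum.reindex_cong[OF inj]) auto
  finally show ?thesis
    using fin by (simp add: sum.inter_filter flip: sum.distrib) (auto intro!: sum.cong)
qed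

lemma compatible_card_insert:
  assumes "lower R" "\<beta> \<notin> R" "S \<in> compatible R"
  shows "card (insert \<beta> S) = Suc (card S)"
proof -
  have "S \<subseteq> R" using assms(3) compatibleD(1) by blast
  then show ?thesis using assms(1,2) lower_finite finite_subset by (metis card_insert_disjoint subsetD)
qed

text \<open>When \<open>R\<close> is stable under the simple reflection in \<open>\<alpha>\<close>, flipping matches the compatible sets avoiding
  \<open>\<alpha>\<close> with those containing it, just as left multiplication by a simple reflection does in the Weyl group.\<close>

definition flip :: "'a \<Rightarrow> 'a set \<Rightarrow> 'a set" where
  "flip \<alpha> S = insert \<alpha> (rfl \<alpha> ` S)"

definition stable :: "'a \<Rightarrow> 'a set \<Rightarrow> bool" where
  "stable \<alpha> R \<longleftrightarrow> (\<forall>x\<in>R. x \<noteq> \<alpha> \<longrightarrow> rfl \<alpha> x \<in> R)"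

lemma flip_compatible:
  assumes R: "lower R" "stable \<alpha> R" "\<alpha> \<in> \<Delta>" "\<alpha> \<in> R"
    and S: "S \<in> compatible R" "\<alpha> \<notin> S"
  shows "flip \<alpha> S \<in> compatible R"
proof -
  note aP = simple_P[OF R(3)] and aF = simple_Phi[OF R(3)]
  note rr = rfl_rfl[OF aF]
  have SR: "S \<subseteq> R" using compatibleD(1)[OF S(1)] .
  have RP: "x \<in> P" if "x \<in> R" for x using lower_P R(1) that by blast
  have st: "rfl \<alpha> x \<in> R" "rfl \<alpha> x \<noteq> \<alpha>" if "x \<in> R" "x \<noteq> \<alpha>" for x
    using R(2) that rfl_P(2)[OF R(3) RP] by (auto simp: stable_def)
  have inS: "rfl \<alpha> x \<in> R" "rfl \<alpha> x \<noteq> \<alpha>" "x \<in> R" "x \<in> P" "rfl \<alpha> x \<in> P" if "x \<in> S" for x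
    using st[of x] that SR S(2) RP[of x] RP[of "rfl \<alpha> x"] by auto
  have rs_in: "x \<in> S \<longleftrightarrow> rfl \<alpha> x \<in> flip \<alpha> S" if "x \<in> R" "x \<noteq> \<alpha>" for x
    using st(2)[OF that] rr by (auto simp: flip_def) (metis rr)
  have add: "x + y \<in> R \<longleftrightarrow> rfl \<alpha> (x + y) \<in> R" "x + y \<noteq> \<alpha>" "rfl \<alpha> (x + y) \<noteq> \<alpha>"
    if "rfl \<alpha> x \<in> P" "rfl \<alpha> y \<in> P" "x \<in> P" "y \<in> P" for x y
  proof -
    show 1: "x + y \<noteq> \<alpha>" using simple_not_sum[OF R(3) that(3,4)] .
    show 2: "rfl \<alpha> (x + y) \<noteq> \<alpha>" using simple_not_sum[OF R(3) that(1,2)] by (simp add: rfl_add)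
    show "x + y \<in> R \<longleftrightarrow> rfl \<alpha> (x + y) \<in> R" using st[of "x + y"] st[of "rfl \<alpha> (x + y)"] 1 2 rr by auto
  qed
  \<comment> \<open>The sums not settled by additivity of the reflection are those involving
    \<alpha>. The sum of \<alpha> and the image of x is the image of x - \<alpha>, and x - \<alpha>
    lies in S because x does and \<alpha> does not.\<close>
  have aS: "\<alpha> + rfl \<alpha> x \<in> flip \<alpha> S" if x: "x \<in> S" "\<alpha> + rfl \<alpha> x \<in> R" for x
  proof -
    let ?z = "x - \<alpha>"
    have e: "rfl \<alpha> ?z = \<alpha> + rfl \<alpha> x" by (simp add: rfl_diff rfl_self[OF aF])
    have "\<alpha> + rfl \<alpha> x \<noteq> \<alpha>" using inS[OF x(1)] P_nonzero by auto
    then have z: "?z \<in> R" "?z \<noteq> \<alpha>" using st[OF x(2)] rr[of ?z] e by auto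
    have "?z \<in> S"
      using compatibleD(3)[OF S(1) z(1) _ R(4) S(2)] x inS(3) by auto
    then show ?thesis using rs_in[OF z] e by simp
  qed
  show ?thesis
  proof (rule compatibleI)
    show "flip \<alpha> S \<subseteq> R" using inS R(4) by (auto simp: flip_def)
  next
    fix x y assume xy: "x \<in> flip \<alpha> S" "y \<in> flip \<alpha> S" "x + y \<in> R"
    consider x' y' where "x' \<in> S" "y' \<in> S" "x = rfl \<alpha> x'" "y = rfl \<alpha> y'"
      | y' where "x = \<alpha>" "y' \<in> S" "y = rfl \<alpha> y'" | x' where "y = \<alpha>" "x' \<in> S" "x = rfl \<alpha> x'"
      | "x = \<alpha>" "y = \<alpha>"
      using xy(1,2) by (auto simp: flip_def)
    then show "x + y \<in> flip \<alpha> S"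
    proof cases
      case 1
      then have a: "x' + y' \<in> R" "x' + y' \<noteq> \<alpha>"
        using add[of x' y'] inS[of x'] inS[of y'] xy(3) by (auto simp: rfl_add)
      then have "x' + y' \<in> S" using compatibleD(2)[OF S(1)] 1 by blast
      then show ?thesis using 1 by (auto simp: flip_def simp flip: rfl_add)
    next
      case 2
      then show ?thesis using aS xy(3) by auto
    next
      case 3
      then show ?thesis using aS[of x'] xy(3) by (auto simp: add.commute)
    next
      case 4
      then show ?thesis using double_not_root[OF aF] xy(3) RP P_root by auto
    qed
  next
    fix x y assume xy: "x \<in> R" "x \<notin> flip \<alpha> S" "y \<in> R" "y \<notin> flip \<alpha> S" "x + y \<in> R"
    have ne: "x \<noteq> \<alpha>" "y \<noteq> \<alpha>" using xy by (auto simp: flip_def)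
    have ns: "rfl \<alpha> x \<in> R" "rfl \<alpha> x \<notin> S" "rfl \<alpha> y \<in> R" "rfl \<alpha> y \<notin> S"
      using st ne xy rr by (auto simp: flip_def) (metis imageI)+
    have a: "rfl \<alpha> (x + y) \<in> R" "x + y \<noteq> \<alpha>"
      using add[of x y] RP ns xy by auto
    then have "rfl \<alpha> (x + y) \<notin> S" using compatibleD(3)[OF S(1) ns] by (simp add: rfl_add)
    then show "x + y \<notin> flip \<alpha> S" using a rr by (auto simp: flip_def)
  qed
qed

lemma sum_compatible_flip:
  assumes R: "lower R" "stable \<alpha> R" "\<alpha> \<in> \<Delta>" "\<alpha> \<in> R"
  shows "(\<Sum>S\<in>compatible R. f S :: int poly) = (\<Sum>S\<in>{S\<in>compatible R. \<alpha> \<notin> S}. f S + f (flip \<alpha> S))"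
    and "bij_betw (flip \<alpha>) {S\<in>compatible R. \<alpha> \<notin> S} {S\<in>compatible R. \<alpha> \<in> S}"
proof -
  let ?A = "{S\<in>compatible R. \<alpha> \<notin> S}" and ?B = "{S\<in>compatible R. \<alpha> \<in> S}"
  note aP = simple_P[OF R(3)] and aF = simple_Phi[OF R(3)]
  note rr = rfl_rfl[OF aF]
  have RP: "x \<in> P" if "x \<in> R" for x using lower_P R(1) that by blast
  have st: "rfl \<alpha> x \<in> R" "rfl \<alpha> x \<noteq> \<alpha>" if "x \<in> R" "x \<noteq> \<alpha>" for x
    using R(2) that rfl_P(2)[OF R(3) RP] by (auto simp: stable_def)
  have undo: "rfl \<alpha> ` (flip \<alpha> S - {\<alpha>}) = S" if "S \<in> ?A" for S
  proof -
    have "S \<subseteq> R" "\<alpha> \<notin> S" using that compatibleD(1) by auto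
    then have "flip \<alpha> S - {\<alpha>} = rfl \<alpha> ` S" using st by (fastforce simp: flip_def)
    then show ?thesis using rr by (auto simp: image_image)
  qed
  show bij: "bij_betw (flip \<alpha>) ?A ?B"
  proof (rule bij_betw_imageI)
    show "inj_on (flip \<alpha>) ?A" by (rule inj_onI) (metis undo)
    show "flip \<alpha> ` ?A = ?B"
    proof (intro equalityI subsetI)
      fix S assume "S \<in> flip \<alpha> ` ?A"
      then show "S \<in> ?B" using flip_compatible[OF R] by (auto simp: flip_def)
    next
      fix S assume S: "S \<in> ?B"
      have SR: "S \<subseteq> R" using S compatibleD(1) by auto
      \<comment> \<open>Only sets avoiding \<alpha> are flipped, so the preimage of S is found by
        flipping the complement and complementing again.\<close>
      let ?T = "R - flip \<alpha> (R - S)"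
      have c: "R - S \<in> compatible R" "\<alpha> \<notin> R - S" using S compatible_compl by auto
      have T: "?T \<in> ?A" using compatible_compl[OF flip_compatible[OF R c]] by (auto simp: flip_def)
      have "x \<in> flip \<alpha> ?T \<longleftrightarrow> x \<in> S" for x
      proof (cases "x \<in> R \<and> x \<noteq> \<alpha>")
        case True
        have inT: "x \<in> flip \<alpha> T \<longleftrightarrow> rfl \<alpha> x \<in> T" for T using True rr by (auto simp: flip_def) (metis imageI)
        have "rfl \<alpha> x \<in> flip \<alpha> (R - S) \<longleftrightarrow> x \<in> R - S"
          using st[of x] True rr by (auto simp: flip_def) (metis DiffI imageI rr)
        then show ?thesis using inT st[of x] True by auto
      next
        case False
        have "flip \<alpha> ?T \<subseteq> R" using flip_compatible[OF R, of ?T] T compatibleD(1) by auto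
        then show ?thesis using False S SR by (auto simp: flip_def)
      qed
      then have "S = flip \<alpha> ?T" by blast
      then show "S \<in> flip \<alpha> ` ?A" using T by blast
    qed
  qed
  have fin: "finite (compatible R)" using finite_compatible lower_finite R(1) by blast
  have "(\<Sum>S\<in>compatible R. f S) = (\<Sum>S\<in>?A. f S) + (\<Sum>S\<in>?B. f S)"
    by (subst sum.union_disjoint[symmetric]) (use fin in \<open>auto intro!: sum.cong\<close>)
  also have "(\<Sum>S\<in>?B. f S) = (\<Sum>S\<in>?A. f (flip \<alpha> S))"
    by (rule sum.reindex_bij_betw[OF bij, symmetric])
  finally show "(\<Sum>S\<in>compatible R. f S) = (\<Sum>S\<in>?A. f S + f (flip \<alpha> S))"
    by (simp add: sum.distrib)
qed

lemma card_flip: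
  assumes R: "lower R" "\<alpha> \<in> \<Delta>" "S \<in> compatible R" "\<alpha> \<notin> S"
  shows "card (flip \<alpha> S) = Suc (card S)"
proof -
  have S: "S \<subseteq> R" "finite S" using R compatibleD(1) lower_finite finite_subset by metis+
  have "\<alpha> \<noteq> rfl \<alpha> x" if x: "x \<in> S" for x
  proof -
    have "x \<in> P" using lower_P[OF R(1)] S(1) x by auto
    moreover have "x \<noteq> \<alpha>" using R(4) x by auto
    ultimately show ?thesis using rfl_P(2)[OF R(2)] by metis
  qed
  then have "\<alpha> \<notin> rfl \<alpha> ` S" by blast
  moreover have "inj_on (rfl \<alpha>) S" using rfl_rfl[OF simple_Phi[OF R(2)]] by (metis inj_on_inverseI)
  ultimately show ?thesis using S by (simp add: flip_def card_image)
qed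

lemma poincare_insert:
  assumes R: "lower R" "\<beta> \<notin> R" "\<beta> \<in> P"
  shows "poincare (insert \<beta> R) = (\<Sum>S\<in>compatible R. monom 1 (card S) *
     ((if forced_in (R - S) \<beta> then 0 else monom 1 1) + (if forced_in S \<beta> then 0 else 1)))"
  unfolding poincare_def sum_compatible_insert[OF R]
proof (rule sum.cong[OF refl])
  fix S assume "S \<in> compatible R"
  then have "monom 1 (card (insert \<beta> S)) = monom 1 (card S) * (monom 1 1 :: int poly)"
    by (simp only: compatible_card_insert[OF R(1,2)] mult_monom) simp
  then show "(if forced_in (R - S) \<beta> then 0 else monom 1 (card (insert \<beta> S))) +
      (if forced_in S \<beta> then 0 else monom 1 (card S)) = monom 1 (card S) *
     ((if forced_in (R - S) \<beta> then 0 else monom 1 1) + (if forced_in S \<beta> then 0 else 1 :: int poly))"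
    by (simp only: distrib_left if_distrib[of "\<lambda>x. monom 1 (card S) * x"] mult_zero_right mult_1_right)
qed

lemma forced_in_insert: "forced_in (insert \<gamma> S) \<beta> \<longleftrightarrow>
    forced_in S \<beta> \<or> \<beta> - \<gamma> \<in> S \<or> \<gamma> + \<gamma> = \<beta>"
proof -
  have "\<gamma> + x = \<beta> \<longleftrightarrow> x = \<beta> - \<gamma>" "x + \<gamma> = \<beta> \<longleftrightarrow> x = \<beta> - \<gamma>" for x
    by (auto simp: eq_diff_eq add.commute)
  then show ?thesis unfolding forced_in_def by auto
qed

section \<open>The modular law for one triple of lower sets\<close>

context
  fixes R \<alpha> \<beta> \<gamma>
  assumes R: "lower R" "stable \<alpha> R" "\<alpha> \<in> \<Delta>" "\<alpha> \<in> R"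
    and g: "\<gamma> \<in> P" "\<gamma> \<notin> R" "lower (insert \<gamma> R)"
    and b: "\<beta> \<in> P" "\<beta> \<notin> insert \<gamma> R" "lower (insert \<beta> (insert \<gamma> R))"
    and bg: "\<beta> = \<gamma> + \<alpha>" "rfl \<alpha> \<gamma> = \<beta>"
begin

text \<open>Otherwise stability would put the reflection of x, which is \<gamma> + 2\<alpha>, into
  R, although it lies above \<gamma>. Hence the root \<alpha> inserted by flipping never helps to
  decompose \<gamma>.\<close>

lemma no_shift:
  assumes "x \<in> R" shows "\<gamma> \<noteq> \<alpha> + x"
proof
  assume e: "\<gamma> = \<alpha> + x"
  note aF = simple_Phi[OF R(3)]
  have xa: "x \<noteq> \<alpha>" using e double_not_root[OF aF] P_root[OF g(1)] by auto
  have "rfl \<alpha> \<gamma> = rfl \<alpha> x - \<alpha>" unfolding e by (simp add: rfl_add rfl_self[OF aF])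
  then have "rfl \<alpha> x = \<gamma> + (\<alpha> + \<alpha>)" using bg by (simp add: algebra_simps)
  moreover have "rfl \<alpha> x \<in> R" using R(2) assms xa by (auto simp: stable_def)
  moreover have "le \<gamma> (\<gamma> + (\<alpha> + \<alpha>))"
    using R(3) by (auto simp: le_def coord_add coord_simple)
  ultimately show False using lower_le[OF R(1) _ g(1)] g(2) by metis
qed

lemma cartan_gamma: "\<gamma> \<bullet> \<alpha> < 0" "\<beta> \<bullet> \<alpha> > 0"
proof -
  note aF = simple_Phi[OF R(3)]
  have a0: "\<alpha> \<bullet> \<alpha> > 0" using root_inner_pos[OF aF] .
  have "cartan_number \<gamma> \<alpha> *\<^sub>R \<alpha> = \<gamma> - \<beta>" using bg(2) by (auto simp: rfl_def)
  then have "cartan_number \<gamma> \<alpha> *\<^sub>R \<alpha> = (-1) *\<^sub>R \<alpha>" by (simp add: bg(1))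
  then have c: "cartan_number \<gamma> \<alpha> = -1" using root_nonzero[OF aF] scaleR_cancel_right by blast
  then have "2 * (\<gamma> \<bullet> \<alpha>) = - (\<alpha> \<bullet> \<alpha>)" using a0 by (simp add: cartan_number_def field_simps)
  then show "\<gamma> \<bullet> \<alpha> < 0" "\<beta> \<bullet> \<alpha> > 0" using a0 unfolding bg(1) inner_add_left by linarith+
qed

text \<open>In a decomposition of \<gamma> some summand pairs negatively with \<alpha>. Adding
  \<alpha> to it gives a root of R, which stays outside S because \<alpha> is outside, and turns the
  decomposition into one of \<beta>.\<close>

lemma forced_out_shift:
  assumes S: "S \<in> compatible R" "\<alpha> \<notin> S" and f: "forced_in (R - S) \<gamma>"
  shows "forced_in (R - S) \<beta>"
proof -
  note aF = simple_Phi[OF R(3)]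
  have key: "forced_in (R - S) \<beta>" if x: "x \<in> R - S" "y \<in> R - S" "x + y = \<gamma>" "x \<bullet> \<alpha> < 0" for x y
  proof -
    have xP: "x \<in> P" "y \<in> P" using x lower_P[OF R(1)] by auto
    have xa: "x \<noteq> \<alpha>" using x(4) root_inner_pos[OF aF] by (metis less_asym)
    have "x \<noteq> - \<alpha>" using P_not_minus[OF simple_P[OF R(3)]] xP by auto
    then have xaP: "x + \<alpha> \<in> P"
      using P_add[OF xP(1) simple_P[OF R(3)]] root_add[OF P_root[OF xP(1)] aF x(4)] by blast
    have "(x + \<alpha>) + y = \<beta>" using x(3) bg by (simp add: algebra_simps)
    then have "x + \<alpha> \<in> insert \<beta> (insert \<gamma> R)" using lower_addD(1)[OF b(3) xaP xP(2)] by simp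
    moreover have "x + \<alpha> \<noteq> \<beta>" using \<open>(x + \<alpha>) + y = \<beta>\<close> P_nonzero[OF xP(2)] by auto
    moreover have "x + \<alpha> \<noteq> \<gamma>" using no_shift[of x] x by (auto simp: add.commute)
    ultimately have xR: "x + \<alpha> \<in> R" by auto
    then have "x + \<alpha> \<notin> S" using compatibleD(3)[OF S(1) _ _ R(4) S(2)] x by blast
    then show ?thesis using xR x \<open>(x + \<alpha>) + y = \<beta>\<close> unfolding forced_in_def by blast
  qed
  obtain x y where x: "x \<in> R - S" "y \<in> R - S" "x + y = \<gamma>" using f unfolding forced_in_def by blast
  have "x \<bullet> \<alpha> < 0 \<or> y \<bullet> \<alpha> < 0"
    using cartan_gamma(1) by (auto simp flip: x(3) simp: inner_add_left)
  then show ?thesis using key[of x y] key[of y x] x by (metis add.commute)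
qed

text \<open>Dually, some summand of \<beta> pairs positively with \<alpha>; after subtracting
  \<alpha> it is still in S, since otherwise it would be a sum of two roots outside S.\<close>

lemma forced_in_shift:
  assumes S: "S \<in> compatible R" "\<alpha> \<notin> S" and f: "forced_in S \<beta>"
  shows "forced_in S \<gamma>"
proof -
  note aF = simple_Phi[OF R(3)]
  have SR: "S \<subseteq> R" using compatibleD(1)[OF S(1)] .
  have key: "forced_in S \<gamma>" if x: "x \<in> S" "y \<in> S" "x + y = \<beta>" "x \<bullet> \<alpha> > 0" for x y
  proof -
    have xP: "x \<in> P" "y \<in> P" using x SR lower_P[OF R(1)] by auto
    have xa: "x \<noteq> \<alpha>" using x(1) S(2) by auto
    have xaP: "x - \<alpha> \<in> P"
      using P_diff_simple[OF R(3) xP(1) xa] root_diff[OF P_root[OF xP(1)] aF x(4) xa] by blast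
    have xR: "x - \<alpha> \<in> R" using lower_addD(1)[OF R(1) xaP simple_P[OF R(3)]] x SR by auto
    have "x - \<alpha> \<in> S"
      using compatibleD(3)[OF S(1) xR _ R(4) S(2)] x SR by auto
    moreover have "(x - \<alpha>) + y = \<gamma>" using x(3) bg by (simp add: algebra_simps)
    ultimately show ?thesis using x unfolding forced_in_def by blast
  qed
  obtain x y where x: "x \<in> S" "y \<in> S" "x + y = \<beta>" using f unfolding forced_in_def by blast
  have "x \<bullet> \<alpha> > 0 \<or> y \<bullet> \<alpha> > 0"
    using cartan_gamma(2) by (auto simp flip: x(3) simp: inner_add_left)
  then show ?thesis using key[of x y] key[of y x] x by (metis add.commute)
qed

lemma rfl_beta: "rfl \<alpha> \<beta> = \<gamma>"
  using rfl_rfl[OF simple_Phi[OF R(3)], of \<gamma>] unfolding bg(2) .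

lemma no_shift':
  assumes "x \<in> R" shows "\<beta> \<noteq> \<alpha> + x"
proof
  assume "\<beta> = \<alpha> + x"
  then have "\<gamma> + \<alpha> = x + \<alpha>" unfolding bg(1) by (simp only: add.commute[of \<alpha> x])
  then have "\<gamma> = x" by (rule add_right_imp_eq)
  then show False using assms g(2) by simp
qed

text \<open>Flipping interchanges the roles of \<open>\<beta>\<close> and \<open>\<gamma>\<close>. Therefore the modular law already holds
  for the contribution of each pair \<open>{S, flip \<alpha> S}\<close>.\<close>

lemma forced_flip:
  assumes S: "S \<in> compatible R" "\<alpha> \<notin> S"
  shows "forced_in (flip \<alpha> S) \<gamma> \<longleftrightarrow> forced_in S \<beta>"
    "forced_in (flip \<alpha> S) \<beta> \<longleftrightarrow> forced_in S \<gamma>"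
    "forced_in (R - flip \<alpha> S) \<gamma> \<longleftrightarrow> forced_in (R - S) \<beta>"
    "forced_in (R - flip \<alpha> S) \<beta> \<longleftrightarrow> forced_in (R - S) \<gamma>"
proof -
  note aF = simple_Phi[OF R(3)]
  note rr = rfl_rfl[OF aF]
  have SR: "S \<subseteq> R" using compatibleD(1)[OF S(1)] .
  have st: "rfl \<alpha> x \<in> R" "rfl \<alpha> x \<noteq> \<alpha>" if "x \<in> R" "x \<noteq> \<alpha>" for x
    using R(2) that rfl_P(2)[OF R(3) lower_P[OF R(1)]] by (auto simp: stable_def)
  have img: "forced_in (rfl \<alpha> ` A) (rfl \<alpha> z) \<longleftrightarrow> forced_in A z" for A z
    unfolding forced_in_def using rfl_eq_iff[OF aF] by (auto simp flip: rfl_add)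
  \<comment> \<open>The element \<alpha> of a flipped set could only contribute a decomposition with
    \<alpha> as a summand; \<open>no_shift\<close> and \<open>no_shift'\<close> exclude these for
    \<gamma> and \<beta>.\<close>
  have fin: "forced_in (flip \<alpha> S) z \<longleftrightarrow> forced_in (rfl \<alpha> ` S) z"
    if "\<And>x. x \<in> R \<Longrightarrow> z \<noteq> \<alpha> + x" for z
    using that[of "rfl \<alpha> _"] that[OF R(4)] st(1) SR S(2) unfolding flip_def forced_in_insert
    by (auto simp: algebra_simps) (metis add.commute diff_add_cancel st(1) subsetD)
  have compl: "R - flip \<alpha> S = rfl \<alpha> ` (R - S - {\<alpha>})"
  proof (intro equalityI subsetI)
    fix x assume x: "x \<in> R - flip \<alpha> S"
    then have "x \<noteq> \<alpha>" "rfl \<alpha> x \<notin> S" using rr by (auto simp: flip_def) (metis imageI)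
    then have "rfl \<alpha> x \<in> R - S - {\<alpha>}" using st[of x] x by auto
    then show "x \<in> rfl \<alpha> ` (R - S - {\<alpha>})" using rr by (metis imageI)
  next
    fix x assume "x \<in> rfl \<alpha> ` (R - S - {\<alpha>})"
    then show "x \<in> R - flip \<alpha> S"
      using st rfl_eq_iff[OF aF] by (auto simp: flip_def)
  qed
  have out: "forced_in (R - S - {\<alpha>}) z \<longleftrightarrow> forced_in (R - S) z"
    if "\<And>x. x \<in> R \<Longrightarrow> z \<noteq> \<alpha> + x" for z
    using that R(4) unfolding forced_in_def by (auto; metis add.commute Diff_iff singletonD)
  note n1 = no_shift and n2 = no_shift'
  show "forced_in (flip \<alpha> S) \<gamma> \<longleftrightarrow> forced_in S \<beta>" using fin[OF n1] img[of S \<beta>] by (simp add: rfl_beta)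
  show "forced_in (flip \<alpha> S) \<beta> \<longleftrightarrow> forced_in S \<gamma>" using fin[OF n2] img[of S \<gamma>] by (simp add: bg(2))
  show "forced_in (R - flip \<alpha> S) \<gamma> \<longleftrightarrow> forced_in (R - S) \<beta>"
    using img[of "R - S - {\<alpha>}" \<beta>] out[OF n2] by (simp add: compl rfl_beta)
  show "forced_in (R - flip \<alpha> S) \<beta> \<longleftrightarrow> forced_in (R - S) \<gamma>"
    using img[of "R - S - {\<alpha>}" \<gamma>] out[OF n1] by (simp add: compl bg(2))
qed

text \<open>All three polynomials become sums over the compatible sets of R and then over pairs
  consisting of S without \<alpha> and its flip. This leaves a finite check on four indicators for
  each pair.\<close>

lemma modular_law:
  "(1 + monom 1 1) * poincare (insert \<gamma> R) =
   poincare (insert \<beta> (insert \<gamma> R)) + monom 1 1 * poincare R"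
proof -
  define t :: "int poly" where "t = monom 1 1"
  \<comment> \<open>\<open>ci\<close> and \<open>co\<close> record whether \<gamma> may go in or
    stay out; \<open>bi\<close> and \<open>bo\<close> do the same for \<beta>, leaving aside the
    decomposition \<beta> = \<gamma> + \<alpha>, which is treated separately through membership of
    \<alpha>.\<close>
  define ci where "ci S = (if forced_in (R - S) \<gamma> then 0 else 1 :: int poly)" for S
  define co where "co S = (if forced_in S \<gamma> then 0 else 1 :: int poly)" for S
  define bi where "bi S = (if forced_in (R - S) \<beta> then 0 else 1 :: int poly)" for S
  define bo where "bo S = (if forced_in S \<beta> then 0 else 1 :: int poly)" for S
  define w where "w S = (monom 1 (card S) :: int poly)" for S :: "'a set"
  let ?A = "{S\<in>compatible R. \<alpha> \<notin> S}"
  have Suc: "monom 1 (Suc n) = t * (monom 1 n :: int poly)" for n by (simp add: t_def mult_monom)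
  have F1: "poincare (insert \<gamma> R) = (\<Sum>S\<in>compatible R. w S * (ci S * t + co S))"
    unfolding poincare_insert[OF R(1) g(2,1)] by (rule sum.cong) (auto simp: ci_def co_def w_def t_def)
  have fS: "forced_in (insert \<gamma> S) \<beta> \<longleftrightarrow> forced_in S \<beta> \<or> \<alpha> \<in> S" for S
    using bg(1) P_root[OF b(1)] double_not_root[OF P_root[OF g(1)]]
    by (auto simp: forced_in_insert)
  have cmp: "R - insert \<gamma> S = R - S" "\<gamma> \<notin> S" "insert \<gamma> R - S = insert \<gamma> (R - S)"
    if "S \<in> compatible R" for S
    using compatibleD(1)[OF that] g(2) by auto
  have F2: "poincare (insert \<beta> (insert \<gamma> R)) = (\<Sum>S\<in>compatible R. w S *
       (ci S * t * (bi S * t + (if \<alpha> \<in> S then 0 else bo S)) + co S * ((if \<alpha> \<in> S then bi S * t else 0) + bo S)))"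
    unfolding poincare_insert[OF g(3) b(2,1)] sum_compatible_insert[OF R(1) g(2,1)]
    by (rule sum.cong)
       (auto simp: cmp fS ci_def co_def bi_def bo_def w_def Suc compatible_card_insert[OF R(1) g(2)] algebra_simps R(4)
         simp flip: t_def)
  have flip: "w (flip \<alpha> S) = t * w S" "ci (flip \<alpha> S) = bi S" "co (flip \<alpha> S) = bo S"
     "bi (flip \<alpha> S) = ci S" "bo (flip \<alpha> S) = co S" "\<alpha> \<in> flip \<alpha> S" if "S \<in> ?A" for S
    using that forced_flip[of S] card_flip[OF R(1,3), of S]
    by (auto simp: w_def ci_def co_def bi_def bo_def Suc flip_def)
  \<comment> \<open>\<open>no_conflict\<close> excludes that both choices are barred for the same
    root, and the two shift lemmas tie the choices for \<beta> to those for \<gamma>; the surviving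
    cases are polynomial identities.\<close>
  have pt: "(1 + t) * (w S * (ci S * t + co S) + t * w S * (bi S * t + bo S)) =
      w S * (ci S * t * (bi S * t + bo S) + co S * bo S) +
      t * w S * (bi S * t * (ci S * t) + bo S * (ci S * t + co S)) + t * (w S + t * w S)"
    if S: "S \<in> ?A" for S
  proof -
    have "\<not> (forced_in S \<gamma> \<and> forced_in (R - S) \<gamma>)" "\<not> (forced_in S \<beta> \<and> forced_in (R - S) \<beta>)"
      using no_conflict[OF R(1)] g(1) b(1) S by blast+
    then show ?thesis
      using forced_in_shift[of S] forced_out_shift[of S] S
      by (auto simp: ci_def co_def bi_def bo_def algebra_simps)
  qed
  have s1: "(\<Sum>S\<in>compatible R. w S * (ci S * t + co S)) =
      (\<Sum>S\<in>?A. w S * (ci S * t + co S) + t * w S * (bi S * t + bo S))"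
    unfolding sum_compatible_flip(1)[OF R] by (rule sum.cong) (auto simp: flip)
  have s2: "poincare (insert \<beta> (insert \<gamma> R)) = (\<Sum>S\<in>?A. w S * (ci S * t * (bi S * t + bo S) + co S * bo S) +
      t * w S * (bi S * t * (ci S * t) + bo S * (ci S * t + co S)))"
    unfolding F2 sum_compatible_flip(1)[OF R] by (rule sum.cong) (auto simp: flip)
  have s0: "poincare R = (\<Sum>S\<in>?A. w S + t * w S)"
    unfolding poincare_def sum_compatible_flip(1)[OF R] by (rule sum.cong) (auto simp: flip(1) simp flip: w_def)
  show ?thesis
    unfolding F1 s1 s2 s0 unfolding t_def[symmetric] sum_distrib_left sum.distrib[symmetric]
    by (rule sum.cong[OF refl pt])
qed

end

end

context based_root_system
begin

section \<open>Parabolic and coatom factorizations\<close>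

text \<open>Both factorizations say that for a suitable \<open>Q\<close> this polynomial does not
  depend on \<open>S\<close>. Classically, for a parabolic \<open>Q\<close>, it is the length
  generating function of the minimal coset representatives.\<close>

definition fibre :: "'a set \<Rightarrow> 'a set \<Rightarrow> 'a set \<Rightarrow> int poly" where
  "fibre R Q S = (\<Sum>S'\<in>{S'\<in>compatible R. S' \<inter> Q = S}. monom 1 (card (S' - Q)))"

lemma compatible_restrict:
  assumes "Q \<subseteq> R" "S \<in> compatible R" shows "S \<inter> Q \<in> compatible Q"
proof (rule compatibleI)
  fix x y assume "x \<in> S \<inter> Q" "y \<in> S \<inter> Q" "x + y \<in> Q"
  then show "x + y \<in> S \<inter> Q" using compatibleD(2)[OF assms(2), of x y] assms(1) by auto
next
  fix x y assume "x \<in> Q" "x \<notin> S \<inter> Q" "y \<in> Q" "y \<notin> S \<inter> Q" "x + y \<in> Q"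
  then show "x + y \<notin> S \<inter> Q" using compatibleD(3)[OF assms(2), of x y] assms(1) by auto
qed simp

lemma poincare_fibre:
  assumes "finite R" "Q \<subseteq> R"
  shows "poincare R = (\<Sum>S\<in>compatible Q. monom 1 (card S) * fibre R Q S)"
proof -
  have fin: "finite (compatible R)" "finite (compatible Q)"
    using assms finite_compatible finite_subset by metis+
  have "poincare R = (\<Sum>S\<in>compatible Q. \<Sum>S'\<in>{S'\<in>compatible R. S' \<inter> Q = S}. monom 1 (card S'))"
    unfolding poincare_def using sum.group[OF fin, of "\<lambda>S. S \<inter> Q" "\<lambda>S. monom 1 (card S) :: int poly"] compatible_restrict[OF assms(2)]
    by (simp add: image_subset_iff)
  also have "\<dots> = (\<Sum>S\<in>compatible Q. monom 1 (card S) * fibre R Q S)"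
  proof (rule sum.cong[OF refl])
    fix S assume "S \<in> compatible Q"
    have "card S' = card S + card (S' - Q)" if "S' \<in> compatible R" "S' \<inter> Q = S" for S'
      using card_Int_Diff[of S' Q] that finite_subset[OF _ assms(1)] compatibleD(1) by metis
    then show "(\<Sum>S'\<in>{S'\<in>compatible R. S' \<inter> Q = S}. monom 1 (card S')) = (monom 1 (card S) :: int poly) * fibre R Q S"
      unfolding fibre_def sum_distrib_left by (intro sum.cong) (auto simp: mult_monom)
  qed
  finally show ?thesis .
qed

lemma fibre_self: "S \<in> compatible R \<Longrightarrow> fibre R R S = 1"
proof -
  assume S: "S \<in> compatible R"
  have "{S'\<in>compatible R. S' \<inter> R = S} = {S}" using S by (auto simp: compatible_def)
  then show ?thesis using compatibleD(1)[OF S] by (simp add: fibre_def Diff_eq_empty_iff[THEN iffD2])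
qed

text \<open>The recursion behind \<open>extension_poly\<close>: \<beta> goes in or stays out, and a
  barred choice has an empty fibre because compatible sets restrict to compatible sets.\<close>

lemma fibre_insert:
  assumes R: "finite R" and Q: "lower Q" "insert \<beta> Q \<subseteq> R" "\<beta> \<notin> Q" "\<beta> \<in> P" and S: "S \<in> compatible Q"
  shows "fibre R Q S =
    (if forced_in (Q - S) \<beta> then 0 else monom 1 1 * fibre R (insert \<beta> Q) (insert \<beta> S)) +
    (if forced_in S \<beta> then 0 else fibre R (insert \<beta> Q) S)"
proof -
  let ?F = "{S'\<in>compatible R. S' \<inter> Q = S}"
  let ?A = "{S'\<in>compatible R. S' \<inter> insert \<beta> Q = insert \<beta> S}" and ?B = "{S'\<in>compatible R. S' \<inter> insert \<beta> Q = S}"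
  have bS: "\<beta> \<notin> S" using compatibleD(1)[OF S] Q(3) by auto
  have fin: "finite ?A" "finite ?B" using finite_compatible[OF R] by auto
  have F: "?F = ?A \<union> ?B" and disj: "?A \<inter> ?B = {}" using bS Q(3) by auto
  have "fibre R Q S = (\<Sum>S'\<in>?A. monom 1 (card (S' - Q))) + (\<Sum>S'\<in>?B. monom 1 (card (S' - Q)))"
    unfolding fibre_def F by (rule sum.union_disjoint[OF fin disj])
  moreover have "(\<Sum>S'\<in>?B. monom 1 (card (S' - Q))) = fibre R (insert \<beta> Q) S"
    unfolding fibre_def using bS by (intro sum.cong) (auto intro!: arg_cong[where f = "\<lambda>X. monom 1 (card X)"])
  moreover have "(\<Sum>S'\<in>?A. monom 1 (card (S' - Q))) = monom 1 1 * fibre R (insert \<beta> Q) (insert \<beta> S)"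
    unfolding fibre_def sum_distrib_left
  proof (rule sum.cong[OF refl])
    fix S' assume S': "S' \<in> ?A"
    then have "S' - Q = insert \<beta> (S' - insert \<beta> Q)" using Q(3) by auto
    moreover have "finite S'" using S' R compatibleD(1) finite_subset by (metis (lifting) mem_Collect_eq)
    ultimately have "card (S' - Q) = Suc (card (S' - insert \<beta> Q))"
      by (metis Diff_iff card_insert_disjoint finite_Diff insertI1)
    then show "monom 1 (card (S' - Q)) = (monom 1 1 :: int poly) * monom 1 (card (S' - insert \<beta> Q))"
      by (simp add: mult_monom)
  qed
  moreover have "fibre R (insert \<beta> Q) S = 0" if "forced_in S \<beta>"
  proof -
    have "?B = {}"
      using compatible_restrict[OF Q(2)] compatible_insert_iff(1)[OF Q(1,3,4) bS] that by blast
    then show ?thesis unfolding fibre_def by (metis sum.empty)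
  qed
  moreover have "fibre R (insert \<beta> Q) (insert \<beta> S) = 0" if "forced_in (Q - S) \<beta>"
  proof -
    have "?A = {}"
      using compatible_restrict[OF Q(2)] compatible_insert_iff(2)[OF Q(1,3,4) bS] that by fastforce
    then show ?thesis unfolding fibre_def by (metis sum.empty)
  qed
  ultimately show ?thesis by auto
qed

text \<open>Flipping maps the extensions of S bijectively to those of
  \<open>flip \<delta> S\<close>. The reflection preserves both Q and the rest of R, apart from
  \<delta> itself, so the part outside Q keeps its size.\<close>

lemma fibre_flip:
  assumes R: "lower R" "stable \<delta> R" "\<delta> \<in> \<Delta>" "\<delta> \<in> Q" and Q: "lower Q" "Q \<subseteq> R"
    and QR: "\<And>x. x \<in> R \<Longrightarrow> x \<noteq> \<delta> \<Longrightarrow> rfl \<delta> x \<in> Q \<longleftrightarrow> x \<in> Q"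
    and S: "S \<in> compatible Q" "\<delta> \<notin> S"
  shows "fibre R Q (flip \<delta> S) = fibre R Q S"
proof -
  note aF = simple_Phi[OF R(3)]
  have dR: "\<delta> \<in> R" using R(4) Q by auto
  have SQ: "S \<subseteq> Q" using compatibleD(1)[OF S(1)] .
  have bij: "bij_betw (flip \<delta>) {S\<in>compatible R. \<delta> \<notin> S} {S\<in>compatible R. \<delta> \<in> S}"
    using sum_compatible_flip(2)[OF R(1-3) dR] .
  have restrict: "flip \<delta> S' \<inter> Q = flip \<delta> (S' \<inter> Q)" if "S' \<subseteq> R" "\<delta> \<notin> S'" for S'
    using QR that R(4) by (fastforce simp: flip_def)
  have inj: "A = B" if "flip \<delta> A = flip \<delta> B" "A \<subseteq> R" "B \<subseteq> R" "\<delta> \<notin> A" "\<delta> \<notin> B" for A B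
  proof -
    have ne: "rfl \<delta> x \<noteq> \<delta>" if "x \<in> R" "x \<noteq> \<delta>" for x
      using rfl_P(2)[OF R(3)] lower_P[OF R(1)] that by blast
    have "\<delta> \<notin> rfl \<delta> ` A" "\<delta> \<notin> rfl \<delta> ` B" using ne that(2-5) by (metis imageE subsetD)+
    then have "rfl \<delta> ` A = rfl \<delta> ` B" using that(1) unfolding flip_def by (metis insert_ident)
    then have "rfl \<delta> ` rfl \<delta> ` A = rfl \<delta> ` rfl \<delta> ` B" by simp
    then show ?thesis by (simp add: image_image rfl_rfl[OF aF])
  qed
  let ?A = "{S'\<in>compatible R. S' \<inter> Q = S}" and ?B = "{S'\<in>compatible R. S' \<inter> Q = flip \<delta> S}"
  have "bij_betw (flip \<delta>) ?A ?B"
  proof (rule bij_betw_subset[OF bij])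
    show "?A \<subseteq> {S\<in>compatible R. \<delta> \<notin> S}" using S(2) R(4) by auto
    show "flip \<delta> ` ?A = ?B"
    proof (intro equalityI subsetI)
      fix X assume "X \<in> flip \<delta> ` ?A"
      then obtain S' where S': "S' \<in> compatible R" "S' \<inter> Q = S" "X = flip \<delta> S'" by auto
      then have "\<delta> \<notin> S'" using S(2) R(4) by auto
      then show "X \<in> ?B" using S' restrict[of S'] compatibleD(1)[OF S'(1)] flip_compatible[OF R(1-3) dR] by auto
    next
      fix X assume X: "X \<in> ?B"
      then have "X \<in> {S\<in>compatible R. \<delta> \<in> S}" by (auto simp: flip_def)
      then obtain S' where S': "S' \<in> compatible R" "\<delta> \<notin> S'" "X = flip \<delta> S'"
        using bij by (auto simp: bij_betw_def) 
      have "flip \<delta> (S' \<inter> Q) = flip \<delta> S" using X S' restrict[of S'] compatibleD(1)[OF S'(1)] by auto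
      then have "S' \<inter> Q = S" by (rule inj) (use S' S(2) SQ Q(2) in auto)
      then show "X \<in> flip \<delta> ` ?A" using S' by auto
    qed
  qed
  then have "fibre R Q (flip \<delta> S) = (\<Sum>S'\<in>?A. monom 1 (card (flip \<delta> S' - Q)))"
    unfolding fibre_def by (rule sum.reindex_bij_betw[symmetric])
  also have "\<dots> = fibre R Q S"
    unfolding fibre_def
  proof (rule sum.cong[OF refl])
    fix S' assume S': "S' \<in> ?A"
    then have "S' \<subseteq> R" "\<delta> \<notin> S'" using compatibleD(1) S(2) R(4) by auto
    then have "flip \<delta> S' - Q = rfl \<delta> ` (S' - Q)" using QR R(4) by (fastforce simp: flip_def)
    moreover have "inj_on (rfl \<delta>) (S' - Q)" using rfl_rfl[OF aF] by (metis inj_on_inverseI)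
    ultimately show "monom 1 (card (flip \<delta> S' - Q)) = (monom 1 (card (S' - Q)) :: int poly)"
      by (simp add: card_image)
  qed
  finally show ?thesis .
qed

lemma stable_restrict:
  assumes "stable \<delta> R" "\<delta> \<in> J" "\<delta> \<in> \<Delta>" "x \<in> R" "x \<noteq> \<delta>"
  shows "rfl \<delta> x \<in> {x\<in>R. \<forall>\<epsilon>\<in>\<Delta> - J. coord x \<epsilon> = 0} \<longleftrightarrow> x \<in> {x\<in>R. \<forall>\<epsilon>\<in>\<Delta> - J. coord x \<epsilon> = 0}"
proof -
  have "coord (rfl \<delta> x) \<epsilon> = coord x \<epsilon>" if "\<epsilon> \<in> \<Delta> - J" for \<epsilon>
    using that assms(2) by (intro coord_rfl[OF assms(3)]) auto
  moreover have "rfl \<delta> x \<in> R" using assms(1,4,5) by (auto simp: stable_def)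
  ultimately show ?thesis using assms(4) by simp
qed

text \<open>The analogue of factoring a Weyl group through a parabolic subgroup. A nonempty
  compatible subset of Q contains a simple root of J and so is the flip of a smaller one; by
  \<open>fibre_flip\<close> every fibre agrees with the one over the empty set.\<close>

lemma poincare_parabolic:
  assumes R: "lower R" and J: "J \<subseteq> \<Delta>" "\<And>\<delta>. \<delta> \<in> J \<Longrightarrow> \<delta> \<in> R \<and> stable \<delta> R"
    and Q: "Q = {x\<in>R. \<forall>\<epsilon>\<in>\<Delta> - J. coord x \<epsilon> = 0}"
  shows "poincare R = poincare Q * fibre R Q {}"
proof -
  have QR: "Q \<subseteq> R" using Q by auto
  have lQ: "lower Q"
    unfolding lower_def
  proof (intro conjI ballI impI)
    show "Q \<subseteq> P" using QR R lower_P by blast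
    fix x y assume xy: "x \<in> P" "y \<in> P" "x + y \<in> Q"
    have "x \<in> R" using lower_addD(1)[OF R xy(1,2)] xy(3) QR by auto
    moreover have "coord x \<epsilon> = 0" if "\<epsilon> \<in> \<Delta> - J" for \<epsilon>
      using xy(3) that P_coord[OF xy(1), of \<epsilon>] P_coord[OF xy(2), of \<epsilon>] by (force simp: Q coord_add)
    ultimately show "x \<in> Q" by (simp add: Q)
  qed
  have JQ: "\<delta> \<in> Q" if "\<delta> \<in> J" for \<delta> using J that by (auto simp: Q coord_simple)
  have st: "stable \<delta> Q" if "\<delta> \<in> J" for \<delta>
    unfolding stable_def
  proof (intro ballI impI)
    fix x assume x: "x \<in> Q" "x \<noteq> \<delta>"
    have "stable \<delta> R" "\<delta> \<in> \<Delta>" using J that by auto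
    then show "rfl \<delta> x \<in> Q"
      using stable_restrict[of \<delta> R J x] that x QR unfolding Q[symmetric] by blast
  qed
  have "fibre R Q S = fibre R Q {}" if "S \<in> compatible Q" for S
    using that
  proof (induction "card S" arbitrary: S)
    case 0
    then have "S = {}" using compatibleD(1) lower_finite[OF lQ] finite_subset by (metis card_0_eq)
    then show ?case by simp
  next
    case (Suc n)
    have SQ: "S \<subseteq> Q" using compatibleD(1)[OF Suc.prems] .
    \<comment> \<open>A non-simple root of Q is a simple root of J plus a lower root of Q. If all
      simple roots of J are outside S, coclosedness and induction on the height leave S
      empty.\<close>
    have "\<exists>\<delta>\<in>J. \<delta> \<in> S"
    proof (rule ccontr)
      assume no: "\<not> (\<exists>\<delta>\<in>J. \<delta> \<in> S)"
      have "\<And>x. x \<in> Q \<Longrightarrow> ht \<Delta> x \<le> real k \<Longrightarrow> x \<notin> S" for k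
      proof (induction k)
        case 0
        then show ?case using ht_pos[OF lower_P[OF lQ 0(1)]] by auto
      next
        case (Suc k)
        have xP: "x \<in> P" using lower_P[OF lQ Suc.prems(1)] .
        have inJ: "\<epsilon> \<in> J" if "\<epsilon> \<in> \<Delta>" "coord x \<epsilon> > 0" for \<epsilon>
          using that Suc.prems(1) by (force simp: Q)
        show ?case
        proof (cases "x \<in> \<Delta>")
          case True
          then show ?thesis using inJ[of x] no by (auto simp: coord_simple)
        next
          case False
          then obtain \<delta> where d: "\<delta> \<in> \<Delta>" "x - \<delta> \<in> P" "coord x \<delta> > 0"
            using P_minus_simple[OF xP] by blast
          then have dJ: "\<delta> \<in> J" using inJ by blast
          have xd: "x - \<delta> \<in> Q" using lower_addD(1)[OF lQ d(2) simple_P[OF d(1)]] Suc.prems(1) by simp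
          then have "x - \<delta> \<notin> S" using Suc.IH[OF xd] Suc.prems(2) by (simp add: ht_diff ht_simple[OF d(1)])
          then show ?thesis
            using compatibleD(3)[OF \<open>S \<in> compatible Q\<close> xd _ JQ[OF dJ]] no dJ Suc.prems(1) by auto
        qed
      qed
      then have "x \<notin> S" if "x \<in> Q" for x using that real_arch_simple by blast
      then have "S = {}" using SQ by auto
      then show False using Suc.hyps(2) by simp
    qed
    then obtain \<delta> where d: "\<delta> \<in> J" "\<delta> \<in> S" by blast
    have d\<Delta>: "\<delta> \<in> \<Delta>" using d J by auto
    obtain S' where S': "S' \<in> compatible Q" "\<delta> \<notin> S'" "S = flip \<delta> S'"
      using sum_compatible_flip(2)[OF lQ st[OF d(1)] d\<Delta> JQ[OF d(1)]] d(2) Suc.prems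
      unfolding bij_betw_def by blast
    have "n = card S'" using card_flip[OF lQ d\<Delta> S'(1,2)] Suc.hyps(2) S'(3) by simp
    then have "fibre R Q S' = fibre R Q {}" using Suc.hyps(1) S'(1) by blast
    moreover have "fibre R Q S = fibre R Q S'"
      unfolding S'(3)
      by (rule fibre_flip[OF R conjunct2[OF J(2)[OF d(1)]] d\<Delta> JQ[OF d(1)] lQ QR _ S'(1,2)])
        (use stable_restrict[of \<delta> R J] J(2)[OF d(1)] d(1) d\<Delta> in \<open>simp add: Q\<close>)
    ultimately show ?case by simp
  qed
  then show ?thesis
    unfolding poincare_fibre[OF lower_finite[OF R] QR] by (simp add: poincare_def sum_distrib_right)
qed

end

text \<open>Below, \<open>M\<close> is the layer of a lower set over a simple root; comparing two of its elements by whether their difference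
  belongs to the given compatible set orders it totally, and the fibres are the upward closed sets.\<close>

lemma upward_closed_gf:
  fixes rel :: "'b \<Rightarrow> 'b \<Rightarrow> bool"
  assumes fin: "finite M"
    and total: "\<And>x y. x \<in> M \<Longrightarrow> y \<in> M \<Longrightarrow> x \<noteq> y \<Longrightarrow> rel x y \<or> rel y x"
    and antisym: "\<And>x y. x \<in> M \<Longrightarrow> y \<in> M \<Longrightarrow> x \<noteq> y \<Longrightarrow> rel x y \<Longrightarrow> \<not> rel y x"
    and trans: "\<And>x y z. x \<in> M \<Longrightarrow> y \<in> M \<Longrightarrow> z \<in> M \<Longrightarrow> x \<noteq> y \<Longrightarrow> y \<noteq> z \<Longrightarrow> x \<noteq> z \<Longrightarrow>
       rel x y \<Longrightarrow> rel y z \<Longrightarrow> rel x z"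
  shows "(\<Sum>U | U \<subseteq> M \<and> (\<forall>x\<in>U. \<forall>y\<in>M. x \<noteq> y \<longrightarrow> rel x y \<longrightarrow> y \<in> U). monom 1 (card U))
    = (\<Sum>k\<le>card M. monom 1 k :: int poly)"
proof -
  let ?F = "{U. U \<subseteq> M \<and> (\<forall>x\<in>U. \<forall>y\<in>M. x \<noteq> y \<longrightarrow> rel x y \<longrightarrow> y \<in> U)}"
  have top: "\<exists>m\<in>A. \<forall>x\<in>A. x \<noteq> m \<longrightarrow> rel x m" if "finite A" "A \<noteq> {}" "A \<subseteq> M" for A
    using that
  proof (induction A rule: finite_ne_induct)
    case (insert a A)
    then obtain m where m: "m \<in> A" "\<forall>x\<in>A. x \<noteq> m \<longrightarrow> rel x m" by auto
    show ?case
    proof (cases "rel a m")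
      case True
      then show ?thesis using m by auto
    next
      case False
      have "a \<noteq> m" using m insert by auto
      then have "rel m a" using False total[of a m] insert m by auto
      then have "rel x a" if "x \<in> A" "x \<noteq> a" for x
        using trans[of x m a] m that insert.prems \<open>a \<noteq> m\<close> by (cases "x = m") auto
      then show ?thesis by auto
    qed
  qed auto
  \<comment> \<open>Upward closed subsets of a finite chain are determined by their size, and every
    size occurs.\<close>
  have "bij_betw card ?F {..card M}"
  proof (rule bij_betw_imageI)
    show "inj_on card ?F"
    proof (rule inj_onI)
      fix U V assume UV: "U \<in> ?F" "V \<in> ?F" "card U = card V"
      have f: "finite U" "finite V" using UV fin finite_subset by auto
      have "U \<subseteq> V \<or> V \<subseteq> U"
      proof (rule ccontr)
        assume "\<not> ?thesis"
        then obtain x y where xy: "x \<in> U" "x \<notin> V" "y \<in> V" "y \<notin> U" by auto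
        then have "x \<in> M" "y \<in> M" "x \<noteq> y" using UV(1,2) by auto
        then show False using total[of x y] UV(1,2) xy by auto
      qed
      then show "U = V" using f UV(3) by (metis card_subset_eq)
    qed
    have "\<exists>U\<in>?F. card U = k" if "k \<le> card M" for k
      using that
    proof (induction k)
      case 0
      then show ?case by (intro bexI[of _ "{}"]) auto
    next
      case (Suc k)
      then obtain U where U: "U \<in> ?F" "card U = k" by auto
      have fU: "finite U" using U fin finite_subset by auto
      have "M - U \<noteq> {}" using Suc.prems U card_mono[OF fU, of M] by auto
      then obtain m where m: "m \<in> M" "m \<notin> U" "\<And>x. x \<in> M \<Longrightarrow> x \<notin> U \<Longrightarrow> x \<noteq> m \<Longrightarrow> rel x m"
        using top[of "M - U"] fin by auto
      have "insert m U \<in> ?F"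
      proof (intro CollectI conjI ballI impI)
        show "insert m U \<subseteq> M" using U m by auto
        fix x y assume xy: "x \<in> insert m U" "y \<in> M" "x \<noteq> y" "rel x y"
        show "y \<in> insert m U"
        proof (cases "x = m")
          case True
          then show ?thesis using antisym[of m y] m xy by auto
        next
          case False
          then show ?thesis using U xy by auto
        qed
      qed
      then show ?case using U fU m by (intro bexI[of _ "insert m U"]) auto
    qed
    then show "card ` ?F = {..card M}" using card_mono[OF fin] by force
  qed
  then show ?thesis by (rule sum.reindex_bij_betw[of card])
qed

section \<open>The layer over a simple root\<close>

context based_root_system
begin

lemma fibre_coatom:
  assumes R: "lower R" "\<delta> \<in> \<Delta>"
    and M: "M = {x\<in>R. coord x \<delta> \<noteq> 0}" "\<And>x. x \<in> M \<Longrightarrow> coord x \<delta> = 1"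
      "\<And>x y. x \<in> M \<Longrightarrow> y \<in> M \<Longrightarrow> x \<noteq> y \<Longrightarrow> x - y \<in> \<Phi>"
    and S: "S \<in> compatible (R - M)"
  shows "fibre R (R - M) S = (\<Sum>k\<le>card M. monom 1 k)"
proof -
  let ?Q = "R - M"
  have MR: "M \<subseteq> R" using M(1) by auto
  have RP: "x \<in> P" if "x \<in> R" for x using lower_P[OF R(1) that] .
  have finM: "finite M" using MR lower_finite[OF R(1)] finite_subset by blast
  have cQ: "coord x \<delta> = 0" if "x \<in> ?Q" for x using that M(1) by auto
  have SQ: "S \<subseteq> ?Q" using compatibleD(1)[OF S] .
  \<comment> \<open>For each d in \<open>R - M\<close> exactly one of d and -d lies in T, so T plays
    the part of a positive system adapted to S. Closedness of S and of its complement combine to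
    \<open>T_add\<close>, which gives the transitivity of \<open>rel\<close>.\<close>
  define T where "T = S \<union> uminus ` (?Q - S)"
  define rel where "rel x y \<longleftrightarrow> y - x \<in> T" for x y :: 'a
  have diffQ: "x - y \<in> ?Q" if "x \<in> M" "y \<in> M" "x - y \<in> P" for x y
  proof -
    have "x - y \<in> R" using lower_addD(1)[OF R(1) that(3) RP[of y]] that MR by auto
    moreover have "coord (x - y) \<delta> = 0" using M(2) that by (simp add: coord_diff)
    ultimately show ?thesis by (simp add: M(1))
  qed
  have T_pos: "d \<in> T \<longleftrightarrow> d \<in> S" if "d \<in> ?Q" for d
  proof
    assume "d \<in> T"
    then show "d \<in> S"
      using that RP P_not_minus unfolding T_def by (metis DiffD1 UnE imageE minus_minus)
  qed (auto simp: T_def)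
  have T_neg: "- d \<in> T \<longleftrightarrow> d \<notin> S" if "d \<in> ?Q" for d
  proof -
    have "- d \<notin> S"
    proof
      assume "- d \<in> S"
      then have "- d \<in> P" "d \<in> P" using RP SQ that by auto
      then show False using P_not_minus by blast
    qed
    then show ?thesis using that by (auto simp: T_def)
  qed
  have T_cases: "d \<in> ?Q \<or> - d \<in> ?Q" if "x \<in> M" "y \<in> M" "x \<noteq> y" "d = x - y" for x y d
    using root_cases[OF M(3)[OF that(1-3)]] diffQ[OF that(1,2)] diffQ[OF that(2,1)] that(4) by auto
  have T_add: "a + b \<in> T" if "a \<in> T" "b \<in> T" "a + b \<in> ?Q \<or> - (a + b) \<in> ?Q" for a b
  proof -
    note cl = compatibleD(2,3)[OF S] and ab = that(1,2)
    have mixed: "a + b \<in> T" if "a \<in> S" "b = - u" "u \<in> ?Q - S" "a + b \<in> ?Q \<or> - (a + b) \<in> ?Q" for a b u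
      using that(4)
    proof
      assume q: "a + b \<in> ?Q"
      have "a + b + u = a" using that by simp
      then have "a + b \<in> S" using cl(2)[OF q, of u] that(1,3) SQ by (metis Diff_iff subsetD)
      then show ?thesis by (simp add: T_def)
    next
      assume q: "- (a + b) \<in> ?Q"
      have "- (a + b) + a = u" using that by simp
      then have "- (a + b) \<notin> S" using cl(1)[of "- (a + b)" a] that by auto
      then show ?thesis using T_neg[OF q] unfolding minus_minus by blast
    qed
    consider "a \<in> S" "b \<in> S" | u where "a \<in> S" "b = - u" "u \<in> ?Q - S"
      | u where "b \<in> S" "a = - u" "u \<in> ?Q - S" | u v where "a = - u" "b = - v" "u \<in> ?Q - S" "v \<in> ?Q - S"
      using ab unfolding T_def by blast
    then show ?thesis
    proof cases
      case 1
      then have "a \<in> P" "b \<in> P" using SQ RP by auto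
      then have "- (a + b) \<notin> ?Q"
        using RP[of "- (a + b)"] P_not_minus[of "- (a + b)"] P_add[of a b] P_root root_minus
        by (metis DiffD1 minus_minus)
      then have "a + b \<in> ?Q" using that(3) by auto
      then show ?thesis using cl(1)[OF 1] by (auto simp: T_def)
    next
      case 2
      then show ?thesis using mixed that(3) by blast
    next
      case 3
      then show ?thesis using mixed[of b a u] that(3) unfolding add.commute[of b a] by blast
    next
      case 4
      then have uv: "u \<in> P" "v \<in> P" "a + b = - (u + v)" using RP by auto
      have "u + v \<in> ?Q"
      proof (rule ccontr)
        assume "u + v \<notin> ?Q"
        then have q: "- (u + v) \<in> ?Q" using that(3) unfolding uv(3) minus_minus by blast
        then have "- (- (u + v)) \<in> \<Phi>" using root_minus[OF P_root[OF RP[of "- (u + v)"]]] by blast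
        then have "u + v \<in> P" using P_add[OF uv(1,2)] unfolding minus_minus by blast
        then show False using P_not_minus RP q by blast
      qed
      moreover have "u + v \<notin> S" using cl(2)[of u v] 4 calculation by auto
      ultimately show ?thesis using T_neg[of "u + v"] unfolding uv(3) by blast
    qed
  qed
  let ?U = "{U. U \<subseteq> M \<and> (\<forall>x\<in>U. \<forall>y\<in>M. x \<noteq> y \<longrightarrow> rel x y \<longrightarrow> y \<in> U)}"
  let ?F = "{S'\<in>compatible R. S' \<inter> ?Q = S}"
  have toU: "S' - ?Q \<in> ?U" if "S' \<in> ?F" for S'
  proof -
    note cl = compatibleD(1-3)[of S' R]
    have S': "S' \<in> compatible R" "S' \<inter> ?Q = S" using that by auto
    have "y \<in> S'" if xy: "x \<in> S'" "x \<in> M" "y \<in> M" "x \<noteq> y" "rel x y" for x y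
    proof -
      consider "y - x \<in> ?Q" | "x - y \<in> ?Q" using T_cases[of y x "y - x"] xy by auto
      then show ?thesis
      proof cases
        case 1
        then have "y - x \<in> S'" using T_pos[OF 1] xy(5) S' by (auto simp: rel_def)
        then show ?thesis using cl(2)[OF S'(1) _ xy(1), of "y - x"] xy(3) MR by auto
      next
        case 2
        then have "x - y \<notin> S'" using T_neg[OF 2] xy(5) S' 2 by (auto simp: rel_def)
        then show ?thesis
          using cl(3)[OF S'(1) _ _ _ _ , of "x - y" y] 2 xy MR by auto
      qed
    qed
    then show ?thesis using cl(1)[OF S'(1)] by auto
  qed
  have fromU: "S \<union> U \<in> ?F" if U: "U \<in> ?U" for U
  proof -
    have UM: "U \<subseteq> M" using U by auto
    \<comment> \<open>The coordinate at \<delta> grades R: it is 0 on \<open>R - M\<close> and 1 on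
      M, so two elements of M never sum to an element of R. The closure conditions between M and
      \<open>R - M\<close> then say that U is upward closed.\<close>
    have cM: "x + y \<in> M" if "x \<in> ?Q" "y \<in> M" "x + y \<in> R" for x y
      using that cQ[OF that(1)] M(2)[OF that(2)] by (simp add: M(1) coord_add)
    have qQ: "x + y \<in> ?Q" if "x \<in> ?Q" "y \<in> ?Q" "x + y \<in> R" for x y
      using that cQ[of x] cQ[of y] by (auto simp: M(1) coord_add)
    have MM: "x + y \<notin> R" if "x \<in> M" "y \<in> M" for x y
      using M(2)[of "x + y"] M(2)[OF that(1)] M(2)[OF that(2)] by (auto simp: M(1) coord_add)
    have up: "x + y \<in> U" if "x \<in> S" "y \<in> U" "x + y \<in> R" for x y
    proof -
      have "x \<noteq> 0" using that(1) SQ RP P_nonzero by blast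
      moreover have "rel y (x + y)" using that(1) by (simp add: rel_def T_def)
      moreover have "x + y \<in> M" "y \<in> M" using cM[of x y] SQ UM that by auto
      moreover have "\<forall>x\<in>U. \<forall>y\<in>M. x \<noteq> y \<longrightarrow> rel x y \<longrightarrow> y \<in> U" using U by blast
      ultimately show ?thesis using that(2) by (metis add_cancel_left_left)
    qed
    have down: "x + y \<notin> U" if "x \<in> ?Q - S" "y \<in> M - U" "x + y \<in> R" for x y
    proof
      assume u: "x + y \<in> U"
      have "x \<noteq> 0" using that(1) RP P_nonzero by blast
      moreover have "rel (x + y) y" using that(1) T_neg[of x] by (simp add: rel_def)
      moreover have "\<forall>x\<in>U. \<forall>y\<in>M. x \<noteq> y \<longrightarrow> rel x y \<longrightarrow> y \<in> U" using U by blast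
      ultimately show False using u that(2) by (metis DiffE add_cancel_left_left)
    qed
    have "S \<union> U \<in> compatible R"
    proof (rule compatibleI)
      show "S \<union> U \<subseteq> R" using SQ UM MR by auto
    next
      fix x y assume xy: "x \<in> S \<union> U" "y \<in> S \<union> U" "x + y \<in> R"
      consider "x \<in> S" "y \<in> S" | "x \<in> S" "y \<in> U" | "y \<in> S" "x \<in> U" | "x \<in> U" "y \<in> U" using xy by auto
      then show "x + y \<in> S \<union> U"
      proof cases
        case 1
        then show ?thesis using qQ[of x y] SQ compatibleD(2)[OF S] xy(3) by auto
      next
        case 2
        then show ?thesis using up xy(3) by auto
      next
        case 3
        then show ?thesis using up[of y x] xy(3) by (simp add: add.commute)
      next
        case 4
        then show ?thesis using MM xy(3) UM by auto
      qed
    next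
      fix x y assume xy: "x \<in> R" "x \<notin> S \<union> U" "y \<in> R" "y \<notin> S \<union> U" "x + y \<in> R"
      consider "x \<in> ?Q - S" "y \<in> ?Q - S" | "x \<in> ?Q - S" "y \<in> M - U" | "y \<in> ?Q - S" "x \<in> M - U" | "x \<in> M" "y \<in> M"
        using xy by auto
      then show "x + y \<notin> S \<union> U"
      proof cases
        case 1
        then show ?thesis using qQ[of x y] compatibleD(3)[OF S, of x y] xy(5) UM by auto
      next
        case 2
        then show ?thesis using down[of x y] cM[of x y] xy(5) SQ by auto
      next
        case 3
        then show ?thesis using down[of y x] cM[of y x] xy(5) SQ by (auto simp: add.commute)
      next
        case 4
        then show ?thesis using MM xy(5) by auto
      qed
    qed
    then show ?thesis using SQ UM by auto
  qed
  have "bij_betw (\<lambda>S'. S' - ?Q) ?F ?U"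
  proof (rule bij_betwI[where g = "\<lambda>U. S \<union> U"])
    show "(\<lambda>S'. S' - ?Q) \<in> ?F \<rightarrow> ?U" using toU by blast
    show "(\<lambda>U. S \<union> U) \<in> ?U \<rightarrow> ?F" using fromU by blast
  qed (use SQ in auto)
  then have "fibre R ?Q S = (\<Sum>U\<in>?U. monom 1 (card U))"
    unfolding fibre_def by (rule sum.reindex_bij_betw)
  also have "\<dots> = (\<Sum>k\<le>card M. monom 1 k)"
  proof (rule upward_closed_gf[OF finM])
    fix x y assume xy: "x \<in> M" "y \<in> M" "x \<noteq> y"
    have e: "x - y = - (y - x)" "y - x = - (x - y)" by simp_all
    show "rel x y \<or> rel y x"
      using T_cases[OF xy refl] T_pos[of "x - y"] T_neg[of "x - y"] T_pos[of "y - x"] T_neg[of "y - x"] unfolding rel_def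
      by auto
    show "\<not> rel y x" if "rel x y"
      using that T_cases[OF xy refl] T_pos[of "x - y"] T_neg[of "x - y"] T_pos[of "y - x"] T_neg[of "y - x"] unfolding rel_def
      by auto
  next
    fix x y z assume a: "x \<in> M" "y \<in> M" "z \<in> M" "x \<noteq> y" "y \<noteq> z" "x \<noteq> z" "rel x y" "rel y z"
    then show "rel x z"
      using T_add[of "y - x" "z - y"] T_cases[of z x "z - x"] by (auto simp: rel_def)
  qed
  finally show ?thesis .
qed

lemma poincare_coatom:
  assumes R: "lower R" "\<delta> \<in> \<Delta>"
    and M: "M = {x\<in>R. coord x \<delta> \<noteq> 0}" "\<And>x. x \<in> M \<Longrightarrow> coord x \<delta> = 1"
      "\<And>x y. x \<in> M \<Longrightarrow> y \<in> M \<Longrightarrow> x \<noteq> y \<Longrightarrow> x - y \<in> \<Phi>"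
  shows "poincare R = poincare (R - M) * (\<Sum>k\<le>card M. monom 1 k)"
  unfolding poincare_fibre[OF lower_finite[OF R(1)] Diff_subset[of R M]]
  by (simp add: fibre_coatom[OF assms] poincare_def sum_distrib_right)

end

section \<open>Exponents\<close>

definition exps_poly :: "nat list \<Rightarrow> int poly" where
  "exps_poly es = prod_list (map (\<lambda>e. \<Sum>k\<le>e. monom 1 k) es)"

lemma exps_poly_mset: "mset es = mset fs \<Longrightarrow> exps_poly es = exps_poly fs"
  unfolding exps_poly_def by (metis mset_map prod_mset_prod_list)

lemma length_filter_mset: "mset es = mset fs \<Longrightarrow> length (filter Q es) = length (filter Q fs)"
  by (metis mset_filter size_mset)

text \<open>In a sorted list an entry that reaches j brings all later entries with it. This turns
  the dual partition in the definition of \<open>ideal_exponent\<close> into list positions.\<close>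

lemma sorted_count_ge:
  assumes "sorted xs" "i < length xs"
  shows "length xs - i \<le> length (filter (\<lambda>e. j \<le> e) xs) \<longleftrightarrow> j \<le> xs ! i"
proof -
  have xs: "xs = take i xs @ drop i xs" by simp
  show ?thesis
  proof
    assume "j \<le> xs ! i"
    moreover have "xs ! i \<le> xs ! (i + k)" if "k < length xs - i" for k
      using sorted_nth_mono[OF assms(1), of i "i + k"] that by simp
    ultimately have "\<forall>e\<in>set (drop i xs). j \<le> e"
      by (fastforce simp: in_set_conv_nth)
    then have "filter (\<lambda>e. j \<le> e) (drop i xs) = drop i xs" by (simp add: filter_id_conv)
    then have "length (filter (\<lambda>e. j \<le> e) xs) = length (filter (\<lambda>e. j \<le> e) (take i xs)) + (length xs - i)"
      by (subst (1) xs) (simp del: append_take_drop_id)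
    then show "length xs - i \<le> length (filter (\<lambda>e. j \<le> e) xs)" by simp
  next
    assume le: "length xs - i \<le> length (filter (\<lambda>e. j \<le> e) xs)"
    show "j \<le> xs ! i"
    proof (rule ccontr)
      assume n: "\<not> j \<le> xs ! i"
      have "e \<le> xs ! i" if "e \<in> set (take (Suc i) xs)" for e
        using that assms sorted_nth_mono[OF assms(1), of _ i] by (auto simp: in_set_conv_nth less_Suc_eq_le)
      then have "\<forall>e\<in>set (take (Suc i) xs). \<not> j \<le> e" using n by fastforce
      then have "filter (\<lambda>e. j \<le> e) (take (Suc i) xs) = []" by (simp add: filter_empty_conv)
      then have "filter (\<lambda>e. j \<le> e) xs = filter (\<lambda>e. j \<le> e) (drop (Suc i) xs)"
        by (metis append_take_drop_id filter_append self_append_conv2)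
      then have "length (filter (\<lambda>e. j \<le> e) xs) \<le> length xs - Suc i"
        by (metis length_drop length_filter_le)
      then show False using le assms(2) by linarith
    qed
  qed
qed

context based_root_system
begin

definition hcount :: "'a set \<Rightarrow> nat \<Rightarrow> nat" where
  "hcount R j = card {x\<in>R. ht \<Delta> x = real j}"

text \<open>The list is the partition dual to the height counts, in any order. Zero entries may
  occur; they change neither the counts nor the product, and \<open>good_product\<close> discards
  them.\<close>

definition has_exps :: "'a set \<Rightarrow> nat list \<Rightarrow> bool" where
  "has_exps R es \<longleftrightarrow> (\<forall>j\<ge>1. hcount R j = length (filter (\<lambda>e. j \<le> e) es))"

definition good :: "'a set \<Rightarrow> bool" where
  "good R \<longleftrightarrow> (\<exists>es. has_exps R es \<and> poincare R = exps_poly es)"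

lemma has_exps_cong: "mset es = mset fs \<Longrightarrow> has_exps R es = has_exps R fs"
  unfolding has_exps_def using length_filter_mset[of es fs] by metis

lemma hcount_insert:
  assumes "finite R" "x \<notin> R"
  shows "hcount (insert x R) j = hcount R j + (if ht \<Delta> x = real j then 1 else 0)"
proof -
  have "{y\<in>insert x R. ht \<Delta> y = real j} =
      (if ht \<Delta> x = real j then insert x {y\<in>R. ht \<Delta> y = real j} else {y\<in>R. ht \<Delta> y = real j})" by auto
  then show ?thesis using assms by (simp add: hcount_def)
qed

text \<open>Raising one entry from h - 1 to h changes the number of entries that are at least j for
  j = h only, which matches one more root of height h.\<close>

lemma has_exps_insert:
  assumes "finite R" "x \<notin> R" "ht \<Delta> x = real h" "h \<ge> 1"
    and "has_exps R es" "h - 1 \<in> set es"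
  shows "has_exps (insert x R) (h # remove1 (h - 1) es)"
  unfolding has_exps_def
proof (intro allI impI)
  fix j :: nat assume j: "j \<ge> 1"
  have "length (filter (\<lambda>e. j \<le> e) es) = length (filter (\<lambda>e. j \<le> e) ((h - 1) # remove1 (h - 1) es))"
    by (rule length_filter_mset) (use assms(6) in simp)
  moreover have "hcount R j = length (filter (\<lambda>e. j \<le> e) es)" using assms(5) j by (simp add: has_exps_def)
  ultimately show "hcount (insert x R) j = length (filter (\<lambda>e. j \<le> e) (h # remove1 (h - 1) es))"
    unfolding hcount_insert[OF assms(1,2)] using assms(3,4) by auto
qed

lemma has_exps_remove:
  assumes "finite R" "x \<notin> R" "ht \<Delta> x = real h" "h \<ge> 1"
    and "has_exps (insert x R) es" "h \<in> set es"
  shows "has_exps R ((h - 1) # remove1 h es)"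
  unfolding has_exps_def
proof (intro allI impI)
  fix j :: nat assume j: "j \<ge> 1"
  have "length (filter (\<lambda>e. j \<le> e) es) = length (filter (\<lambda>e. j \<le> e) (h # remove1 h es))"
    by (rule length_filter_mset) (use assms(6) in simp)
  moreover have "hcount (insert x R) j = length (filter (\<lambda>e. j \<le> e) es)" using assms(5) j by (simp add: has_exps_def)
  ultimately show "hcount R j = length (filter (\<lambda>e. j \<le> e) ((h - 1) # remove1 h es))"
    unfolding hcount_insert[OF assms(1,2)] using assms(3,4) j by (auto split: if_splits)
qed

text \<open>Two roots of M differ by a root, so their heights differ; by
  \<open>exists_between_ht\<close> the heights fill the interval from 1 to the size of M. The layer
  therefore adds one to each of these height counts, which is one new exponent.\<close>

lemma has_exps_coatom:
  assumes R: "lower R" "\<delta> \<in> \<Delta>" "\<delta> \<in> R"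
    and M: "M = {x\<in>R. coord x \<delta> \<noteq> 0}" "\<And>x. x \<in> M \<Longrightarrow> coord x \<delta> = 1"
      "\<And>x y. x \<in> M \<Longrightarrow> y \<in> M \<Longrightarrow> x \<noteq> y \<Longrightarrow> x - y \<in> \<Phi>"
    and es: "has_exps (R - M) es"
  shows "has_exps R (card M # es)"
proof -
  have MR: "M \<subseteq> R" using M(1) by auto
  have RP: "x \<in> P" if "x \<in> R" for x using lower_P[OF R(1) that] .
  have finR: "finite R" using lower_finite[OF R(1)] .
  have finM: "finite M" using MR finR finite_subset by blast
  define h where "h x = (THE k::nat. ht \<Delta> x = real k)" for x
  have h: "ht \<Delta> x = real (h x)" "h x \<ge> 1" if xM: "x \<in> M" for x
  proof -
    obtain k :: nat where k: "ht \<Delta> x = real k" "k \<ge> 1" using ht_natE[OF RP[of x]] xM MR by blast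
    then have "h x = k" by (auto simp: h_def)
    then show "ht \<Delta> x = real (h x)" "h x \<ge> 1" using k by auto
  qed
  have inj: "inj_on h M"
  proof (rule inj_onI, rule ccontr)
    fix x y assume xy: "x \<in> M" "y \<in> M" "h x = h y" "x \<noteq> y"
    have "ht \<Delta> (x - y) = 0" "ht \<Delta> (y - x) = 0" using h[OF xy(1)] h[OF xy(2)] xy(3) by (simp_all add: ht_diff)
    moreover have "x - y \<in> P \<or> y - x \<in> P" using root_cases[OF M(3)[OF xy(1,2,4)]] by simp
    ultimately show False using ht_pos by fastforce
  qed
  have down: "k \<in> h ` M" if x: "x \<in> M" and k: "1 \<le> k" "k \<le> h x" for x k
  proof -
    have xP: "x \<in> P" using x MR RP by auto
    have "le \<delta> x"
      using M(2)[OF x] P_coord[OF xP] R(2) by (auto simp: le_def coord_simple)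
    then obtain z where z: "z \<in> P" "le \<delta> z" "le z x" "ht \<Delta> z = real k"
      using exists_between_ht[OF simple_P[OF R(2)] xP, of k] h[OF x] k by (auto simp: ht_simple[OF R(2)])
    have "z \<in> R" using lower_le[OF R(1) _ z(1,3)] x MR by auto
    moreover have "coord z \<delta> \<ge> 1" using z(2) R(2) by (auto simp: le_def coord_simple)
    ultimately have zM: "z \<in> M" by (auto simp: M(1))
    then have "h z = k" using h[OF zM] z(4) by simp
    then show ?thesis using zM by blast
  qed
  have img: "h ` M = {1..card M}"
  proof -
    let ?H = "h ` M"
    have sub: "{1..k} \<subseteq> ?H" if "k \<in> ?H" for k using that down by auto
    have fin: "finite ?H" using finM by simp
    have "?H \<noteq> {}" using R by (auto simp: M(1) coord_simple)
    then have mx: "Max ?H \<in> ?H" using fin by (simp add: Max_in)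
    have "?H = {1..Max ?H}"
    proof
      show "?H \<subseteq> {1..Max ?H}" using h fin by auto
      show "{1..Max ?H} \<subseteq> ?H" using sub[OF mx] .
    qed
    then show ?thesis using card_image[OF inj] by (metis card_atLeastAtMost diff_Suc_1)
  qed
  show ?thesis
    unfolding has_exps_def
  proof (intro allI impI)
    fix j :: nat assume j: "j \<ge> 1"
    have "{x\<in>R. ht \<Delta> x = real j} = {x\<in>R - M. ht \<Delta> x = real j} \<union> {x\<in>M. ht \<Delta> x = real j}" using MR by auto
    then have "hcount R j = hcount (R - M) j + card {x\<in>M. ht \<Delta> x = real j}"
      unfolding hcount_def by (subst card_Un_disjoint[symmetric]) (use finR finM in auto)
    moreover have "card {x\<in>M. ht \<Delta> x = real j} = (if j \<le> card M then 1 else 0)"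
    proof -
      have "h ` {x\<in>M. ht \<Delta> x = real j} = (if j \<le> card M then {j} else {})"
      proof -
        have "h ` {x\<in>M. ht \<Delta> x = real j} = h ` M \<inter> {j}" using h(1) by force
        then show ?thesis unfolding img using j by auto
      qed
      moreover have "card (h ` {x\<in>M. ht \<Delta> x = real j}) = card {x\<in>M. ht \<Delta> x = real j}"
        by (rule card_image, rule inj_on_subset[OF inj]) auto
      ultimately show ?thesis by (metis card.empty card_1_singleton_iff One_nat_def)
    qed
    moreover have "hcount (R - M) j = length (filter (\<lambda>e. j \<le> e) es)" using es j by (simp add: has_exps_def)
    ultimately show "hcount R j = length (filter (\<lambda>e. j \<le> e) (card M # es))" by simp
  qed
qed

lemma good_coatom:
  assumes R: "lower R" "\<delta> \<in> \<Delta>" "\<delta> \<in> R"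
    and M: "M = {x\<in>R. coord x \<delta> \<noteq> 0}" "\<And>x. x \<in> M \<Longrightarrow> coord x \<delta> = 1"
      "\<And>x y. x \<in> M \<Longrightarrow> y \<in> M \<Longrightarrow> x \<noteq> y \<Longrightarrow> x - y \<in> \<Phi>"
    and "good (R - M)"
  shows "good R"
proof -
  obtain es where es: "has_exps (R - M) es" "poincare (R - M) = exps_poly es"
    using assms(7) by (auto simp: good_def)
  have "poincare R = exps_poly (card M # es)"
    by (simp add: poincare_coatom[OF R(1,2) M] es(2) exps_poly_def)
  then show ?thesis using has_exps_coatom[OF R M es(1)] by (auto simp: good_def)
qed

lemma good_product:
  assumes "root_ideal P I" "good (P - I)"
  shows "ideal_poincare P I =
    (\<Prod>i = 1..height_count \<Delta> P I 1. \<Sum>k\<le>ideal_exponent \<Delta> P I i. monom 1 k)"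
proof -
  obtain es where es: "has_exps (P - I) es" "poincare (P - I) = exps_poly es"
    using assms(2) by (auto simp: good_def)
  \<comment> \<open>\<open>ideal_exponent\<close> yields the positive exponents in increasing order,
    so zeros are dropped and the rest is sorted; s is then the length of \<open>fs\<close>.\<close>
  define fs where "fs = sort (filter (\<lambda>e. 1 \<le> e) es)"
  have hc: "height_count \<Delta> P I j = hcount (P - I) j" for j
    by (simp add: height_count_def hcount_def)
  have count_lower: "hcount (P - I) j = length (filter (\<lambda>e. j \<le> e) fs)" if "j \<ge> 1" for j
  proof -
    have "filter (\<lambda>e. j \<le> e) (filter (\<lambda>e. 1 \<le> e) es) = filter (\<lambda>e. j \<le> e) es"
      using that by (simp add: filter_filter) (rule filter_cong, auto)
    moreover have "length (filter (\<lambda>e. j \<le> e) fs) = length (filter (\<lambda>e. j \<le> e) (filter (\<lambda>e. 1 \<le> e) es))"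
      by (rule length_filter_mset) (simp add: fs_def)
    ultimately show ?thesis using es(1) that by (simp add: has_exps_def)
  qed
  have pos: "1 \<le> e" if "e \<in> set fs" for e using that by (simp add: fs_def)
  have s: "height_count \<Delta> P I 1 = length fs"
  proof -
    have "filter (\<lambda>e. 1 \<le> e) fs = fs" using pos by (simp add: filter_id_conv)
    then show ?thesis using count_lower[of 1] hc[of 1] by simp
  qed
  have sorted: "sorted fs" by (simp add: fs_def)
  have ie: "ideal_exponent \<Delta> P I i = fs ! (i - 1)" if i: "i \<in> {1..length fs}" for i
  proof -
    \<comment> \<open>Exponents are numbered from 1, list positions from 0.\<close>
    have "length fs - i + 1 = length fs - (i - 1)" using i by auto
    then have "{j. 1 \<le> j \<and> height_count \<Delta> P I j \<ge> height_count \<Delta> P I 1 - i + 1} = {1..fs ! (i - 1)}"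
      using sorted_count_ge[OF sorted, of "i - 1"] i count_lower hc s by auto
    then show ?thesis by (simp add: ideal_exponent_def)
  qed
  have "exps_poly es = exps_poly (filter (\<lambda>e. 1 \<le> e) es)"
    unfolding exps_poly_def by (induction es) (auto simp: not_le)
  also have "\<dots> = exps_poly fs" by (rule exps_poly_mset) (simp add: fs_def)
  also have "\<dots> = (\<Prod>i<length fs. \<Sum>k\<le>fs ! i. monom 1 k)"
    unfolding exps_poly_def by (simp add: prod.list_conv_set_nth atLeast0LessThan)
  also have "\<dots> = (\<Prod>i = 1..length fs. \<Sum>k\<le>fs ! (i - 1). monom 1 k)"
    by (rule prod.reindex_bij_witness[of _ "\<lambda>i. i - 1" Suc]) auto
  also have "\<dots> = (\<Prod>i = 1..length fs. \<Sum>k\<le>ideal_exponent \<Delta> P I i. monom 1 k)"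
    by (rule prod.cong) (simp_all add: ie)
  finally show ?thesis unfolding ideal_poincare_eq es(2) s .
qed

end

section \<open>Data structures for the certificates\<close>

text \<open>The functions of the checker are evaluated by rewriting. Auxiliary functions with an extra Boolean or option argument
  force that argument to a normal form before the recursion continues, so that nothing is evaluated twice or needlessly.

  Positive roots are named by binary numerals, which index binary tries. Sets of roots are tries
  that only grow by insertions and unions, so that equal sets are equal tries.\<close>

datatype 'a tr = Lf | Nd "'a tr" "'a option" "'a tr"

fun lookup :: "'a tr \<Rightarrow> num \<Rightarrow> 'a option" where
  "lookup Lf k = None"
| "lookup (Nd l b r) num.One = b"
| "lookup (Nd l b r) (num.Bit0 k) = lookup l k"
| "lookup (Nd l b r) (num.Bit1 k) = lookup r k"

fun update :: "num \<Rightarrow> 'a \<Rightarrow> 'a tr \<Rightarrow> 'a tr" where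
  "update num.One a Lf = Nd Lf (Some a) Lf"
| "update (num.Bit0 k) a Lf = Nd (update k a Lf) None Lf"
| "update (num.Bit1 k) a Lf = Nd Lf None (update k a Lf)"
| "update num.One a (Nd l b r) = Nd l (Some a) r"
| "update (num.Bit0 k) a (Nd l b r) = Nd (update k a l) b r"
| "update (num.Bit1 k) a (Nd l b r) = Nd l b (update k a r)"

lemma lookup_upd: "lookup (update k a t) j = (if j = k then Some a else lookup t j)"
proof (induction k a t arbitrary: j rule: update.induct)
  case (1 a) then show ?case by (cases j) auto
next
  case (2 k a) then show ?case by (cases j) auto
next
  case (3 k a) then show ?case by (cases j) auto
next
  case (4 a l b r) then show ?case by (cases j) auto
next
  case (5 k a l b r) then show ?case by (cases j) auto
next
  case (6 k a l b r) then show ?case by (cases j) auto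
qed

datatype ts = E | B ts bool ts

fun mem :: "ts \<Rightarrow> num \<Rightarrow> bool" where
  "mem E k = False"
| "mem (B l b r) num.One = b"
| "mem (B l b r) (num.Bit0 k) = mem l k"
| "mem (B l b r) (num.Bit1 k) = mem r k"

fun ins :: "num \<Rightarrow> ts \<Rightarrow> ts" where
  "ins num.One E = B E True E"
| "ins (num.Bit0 k) E = B (ins k E) False E"
| "ins (num.Bit1 k) E = B E False (ins k E)"
| "ins num.One (B l b r) = B l True r"
| "ins (num.Bit0 k) (B l b r) = B (ins k l) b r"
| "ins (num.Bit1 k) (B l b r) = B l b (ins k r)"

lemma mem_ins: "mem (ins k t) j \<longleftrightarrow> j = k \<or> mem t j"
proof (induction k t arbitrary: j rule: ins.induct)
  case 1 then show ?case by (cases j) auto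
next
  case (2 k) then show ?case by (cases j) auto
next
  case (3 k) then show ?case by (cases j) auto
next
  case (4 l b r) then show ?case by (cases j) auto
next
  case (5 k l b r) then show ?case by (cases j) auto
next
  case (6 k l b r) then show ?case by (cases j) auto
qed

fun uni :: "ts \<Rightarrow> ts \<Rightarrow> ts" where
  "uni E t = t"
| "uni (B l b r) E = B l b r"
| "uni (B l b r) (B l' b' r') = B (uni l l') (b \<or> b') (uni r r')"

lemma mem_uni: "mem (uni s t) k \<longleftrightarrow> mem s k \<or> mem t k"
proof (induction s t arbitrary: k rule: uni.induct)
  case (3 l b r l' b' r') then show ?case by (cases k) auto
qed auto

fun eqs :: "ts \<Rightarrow> ts \<Rightarrow> bool" where
  "eqs E E = True"
| "eqs (B l True r) (B l' True r') = (eqs l l' \<and> eqs r r')"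
| "eqs (B l False r) (B l' False r') = (eqs l l' \<and> eqs r r')"
| "eqs (B l True r) (B l' False r') = False"
| "eqs (B l False r) (B l' True r') = False"
| "eqs E (B l b r) = False"
| "eqs (B l b r) E = False"

lemma eqs_eq: "eqs s t \<Longrightarrow> s = t"
  by (induction s t rule: eqs.induct) auto

definition tonum :: "int \<Rightarrow> num" where "tonum i = num_of_nat (nat i)"

text \<open>Certificates are written with integer literals. These equations let evaluation read off
  the binary key directly, without passing through unary natural numbers.\<close>

lemma tonum_code [code]: "tonum (Int.Pos k) = k" "tonum 0 = num.One" "tonum (Int.Neg k) = num.One"
  by (simp_all add: tonum_def Int.Pos_def Int.Neg_def nat_of_num_inverse flip: nat_of_num_numeral)

fun dot :: "int list \<Rightarrow> int list \<Rightarrow> int" where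
  "dot [] ys = 0"
| "dot (x # xs) [] = 0"
| "dot (x # xs) (y # ys) = x * y + dot xs ys"

fun vadd :: "int list \<Rightarrow> int list \<Rightarrow> int list" where
  "vadd (x # xs) (y # ys) = (x + y) # vadd xs ys"
| "vadd [] ys = []"
| "vadd (x # xs) [] = []"

fun vsub :: "int list \<Rightarrow> int \<Rightarrow> int list \<Rightarrow> int list" where
  "vsub (x # xs) d (y # ys) = (x - d * y) # vsub xs d ys"
| "vsub [] d ys = []"
| "vsub (x # xs) d [] = []"

fun coeffs_le :: "bool \<Rightarrow> int list \<Rightarrow> int list \<Rightarrow> bool" where
  "coeffs_le False xs ys = False"
| "coeffs_le True [] [] = True"
| "coeffs_le True (x # xs) (y # ys) = coeffs_le (x \<le> y) xs ys"
| "coeffs_le True [] (y # ys) = False"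
| "coeffs_le True (x # xs) [] = False"

fun coeffs_eq :: "bool \<Rightarrow> int list \<Rightarrow> int list \<Rightarrow> bool" where
  "coeffs_eq False xs ys = False"
| "coeffs_eq True [] [] = True"
| "coeffs_eq True (x # xs) (y # ys) = coeffs_eq (x = y) xs ys"
| "coeffs_eq True [] (y # ys) = False"
| "coeffs_eq True (x # xs) [] = False"

lemma coeffs_le_iff: "coeffs_le b xs ys \<longleftrightarrow> b \<and> list_all2 (\<le>) xs ys"
  by (induction b xs ys rule: coeffs_le.induct) auto

lemma coeffs_eq_iff: "coeffs_eq b xs ys \<longleftrightarrow> b \<and> xs = ys"
  by (induction b xs ys rule: coeffs_eq.induct) auto

text \<open>A table lists the positive roots with their coefficients with respect to the simple roots. The coefficient lists may be
  padded by zeros, so that a parabolic subsystem can be described by an initial segment of a larger table.\<close>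

type_synonym table = "(num \<times> int list) list"

fun is_row :: "bool \<Rightarrow> table \<Rightarrow> int list \<Rightarrow> bool" where
  "is_row True t c = True"
| "is_row False [] c = False"
| "is_row False ((k, d) # t) c = is_row (coeffs_eq True d c) t c"

lemma is_row_iff: "is_row b t c \<longleftrightarrow> b \<or> c \<in> snd ` set t"
  by (induction b t c rule: is_row.induct) (auto simp: coeffs_eq_iff)

fun guarded_Some :: "bool \<Rightarrow> num \<Rightarrow> num option" where
  "guarded_Some True k = Some k" | "guarded_Some False k = None"

fun row_id :: "num option \<Rightarrow> table \<Rightarrow> int list \<Rightarrow> num option" where
  "row_id (Some k) t c = Some k"
| "row_id None [] c = None"
| "row_id None ((k, d) # t) c = row_id (guarded_Some (coeffs_eq True d c) k) t c"

lemma row_id_Some: "row_id None t c = Some k \<Longrightarrow> (k, c) \<in> set t"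
proof (induction "None :: num option" t c rule: row_id.induct)
  case (3 j d t c)
  then show ?case by (cases "d = c") (auto simp: coeffs_eq_iff)
qed auto

lemma row_id_None: "row_id None t c = None \<Longrightarrow> c \<notin> snd ` set t"
proof (induction "None :: num option" t c rule: row_id.induct)
  case (3 j d t c)
  then show ?case by (cases "d = c") (auto simp: coeffs_eq_iff)
qed auto

fun guarded_ins :: "bool \<Rightarrow> num \<Rightarrow> ts \<Rightarrow> ts" where
  "guarded_ins True k s = ins k s" | "guarded_ins False k s = s"

fun down_set :: "table \<Rightarrow> int list \<Rightarrow> ts" where
  "down_set [] c = E"
| "down_set ((k, d) # t) c = guarded_ins (coeffs_le True d c) k (down_set t c)"

fun up_set :: "table \<Rightarrow> int list \<Rightarrow> ts" where
  "up_set [] c = E"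
| "up_set ((k, d) # t) c = guarded_ins (coeffs_le True c d) k (up_set t c)"

lemma mem_insb: "mem (guarded_ins b k s) j \<longleftrightarrow> b \<and> j = k \<or> mem s j"
  by (cases b) (auto simp: mem_ins)

lemma mem_dset: "mem (down_set t c) j \<longleftrightarrow> (\<exists>d. (j, d) \<in> set t \<and> list_all2 (\<le>) d c)"
  by (induction t c rule: down_set.induct) (auto simp: mem_insb coeffs_le_iff)

lemma mem_uset: "mem (up_set t c) j \<longleftrightarrow> (\<exists>d. (j, d) \<in> set t \<and> list_all2 (\<le>) c d)"
  by (induction t c rule: up_set.induct) (auto simp: mem_insb coeffs_le_iff)

fun coord_trie :: "table \<Rightarrow> int list tr" where
  "coord_trie [] = Lf" | "coord_trie ((k, c) # t) = update k c (coord_trie t)"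

fun down_trie :: "table \<Rightarrow> table \<Rightarrow> ts tr" where
  "down_trie t [] = Lf" | "down_trie t ((k, c) # s) = update k (down_set t c) (down_trie t s)"

fun up_trie :: "table \<Rightarrow> table \<Rightarrow> ts tr" where
  "up_trie t [] = Lf" | "up_trie t ((k, c) # s) = update k (up_set t c) (up_trie t s)"

lemma lookup_mkct: "lookup (coord_trie t) k = map_of t k"
  by (induction t rule: coord_trie.induct) (auto simp: lookup_upd)

lemma lookup_mkdt: "lookup (down_trie t s) k = map_option (down_set t) (map_of s k)"
  by (induction t s rule: down_trie.induct) (auto simp: lookup_upd)

lemma lookup_mkut: "lookup (up_trie t s) k = map_option (up_set t) (map_of s k)"
  by (induction t s rule: up_trie.induct) (auto simp: lookup_upd)

text \<open>The roots that a simple reflection moves up, with their images. A lower set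
  containing the simple root is stable if and only if it contains the images of its members. The image
  \<open>None\<close> never arises from a valid table.\<close>

fun ascents1 :: "bool \<Rightarrow> table \<Rightarrow> num \<Rightarrow> int list \<Rightarrow> (num \<times> num option) list \<Rightarrow> (num \<times> num option) list" where
  "ascents1 True t k c r = (k, row_id None t c) # r"
| "ascents1 False t k c r = r"

fun ascents :: "table \<Rightarrow> int list \<Rightarrow> int list \<Rightarrow> table \<Rightarrow> (num \<times> num option) list" where
  "ascents t col u [] = []"
| "ascents t col u ((k, c) # s) = ascents1 (dot c col < 0) t k (vsub c (dot c col) u) (ascents t col u s)"

lemma ascents_mem: "(k, c) \<in> set s \<Longrightarrow> dot c col < 0 \<Longrightarrow>
    (k, row_id None t (vsub c (dot c col) u)) \<in> set (ascents t col u s)"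
proof (induction t col u s rule: ascents.induct)
  case (2 t col u k' c' s)
  then show ?case by (cases "dot c' col < 0") auto
qed auto

type_synonym simple_data_trie = "(int list \<times> (num \<times> num option) list) tr"

fun simple_trie1 :: "table \<Rightarrow> num \<Rightarrow> int list option \<Rightarrow> int list \<Rightarrow> simple_data_trie \<Rightarrow> simple_data_trie" where
  "simple_trie1 t a None col s = s"
| "simple_trie1 t a (Some u) col s = update a (col, ascents t col u t) s"

fun simple_trie :: "table \<Rightarrow> int list tr \<Rightarrow> num list \<Rightarrow> int list list \<Rightarrow> simple_data_trie" where
  "simple_trie t ct (a # as) (col # cols) = simple_trie1 t a (lookup ct a) col (simple_trie t ct as cols)"
| "simple_trie t ct [] cols = Lf"
| "simple_trie t ct (a # as) [] = Lf"

lemma simple_trie_Some: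
  "lookup (simple_trie t ct as cols) a = Some (col, prs) \<Longrightarrow>
    \<exists>i<length as. i < length cols \<and> as ! i = a \<and> cols ! i = col \<and> (\<exists>u. lookup ct a = Some u \<and> prs = ascents t col u t)"
proof (induction t ct as cols rule: simple_trie.induct)
  case (1 t ct a' as col' cols)
  show ?case
  proof (cases "lookup ct a'")
    case None
    then obtain i where "i<length as" "i < length cols" "as ! i = a" "cols ! i = col"
        "\<exists>u. lookup ct a = Some u \<and> prs = ascents t col u t" using 1 by auto
    then show ?thesis by (intro exI[of _ "Suc i"]) auto
  next
    case (Some u)
    show ?thesis
    proof (cases "a = a'")
      case True
      then show ?thesis using 1(2) Some by (intro exI[of _ 0]) (auto simp: lookup_upd)
    next
      case False
      then obtain i where "i<length as" "i < length cols" "as ! i = a" "cols ! i = col"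
        "\<exists>u. lookup ct a = Some u \<and> prs = ascents t col u t" using 1 Some by (auto simp: lookup_upd)
      then show ?thesis by (intro exI[of _ "Suc i"]) auto
    qed
  qed
qed auto

fun option_mem :: "ts \<Rightarrow> num option \<Rightarrow> bool" where
  "option_mem R None = False" | "option_mem R (Some k) = mem R k"

fun maps_into :: "ts \<Rightarrow> (num \<times> num option) list \<Rightarrow> bool" where
  "maps_into R [] = True"
| "maps_into R ((k, l) # prs) = ((mem R k \<longrightarrow> option_mem R l) \<and> maps_into R prs)"

lemma stabD: "maps_into R prs \<Longrightarrow> (k, l) \<in> set prs \<Longrightarrow> mem R k \<Longrightarrow> option_mem R l"
  by (induction R prs rule: maps_into.induct) auto

fun ins_list :: "num list \<Rightarrow> ts \<Rightarrow> ts" where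
  "ins_list [] R = R" | "ins_list (k # ks) R = ins k (ins_list ks R)"

lemma mem_insl: "mem (ins_list ks R) k \<longleftrightarrow> k \<in> set ks \<or> mem R k"
  by (induction ks) (auto simp: mem_ins)

fun option_uni :: "ts option \<Rightarrow> ts \<Rightarrow> ts" where
  "option_uni None R = R" | "option_uni (Some S) R = uni S R"

fun down_sets :: "ts tr \<Rightarrow> int list \<Rightarrow> ts" where
  "down_sets dt [] = E" | "down_sets dt (g # gs) = option_uni (lookup dt (tonum g)) (down_sets dt gs)"

fun list_ht :: "int list \<Rightarrow> int" where
  "list_ht [] = 0" | "list_ht (x # xs) = x + list_ht xs"

text \<open>Polynomials in \<open>t\<close> as coefficient lists, constant term first.\<close>

fun times_t :: "int list \<Rightarrow> int list" where
  "times_t [] = []" | "times_t (x # xs) = 0 # x # xs"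

fun poly_add :: "int list \<Rightarrow> int list \<Rightarrow> int list" where
  "poly_add [] ys = ys" | "poly_add (x # xs) [] = x # xs" | "poly_add (x # xs) (y # ys) = (x + y) # poly_add xs ys"

fun poly_sub :: "int list \<Rightarrow> int list \<Rightarrow> int list" where
  "poly_sub xs [] = xs" | "poly_sub [] (y # ys) = (- y) # poly_sub [] ys" | "poly_sub (x # xs) (y # ys) = (x - y) # poly_sub xs ys"

fun times_geometric :: "nat \<Rightarrow> int list \<Rightarrow> int list" where
  "times_geometric 0 c = c" | "times_geometric (Suc m) c = poly_add c (times_t (times_geometric m c))"

text \<open>Division by 1 + t: \<open>r\<close> is the previous coefficient of the quotient,
  initially 0, and the last coefficient of the dividend is dropped. Exactness is not tested here;
  \<open>modular_step\<close> checks the relation afterwards.\<close>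

fun divide_linear :: "int \<Rightarrow> int list \<Rightarrow> int list" where
  "divide_linear r [] = []" | "divide_linear r [x] = []" | "divide_linear r (x # y # xs) = (x - r) # divide_linear (x - r) (y # xs)"

text \<open>Trailing zeros are tolerated, since the operations above do not normalize their
  results.\<close>

fun coeffs_same :: "int list \<Rightarrow> int list \<Rightarrow> bool" where
  "coeffs_same [] [] = True"
| "coeffs_same (x # xs) [] = (x = 0 \<and> coeffs_same xs [])"
| "coeffs_same [] (y # ys) = (y = 0 \<and> coeffs_same [] ys)"
| "coeffs_same (x # xs) (y # ys) = (x = y \<and> coeffs_same xs ys)"

lemma Poly_pc0 [simp]: "Poly (times_t c) = monom 1 1 * Poly c"
  by (cases c) (simp_all add: monom_altdef)

lemma Poly_padd [simp]: "Poly (poly_add c d) = Poly c + Poly d"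
  by (induction c d rule: poly_add.induct) simp_all

lemma Poly_psub [simp]: "Poly (poly_sub c d) = Poly c - Poly d"
  by (induction c d rule: poly_sub.induct) simp_all

lemma sum_monom_Suc: "(\<Sum>k\<le>Suc m. monom 1 k) = 1 + monom 1 1 * (\<Sum>k\<le>m. monom 1 k :: int poly)"
  unfolding sum.atMost_Suc_shift sum_distrib_left by (simp add: mult_monom)

lemma Poly_pmt [simp]: "Poly (times_geometric m c) = (\<Sum>k\<le>m. monom 1 k) * Poly c"
proof (induction m)
  case (Suc m)
  show ?case unfolding sum_monom_Suc by (simp add: Suc distrib_right mult.assoc)
qed (simp add: one_pCons)

lemma coeffs_same_Poly: "coeffs_same c d \<Longrightarrow> Poly c = Poly d"
  by (induction c d rule: coeffs_same.induct) auto

lemma coeffs_same_iff_zero: "coeffs_same c [] \<longleftrightarrow> Poly c = 0"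
  by (induction c) auto

section \<open>Root systems described by a table of coefficients\<close>

locale coord_base = based_root_system \<Phi> \<Delta> for \<Phi> \<Delta> :: "'a::euclidean_space set" +
  fixes \<alpha> :: "nat \<Rightarrow> 'a" and n N :: nat and tab :: table and sl :: "num list" and cols :: "int list list"
  assumes simple_eq: "\<Delta> = \<alpha> ` {..<n}" and inj_simple: "inj_on \<alpha> {..<n}" and nN: "n \<le> N"
    and distinct_tab: "distinct (map fst tab)"
    and tab_list: "\<And>k c. (k, c) \<in> set tab \<Longrightarrow> length c = N \<and> (\<forall>i<N. c ! i \<ge> 0 \<and> (n \<le> i \<longrightarrow> c ! i = 0))"
    and len_sl: "length sl = n" and sl_unit: "\<And>i. i < n \<Longrightarrow> map_of tab (sl ! i) = Some ((replicate N 0)[i := 1])"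
    and len_cols: "length cols = n" and cols_cartan: "\<And>i j. i < n \<Longrightarrow> j < n \<Longrightarrow>
      length (cols ! j) = N \<and> of_int (cols ! j ! i) = cartan_number (\<alpha> i) (\<alpha> j)"
begin

definition vec :: "int list \<Rightarrow> 'a" where "vec c = (\<Sum>i<n. of_int (c ! i) *\<^sub>R \<alpha> i)"

definition root :: "num \<Rightarrow> 'a" where "root k = vec (the (map_of tab k))"

definition rs :: "ts \<Rightarrow> 'a set" where "rs R = {root k | k. k \<in> fst ` set tab \<and> mem R k}"

text \<open>\<open>N\<close> may exceed the rank \<open>n\<close>. The entries from position
  \<open>n\<close> on are padding, which lets E6 and E7 share the coefficient lists of E8.\<close>

definition wf :: "int list \<Rightarrow> bool" where
  "wf c \<longleftrightarrow> length c = N \<and> (\<forall>i<N. n \<le> i \<longrightarrow> c ! i = 0)"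

abbreviation "ct \<equiv> coord_trie tab"
abbreviation "dt \<equiv> down_trie tab tab"
abbreviation "ut \<equiv> up_trie tab tab"
abbreviation "sp \<equiv> simple_trie tab ct sl cols"

lemma tab_map_of: "(k, c) \<in> set tab \<longleftrightarrow> map_of tab k = Some c"
  using distinct_tab by (metis map_of_SomeD map_of_is_SomeI)

lemma tab_wf: "(k, c) \<in> set tab \<Longrightarrow> wf c"
  using tab_list by (auto simp: wf_def)

lemma root_tab: "(k, c) \<in> set tab \<Longrightarrow> root k = vec c"
  by (simp add: root_def tab_map_of)

lemma simple_mem: "i < n \<Longrightarrow> \<alpha> i \<in> \<Delta>"
  by (simp add: simple_eq)

lemma coord_vec: "i < n \<Longrightarrow> coord (vec c) (\<alpha> i) = of_int (c ! i)"
proof -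
  assume i: "i < n"
  have "coord (vec c) (\<alpha> i) = (\<Sum>j<n. of_int (c ! j) * coord (\<alpha> j) (\<alpha> i))"
    by (simp add: vec_def coord_sum coord_scale)
  also have "\<dots> = (\<Sum>j<n. if j = i then of_int (c ! j) else 0)"
    by (rule sum.cong) (use i inj_simple in \<open>auto simp: coord_simple simple_mem inj_on_def\<close>)
  finally show ?thesis using i by simp
qed

lemma vec_inj: "wf c \<Longrightarrow> wf d \<Longrightarrow> vec c = vec d \<Longrightarrow> c = d"
proof (rule nth_equalityI)
  assume a: "wf c" "wf d" "vec c = vec d"
  show "length c = length d" using a by (simp add: wf_def)
  fix i assume "i < length c"
  then show "c ! i = d ! i"
    using a coord_vec[of i c] coord_vec[of i d] by (cases "i < n") (auto simp: wf_def)
qed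

lemma root_inj: "j \<in> fst ` set tab \<Longrightarrow> k \<in> fst ` set tab \<Longrightarrow> distinct (map snd tab) \<Longrightarrow> root j = root k \<Longrightarrow> j = k"
proof -
  assume a: "j \<in> fst ` set tab" "k \<in> fst ` set tab" "distinct (map snd tab)" "root j = root k"
  then obtain c d where cd: "(j, c) \<in> set tab" "(k, d) \<in> set tab" by auto
  then have "c = d" using vec_inj[OF tab_wf tab_wf] a(4) root_tab by metis
  then have "(j, c) = (k, d)"
    using a(3) cd inj_onD[of snd "set tab" "(j, c)" "(k, d)"] by (simp add: distinct_map)
  then show ?thesis by simp
qed

lemma nth_vadd: "length xs = length ys \<Longrightarrow> i < length xs \<Longrightarrow> vadd xs ys ! i = xs ! i + ys ! i"
  by (induction xs ys arbitrary: i rule: vadd.induct) (auto simp: nth_Cons split: nat.splits)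

lemma length_vadd: "length xs = length ys \<Longrightarrow> length (vadd xs ys) = length xs"
  by (induction xs ys rule: vadd.induct) auto

lemma nth_vsub: "length xs = length ys \<Longrightarrow> i < length xs \<Longrightarrow> vsub xs d ys ! i = xs ! i - d * ys ! i"
  by (induction xs d ys arbitrary: i rule: vsub.induct) (auto simp: nth_Cons split: nat.splits)

lemma length_vsub: "length xs = length ys \<Longrightarrow> length (vsub xs d ys) = length xs"
  by (induction xs d ys rule: vsub.induct) auto

lemma wf_vsub: "wf c \<Longrightarrow> wf d \<Longrightarrow> wf (vsub c m d)"
  by (auto simp: wf_def length_vsub nth_vsub)

lemma vec_vadd: "wf c \<Longrightarrow> wf d \<Longrightarrow> vec (vadd c d) = vec c + vec d"
  using nN by (auto simp: vec_def wf_def nth_vadd sum.distrib[symmetric] scaleR_left_distrib intro!: sum.cong)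

lemma vec_vsub: "wf c \<Longrightarrow> wf d \<Longrightarrow> vec (vsub c m d) = vec c - of_int m *\<^sub>R vec d"
  using nN by (auto simp: vec_def wf_def nth_vsub sum_subtractf[symmetric] scaleR_sum_right scaleR_left_diff_distrib intro!: sum.cong)

lemma dot_sum: "length xs = length ys \<Longrightarrow> dot xs ys = (\<Sum>i<length xs. xs ! i * ys ! i)"
proof (induction xs ys rule: dot.induct)
  case (3 x xs y ys)
  then show ?case by (simp add: sum.lessThan_Suc_shift del: sum.lessThan_Suc)
qed auto

lemma dot_wf: "wf c \<Longrightarrow> length d = N \<Longrightarrow> dot c d = (\<Sum>i<n. c ! i * d ! i)"
proof -
  assume a: "wf c" "length d = N"
  have "dot c d = (\<Sum>i<N. c ! i * d ! i)" using a by (simp add: dot_sum wf_def)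
  also have "\<dots> = (\<Sum>i<n. c ! i * d ! i)"
    by (rule sum.mono_neutral_right) (use a nN in \<open>auto simp: wf_def\<close>)
  finally show ?thesis .
qed

lemma list_ht_ht: "wf c \<Longrightarrow> ht \<Delta> (vec c) = of_int (list_ht c)"
proof -
  assume c: "wf c"
  have l: "list_ht c = (\<Sum>i<length c. c ! i)"
    by (induction c) (simp_all add: sum.lessThan_Suc_shift del: sum.lessThan_Suc)
  have "list_ht c = (\<Sum>i<n. c ! i)"
    unfolding l by (rule sum.mono_neutral_right) (use c nN in \<open>auto simp: wf_def\<close>)
  moreover have "ht \<Delta> (vec c) = (\<Sum>i<n. of_int (c ! i))"
  proof -
    have "(\<Sum>\<delta>\<in>\<Delta>. f \<delta>) = (\<Sum>i<n. f (\<alpha> i))" for f :: "'a \<Rightarrow> real"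
      unfolding simple_eq sum.reindex[OF inj_simple] by simp
    then show ?thesis by (simp add: ht_def coord_vec)
  qed
  ultimately show ?thesis by simp
qed

lemma le_vec: "wf c \<Longrightarrow> wf d \<Longrightarrow> le (vec c) (vec d) \<longleftrightarrow> list_all2 (\<le>) c d"
proof -
  assume a: "wf c" "wf d"
  have "(\<forall>\<delta>\<in>\<Delta>. Q \<delta>) \<longleftrightarrow> (\<forall>i<n. Q (\<alpha> i))" for Q
    unfolding simple_eq by auto
  then have "le (vec c) (vec d) \<longleftrightarrow> (\<forall>i<n. c ! i \<le> d ! i)"
    by (simp add: le_def coord_vec)
  also have "\<dots> \<longleftrightarrow> (\<forall>i<N. c ! i \<le> d ! i)"
    using a nN unfolding wf_def by (auto simp: not_le) (metis linorder_not_less order_refl)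
  also have "\<dots> \<longleftrightarrow> list_all2 (\<le>) c d"
    using a by (simp add: list_all2_conv_all_nth wf_def)
  finally show ?thesis .
qed

lemma cartan_vec:
  assumes "wf c" "j < n" shows "cartan_number (vec c) (\<alpha> j) = of_int (dot c (cols ! j))"
proof -
  have l: "length (cols ! j) = N" using cols_cartan[of j j] assms by auto
  have "cartan_number (vec c) (\<alpha> j) = (\<Sum>i<n. of_int (c ! i) * cartan_number (\<alpha> i) (\<alpha> j))"
    by (simp add: vec_def cartan_number_def inner_sum_left sum_distrib_left sum_divide_distrib algebra_simps)
  also have "\<dots> = (\<Sum>i<n. of_int (c ! i * cols ! j ! i))"
    by (rule sum.cong) (use cols_cartan assms in auto)
  finally show ?thesis using dot_wf[OF assms(1) l] by simp
qed

lemma sl_root: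
  assumes "i < n"
  shows "(sl ! i, (replicate N 0)[i := 1]) \<in> set tab" "vec ((replicate N 0)[i := 1]) = \<alpha> i"
    "root (sl ! i) = \<alpha> i"
proof -
  show 1: "(sl ! i, (replicate N 0)[i := 1]) \<in> set tab" using sl_unit[OF assms] tab_map_of by blast
  have "vec ((replicate N 0)[i := 1]) = (\<Sum>j<n. if j = i then \<alpha> j else 0)"
    unfolding vec_def by (rule sum.cong) (use assms nN in \<open>auto simp: nth_list_update\<close>)
  then show 2: "vec ((replicate N 0)[i := 1]) = \<alpha> i" using assms by simp
  show "root (sl ! i) = \<alpha> i" using root_tab[OF 1] 2 by simp
qed

lemma rs_iff: "(k, c) \<in> set tab \<Longrightarrow> distinct (map snd tab) \<Longrightarrow> vec c \<in> rs R \<longleftrightarrow> mem R k"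
  using root_inj root_tab unfolding rs_def by (force simp: image_iff)

end

text \<open>Kept apart from \<open>coord_base\<close> because \<open>P_tab\<close> is itself proved
  there, in \<open>P_eq_tab\<close>, from the computable conditions of
  \<open>table_ok\<close>.\<close>

locale coord_system = coord_base +
  assumes distinct_snd: "distinct (map snd tab)"
    and P_tab: "P = vec ` snd ` set tab"
begin

lemma vec_P: "(k, c) \<in> set tab \<Longrightarrow> vec c \<in> P"
  unfolding P_tab by force

lemma P_root_tab: "x \<in> P \<Longrightarrow> \<exists>k c. (k, c) \<in> set tab \<and> x = vec c \<and> x = root k"
proof -
  assume "x \<in> P"
  then obtain k c where "(k, c) \<in> set tab" "x = vec c" by (auto simp: P_tab)
  then show ?thesis using root_tab by metis
qed

lemma rs_P: "rs R \<subseteq> P"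
  unfolding rs_def using root_tab vec_P by force

lemma mem_rs: "(k, c) \<in> set tab \<Longrightarrow> vec c \<in> rs R \<longleftrightarrow> mem R k"
  using rs_iff distinct_snd by blast

lemma rs_E: "rs E = {}"
  by (simp add: rs_def)

lemma rs_uni: "rs (uni R S) = rs R \<union> rs S"
  by (auto simp: rs_def mem_uni)

lemma rs_ins: "k \<in> fst ` set tab \<Longrightarrow> rs (ins k R) = insert (root k) (rs R)"
  by (auto simp: rs_def mem_ins)

lemma rs_insl: "set ks \<subseteq> fst ` set tab \<Longrightarrow> rs (ins_list ks R) = root ` set ks \<union> rs R"
  by (auto simp: rs_def mem_insl)

lemma lower_Un: "lower R \<Longrightarrow> lower S \<Longrightarrow> lower (R \<union> S)"
  by (auto simp: lower_def)

lemma dt_rs: "lookup dt k = Some D \<Longrightarrow> \<exists>c. (k, c) \<in> set tab \<and> rs D = {x\<in>P. le x (vec c)}"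
proof -
  assume "lookup dt k = Some D"
  then obtain c where c: "(k, c) \<in> set tab" "D = down_set tab c" by (auto simp: lookup_mkdt tab_map_of)
  have "x \<in> rs D \<longleftrightarrow> x \<in> P \<and> le x (vec c)" for x
  proof (cases "x \<in> P")
    case True
    then obtain j d where d: "(j, d) \<in> set tab" "x = vec d" using P_root_tab by blast
    have "x \<in> rs D \<longleftrightarrow> mem D j" using mem_rs d by simp
    also have "\<dots> \<longleftrightarrow> list_all2 (\<le>) d c" unfolding c(2) mem_dset using d tab_map_of by (metis option.inject)
    finally show ?thesis using le_vec tab_wf d c True by metis
  qed (use rs_P in blast)
  then show ?thesis using c by blast
qed

lemma ut_rs: "lookup ut k = Some D \<Longrightarrow> \<exists>c. (k, c) \<in> set tab \<and> rs D = {x\<in>P. le (vec c) x}"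
proof -
  assume "lookup ut k = Some D"
  then obtain c where c: "(k, c) \<in> set tab" "D = up_set tab c" by (auto simp: lookup_mkut tab_map_of)
  have "x \<in> rs D \<longleftrightarrow> x \<in> P \<and> le (vec c) x" for x
  proof (cases "x \<in> P")
    case True
    then obtain j d where d: "(j, d) \<in> set tab" "x = vec d" using P_root_tab by blast
    have "x \<in> rs D \<longleftrightarrow> mem D j" using mem_rs d by simp
    also have "\<dots> \<longleftrightarrow> list_all2 (\<le>) c d" unfolding c(2) mem_uset using d tab_map_of by (metis option.inject)
    finally show ?thesis using le_vec tab_wf d c True by metis
  qed (use rs_P in blast)
  then show ?thesis using c by blast
qed

lemma lower_le_set: "lower {x\<in>P. le x y}"
  unfolding lower_def
proof (intro conjI ballI impI)
  fix x z assume a: "x \<in> P" "z \<in> P" "x + z \<in> {x\<in>P. le x y}"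
  then show "x \<in> {x\<in>P. le x y}" using le_trans[OF le_add_right[OF a(2)]] by auto
qed auto

text \<open>Unknown generators are skipped, so any list of generators denotes a lower set and no
  certificate step has to test this.\<close>

lemma lower_gens: "lower (rs (down_sets dt gs))"
proof (induction gs)
  case Nil
  then show ?case by (simp add: rs_E lower_def)
next
  case (Cons g gs)
  show ?case
  proof (cases "lookup dt (tonum g)")
    case (Some D)
    then show ?thesis using Cons dt_rs[OF Some] lower_le_set by (auto simp: rs_uni intro!: lower_Un)
  qed (use Cons in simp)
qed

lemma sp_sound:
  assumes "lookup sp a = Some (col, prs)"
  obtains i where "i < n" "root a = \<alpha> i" "(a, (replicate N 0)[i := 1]) \<in> set tab" "col = cols ! i"
    "prs = ascents tab col ((replicate N 0)[i := 1]) tab"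
proof -
  obtain i u where i: "i < n" "sl ! i = a" "cols ! i = col" "lookup ct a = Some u" "prs = ascents tab col u tab"
    using simple_trie_Some[OF assms] len_sl len_cols by auto
  have "u = (replicate N 0)[i := 1]" using i sl_unit[OF i(1)] by (auto simp: lookup_mkct)
  then show ?thesis using that[OF i(1)] sl_root[OF i(1)] i by auto
qed

lemma maps_into_sound:
  assumes sp: "lookup sp a = Some (col, prs)" and st: "maps_into R prs" and R: "lower (rs R)"
  shows "root a \<in> \<Delta>" "stable (root a) (rs R)"
proof -
  obtain i where i: "i < n" "root a = \<alpha> i" "(a, (replicate N 0)[i := 1]) \<in> set tab" "col = cols ! i"
    "prs = ascents tab col ((replicate N 0)[i := 1]) tab" using sp_sound[OF sp] by blast
  show d: "root a \<in> \<Delta>" using i simple_mem by simp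
  show "stable (root a) (rs R)"
    unfolding stable_def
  proof (intro ballI impI)
    fix x assume x: "x \<in> rs R" "x \<noteq> root a"
    then obtain k c where k: "(k, c) \<in> set tab" "x = vec c" "mem R k"
      using rs_P P_root_tab mem_rs by (metis subsetD)
    let ?u = "(replicate N 0)[i := 1]"
    have u: "vec ?u = root a" using sl_root(2)[OF i(1)] i(2) by simp
    have rx: "rfl (root a) x = vec (vsub c (dot c col) ?u)"
      using cartan_vec[OF tab_wf[OF k(1)] i(1)] i(2,4) u vec_vsub[OF tab_wf[OF k(1)] tab_wf[OF i(3)]] k(2)
      by (simp add: rfl_def)
    show "rfl (root a) x \<in> rs R"
    proof (cases "dot c col < 0")
      case True
      let ?d = "vsub c (dot c col) ?u"
      have "(k, row_id None tab ?d) \<in> set prs" using ascents_mem[OF k(1) True] i(5) by blast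
      then have "option_mem R (row_id None tab ?d)" using stabD[OF st _ k(3)] by blast
      then obtain j where j: "row_id None tab ?d = Some j" "mem R j" by (cases "row_id None tab ?d") auto
      then have "(j, ?d) \<in> set tab" using row_id_Some by blast
      then show ?thesis using mem_rs j(2) rx by simp
    next
      case False
      have xP: "x \<in> P" using x rs_P by blast
      have "rfl (root a) x \<in> P" using rfl_P(1)[OF d xP x(2)] .
      moreover have "le (rfl (root a) x) x"
        using False cartan_vec[OF tab_wf[OF k(1)] i(1)] i(2,4) k(2) d
        by (auto simp: rfl_def le_def coord_diff coord_scale coord_simple)
      ultimately show ?thesis using lower_le[OF R x(1)] by blast
    qed
  qed
qed

end

section \<open>The checker\<close>

text \<open>A node is a lower set \<open>R\<close>, its exponents \<open>es\<close> and a polynomial \<open>c\<close> such that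
  \<open>poincare R - exps_poly es = c * X\<close>, where the unknown polynomial \<open>X\<close> is the same for all nodes of a stage.\<close>

type_synonym node = "ts \<times> nat list \<times> int list"
type_synonym simple_data = "int list \<times> (num \<times> num option) list"

fun modular_triple :: "simple_data option \<Rightarrow> int list option \<Rightarrow> int list option \<Rightarrow> int list option \<Rightarrow>
    num \<Rightarrow> num \<Rightarrow> num \<Rightarrow> ts \<Rightarrow> ts \<Rightarrow> ts \<Rightarrow> bool" where
  "modular_triple (Some (col, prs)) (Some ca) (Some cg) (Some cb) a g b R2 R1 R0 =
    (mem R0 a \<and> \<not> mem R0 g \<and> \<not> mem R1 b \<and> eqs R1 (ins g R0) \<and> eqs R2 (ins b R1) \<and>
     dot cg col = - 1 \<and> coeffs_eq True cb (vadd cg ca) \<and> maps_into R0 prs)"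
| "modular_triple None ca cg cb a g b R2 R1 R0 = False"
| "modular_triple (Some s) None cg cb a g b R2 R1 R0 = False"
| "modular_triple (Some s) (Some ca) None cb a g b R2 R1 R0 = False"
| "modular_triple (Some s) (Some ca) (Some cg) None a g b R2 R1 R0 = False"

text \<open>Sorted insertion keeps a single list per multiset, so that \<open>exps_step\<close> can
  compare exponents by equality.\<close>

definition replace_exp :: "nat \<Rightarrow> nat \<Rightarrow> nat list \<Rightarrow> nat list" where "replace_exp x y es = insort y (remove1 x es)"

fun exps_step :: "nat \<Rightarrow> nat list \<Rightarrow> nat list \<Rightarrow> nat list \<Rightarrow> bool" where
  "exps_step 0 e2 e1 e0 = False"
| "exps_step (Suc h) e2 e1 e0 = (h \<in> set e0 \<and> e1 = replace_exp h (Suc h) e0 \<and> e2 = replace_exp (Suc h) (Suc (Suc h)) e1)"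

fun option_ht :: "int list option \<Rightarrow> nat" where
  "option_ht None = 0" | "option_ht (Some c) = nat (list_ht c)"

fun modular_step :: "simple_data_trie \<Rightarrow> int list tr \<Rightarrow> num \<Rightarrow> num \<Rightarrow> num \<Rightarrow> node \<Rightarrow> node \<Rightarrow> node \<Rightarrow> bool" where
  "modular_step simple_data_trie ct a g b (R2, e2, c2) (R1, e1, c1) (R0, e0, c0) =
    (modular_triple (lookup simple_data_trie a) (lookup ct a) (lookup ct g) (lookup ct b) a g b R2 R1 R0 \<and>
     exps_step (option_ht (lookup ct g)) e2 e1 e0 \<and>
     coeffs_same (poly_add c1 (times_t c1)) (poly_add c2 (times_t c0)))"

fun put :: "bool \<Rightarrow> num \<Rightarrow> node \<Rightarrow> node tr \<Rightarrow> node tr option" where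
  "put True i n st = Some (update i n st)" | "put False i n st = None"

text \<open>This function and the next two merely solve the modular relation for the missing node;
  \<open>modular_step\<close> then tests the complete triple, so soundness does not rest on them.
  The \<open>tl\<close> in \<open>lower_node\<close> is division by t.\<close>

fun upper_node :: "nat \<Rightarrow> ts \<Rightarrow> node \<Rightarrow> node \<Rightarrow> node" where
  "upper_node h R (R1, e1, c1) (R0, e0, c0) = (R, replace_exp h (Suc h) e1, poly_sub (poly_add c1 (times_t c1)) (times_t c0))"

fun middle_node :: "nat \<Rightarrow> ts \<Rightarrow> node \<Rightarrow> node \<Rightarrow> node" where
  "middle_node h R (R2, e2, c2) (R0, e0, c0) = (R, replace_exp (h - 1) h e0, divide_linear 0 (poly_add c2 (times_t c0)))"

fun lower_node :: "nat \<Rightarrow> ts \<Rightarrow> node \<Rightarrow> node \<Rightarrow> node" where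
  "lower_node h R (R2, e2, c2) (R1, e1, c1) = (R, replace_exp h (h - 1) e1, tl (poly_sub (poly_add c1 (times_t c1)) c2))"

text \<open>The arguments of a step are the identifier of the new node, generators of its lower set, the nodes it is derived from
  and the roots involved. \<open>Up\<close>, \<open>Mid\<close> and \<open>Down\<close> derive the largest, the middle and the smallest of the
  three lower sets in the modular law from the other two (larger one first, then the roots \<open>\<beta>\<close>, \<open>\<gamma>\<close>, \<open>\<alpha>\<close>);
  \<open>Coat\<close> adds the listed layer over a simple root.\<close>

datatype step =
    Up int "int list" int int int int int
  | Mid int "int list" int int int int int
  | Down int "int list" int int int int int
  | Coat int "int list" int int "int list"

fun up2 where
  "up2 simple_data_trie ct i n2 n1 n0 a g b st = put (modular_step simple_data_trie ct a g b n2 n1 n0) i n2 st"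
fun mid2 where
  "mid2 simple_data_trie ct i n2 n1 n0 a g b st = put (modular_step simple_data_trie ct a g b n2 n1 n0) i n1 st"
fun down2 where
  "down2 simple_data_trie ct i n2 n1 n0 a g b st = put (modular_step simple_data_trie ct a g b n2 n1 n0) i n0 st"

fun up1 :: "simple_data_trie \<Rightarrow> int list tr \<Rightarrow> num \<Rightarrow> ts \<Rightarrow> node option \<Rightarrow> node option \<Rightarrow> num \<Rightarrow> num \<Rightarrow> num \<Rightarrow> node tr \<Rightarrow> node tr option" where
  "up1 simple_data_trie ct i R (Some n1) (Some n0) a g b st = up2 simple_data_trie ct i (upper_node (option_ht (lookup ct g)) R n1 n0) n1 n0 a g b st"
| "up1 simple_data_trie ct i R None n0 a g b st = None"
| "up1 simple_data_trie ct i R (Some n1) None a g b st = None"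

fun mid1 :: "simple_data_trie \<Rightarrow> int list tr \<Rightarrow> num \<Rightarrow> ts \<Rightarrow> node option \<Rightarrow> node option \<Rightarrow> num \<Rightarrow> num \<Rightarrow> num \<Rightarrow> node tr \<Rightarrow> node tr option" where
  "mid1 simple_data_trie ct i R (Some n2) (Some n0) a g b st = mid2 simple_data_trie ct i n2 (middle_node (option_ht (lookup ct g)) R n2 n0) n0 a g b st"
| "mid1 simple_data_trie ct i R None n0 a g b st = None"
| "mid1 simple_data_trie ct i R (Some n1) None a g b st = None"

fun down1 :: "simple_data_trie \<Rightarrow> int list tr \<Rightarrow> num \<Rightarrow> ts \<Rightarrow> node option \<Rightarrow> node option \<Rightarrow> num \<Rightarrow> num \<Rightarrow> num \<Rightarrow> node tr \<Rightarrow> node tr option" where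
  "down1 simple_data_trie ct i R (Some n2) (Some n1) a g b st = down2 simple_data_trie ct i n2 n1 (lower_node (option_ht (lookup ct g)) R n2 n1) a g b st"
| "down1 simple_data_trie ct i R None n0 a g b st = None"
| "down1 simple_data_trie ct i R (Some n1) None a g b st = None"

fun ocons :: "'x option \<Rightarrow> 'x list option \<Rightarrow> 'x list option" where
  "ocons (Some x) (Some xs) = Some (x # xs)" | "ocons None xs = None" | "ocons (Some x) None = None"

fun lookups :: "int list tr \<Rightarrow> num list \<Rightarrow> int list list option" where
  "lookups ct [] = Some []" | "lookups ct (k # ks) = ocons (lookup ct k) (lookups ct ks)"

fun all_one :: "int list list \<Rightarrow> int list \<Rightarrow> bool" where
  "all_one [] u = True" | "all_one (c # cs) u = (dot c u = 1 \<and> all_one cs u)"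

fun differ_one_way1 :: "table \<Rightarrow> int list \<Rightarrow> int list list \<Rightarrow> bool" where
  "differ_one_way1 t c [] = True" | "differ_one_way1 t c (d # cs) = (is_row False t (vsub d 1 c) \<and> differ_one_way1 t c cs)"

text \<open>Certificates list a layer in increasing order, so testing later minus earlier suffices.
  At the leaves of the decision tree the order is that of the table, and \<open>differ\<close> tests
  both signs.\<close>

fun differ_one_way :: "table \<Rightarrow> int list list \<Rightarrow> bool" where
  "differ_one_way t [] = True" | "differ_one_way t (c # cs) = (differ_one_way1 t c cs \<and> differ_one_way t cs)"

fun coat :: "table \<Rightarrow> simple_data option \<Rightarrow> int list option \<Rightarrow> int list list option \<Rightarrow> num \<Rightarrow> num list \<Rightarrow> ts \<Rightarrow> ts \<Rightarrow> bool" where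
  "coat t (Some s) (Some u) (Some cs) j Ms R R0 =
    (mem R j \<and> \<not> mem R0 j \<and> eqs R (ins_list Ms R0) \<and> all_one cs u \<and> differ_one_way t cs)"
| "coat t None u cs j Ms R R0 = False"
| "coat t (Some s) None cs j Ms R R0 = False"
| "coat t (Some s) (Some u) None j Ms R R0 = False"

fun coat1 :: "table \<Rightarrow> simple_data_trie \<Rightarrow> int list tr \<Rightarrow> num \<Rightarrow> ts \<Rightarrow> node option \<Rightarrow> num \<Rightarrow> num list \<Rightarrow> node tr \<Rightarrow> node tr option" where
  "coat1 t simple_data_trie ct i R None j Ms st = None"
| "coat1 t simple_data_trie ct i R (Some (R0, e0, c0)) j Ms st =
    put (coat t (lookup simple_data_trie j) (lookup ct j) (lookups ct Ms) j Ms R R0) i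
      (R, insort (length Ms) e0, times_geometric (length Ms) c0) st"

fun nums :: "int list \<Rightarrow> num list" where
  "nums [] = []" | "nums (x # xs) = tonum x # nums xs"

fun run_step :: "table \<Rightarrow> int list tr \<Rightarrow> ts tr \<Rightarrow> simple_data_trie \<Rightarrow> node tr \<Rightarrow> step \<Rightarrow> node tr option" where
  "run_step t ct dt simple_data_trie st (Up i gs i1 i0 b g a) = up1 simple_data_trie ct (tonum i) (down_sets dt gs)
     (lookup st (tonum i1)) (lookup st (tonum i0)) (tonum a) (tonum g) (tonum b) st"
| "run_step t ct dt simple_data_trie st (Mid i gs i2 i0 b g a) = mid1 simple_data_trie ct (tonum i) (down_sets dt gs)
     (lookup st (tonum i2)) (lookup st (tonum i0)) (tonum a) (tonum g) (tonum b) st"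
| "run_step t ct dt simple_data_trie st (Down i gs i2 i1 b g a) = down1 simple_data_trie ct (tonum i) (down_sets dt gs)
     (lookup st (tonum i2)) (lookup st (tonum i1)) (tonum a) (tonum g) (tonum b) st"
| "run_step t ct dt simple_data_trie st (Coat i gs i0 j Ms) = coat1 t simple_data_trie ct (tonum i) (down_sets dt gs)
     (lookup st (tonum i0)) (tonum j) (nums Ms) st"

fun run_steps :: "table \<Rightarrow> int list tr \<Rightarrow> ts tr \<Rightarrow> simple_data_trie \<Rightarrow> node tr option \<Rightarrow> step list \<Rightarrow> node tr option" where
  "run_steps t ct dt simple_data_trie st [] = st"
| "run_steps t ct dt simple_data_trie None (s # ss) = None"
| "run_steps t ct dt simple_data_trie (Some st) (s # ss) = run_steps t ct dt simple_data_trie (run_step t ct dt simple_data_trie st s) ss"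

section \<open>Soundness of the certificate steps\<close>

lemma insort_mset: "mset (insort x xs) = add_mset x (mset xs)"
  by (induction xs) auto

lemma replace_exp_mset: "x \<in> set es \<Longrightarrow> mset (replace_exp x y es) = mset (y # remove1 x es)"
  by (simp add: replace_exp_def insort_mset)

text \<open>With [k] = 1 + t + ... + t^k this is (1 + t) [k] = [k + 1] + t [k - 1], multiplied by
  the factors of the unchanged exponents. In the applications k is the height of \<gamma>.\<close>

lemma exps_modular:
  assumes "exps_step h e2 e1 e0"
  shows "(1 + monom 1 1) * exps_poly e1 = exps_poly e2 + monom 1 1 * exps_poly e0"
proof -
  obtain h' where h: "h = Suc h'" "h' \<in> set e0" "e1 = replace_exp h' (Suc h') e0" "e2 = replace_exp (Suc h') (Suc (Suc h')) e1"
    using assms by (cases h) auto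
  let ?r = "remove1 h' e0" and ?s = "\<lambda>m. (\<Sum>k\<le>m. monom 1 k) :: int poly" and ?t = "monom 1 1 :: int poly"
  have m1: "mset e1 = mset (Suc h' # ?r)" using replace_exp_mset[OF h(2)] h(3) by simp
  then have "Suc h' \<in> set e1" by (metis list.set_intros(1) set_mset_mset)
  then have "mset e2 = mset (Suc (Suc h') # remove1 (Suc h') e1)" using replace_exp_mset h(4) by blast
  then have m2: "mset e2 = mset (Suc (Suc h') # ?r)" using m1 by simp
  have m0: "mset e0 = mset (h' # ?r)" using h(2) by simp
  have "exps_poly e1 = ?s (Suc h') * exps_poly ?r" "exps_poly e2 = ?s (Suc (Suc h')) * exps_poly ?r"
    "exps_poly e0 = ?s h' * exps_poly ?r"
    using exps_poly_mset[OF m1] exps_poly_mset[OF m2] exps_poly_mset[OF m0] by (simp_all add: exps_poly_def)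
  moreover have "(1 + ?t) * ?s (Suc h') = ?s (Suc (Suc h')) + ?t * ?s h'"
    unfolding sum_monom_Suc[of "Suc h'"] unfolding sum_monom_Suc[of h'] by (simp add: algebra_simps)
  ultimately show ?thesis by (metis (no_types, opaque_lifting) distrib_right mult.assoc)
qed

context coord_system
begin

text \<open>Both terms obey the modular law and acquire the same factor along a layer, so from one
  seed on all defects remain multiples of the defect of that seed.\<close>

definition defect :: "'a set \<Rightarrow> nat list \<Rightarrow> int poly" where
  "defect R es = poincare R - exps_poly es"

fun node_ok :: "int poly \<Rightarrow> node \<Rightarrow> bool" where
  "node_ok X (R, es, c) \<longleftrightarrow> lower (rs R) \<and> has_exps (rs R) es \<and> defect (rs R) es = Poly c * X"

definition inv :: "int poly \<Rightarrow> node tr \<Rightarrow> bool" where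
  "inv X st \<longleftrightarrow> (\<forall>i nd. lookup st i = Some nd \<longrightarrow> node_ok X nd)"

lemma ct_tab: "lookup ct k = Some c \<longleftrightarrow> (k, c) \<in> set tab"
  by (simp add: lookup_mkct tab_map_of)

text \<open>Translates the tests into the assumptions of \<open>modular_law\<close>; the Cartan
  number -1 is what makes \<gamma> + \<alpha> the reflection of \<gamma>.\<close>

lemma modular_triple_sound:
  assumes t: "modular_triple (lookup sp a) (lookup ct a) (lookup ct g) (lookup ct b) a g b R2 R1 R0"
    and low: "lower (rs R2)" "lower (rs R1)" "lower (rs R0)"
  shows "(1 + monom 1 1) * poincare (rs R1) = poincare (rs R2) + monom 1 1 * poincare (rs R0)"
    and "rs R1 = insert (root g) (rs R0)" "root g \<notin> rs R0"
      "rs R2 = insert (root b) (rs R1)" "root b \<notin> rs R1"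
      "ht \<Delta> (root g) = real (option_ht (lookup ct g))" "ht \<Delta> (root b) = real (Suc (option_ht (lookup ct g)))"
proof -
  obtain col prs ca cg cb where l: "lookup sp a = Some (col, prs)" "lookup ct a = Some ca" "lookup ct g = Some cg" "lookup ct b = Some cb"
    using t by (cases "lookup sp a"; cases "lookup ct a"; cases "lookup ct g"; cases "lookup ct b") auto
  then have c: "mem R0 a" "\<not> mem R0 g" "\<not> mem R1 b" "R1 = ins g R0" "R2 = ins b R1"
     "dot cg col = - 1" "cb = vadd cg ca" "maps_into R0 prs"
    using t eqs_eq by (auto simp: coeffs_eq_iff)
  have tb: "(a, ca) \<in> set tab" "(g, cg) \<in> set tab" "(b, cb) \<in> set tab" using l ct_tab by auto
  then have ids: "g \<in> fst ` set tab" "b \<in> fst ` set tab" by force+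
  have wf: "wf ca" "wf cg" using tab_wf tb by auto
  obtain i where i: "i < n" "root a = \<alpha> i" "col = cols ! i" using sp_sound[OF l(1)] by metis
  have aR: "root a \<in> rs R0" using mem_rs[OF tb(1)] c(1) root_tab[OF tb(1)] by simp
  show r1: "rs R1 = insert (root g) (rs R0)" using rs_ins ids c by simp
  show g0: "root g \<notin> rs R0" using mem_rs[OF tb(2)] c(2) root_tab[OF tb(2)] by simp
  show r2: "rs R2 = insert (root b) (rs R1)" using rs_ins ids c by simp
  show b1: "root b \<notin> rs R1" using mem_rs[OF tb(3)] c(3) root_tab[OF tb(3)] by simp
  have bg: "root b = root g + root a"
    using vec_vadd[OF wf(2,1)] root_tab tb c(7) by metis
  have "cartan_number (root g) (root a) = -1"
    using cartan_vec[OF wf(2) i(1)] i(2,3) c(6) root_tab[OF tb(2)] by simp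
  then have rg: "rfl (root a) (root g) = root b" using bg by (simp add: rfl_def)
  note st = maps_into_sound[OF l(1) c(8) low(3)]
  have gP: "root g \<in> P" "root b \<in> P" using vec_P tb root_tab by metis+
  show "(1 + monom 1 1) * poincare (rs R1) = poincare (rs R2) + monom 1 1 * poincare (rs R0)"
    using modular_law[OF low(3) st(2,1) aR gP(1) g0 low(2)[unfolded r1] gP(2) b1[unfolded r1] _ bg rg] low(1)
    unfolding r2 r1 by blast
  have "ht \<Delta> (root g) = of_int (list_ht cg)" using list_ht_ht[OF wf(2)] root_tab[OF tb(2)] by simp
  moreover have "list_ht cg \<ge> 0" using ht_pos[OF gP(1)] calculation by simp
  ultimately show h: "ht \<Delta> (root g) = real (option_ht (lookup ct g))" using l(3) by simp
  show "ht \<Delta> (root b) = real (Suc (option_ht (lookup ct g)))"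
    unfolding bg ht_add h ht_simple[OF st(1)] by simp
qed

text \<open>One homogeneous relation between the errors of three nodes, with coefficients 1 + t, 1
  and t. All are nonzero, so when two errors vanish the third does too; this serves steps in all
  three directions.\<close>

lemma modular_step_rel:
  assumes t: "modular_step sp ct a g b (R2, e2, c2) (R1, e1, c1) (R0, e0, c0)"
    and low: "lower (rs R2)" "lower (rs R1)" "lower (rs R0)"
  shows "(1 + monom 1 1) * (defect (rs R1) e1 - Poly c1 * X) =
      (defect (rs R2) e2 - Poly c2 * X) + monom 1 1 * (defect (rs R0) e0 - Poly c0 * X)"
proof -
  have T: "modular_triple (lookup sp a) (lookup ct a) (lookup ct g) (lookup ct b) a g b R2 R1 R0"
    and es: "exps_step (option_ht (lookup ct g)) e2 e1 e0" and c: "coeffs_same (poly_add c1 (times_t c1)) (poly_add c2 (times_t c0))"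
    using t by auto
  have "Poly c1 + monom 1 1 * Poly c1 = Poly c2 + monom 1 1 * Poly c0"
    using coeffs_same_Poly[OF c] by simp
  then have c': "(1 + monom 1 1) * (Poly c1 * X) = Poly c2 * X + monom 1 1 * (Poly c0 * X)"
    by (metis (no_types, opaque_lifting) distrib_right mult.assoc mult_1)
  show ?thesis
    using modular_triple_sound(1)[OF T low] exps_modular[OF es] c' unfolding defect_def right_diff_distrib by simp
qed

lemma modular_triple_exps:
  assumes t: "modular_step sp ct a g b (R2, e2, c2) (R1, e1, c1) (R0, e0, c0)"
    and low: "lower (rs R2)" "lower (rs R1)" "lower (rs R0)"
  shows "has_exps (rs R1) e1 \<Longrightarrow> has_exps (rs R2) e2"
    and "has_exps (rs R0) e0 \<Longrightarrow> has_exps (rs R1) e1"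
    and "has_exps (rs R1) e1 \<Longrightarrow> has_exps (rs R0) e0"
proof -
  have T: "modular_triple (lookup sp a) (lookup ct a) (lookup ct g) (lookup ct b) a g b R2 R1 R0"
    and es: "exps_step (option_ht (lookup ct g)) e2 e1 e0" using t by auto
  note s = modular_triple_sound[OF T low]
  note fin = lower_finite[OF low(3)] lower_finite[OF low(2)]
  obtain h where h: "option_ht (lookup ct g) = Suc h" "h \<in> set e0" "e1 = replace_exp h (Suc h) e0" "e2 = replace_exp (Suc h) (Suc (Suc h)) e1"
    using es by (cases "option_ht (lookup ct g)") auto
  have m1: "mset e1 = mset (Suc h # remove1 h e0)" using replace_exp_mset[OF h(2)] h(3) by simp
  then have in1: "Suc h \<in> set e1" by (metis list.set_intros(1) set_mset_mset)
  have m2: "mset e2 = mset (Suc (Suc h) # remove1 (Suc h) e1)" using replace_exp_mset[OF in1] h(4) by blast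
  show "has_exps (rs R2) e2" if "has_exps (rs R1) e1"
    using has_exps_insert[OF fin(2) s(5,7) _ that] in1 has_exps_cong[OF m2] h(1) s(4) by simp
  show "has_exps (rs R1) e1" if "has_exps (rs R0) e0"
    using has_exps_insert[OF fin(1) s(3,6) _ that] h(2) has_exps_cong[OF m1] h(1) s(2) by simp
  show "has_exps (rs R0) e0" if "has_exps (rs R1) e1"
  proof -
    have "has_exps (rs R0) (h # remove1 (Suc h) e1)"
      using has_exps_remove[OF fin(1) s(3,6), of e1] that in1 h(1) s(2) by simp
    moreover have "mset (h # remove1 (Suc h) e1) = mset e0" using m1 h(2) by simp
    ultimately show ?thesis using has_exps_cong by blast
  qed
qed

lemma one_plus_t_neq_0: "1 + monom 1 1 \<noteq> (0 :: int poly)"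
  by (simp add: monom_altdef one_pCons)

lemma put_Some: "put b i nd st = Some st' \<longleftrightarrow> b \<and> st' = update i nd st"
  by (cases b) auto

lemma inv_upd: "inv X st \<Longrightarrow> node_ok X nd \<Longrightarrow> inv X (update i nd st)"
  by (auto simp: inv_def lookup_upd)

lemma up1_sound:
  assumes "inv X st" "lower (rs R)" "up1 sp ct i R n1 n0 a g b st = Some st'" "\<And>nd. n1 = Some nd \<Longrightarrow> node_ok X nd"
    "\<And>nd. n0 = Some nd \<Longrightarrow> node_ok X nd"
  shows "inv X st'"
proof -
  obtain R1 e1 c1 R0 e0 c0 where n: "n1 = Some (R1, e1, c1)" "n0 = Some (R0, e0, c0)"
    using assms(3) by (cases n1; cases n0) auto
  obtain e2 c2 where c: "upper_node (option_ht (lookup ct g)) R (R1, e1, c1) (R0, e0, c0) = (R, e2, c2)" by simp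
  have t: "modular_step sp ct a g b (R, e2, c2) (R1, e1, c1) (R0, e0, c0)" and st': "st' = update i (R, e2, c2) st"
    using assms(3) unfolding n up1.simps up2.simps c put_Some by auto
  have ok: "node_ok X (R1, e1, c1)" "node_ok X (R0, e0, c0)" using assms(4,5) n by auto
  have "defect (rs R) e2 - Poly c2 * X = 0"
    using modular_step_rel[OF t assms(2), of X] ok by simp
  then show ?thesis
    unfolding st' using inv_upd[OF assms(1)] modular_triple_exps(1)[OF t assms(2)] ok assms(2) by simp
qed

lemma mid1_sound:
  assumes "inv X st" "lower (rs R)" "mid1 sp ct i R n2 n0 a g b st = Some st'" "\<And>nd. n2 = Some nd \<Longrightarrow> node_ok X nd"
    "\<And>nd. n0 = Some nd \<Longrightarrow> node_ok X nd"
  shows "inv X st'"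
proof -
  obtain R2 e2 c2 R0 e0 c0 where n: "n2 = Some (R2, e2, c2)" "n0 = Some (R0, e0, c0)"
    using assms(3) by (cases n2; cases n0) auto
  obtain e1 c1 where c: "middle_node (option_ht (lookup ct g)) R (R2, e2, c2) (R0, e0, c0) = (R, e1, c1)" by simp
  have t: "modular_step sp ct a g b (R2, e2, c2) (R, e1, c1) (R0, e0, c0)" and st': "st' = update i (R, e1, c1) st"
    using assms(3) unfolding n mid1.simps mid2.simps c put_Some by auto
  have ok: "node_ok X (R2, e2, c2)" "node_ok X (R0, e0, c0)" using assms(4,5) n by auto
  have "(1 + monom 1 1) * (defect (rs R) e1 - Poly c1 * X) = 0"
    using modular_step_rel[OF t _ assms(2), of X] ok by simp
  then have "defect (rs R) e1 - Poly c1 * X = 0" using one_plus_t_neq_0 mult_eq_0_iff by blast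
  then show ?thesis
    unfolding st' using inv_upd[OF assms(1)] modular_triple_exps(2)[OF t _ assms(2)] ok assms(2) by simp
qed

lemma down1_sound:
  assumes "inv X st" "lower (rs R)" "down1 sp ct i R n2 n1 a g b st = Some st'" "\<And>nd. n2 = Some nd \<Longrightarrow> node_ok X nd"
    "\<And>nd. n1 = Some nd \<Longrightarrow> node_ok X nd"
  shows "inv X st'"
proof -
  obtain R2 e2 c2 R1 e1 c1 where n: "n2 = Some (R2, e2, c2)" "n1 = Some (R1, e1, c1)"
    using assms(3) by (cases n2; cases n1) auto
  obtain e0 c0 where c: "lower_node (option_ht (lookup ct g)) R (R2, e2, c2) (R1, e1, c1) = (R, e0, c0)" by simp
  have t: "modular_step sp ct a g b (R2, e2, c2) (R1, e1, c1) (R, e0, c0)" and st': "st' = update i (R, e0, c0) st"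
    using assms(3) unfolding n down1.simps down2.simps c put_Some by auto
  have ok: "node_ok X (R2, e2, c2)" "node_ok X (R1, e1, c1)" using assms(4,5) n by auto
  have "monom 1 1 * (defect (rs R) e0 - Poly c0 * X) = 0"
    using modular_step_rel[OF t _ _ assms(2), of X] ok by simp
  then have "defect (rs R) e0 - Poly c0 * X = 0"
    by (metis monom_eq_0_iff mult_eq_0_iff zero_neq_one)
  then show ?thesis
    unfolding st' using inv_upd[OF assms(1)] modular_triple_exps(3)[OF t _ _ assms(2)] ok assms(2) by simp
qed

lemma lookups_Some: "lookups ct Ms = Some cs \<Longrightarrow> length cs = length Ms \<and> (\<forall>i<length Ms. (Ms ! i, cs ! i) \<in> set tab)"
proof (induction Ms arbitrary: cs)
  case (Cons k ks)
  then obtain c cs' where "lookup ct k = Some c" "lookups ct ks = Some cs'" "cs = c # cs'"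
    by (cases "lookup ct k"; cases "lookups ct ks") auto
  then show ?case using Cons.IH[of cs'] ct_tab by (auto simp: nth_Cons split: nat.splits)
qed simp

lemma all_one_iff: "all_one cs u \<longleftrightarrow> (\<forall>c\<in>set cs. dot c u = 1)"
  by (induction cs) auto

lemma differ_one_way1_iff: "differ_one_way1 t c cs \<longleftrightarrow> (\<forall>d\<in>set cs. vsub d 1 c \<in> snd ` set t)"
  by (induction cs) (auto simp: is_row_iff)

lemma differ_one_way_iff: "differ_one_way t cs \<longleftrightarrow> (\<forall>i j. i < j \<longrightarrow> j < length cs \<longrightarrow> vsub (cs ! j) 1 (cs ! i) \<in> snd ` set t)"
proof (induction cs)
  case (Cons c cs)
  show ?case
    unfolding differ_one_way.simps differ_one_way1_iff Cons all_set_conv_all_nth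
    by (auto simp: nth_Cons split: nat.splits)
qed simp

lemma coef_simple:
  assumes "lookup sp j = Some s" "lookup ct j = Some u" "wf c"
  shows "root j \<in> \<Delta>" "coord (vec c) (root j) = of_int (dot c u)"
proof -
  obtain i where i: "i < n" "root j = \<alpha> i" "(j, (replicate N 0)[i := 1]) \<in> set tab"
    using sp_sound assms(1) by (metis prod.collapse)
  then show "root j \<in> \<Delta>" using simple_mem by simp
  have u: "u = (replicate N 0)[i := 1]" using i(3) assms(2) by (simp add: ct_tab tab_map_of)
  have "dot c u = (\<Sum>k<n. c ! k * u ! k)" using dot_wf[OF assms(3)] u by simp
  also have "\<dots> = (\<Sum>k<n. if k = i then c ! k else 0)"
    by (rule sum.cong) (use i nN u in \<open>auto simp: nth_list_update\<close>)
  finally show "coord (vec c) (root j) = of_int (dot c u)" using i coord_vec by simp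
qed

lemma coat_sound:
  assumes t: "coat tab (lookup sp j) (lookup ct j) (lookups ct Ms) j Ms R R0" and low: "lower (rs R)" "lower (rs R0)"
  obtains M where "M = {x\<in>rs R. coord x (root j) \<noteq> 0}" "\<And>x. x \<in> M \<Longrightarrow> coord x (root j) = 1"
     "\<And>x y. x \<in> M \<Longrightarrow> y \<in> M \<Longrightarrow> x \<noteq> y \<Longrightarrow> x - y \<in> \<Phi>" "rs R0 = rs R - M" "card M = length Ms"
     "root j \<in> \<Delta>" "root j \<in> rs R"
proof -
  obtain s u cs where l: "lookup sp j = Some s" "lookup ct j = Some u" "lookups ct Ms = Some cs"
    using t by (cases "lookup sp j"; cases "lookup ct j"; cases "lookups ct Ms") auto
  have c: "mem R j" "\<not> mem R0 j" "R = ins_list Ms R0" "all_one cs u" "differ_one_way tab cs"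
    using t l eqs_eq by auto
  note cs = lookups_Some[OF l(3)]
  have tj: "(j, u) \<in> set tab" using l(2) ct_tab by simp
  have jD: "root j \<in> \<Delta>" using coef_simple(1)[OF l(1,2) tab_wf[OF tj]] .
  have jR: "root j \<in> rs R" "root j \<notin> rs R0" using mem_rs[OF tj] c(1,2) root_tab[OF tj] by auto
  have ids: "set Ms \<subseteq> fst ` set tab" using cs by (force simp: in_set_conv_nth)
  let ?M = "root ` set Ms"
  have RM: "rs R = ?M \<union> rs R0" using rs_insl[OF ids] c(3) by simp
  have r: "root (Ms ! i) = vec (cs ! i)" "wf (cs ! i)" if "i < length Ms" for i
    using root_tab tab_wf cs that by blast+
  have one: "coord x (root j) = 1" if x: "x \<in> ?M" for x
  proof -
    obtain i where i: "i < length Ms" "x = root (Ms ! i)" using x by (auto simp: in_set_conv_nth)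
    have "dot (cs ! i) u = 1" using c(4) all_one_iff cs i(1) by (metis nth_mem)
    then show ?thesis using coef_simple(2)[OF l(1,2) r(2)[OF i(1)]] r(1) i by simp
  qed
  \<comment> \<open>A root of the smaller set involving the simple root would lie above it and pull
    it into that lower set.\<close>
  have forget_coeffs: "coord x (root j) = 0" if x: "x \<in> rs R0" for x
  proof (rule ccontr)
    assume nz: "coord x (root j) \<noteq> 0"
    have xP: "x \<in> P" using x rs_P by blast
    have "coord x (root j) \<ge> 1" using P_coord_pos[OF xP jD nz] .
    then have "le (root j) x" using P_coord[OF xP] jD by (auto simp: le_def coord_simple)
    then show False using lower_le[OF low(2) x simple_P[OF jD]] jR by blast
  qed
  have M: "?M = {x\<in>rs R. coord x (root j) \<noteq> 0}" using RM one forget_coeffs by fastforce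
  have diff: "root (Ms ! k) - root (Ms ! i) \<in> P" if ik: "i < k" "k < length Ms" for i k
  proof -
    have i: "i < length Ms" using ik by simp
    have "vsub (cs ! k) 1 (cs ! i) \<in> snd ` set tab" using c(5) ik cs unfolding differ_one_way_iff by simp
    then have "vec (vsub (cs ! k) 1 (cs ! i)) \<in> P" using vec_P by force
    then show ?thesis using vec_vsub[OF r(2)[OF ik(2)] r(2)[OF i], of 1] r(1)[OF ik(2)] r(1)[OF i] by simp
  qed
  have d2: "x - y \<in> \<Phi>" if xy: "x \<in> ?M" "y \<in> ?M" "x \<noteq> y" for x y
  proof -
    obtain i k where ik: "i < length Ms" "k < length Ms" "x = root (Ms ! i)" "y = root (Ms ! k)"
      using xy by (auto simp: in_set_conv_nth)
    then have "i < k \<or> k < i" using xy(3) by (metis linorder_neqE_nat)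
    then show ?thesis
      using diff[of i k] diff[of k i] ik P_root root_minus[of "y - x"] by auto
  qed
  \<comment> \<open>Entries at different positions differ by a positive root up to sign, hence never
    by 0; the list has no repetitions and its length is the size of the layer.\<close>
  have "inj_on (\<lambda>i. root (Ms ! i)) {..<length Ms}"
  proof (rule linorder_inj_onI)
    fix i k assume "i < k" "k \<in> {..<length Ms}"
    then show "root (Ms ! i) \<noteq> root (Ms ! k)" using diff[of i k] P_nonzero[of 0] by auto
  qed auto
  moreover have "?M = (\<lambda>i. root (Ms ! i)) ` {..<length Ms}"
  proof -
    have "set Ms = (\<lambda>i. Ms ! i) ` {..<length Ms}" by (auto simp: set_conv_nth)
    then show ?thesis by (simp add: image_image)
  qed
  ultimately have card: "card ?M = length Ms" by (simp add: card_image)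
  have "rs R0 = rs R - ?M" using RM one forget_coeffs by fastforce
  then show ?thesis using that[OF M one d2 _ card jD jR(1)] by simp
qed

lemma coat1_sound:
  assumes "inv X st" "lower (rs R)" "coat1 tab sp ct i R n0 j Ms st = Some st'" "\<And>nd. n0 = Some nd \<Longrightarrow> node_ok X nd"
  shows "inv X st'"
proof -
  obtain R0 e0 c0 where n: "n0 = Some (R0, e0, c0)" using assms(3) by (cases n0) auto
  have t: "coat tab (lookup sp j) (lookup ct j) (lookups ct Ms) j Ms R R0"
    and st': "st' = update i (R, insort (length Ms) e0, times_geometric (length Ms) c0) st"
    using assms(3) unfolding n coat1.simps put_Some by auto
  have ok: "node_ok X (R0, e0, c0)" using assms(4) n by auto
  then have low0: "lower (rs R0)" by simp
  obtain M where M: "M = {x\<in>rs R. coord x (root j) \<noteq> 0}" "\<And>x. x \<in> M \<Longrightarrow> coord x (root j) = 1"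
     "\<And>x y. x \<in> M \<Longrightarrow> y \<in> M \<Longrightarrow> x \<noteq> y \<Longrightarrow> x - y \<in> \<Phi>" "rs R0 = rs R - M" "card M = length Ms"
     "root j \<in> \<Delta>" "root j \<in> rs R" by (rule coat_sound[OF t assms(2) low0]) (rule that)
  let ?m = "length Ms"
  have ms: "mset (insort ?m e0) = mset (?m # e0)" by (simp add: insort_mset)
  have "has_exps (rs R) (?m # e0)"
    using has_exps_coatom[OF assms(2) M(6,7,1-3), of e0] ok M(4,5) by simp
  then have "has_exps (rs R) (insort ?m e0)" using has_exps_cong[OF ms] by blast
  moreover have "defect (rs R) (insort ?m e0) = Poly (times_geometric ?m c0) * X"
  proof -
    have "poincare (rs R) = poincare (rs R0) * (\<Sum>k\<le>?m. monom 1 k)"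
      using poincare_coatom[OF assms(2) M(6,1-3)] M(4,5) by simp
    then have "defect (rs R) (insort ?m e0) = (\<Sum>k\<le>?m. monom 1 k) * defect (rs R0) e0"
      unfolding defect_def exps_poly_mset[OF ms] by (simp add: exps_poly_def algebra_simps)
    then show ?thesis using ok by (simp add: mult.assoc)
  qed
  ultimately show ?thesis unfolding st' using inv_upd[OF assms(1)] assms(2) by simp
qed

lemma run_step_sound:
  assumes inv: "inv X st" and run: "run_step tab ct dt sp st s = Some st'"
  shows "inv X st'"
proof (cases s)
  case (Up i gs i1 i0 b g a)
  show ?thesis
    by (rule up1_sound[OF inv lower_gens run[unfolded Up run_step.simps]])
      (use inv in \<open>auto simp: inv_def\<close>)
next
  case (Mid i gs i1 i0 b g a)
  show ?thesis
    by (rule mid1_sound[OF inv lower_gens run[unfolded Mid run_step.simps]])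
      (use inv in \<open>auto simp: inv_def\<close>)
next
  case (Down i gs i1 i0 b g a)
  show ?thesis
    by (rule down1_sound[OF inv lower_gens run[unfolded Down run_step.simps]])
      (use inv in \<open>auto simp: inv_def\<close>)
next
  case (Coat i gs i0 j Ms)
  show ?thesis
    by (rule coat1_sound[OF inv lower_gens run[unfolded Coat run_step.simps]])
      (use inv in \<open>auto simp: inv_def\<close>)
qed

lemma run_steps_sound: "inv X st \<Longrightarrow> run_steps tab ct dt sp (Some st) ss = Some st' \<Longrightarrow> inv X st'"
proof (induction ss arbitrary: st)
  case (Cons s ss)
  then obtain st1 where "run_step tab ct dt sp st s = Some st1" 
    by (cases "run_step tab ct dt sp st s"; cases ss) auto
  then show ?case using Cons.IH[of st1] Cons.prems run_step_sound[of X st s st1] by simp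
qed simp

end

section \<open>Ending a stage and classifying lower sets\<close>

fun guarded_Cons :: "bool \<Rightarrow> num \<Rightarrow> num list \<Rightarrow> num list" where
  "guarded_Cons True a as = a # as" | "guarded_Cons False a as = as"

fun parabolic_simples :: "num list \<Rightarrow> int list \<Rightarrow> num list" where
  "parabolic_simples (a # as) (x # xs) = guarded_Cons (x = 0) a (parabolic_simples as xs)"
| "parabolic_simples [] xs = []" | "parabolic_simples (a # as) [] = []"

fun option_maps_into :: "ts \<Rightarrow> simple_data option \<Rightarrow> bool" where
  "option_maps_into R None = False" | "option_maps_into R (Some (col, prs)) = maps_into R prs"

fun stable_under_all :: "simple_data_trie \<Rightarrow> ts \<Rightarrow> num list \<Rightarrow> bool" where
  "stable_under_all simple_data_trie R [] = True"
| "stable_under_all simple_data_trie R (a # as) = (mem R a \<and> option_maps_into R (lookup simple_data_trie a) \<and> stable_under_all simple_data_trie R as)"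

text \<open>Coefficients of positive roots and the entries of \<open>u\<close> are nonnegative, so
  the product vanishes exactly when no simple root outside the parabolic part occurs.\<close>

fun is_parabolic_part :: "table \<Rightarrow> ts \<Rightarrow> ts \<Rightarrow> int list \<Rightarrow> bool" where
  "is_parabolic_part [] R R0 u = True"
| "is_parabolic_part ((k, c) # t) R R0 u = ((mem R0 k \<longleftrightarrow> mem R k \<and> dot c u = 0) \<and> is_parabolic_part t R R0 u)"

fun splittings2 :: "num option \<Rightarrow> num \<Rightarrow> (num \<times> num) list \<Rightarrow> (num \<times> num) list" where
  "splittings2 None k r = r" | "splittings2 (Some l) k r = (k, l) # r"

fun splittings1 :: "bool \<Rightarrow> table \<Rightarrow> num \<Rightarrow> int list \<Rightarrow> int list \<Rightarrow> (num \<times> num) list \<Rightarrow> (num \<times> num) list" where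
  "splittings1 True t k d c r = splittings2 (row_id None t (vsub c 1 d)) k r"
| "splittings1 False t k d c r = r"

fun splittings :: "table \<Rightarrow> int list \<Rightarrow> table \<Rightarrow> (num \<times> num) list" where
  "splittings t c [] = []"
| "splittings t c ((k, d) # s) = splittings1 (coeffs_le True d c) t k d c (splittings t c s)"

fun option_splittings :: "table \<Rightarrow> int list option \<Rightarrow> (num \<times> num) list" where
  "option_splittings t None = []" | "option_splittings t (Some c) = splittings t c t"

fun splitting_table :: "table \<Rightarrow> int list tr \<Rightarrow> num list \<Rightarrow> (num \<times> (num \<times> num) list) list" where
  "splitting_table t ct [] = []" | "splitting_table t ct (b # bs) = (b, option_splittings t (lookup ct b)) # splitting_table t ct bs"

fun all_in :: "ts \<Rightarrow> (num \<times> num) list \<Rightarrow> bool" where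
  "all_in Q [] = True" | "all_in Q ((x, y) # ps) = (mem Q x \<and> mem Q y \<and> all_in Q ps)"

fun is_Some :: "'x option \<Rightarrow> bool" where "is_Some None = False" | "is_Some (Some x) = True"

text \<open>Every new root comes after both summands of each of its decompositions, so all the
  intermediate sets are lower and \<open>fibre_insert\<close> applies.\<close>

fun fills_up :: "int list tr \<Rightarrow> ts \<Rightarrow> (num \<times> (num \<times> num) list) list \<Rightarrow> ts \<Rightarrow> bool" where
  "fills_up ct Q [] R = eqs Q R"
| "fills_up ct Q ((b, ps) # ms) R = (is_Some (lookup ct b) \<and> \<not> mem Q b \<and> all_in Q ps \<and> fills_up ct (ins b Q) ms R)"

fun may_add :: "ts \<Rightarrow> (num \<times> num) list \<Rightarrow> bool" where
  "may_add S [] = True" | "may_add S ((x, y) # ps) = ((mem S x \<or> mem S y) \<and> may_add S ps)"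

fun may_omit :: "ts \<Rightarrow> (num \<times> num) list \<Rightarrow> bool" where
  "may_omit S [] = True" | "may_omit S ((x, y) # ps) = (\<not> (mem S x \<and> mem S y) \<and> may_omit S ps)"

text \<open>The generating function of the compatible extensions of \<open>S\<close> by the roots listed in \<open>ms\<close>, each of which
  comes with its decompositions into sums of two earlier roots.\<close>

fun extension_poly :: "bool \<Rightarrow> (num \<times> (num \<times> num) list) list \<Rightarrow> ts \<Rightarrow> int list" where
  "extension_poly False ms S = []"
| "extension_poly True [] S = [1]"
| "extension_poly True ((b, ps) # ms) S = poly_add (times_t (extension_poly (may_add S ps) ms (ins b S))) (extension_poly (may_omit S ps) ms S)"

fun times_exps :: "nat list \<Rightarrow> int list \<Rightarrow> int list" where
  "times_exps [] c = c" | "times_exps (e # es) c = times_geometric e (times_exps es c)"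

fun nonneg :: "int list \<Rightarrow> bool" where
  "nonneg [] = True" | "nonneg (x # xs) = (0 \<le> x \<and> nonneg xs)"

text \<open>A single row is enough: all rows of a valid table have the same length.\<close>

fun length_ok :: "table \<Rightarrow> int list \<Rightarrow> bool" where
  "length_ok [] u = False" | "length_ok ((k, c) # t) u = (length u = length c)"

text \<open>A nonzero \<open>c\<close> makes a vanishing defect force X = 0, and a zero
  \<open>c0\<close> means that the polynomial of the parabolic part is already known. The last test
  compares that polynomial times the fibre with the expected product.\<close>

fun evaluates2 :: "simple_data_trie \<Rightarrow> table \<Rightarrow> num list \<Rightarrow> int list \<Rightarrow> node \<Rightarrow> node \<Rightarrow> (num \<times> (num \<times> num) list) list \<Rightarrow> int list tr \<Rightarrow> bool" where
  "evaluates2 simple_data_trie t sl u (R, e, c) (R0, e0, c0) ms ct =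
    (length_ok t u \<and> \<not> coeffs_same c [] \<and> coeffs_same c0 [] \<and> nonneg u \<and> stable_under_all simple_data_trie R (parabolic_simples sl u) \<and> is_parabolic_part t R R0 u \<and>
     fills_up ct R0 ms R \<and> coeffs_same (times_exps e0 (extension_poly True ms E)) (times_exps e [1]))"

fun evaluates :: "simple_data_trie \<Rightarrow> table \<Rightarrow> num list \<Rightarrow> int list \<Rightarrow> node option \<Rightarrow> node option \<Rightarrow> (num \<times> (num \<times> num) list) list \<Rightarrow> int list tr \<Rightarrow> bool" where
  "evaluates simple_data_trie t sl u (Some n1) (Some n0) ms ct = evaluates2 simple_data_trie t sl u n1 n0 ms ct"
| "evaluates simple_data_trie t sl u None n0 ms ct = False"
| "evaluates simple_data_trie t sl u (Some n1) None ms ct = False"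

text \<open>Once X = 0 is known, the coefficients are reset to 0; the nodes are then valid for
  whatever unknown the next stage introduces.\<close>

fun forget_coeff :: "node option \<Rightarrow> node option" where
  "forget_coeff None = None" | "forget_coeff (Some (R, e, c)) = Some (R, e, [])"

fun forget_coeffs :: "node tr \<Rightarrow> node tr" where
  "forget_coeffs Lf = Lf" | "forget_coeffs (Nd l b r) = Nd (forget_coeffs l) (forget_coeff b) (forget_coeffs r)"

lemma lookup_zero: "lookup (forget_coeffs st) i = forget_coeff (lookup st i)"
proof (induction st arbitrary: i)
  case (Nd l b r)
  then show ?case by (cases i) auto
qed simp

text \<open>The distribution of heights is compared with a list of exponents only up to height 30; the largest height in
  \<open>E8\<close> is 29.\<close>

fun height_list1 :: "bool \<Rightarrow> int list \<Rightarrow> nat list \<Rightarrow> nat list" where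
  "height_list1 True c r = nat (list_ht c) # r" | "height_list1 False c r = r"

fun height_list :: "table \<Rightarrow> ts \<Rightarrow> nat list" where
  "height_list [] R = []" | "height_list ((k, c) # t) R = height_list1 (mem R k) c (height_list t R)"

fun count_lower_eq :: "nat \<Rightarrow> nat list \<Rightarrow> nat" where
  "count_lower_eq j [] = 0" | "count_lower_eq j (h # hs) = (if h = j then Suc (count_lower_eq j hs) else count_lower_eq j hs)"

fun count_lower_ge :: "nat \<Rightarrow> nat list \<Rightarrow> nat" where
  "count_lower_ge j [] = 0" | "count_lower_ge j (h # hs) = (if j \<le> h then Suc (count_lower_ge j hs) else count_lower_ge j hs)"

fun counts_agree :: "nat \<Rightarrow> nat list \<Rightarrow> nat list \<Rightarrow> bool" where
  "counts_agree 0 hs es = True"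
| "counts_agree (Suc j) hs es = (count_lower_eq (Suc j) hs = count_lower_ge (Suc j) es \<and> counts_agree j hs es)"

fun heights_small :: "nat list \<Rightarrow> bool" where
  "heights_small [] = True" | "heights_small (h # hs) = (h \<le> 30 \<and> heights_small hs)"

definition exps_ok :: "table \<Rightarrow> ts \<Rightarrow> nat list \<Rightarrow> bool" where
  "exps_ok t R es = (heights_small (height_list t R) \<and> heights_small es \<and> counts_agree 30 (height_list t R) es)"

text \<open>A stage starts from a seed, a node whose defect is the unknown \<open>X\<close>. At its end the defect of one node
  with nonzero coefficient is shown to vanish by evaluating its Poincare polynomial through the parabolic factorization; then
  \<open>X = 0\<close>, and all nodes of the stage are good. The last four arguments are that node, the node of its parabolic part, the
  indicator vector of the simple roots outside the parabolic part, and the remaining roots.\<close>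

datatype item = Plain "step list"
  | Stage int "int list" "nat list" "step list" int int "int list" "int list"

fun end_stage :: "simple_data_trie \<Rightarrow> int list tr \<Rightarrow> table \<Rightarrow> num list \<Rightarrow> node tr option \<Rightarrow> num \<Rightarrow> num \<Rightarrow> int list \<Rightarrow> num list \<Rightarrow> node tr option" where
  "end_stage simple_data_trie ct t sl None i i0 u Ms = None"
| "end_stage simple_data_trie ct t sl (Some st) i i0 u Ms =
    (if evaluates simple_data_trie t sl u (lookup st i) (lookup st i0) (splitting_table t ct Ms) ct then Some (forget_coeffs st) else None)"

fun option_forget :: "node tr option \<Rightarrow> node tr option" where
  "option_forget None = None" | "option_forget (Some st) = Some (forget_coeffs st)"

fun seed :: "bool \<Rightarrow> num \<Rightarrow> node \<Rightarrow> node tr \<Rightarrow> node tr option" where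
  "seed True i nd st = Some (update i nd st)" | "seed False i nd st = None"

fun run_items :: "table \<Rightarrow> int list tr \<Rightarrow> ts tr \<Rightarrow> simple_data_trie \<Rightarrow> num list \<Rightarrow> node tr option \<Rightarrow> item list \<Rightarrow> node tr option" where
  "run_items t ct dt simple_data_trie sl st [] = st"
| "run_items t ct dt simple_data_trie sl None (x # xs) = None"
| "run_items t ct dt simple_data_trie sl (Some st) (Plain ss # xs) =
    run_items t ct dt simple_data_trie sl (option_forget (run_steps t ct dt simple_data_trie (Some st) ss)) xs"
| "run_items t ct dt simple_data_trie sl (Some st) (Stage i gs es ss k k0 u Ms # xs) =
    run_items t ct dt simple_data_trie sl
      (end_stage simple_data_trie ct t sl (run_steps t ct dt simple_data_trie (seed (exps_ok t (down_sets dt gs) es) (tonum i) (down_sets dt gs, es, [1]) st) ss)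
        (tonum k) (tonum k0) u (nums Ms)) xs"

text \<open>A decision tree classifies the lower sets. \<open>Split x a b\<close> treats in \<open>a\<close> the sets without the root \<open>x\<close> and
  in \<open>b\<close> the sets with it; \<open>I\<close> and \<open>U\<close> below collect the roots known to be inside and outside. At a leaf the set is reduced
  to a smaller one by the coatom factorization, equal to the set of a node, or contains the given exceptional roots.\<close>

datatype tree = Split int tree tree | Red int | Known int | Bad

fun decides :: "ts \<Rightarrow> node option \<Rightarrow> ts \<Rightarrow> ts \<Rightarrow> bool" where
  "decides F None I U = False"
| "decides F (Some (R, e, c)) I U = (eqs R I \<and> eqs (uni I U) F)"

fun all_ids :: "table \<Rightarrow> ts" where
  "all_ids [] = E" | "all_ids ((k, c) # t) = ins k (all_ids t)"

fun off_parabolic1 :: "bool \<Rightarrow> num \<Rightarrow> int list \<Rightarrow> table \<Rightarrow> table" where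
  "off_parabolic1 True k c r = r" | "off_parabolic1 False k c r = (k, c) # r"

fun off_parabolic :: "table \<Rightarrow> int list \<Rightarrow> table" where
  "off_parabolic [] u = []" | "off_parabolic ((k, c) # t) u = off_parabolic1 (dot c u = 0) k c (off_parabolic t u)"

fun off_parabolic_trie1 :: "num \<Rightarrow> int list option \<Rightarrow> table \<Rightarrow> table tr \<Rightarrow> table tr" where
  "off_parabolic_trie1 a None t s = s" | "off_parabolic_trie1 a (Some u) t s = update a (off_parabolic t u) s"

fun off_parabolic_trie :: "table \<Rightarrow> int list tr \<Rightarrow> num list \<Rightarrow> table tr" where
  "off_parabolic_trie t ct [] = Lf" | "off_parabolic_trie t ct (a # as) = off_parabolic_trie1 a (lookup ct a) t (off_parabolic_trie t ct as)"

fun not_excluded1 :: "bool \<Rightarrow> int list \<Rightarrow> int list list \<Rightarrow> int list list" where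
  "not_excluded1 True c r = r" | "not_excluded1 False c r = c # r"

fun not_excluded :: "table \<Rightarrow> ts \<Rightarrow> int list list" where
  "not_excluded [] U = []" | "not_excluded ((k, c) # t) U = not_excluded1 (mem U k) c (not_excluded t U)"

fun differ1 :: "table \<Rightarrow> int list \<Rightarrow> int list list \<Rightarrow> bool" where
  "differ1 t c [] = True"
| "differ1 t c (d # cs) = (is_row (is_row False t (vsub d 1 c)) t (vsub c 1 d) \<and> differ1 t c cs)"

fun differ :: "table \<Rightarrow> int list list \<Rightarrow> bool" where
  "differ t [] = True" | "differ t (c # cs) = (differ1 t c cs \<and> differ t cs)"

fun coatom_step1 :: "table \<Rightarrow> int list list \<Rightarrow> int list \<Rightarrow> bool" where
  "coatom_step1 t cs u = (all_one cs u \<and> differ t cs)"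

text \<open>At a leaf the layer of the set is not fully known, but it is contained in the rows
  outside \<open>U\<close>. Testing all of these covers every lower set that reaches the
  leaf.\<close>

fun coatom_step :: "table \<Rightarrow> table option \<Rightarrow> simple_data option \<Rightarrow> int list option \<Rightarrow> num \<Rightarrow> ts \<Rightarrow> ts \<Rightarrow> bool" where
  "coatom_step t (Some l) (Some s) (Some u) j I U = (mem I j \<and> coatom_step1 t (not_excluded l U) u)"
| "coatom_step t None s u j I U = False"
| "coatom_step t (Some l) None u j I U = False"
| "coatom_step t (Some l) (Some s) None j I U = False"

fun all_mem :: "ts \<Rightarrow> num list \<Rightarrow> bool" where
  "all_mem I [] = True" | "all_mem I (b # bs) = (mem I b \<and> all_mem I bs)"

fun cover :: "table \<Rightarrow> ts \<Rightarrow> table tr \<Rightarrow> int list tr \<Rightarrow> ts tr \<Rightarrow> ts tr \<Rightarrow> simple_data_trie \<Rightarrow> node tr \<Rightarrow> num list option \<Rightarrow> ts \<Rightarrow> ts \<Rightarrow> tree \<Rightarrow> bool" where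
  "cover t F jt ct dt ut simple_data_trie st bs I U (Split x a b) =
    (is_Some (lookup dt (tonum x)) \<and> is_Some (lookup ut (tonum x)) \<and>
     cover t F jt ct dt ut simple_data_trie st bs I (option_uni (lookup ut (tonum x)) U) a \<and>
     cover t F jt ct dt ut simple_data_trie st bs (option_uni (lookup dt (tonum x)) I) U b)"
| "cover t F jt ct dt ut simple_data_trie st bs I U (Red j) =
    coatom_step t (lookup jt (tonum j)) (lookup simple_data_trie (tonum j)) (lookup ct (tonum j)) (tonum j) I U"
| "cover t F jt ct dt ut simple_data_trie st bs I U (Known i) = decides F (lookup st (tonum i)) I U"
| "cover t F jt ct dt ut simple_data_trie st None I U Bad = False"
| "cover t F jt ct dt ut simple_data_trie st (Some bs) I U Bad = all_mem I bs"

section \<open>Soundness of stages and of the decision tree\<close>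

context coord_system
begin

lemma stable_under_all_sound:
  assumes "stable_under_all sp R as" "lower (rs R)" "a \<in> set as"
  shows "mem R a" "stable (root a) (rs R)"
proof -
  have m: "mem R a" and o: "option_maps_into R (lookup sp a)" using assms(1,3) by (induction as) auto
  show "mem R a" by fact
  obtain col prs where "lookup sp a = Some (col, prs)" using o by (cases "lookup sp a") auto
  then show "stable (root a) (rs R)" using maps_into_sound(2) o assms(2) by auto
qed

lemma parabolic_simples_iff: "length as \<le> length u \<Longrightarrow> a \<in> set (parabolic_simples as u) \<longleftrightarrow> (\<exists>i<length as. as ! i = a \<and> u ! i = 0)"
proof (induction as u rule: parabolic_simples.induct)
  case (1 b as x xs)
  have "a \<in> set (guarded_Cons (x = 0) b ys) \<longleftrightarrow> x = 0 \<and> a = b \<or> a \<in> set ys" for ys by (cases "x = 0") auto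
  then show ?case using 1 by (auto simp: nth_Cons less_Suc_eq_0_disj)
qed auto

lemma is_parabolic_part_iff: "is_parabolic_part t R R0 u \<longleftrightarrow> (\<forall>(k, c)\<in>set t. mem R0 k \<longleftrightarrow> mem R k \<and> dot c u = 0)"
  by (induction t) auto

lemma nonneg_iff: "nonneg u \<longleftrightarrow> (\<forall>i<length u. u ! i \<ge> 0)"
  by (induction u) (auto simp: nth_Cons split: nat.splits)

lemma splittings_mem: "(x, y) \<in> set (splittings t c s) \<longleftrightarrow>
   (\<exists>d. (x, d) \<in> set s \<and> list_all2 (\<le>) d c \<and> row_id None t (vsub c 1 d) = Some y)"
proof (induction t c s rule: splittings.induct)
  case (2 t c k d s)
  have "(x, y) \<in> set (splittings1 b t k d c r) \<longleftrightarrow> b \<and> x = k \<and> row_id None t (vsub c 1 d) = Some y \<or> (x, y) \<in> set r" for b r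
    by (cases b; cases "row_id None t (vsub c 1 d)") auto
  then show ?case using 2 by (auto simp: coeffs_le_iff)
qed simp

lemma splittings_sound:
  assumes b: "(b, c) \<in> set tab" and xy: "x \<in> P" "y \<in> P" "x + y = root b"
  obtains k l where "(k, l) \<in> set (splittings tab c tab)" "x = root k" "y = root l"
proof -
  obtain k d where k: "(k, d) \<in> set tab" "x = vec d" "x = root k" using P_root_tab xy(1) by blast
  obtain l f where l: "(l, f) \<in> set tab" "y = vec f" "y = root l" using P_root_tab xy(2) by blast
  have "le x (root b)" using le_add_right[OF xy(2), of x] xy(3) by simp
  then have le: "list_all2 (\<le>) d c" using le_vec[OF tab_wf[OF k(1)] tab_wf[OF b]] k(2) root_tab[OF b] by simp
  have wf: "wf (vsub c 1 d)" using wf_vsub tab_wf b k(1) by blast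
  have "vec (vsub c 1 d) = root b - x"
    using vec_vsub[OF tab_wf[OF b] tab_wf[OF k(1)], of 1] k(2) root_tab[OF b] by simp
  also have "\<dots> = vec f" using xy(3) l(2) by (simp flip: xy(3))
  finally have f: "vsub c 1 d = f" using vec_inj[OF wf tab_wf[OF l(1)]] by blast
  have "row_id None tab f \<noteq> None" using row_id_None l(1) by force
  then obtain l' where l': "row_id None tab f = Some l'" by blast
  then have "root l' = y" using row_id_Some root_tab l(2) by blast
  moreover have "(k, l') \<in> set (splittings tab c tab)" using splittings_mem k(1) le f l' by blast
  ultimately show ?thesis using that k(3) by blast
qed

lemma splittings_root:
  assumes b: "(b, c) \<in> set tab" and "(k, l) \<in> set (splittings tab c tab)"
  shows "k \<in> fst ` set tab" "l \<in> fst ` set tab" "root k + root l = root b"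
proof -
  obtain d where d: "(k, d) \<in> set tab" "row_id None tab (vsub c 1 d) = Some l"
    using assms(2) splittings_mem by blast
  then have l: "(l, vsub c 1 d) \<in> set tab" using row_id_Some by blast
  show "k \<in> fst ` set tab" "l \<in> fst ` set tab" using d(1) l by force+
  show "root k + root l = root b"
    using root_tab[OF d(1)] root_tab[OF l] root_tab[OF b] vec_vsub[OF tab_wf[OF b] tab_wf[OF d(1)], of 1] by simp
qed

lemma mem_rs': "k \<in> fst ` set tab \<Longrightarrow> root k \<in> rs R \<longleftrightarrow> mem R k"
  using mem_rs root_tab by force

lemma may_add_iff: "may_add S ps \<longleftrightarrow> (\<forall>(x, y)\<in>set ps. mem S x \<or> mem S y)"
  by (induction ps) auto

lemma may_omit_iff: "may_omit S ps \<longleftrightarrow> (\<forall>(x, y)\<in>set ps. \<not> (mem S x \<and> mem S y))"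
  by (induction ps) auto

lemma all_in_iff: "all_in S ps \<longleftrightarrow> (\<forall>(x, y)\<in>set ps. mem S x \<and> mem S y)"
  by (induction ps) auto

text \<open>Induction along \<open>fibre_insert\<close>. The inclusion is part of the claim because
  that lemma needs the next root to lie in the final set.\<close>

lemma extension_poly_fibre:
  assumes "fills_up ct Q ms R" "lower (rs Q)" "\<forall>(b, ps)\<in>set ms. ps = option_splittings tab (lookup ct b)"
    "rs S \<in> compatible (rs Q)" "finite (rs R)"
  shows "Poly (extension_poly True ms S) = fibre (rs R) (rs Q) (rs S) \<and> rs Q \<subseteq> rs R"
  using assms
proof (induction ms arbitrary: Q S)
  case Nil
  then have "R = Q" using eqs_eq by auto
  then show ?case using fibre_self Nil by (simp add: one_pCons)
next
  case (Cons bp ms)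
  obtain b ps where bp: "bp = (b, ps)" by (cases bp)
  have d: "is_Some (lookup ct b)" "\<not> mem Q b" "all_in Q ps" "fills_up ct (ins b Q) ms R" using Cons.prems(1) bp by auto
  obtain c where c: "lookup ct b = Some c" using d(1) by (cases "lookup ct b") auto
  then have tb: "(b, c) \<in> set tab" using ct_tab by blast
  have ps: "ps = splittings tab c tab" using Cons.prems(3) bp c by simp
  have bid: "b \<in> fst ` set tab" using tb by force
  have bP: "root b \<in> P" using vec_P[OF tb] root_tab[OF tb] by simp
  have bQ: "root b \<notin> rs Q" using mem_rs'[OF bid] d(2) by simp
  have rQ: "rs (ins b Q) = insert (root b) (rs Q)" and rS: "rs (ins b S) = insert (root b) (rs S)"
    using rs_ins[OF bid] by auto
  have SQ: "rs S \<subseteq> rs Q" using compatibleD(1)[OF Cons.prems(4)] .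
  have pr: "x \<in> rs Q \<and> y \<in> rs Q" if xy: "x \<in> P" "y \<in> P" "x + y = root b" for x y
  proof -
    obtain k l where kl: "(k, l) \<in> set ps" "x = root k" "y = root l" using splittings_sound[OF tb xy] ps by blast
    then have "mem Q k" "mem Q l" using d(3) all_in_iff by blast+
    then show ?thesis using kl splittings_root[OF tb] ps mem_rs' by auto
  qed
  have lQ: "lower (insert (root b) (rs Q))"
    using Cons.prems(2) bP pr unfolding lower_def by blast
  have fo: "forced_in (rs Q - rs S) (root b) \<longleftrightarrow> \<not> may_add S ps"
  proof
    assume "forced_in (rs Q - rs S) (root b)"
    then obtain x y where xy: "x \<in> rs Q - rs S" "y \<in> rs Q - rs S" "x + y = root b" unfolding forced_in_def by blast
    then have "x \<in> P" "y \<in> P" using rs_P by auto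
    then obtain k l where kl: "(k, l) \<in> set ps" "x = root k" "y = root l" using splittings_sound[OF tb _ _ xy(3)] ps by blast
    then have "\<not> mem S k" "\<not> mem S l" using xy mem_rs'[of k S] mem_rs'[of l S] splittings_root[OF tb, of k l] ps by auto
    then show "\<not> may_add S ps" using kl(1) may_add_iff by blast
  next
    assume "\<not> may_add S ps"
    then obtain k l where kl: "(k, l) \<in> set ps" "\<not> mem S k" "\<not> mem S l" using may_add_iff by blast
    have ids: "k \<in> fst ` set tab" "l \<in> fst ` set tab" "root k + root l = root b" using splittings_root[OF tb] kl(1) ps by auto
    have "mem Q k" "mem Q l" using kl(1) d(3) all_in_iff by blast+
    then show "forced_in (rs Q - rs S) (root b)"
      unfolding forced_in_def using ids kl mem_rs' by (intro bexI[of _ "root k"] bexI[of _ "root l"]) auto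
  qed
  have fi: "forced_in (rs S) (root b) \<longleftrightarrow> \<not> may_omit S ps"
  proof
    assume "forced_in (rs S) (root b)"
    then obtain x y where xy: "x \<in> rs S" "y \<in> rs S" "x + y = root b" unfolding forced_in_def by blast
    then have "x \<in> P" "y \<in> P" using rs_P by auto
    then obtain k l where kl: "(k, l) \<in> set ps" "x = root k" "y = root l" using splittings_sound[OF tb _ _ xy(3)] ps by blast
    then have "mem S k" "mem S l" using xy mem_rs'[of k S] mem_rs'[of l S] splittings_root[OF tb, of k l] ps by auto
    then show "\<not> may_omit S ps" using kl(1) may_omit_iff by blast
  next
    assume "\<not> may_omit S ps"
    then obtain k l where kl: "(k, l) \<in> set ps" "mem S k" "mem S l" using may_omit_iff by blast
    have ids: "k \<in> fst ` set tab" "l \<in> fst ` set tab" "root k + root l = root b" using splittings_root[OF tb] kl(1) ps by auto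
    then show "forced_in (rs S) (root b)"
      unfolding forced_in_def using kl mem_rs' by (intro bexI[of _ "root k"] bexI[of _ "root l"]) auto
  qed
  have bS: "root b \<notin> rs S" using SQ bQ by blast
  note ci = compatible_insert_iff[OF Cons.prems(2) bQ bP bS]
  have pms: "\<forall>(b, ps)\<in>set ms. ps = option_splittings tab (lookup ct b)" using Cons.prems(3) by simp
  \<comment> \<open>The induction hypothesis yields the inclusion from any admissible extension; by
    \<open>no_conflict\<close> at least one of the two exists.\<close>
  have inc: "insert (root b) (rs Q) \<subseteq> rs R"
  proof (cases "may_add S ps")
    case True
    then show ?thesis using Cons.IH[OF d(4) lQ[folded rQ] pms, of "ins b S"] Cons.prems(4,5) ci(2) fo rQ rS by simp
  next
    case False
    then have "forced_in (rs Q - rs S) (root b)" using fo by simp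
    then have "\<not> forced_in (rs S) (root b)" using no_conflict[OF Cons.prems(2) bP Cons.prems(4)] by blast
    then show ?thesis using Cons.IH[OF d(4) lQ[folded rQ] pms, of S] Cons.prems(4,5) ci(1) rQ by simp
  qed
  have "Poly (extension_poly (may_add S ps) ms (ins b S)) =
      (if forced_in (rs Q - rs S) (root b) then 0 else fibre (rs R) (insert (root b) (rs Q)) (insert (root b) (rs S)))"
  proof (cases "may_add S ps")
    case True
    then show ?thesis using Cons.IH[OF d(4) lQ[folded rQ] pms, of "ins b S"] Cons.prems(4,5) ci(2) fo rQ rS by simp
  qed (use fo in simp)
  moreover have "Poly (extension_poly (may_omit S ps) ms S) =
      (if forced_in (rs S) (root b) then 0 else fibre (rs R) (insert (root b) (rs Q)) (rs S))"
  proof (cases "may_omit S ps")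
    case True
    then show ?thesis using Cons.IH[OF d(4) lQ[folded rQ] pms, of S] Cons.prems(4,5) ci(1) fi rQ by simp
  qed (use fi in simp)
  ultimately show ?case
    using fibre_insert[OF Cons.prems(5,2) inc bQ bP Cons.prems(4)] inc bp by simp
qed

lemma splitting_table_pairs: "(b, ps) \<in> set (splitting_table tab ct Ms) \<Longrightarrow> ps = option_splittings tab (lookup ct b)"
  by (induction Ms) auto

lemma Poly_pmts: "Poly (times_exps es c) = exps_poly es * Poly c"
  by (induction es) (simp_all add: exps_poly_def mult.assoc)

lemma evaluates2_sound:
  assumes ok: "node_ok X (R, e, c)" "node_ok X (R0, e0, c0)"
    and k: "evaluates2 sp tab sl u (R, e, c) (R0, e0, c0) (splitting_table tab ct Ms) ct"
  shows "X = 0"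
proof -
  let ?ms = "splitting_table tab ct Ms"
  have lu: "length u = N"
  proof -
    have "length_ok tab u" using k by simp
    then obtain j d t where "tab = (j, d) # t" "length u = length d"
      by (cases tab) auto
    then show ?thesis using tab_list[of j d] by simp
  qed
  have c: "Poly c \<noteq> 0" "Poly c0 = 0" "nonneg u" "stable_under_all sp R (parabolic_simples sl u)" "is_parabolic_part tab R R0 u"
     "fills_up ct R0 ?ms R" "coeffs_same (times_exps e0 (extension_poly True ?ms E)) (times_exps e [1])"
    using k coeffs_same_iff_zero by auto
  have low: "lower (rs R)" "lower (rs R0)" using ok by auto
  define J where "J = {\<alpha> i | i. i < n \<and> u ! i = 0}"
  have J: "\<delta> \<in> rs R \<and> stable \<delta> (rs R)" if dJ: "\<delta> \<in> J" for \<delta>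
  proof -
    obtain i where i: "i < n" "u ! i = 0" "\<delta> = \<alpha> i" using dJ by (auto simp: J_def)
    have "sl ! i \<in> set (parabolic_simples sl u)" using parabolic_simples_iff[of sl u "sl ! i"] len_sl lu nN i by auto
    then have "mem R (sl ! i)" "stable (root (sl ! i)) (rs R)" using stable_under_all_sound[OF c(4) low(1)] by auto
    moreover have "sl ! i \<in> fst ` set tab" using sl_root(1)[OF i(1)] by force
    ultimately show ?thesis using mem_rs' sl_root(3)[OF i(1)] i(3) by metis
  qed
  have Q: "rs R0 = {x\<in>rs R. \<forall>\<epsilon>\<in>\<Delta> - J. coord x \<epsilon> = 0}"
  proof -
    have "x \<in> rs R0 \<longleftrightarrow> x \<in> rs R \<and> (\<forall>\<epsilon>\<in>\<Delta> - J. coord x \<epsilon> = 0)" if xP: "x \<in> P" for x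
    proof -
      obtain k d where kd: "(k, d) \<in> set tab" "x = vec d" using P_root_tab[OF xP] by blast
      have D: "\<Delta> - J = {\<alpha> i | i. i < n \<and> u ! i \<noteq> 0}"
        using inj_simple by (auto simp: J_def simple_eq inj_on_def)
      have "(\<forall>\<epsilon>\<in>\<Delta> - J. coord x \<epsilon> = 0) \<longleftrightarrow> (\<forall>i<n. u ! i \<noteq> 0 \<longrightarrow> d ! i = 0)"
        unfolding D kd(2) using coord_vec by auto
      also have "\<dots> \<longleftrightarrow> (\<Sum>i<n. d ! i * u ! i) = 0"
        using tab_list[OF kd(1)] c(3)[unfolded nonneg_iff] lu nN by (subst sum_nonneg_eq_0_iff) auto
      also have "\<dots> \<longleftrightarrow> dot d u = 0" using dot_wf[OF tab_wf[OF kd(1)] lu] by simp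
      finally show ?thesis
        using c(5) kd(1) mem_rs[OF kd(1)] unfolding is_parabolic_part_iff kd(2) by blast
    qed
    then show ?thesis using rs_P by blast
  qed
  have JD: "J \<subseteq> \<Delta>" by (auto simp: J_def simple_eq)
  have "poincare (rs R) = poincare (rs R0) * fibre (rs R) (rs R0) {}"
    using poincare_parabolic[OF low(1) JD J Q] .
  moreover have "Poly (extension_poly True ?ms E) = fibre (rs R) (rs R0) {}"
  proof -
    have "rs E \<in> compatible (rs R0)" unfolding rs_E by (rule compatibleI) auto
    then show ?thesis
      using extension_poly_fibre[OF c(6) low(2) _ _ lower_finite[OF low(1)], of E] splitting_table_pairs rs_E by auto
  qed
  moreover have "poincare (rs R0) = exps_poly e0" using ok(2) c(2) by (simp add: defect_def)
  moreover have "exps_poly e0 * Poly (extension_poly True ?ms E) = exps_poly e"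
    using coeffs_same_Poly[OF c(7)] by (simp add: Poly_pmts one_pCons)
  ultimately have "defect (rs R) e = 0" by (simp add: defect_def)
  then show ?thesis using ok(1) c(1) by simp
qed

lemma evaluates_sound:
  assumes "inv X st" "evaluates sp tab sl u (lookup st i) (lookup st i0) (splitting_table tab ct Ms) ct"
  shows "X = 0"
proof -
  obtain R e c R0 e0 c0 where n: "lookup st i = Some (R, e, c)" "lookup st i0 = Some (R0, e0, c0)"
    using assms(2) by (cases "lookup st i"; cases "lookup st i0") auto
  show ?thesis
    by (rule evaluates2_sound[of X R e c R0 e0 c0 u Ms]) (use assms n in \<open>auto simp only: inv_def evaluates.simps\<close>)
qed

lemma inv_zero: "inv 0 st \<Longrightarrow> inv X (forget_coeffs st)"
  unfolding inv_def lookup_zero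
proof (intro allI impI)
  fix i nd assume a: "\<forall>i nd. lookup st i = Some nd \<longrightarrow> node_ok 0 nd" "forget_coeff (lookup st i) = Some nd"
  then obtain R e c where n: "lookup st i = Some (R, e, c)" by (cases "lookup st i") auto
  then have "node_ok 0 (R, e, c)" using a(1) by blast
  then show "node_ok X nd" using a(2) n by auto
qed

lemma height_list_count: "count_lower_eq j (height_list t R) = length (filter (\<lambda>(k, c). mem R k \<and> nat (list_ht c) = j) t)"
proof (induction t R rule: height_list.induct)
  case (2 k c t R)
  then show ?case by (cases "mem R k") auto
qed simp

lemma count_lower_ge_filter: "count_lower_ge j es = length (filter (\<lambda>e. j \<le> e) es)"
  by (induction es) auto

lemma counts_agree_iff: "counts_agree m hs es \<longleftrightarrow> (\<forall>j. 1 \<le> j \<and> j \<le> m \<longrightarrow> count_lower_eq j hs = count_lower_ge j es)"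
proof (induction m)
  case (Suc m)
  show ?case unfolding counts_agree.simps Suc by (auto simp: le_Suc_eq)
qed simp

lemma heights_small_iff: "heights_small hs \<longleftrightarrow> (\<forall>h\<in>set hs. h \<le> 30)"
  by (induction hs) auto

lemma count_lower_eq_0: "\<forall>h\<in>set hs. h < j \<Longrightarrow> count_lower_eq j hs = 0"
  by (induction hs) auto

lemma count_lower_ge_0: "\<forall>h\<in>set hs. h < j \<Longrightarrow> count_lower_ge j hs = 0"
  by (induction hs) auto

lemma exps_ok_sound:
  assumes "exps_ok tab R es" shows "has_exps (rs R) es"
  unfolding has_exps_def
proof (intro allI impI)
  fix j :: nat assume j: "j \<ge> 1"
  let ?f = "filter (\<lambda>(k, c). mem R k \<and> nat (list_ht c) = j) tab"
  have h: "ht \<Delta> (root k) = real j \<longleftrightarrow> nat (list_ht c) = j" if "(k, c) \<in> set tab" for k c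
  proof -
    have "ht \<Delta> (root k) = of_int (list_ht c)" using list_ht_ht[OF tab_wf[OF that]] root_tab[OF that] by simp
    then show ?thesis using j by auto
  qed
  have img: "{x\<in>rs R. ht \<Delta> x = real j} = root ` set (map fst ?f)"
    using h unfolding rs_def by force
  have inj: "inj_on root (set (map fst ?f))"
    by (rule inj_onI, rule root_inj[OF _ _ distinct_snd]) auto
  have "card (set (map fst ?f)) = length (map fst ?f)"
    by (rule distinct_card) (rule distinct_map_filter[OF distinct_tab])
  then have "hcount (rs R) j = count_lower_eq j (height_list tab R)"
    unfolding hcount_def height_list_count img card_image[OF inj] by simp
  also have "\<dots> = count_lower_ge j es"
  proof (cases "j \<le> 30")
    case True
    then show ?thesis using assms j unfolding exps_ok_def counts_agree_iff by blast
  next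
    case False
    then show ?thesis using assms count_lower_eq_0[of "height_list tab R" j] count_lower_ge_0[of es j] by (force simp: exps_ok_def heights_small_iff)
  qed
  finally show "hcount (rs R) j = length (filter (\<lambda>e. j \<le> e) es)" by (simp add: count_lower_ge_filter)
qed

text \<open>Between items the nodes are valid for every unknown, within a stage only for the defect
  of its seed. The quantified assumption is what allows the next stage to choose its own
  unknown.\<close>

lemma run_items_sound:
  "inv 0 st \<Longrightarrow> (\<And>X. inv X st) \<Longrightarrow> run_items tab ct dt sp sl (Some st) its = Some st' \<Longrightarrow> inv 0 st'"
proof (induction its arbitrary: st)
  case (Cons it its)
  note prems = Cons.prems and IH = Cons.IH
  have none: "run_items tab ct dt sp sl None its = Some st' \<Longrightarrow> False" by (cases its) auto
  show ?case
  proof (cases it)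
    case (Plain ss)
    obtain st1 where st1: "run_steps tab ct dt sp (Some st) ss = Some st1"
      using prems(3) none Plain by (cases "run_steps tab ct dt sp (Some st) ss") auto
    have "inv 0 st1" using run_steps_sound[OF prems(1) st1] .
    then show ?thesis using IH[of "forget_coeffs st1"] inv_zero prems(3) Plain st1 by simp
  next
    case (Stage i gs es ss k k0 u Ms)
    let ?R = "down_sets dt gs"
    have e: "exps_ok tab ?R es"
    proof (rule ccontr)
      assume "\<not> exps_ok tab ?R es"
      then have "run_steps tab ct dt sp (seed (exps_ok tab ?R es) (tonum i) (?R, es, [1]) st) ss = None"
        by (cases ss) auto
      then show False using prems(3) none Stage by simp
    qed
    let ?st = "update (tonum i) (?R, es, [1]) st"
    obtain st1 where st1: "run_steps tab ct dt sp (Some ?st) ss = Some st1"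
      using prems(3) none Stage e by (cases "run_steps tab ct dt sp (Some ?st) ss") auto
    have k: "evaluates sp tab sl u (lookup st1 (tonum k)) (lookup st1 (tonum k0)) (splitting_table tab ct (nums Ms)) ct"
      using prems(3) none Stage e st1 by (auto split: if_splits)
    \<comment> \<open>The unknown is chosen as the defect of the seed, so the seed enters with
      coefficient 1.\<close>
    let ?X = "defect (rs ?R) es"
    have "node_ok ?X (?R, es, [1])" using lower_gens exps_ok_sound[OF e] by (simp add: one_pCons)
    then have "inv ?X ?st" using inv_upd prems(2) by blast
    then have i1: "inv ?X st1" using run_steps_sound st1 by blast
    then have "?X = 0" using evaluates_sound k by blast
    then have "inv 0 st1" using i1 by simp
    then show ?thesis using IH[of "forget_coeffs st1"] inv_zero prems(3) Stage st1 e k by simp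
  qed
qed simp

text \<open>Node 1 of every certificate is the empty lower set; derived nodes are numbered from 2
  on.\<close>

definition init :: "node tr" where "init = update num.One (E, [], []) Lf"

lemma inv_init: "inv X init"
  unfolding inv_def init_def lookup_upd
  by (auto simp: rs_E lower_def has_exps_def hcount_def defect_def poincare_empty exps_poly_def
      split: if_splits)

lemma mem_fulls: "mem (all_ids t) k \<longleftrightarrow> k \<in> fst ` set t"
  by (induction t) (auto simp: mem_ins)

lemma off_parabolic_mem: "(k, c) \<in> set (off_parabolic t u) \<longleftrightarrow> (k, c) \<in> set t \<and> dot c u \<noteq> 0"
proof (induction t)
  case (Cons ld t)
  obtain l d where "ld = (l, d)" by (cases ld)
  then show ?case using Cons by (cases "dot d u = 0") auto
qed simp

lemma off_parabolic_trie_Some: "lookup (off_parabolic_trie t ct as) j = Some l \<Longrightarrow> \<exists>u. lookup ct j = Some u \<and> l = off_parabolic t u"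
proof (induction as)
  case (Cons a as)
  then show ?case by (cases "lookup ct a") (auto simp: lookup_upd split: if_splits)
qed simp

lemma not_excluded_mem: "c \<in> set (not_excluded t U) \<longleftrightarrow> (\<exists>k. (k, c) \<in> set t \<and> \<not> mem U k)"
proof (induction t)
  case (Cons kd t)
  obtain k d where "kd = (k, d)" by (cases kd)
  then show ?case using Cons by (cases "mem U k") auto
qed simp

lemma differ1_iff: "differ1 t c cs \<longleftrightarrow> (\<forall>d\<in>set cs. vsub d 1 c \<in> snd ` set t \<or> vsub c 1 d \<in> snd ` set t)"
  by (induction cs) (auto simp: is_row_iff)

lemma differ_D: "differ t cs \<Longrightarrow> c \<in> set cs \<Longrightarrow> d \<in> set cs \<Longrightarrow> c \<noteq> d \<Longrightarrow>
    vsub d 1 c \<in> snd ` set t \<or> vsub c 1 d \<in> snd ` set t"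
  by (induction cs) (auto simp: differ1_iff)

abbreviation "jt \<equiv> off_parabolic_trie tab ct sl"

lemma coatom_step_sound:
  assumes r: "coatom_step tab (lookup jt j) (lookup sp j) (lookup ct j) j I U" and R: "lower R" "rs I \<subseteq> R" "R \<inter> rs U = {}"
  obtains M where "M = {x\<in>R. coord x (root j) \<noteq> 0}" "\<And>x. x \<in> M \<Longrightarrow> coord x (root j) = 1"
     "\<And>x y. x \<in> M \<Longrightarrow> y \<in> M \<Longrightarrow> x \<noteq> y \<Longrightarrow> x - y \<in> \<Phi>" "root j \<in> \<Delta>" "root j \<in> R"
proof -
  obtain l' s u where l': "lookup jt j = Some l'" and l: "lookup sp j = Some s" "lookup ct j = Some u"
    using r by (cases "lookup jt j"; cases "lookup sp j"; cases "lookup ct j") auto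
  let ?cs = "not_excluded l' U"
  have l'_eq: "l' = off_parabolic tab u" using off_parabolic_trie_Some[OF l'] l(2) by auto
  have c: "mem I j" "all_one ?cs u" "differ tab ?cs" using r l l' by auto
  have tj: "(j, u) \<in> set tab" using l(2) ct_tab by simp
  have jD: "root j \<in> \<Delta>" using coef_simple(1)[OF l tab_wf[OF tj]] .
  have jR: "root j \<in> R" using mem_rs[OF tj] c(1) root_tab[OF tj] R(2) by auto
  define M where "M = {x\<in>R. coord x (root j) \<noteq> 0}"
  have inav: "\<exists>c. c \<in> set ?cs \<and> x = vec c \<and> wf c" if x: "x \<in> M" for x
  proof -
    have xR: "x \<in> R" "x \<in> P" using x lower_P[OF R(1)] by (auto simp: M_def)
    then obtain k d where kd: "(k, d) \<in> set tab" "x = vec d" using P_root_tab by blast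
    have "dot d u \<noteq> 0" using x coef_simple(2)[OF l tab_wf[OF kd(1)]] kd(2) by (simp add: M_def)
    moreover have "\<not> mem U k" using mem_rs[OF kd(1)] kd(2) xR(1) R(3) by blast
    ultimately show ?thesis using not_excluded_mem[of d l' U] off_parabolic_mem[of k d tab u] l'_eq kd tab_wf by blast
  qed
  have one: "coord x (root j) = 1" if x: "x \<in> M" for x
  proof -
    obtain c' where c': "c' \<in> set ?cs" "x = vec c'" "wf c'" using inav[OF x] by blast
    then have "dot c' u = 1" using c(2) all_one_iff by blast
    then show ?thesis using coef_simple(2)[OF l c'(3)] c'(2) by simp
  qed
  have diff: "x - y \<in> \<Phi>" if xy: "x \<in> M" "y \<in> M" "x \<noteq> y" for x y
  proof -
    obtain f g where f: "f \<in> set ?cs" "x = vec f" "wf f" and g: "g \<in> set ?cs" "y = vec g" "wf g"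
      using inav xy by blast
    then have "f \<noteq> g" using xy(3) by auto
    then have "vsub g 1 f \<in> snd ` set tab \<or> vsub f 1 g \<in> snd ` set tab" using differ_D[OF c(3)] f g by blast
    then have "vec (vsub g 1 f) \<in> P \<or> vec (vsub f 1 g) \<in> P" using vec_P by force
    then have "y - x \<in> P \<or> x - y \<in> P" using vec_vsub[OF f(3) g(3), of 1] vec_vsub[OF g(3) f(3), of 1] f g by simp
    then show ?thesis using P_root root_minus[of "y - x"] by auto
  qed
  show ?thesis using that[OF M_def one diff jD jR] by simp
qed

lemma all_mem_iff: "all_mem I bs \<longleftrightarrow> (\<forall>b\<in>set bs. mem I b)"
  by (induction bs) auto

definition covered :: "num list option \<Rightarrow> 'a set \<Rightarrow> bool" where
  "covered bso R \<longleftrightarrow> good R \<or> (\<exists>bs. bso = Some bs \<and> root ` set bs \<subseteq> R)"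

lemma lower_diff_simple:
  assumes "lower R" "\<delta> \<in> \<Delta>" shows "lower (R - {x\<in>R. coord x \<delta> \<noteq> 0})"
  unfolding lower_def
proof (intro conjI ballI impI)
  show "R - {x\<in>R. coord x \<delta> \<noteq> 0} \<subseteq> P" using lower_P[OF assms(1)] by blast
  fix x y assume xy: "x \<in> P" "y \<in> P" "x + y \<in> R - {x\<in>R. coord x \<delta> \<noteq> 0}"
  then have "x \<in> R" using lower_addD(1)[OF assms(1)] by blast
  moreover have "coord x \<delta> = 0"
  proof -
    have "coord (x + y) \<delta> = 0" using xy(3) by blast
    then show ?thesis
      using P_coord[OF xy(1) assms(2)] P_coord[OF xy(2) assms(2)] unfolding coord_add by linarith
  qed
  ultimately show "x \<in> R - {x\<in>R. coord x \<delta> \<noteq> 0}" by simp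
qed

text \<open>The assumption on proper lower subsets is the induction hypothesis of
  \<open>cover_sound\<close>. Because of it a leaf \<open>Red\<close> needs no node for the reduced
  set.\<close>

lemma cover_tree:
  assumes st: "inv 0 st" and R: "lower R" and hyp: "\<And>R'. R' \<subset> R \<Longrightarrow> lower R' \<Longrightarrow> covered bso R'"
    and bso: "\<And>bs. bso = Some bs \<Longrightarrow> set bs \<subseteq> fst ` set tab"
  shows "cover tab (all_ids tab) jt ct dt ut sp st bso I U t \<Longrightarrow> rs I \<subseteq> R \<Longrightarrow> R \<inter> rs U = {} \<Longrightarrow> covered bso R"
proof (induction t arbitrary: I U)
  case (Split x a b)
  obtain D W where DW: "lookup dt (tonum x) = Some D" "lookup ut (tonum x) = Some W"
    using Split.prems(1) by (cases "lookup dt (tonum x)"; cases "lookup ut (tonum x)") auto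
  obtain c where c: "(tonum x, c) \<in> set tab" "rs D = {y\<in>P. le y (vec c)}" using dt_rs[OF DW(1)] by blast
  obtain d where d: "(tonum x, d) \<in> set tab" "rs W = {y\<in>P. le (vec d) y}" using ut_rs[OF DW(2)] by blast
  have dc: "d = c" using c(1) d(1) tab_map_of by simp
  show ?case
  proof (cases "vec c \<in> R")
    case True
    then have "rs D \<subseteq> R" using lower_le[OF R] c(2) by blast
    then show ?thesis using Split.IH(2)[of "uni D I" U] Split.prems DW by (simp add: rs_uni)
  next
    case False
    have "R \<inter> rs W = {}" using False lower_le[OF R _ vec_P[OF c(1)]] d(2) dc by blast
    then show ?thesis using Split.IH(1)[of I "uni W U"] Split.prems DW by (simp add: rs_uni Int_Un_distrib)
  qed
next
  case (Red j)
  let ?j = "tonum j"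
  have r: "coatom_step tab (lookup jt ?j) (lookup sp ?j) (lookup ct ?j) ?j I U" using Red.prems(1) by simp
  obtain M where M: "M = {x\<in>R. coord x (root ?j) \<noteq> 0}" "\<And>x. x \<in> M \<Longrightarrow> coord x (root ?j) = 1"
     "\<And>x y. x \<in> M \<Longrightarrow> y \<in> M \<Longrightarrow> x \<noteq> y \<Longrightarrow> x - y \<in> \<Phi>" "root ?j \<in> \<Delta>" "root ?j \<in> R"
    by (rule coatom_step_sound[OF r R Red.prems(2,3)]) (rule that)
  have "root ?j \<in> M" using M(4,5) by (simp add: M(1) coord_simple)
  then have "R - M \<subset> R" using M(5) by blast
  moreover have "lower (R - M)" unfolding M(1) by (rule lower_diff_simple[OF R M(4)])
  ultimately have "covered bso (R - M)" using hyp by blast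
  \<comment> \<open>If the reduced set is not good, it contains the exceptional roots, and then so
    does R.\<close>
  then show ?case
    using good_coatom[OF R M(4,5,1-3)] unfolding covered_def by blast
next
  case (Known i)
  have "decides (all_ids tab) (lookup st (tonum i)) I U" using Known.prems(1) by simp
  then obtain Q e c where Q: "lookup st (tonum i) = Some (Q, e, c)" and eq: "Q = I" "uni I U = all_ids tab"
    using eqs_eq by (cases "lookup st (tonum i)") auto
  have "x \<in> R \<longleftrightarrow> x \<in> rs Q" if xP: "x \<in> P" for x
  proof -
    obtain k d where kd: "(k, d) \<in> set tab" "x = vec d" using P_root_tab[OF xP] by blast
    have "mem (uni I U) k" unfolding eq(2) mem_fulls using kd(1) by force
    then have "x \<in> rs I \<or> x \<in> rs U" using mem_rs[OF kd(1)] kd(2) by (simp add: mem_uni)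
    then show ?thesis using Known.prems(2,3) eq(1) by blast
  qed
  then have "R = rs Q" using lower_P[OF R] rs_P by blast
  moreover have "node_ok 0 (Q, e, c)" using st Q unfolding inv_def by blast
  ultimately have "good R" by (auto simp: good_def defect_def)
  then show ?case by (simp add: covered_def)
next
  case Bad
  then obtain bs where bs: "bso = Some bs" "all_mem I bs" by (cases bso) auto
  have "root ` set bs \<subseteq> R"
  proof
    fix x assume "x \<in> root ` set bs"
    then obtain b where b: "b \<in> set bs" "x = root b" by blast
    then have "mem I b" "b \<in> fst ` set tab" using bs bso all_mem_iff by auto
    then have "x \<in> rs I" using mem_rs' b(2) by blast
    then show "x \<in> R" using Bad.prems(2) by blast
  qed
  then show ?case using bs(1) by (auto simp: covered_def)
qed

lemma cover_sound:
  assumes st: "inv 0 st" and c: "cover tab (all_ids tab) jt ct dt ut sp st bso E E t"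
    and bso: "\<And>bs. bso = Some bs \<Longrightarrow> set bs \<subseteq> fst ` set tab"
  shows "lower R \<Longrightarrow> covered bso R"
proof (induction "card R" arbitrary: R rule: less_induct)
  case less
  have "covered bso R'" if "R' \<subset> R" "lower R'" for R'
    using less.hyps psubset_card_mono[OF lower_finite[OF less.prems] that(1)] that(2) by blast
  then show ?case
    using cover_tree[OF st less.prems _ bso c] by (simp add: rs_E)
qed

end

section \<open>Validity of the root tables\<close>

fun reflects_into :: "table \<Rightarrow> int list \<Rightarrow> int list list \<Rightarrow> int list list \<Rightarrow> bool" where
  "reflects_into acc c (col # cols) (u # us) =
    (coeffs_eq True c u \<or> is_row False acc (vsub c (dot c col) u) \<or> reflects_into acc c cols us)"
| "reflects_into acc c [] us = False" | "reflects_into acc c (col # cols) [] = False"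

fun generated :: "table \<Rightarrow> table \<Rightarrow> int list list \<Rightarrow> int list list \<Rightarrow> bool" where
  "generated acc [] cols us = True"
| "generated acc ((k, c) # t) cols us = (reflects_into acc c cols us \<and> generated ((k, c) # acc) t cols us)"

fun reflections_in :: "table \<Rightarrow> int list \<Rightarrow> int list list \<Rightarrow> int list list \<Rightarrow> bool" where
  "reflections_in t c (col # cols) (u # us) =
    ((coeffs_eq True c u \<or> is_row False t (vsub c (dot c col) u)) \<and> reflections_in t c cols us)"
| "reflections_in t c [] us = True" | "reflections_in t c (col # cols) [] = True"

fun reflection_closed :: "table \<Rightarrow> table \<Rightarrow> int list list \<Rightarrow> int list list \<Rightarrow> bool" where
  "reflection_closed t [] cols us = True"
| "reflection_closed t ((k, c) # s) cols us = (reflections_in t c cols us \<and> reflection_closed t s cols us)"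

definition units :: "nat \<Rightarrow> nat \<Rightarrow> int list list" where
  "units n N = map (\<lambda>i. (replicate N 0)[i := 1]) [0..<n]"

text \<open>A table satisfying \<open>generated\<close> and \<open>reflection_closed\<close> lists all positive roots: each of its roots is simple or a simple
  reflection of an earlier one, and it is closed under simple reflections apart from \<open>\<alpha> \<mapsto> - \<alpha>\<close>.\<close>

definition table_ok :: "nat \<Rightarrow> nat \<Rightarrow> table \<Rightarrow> num list \<Rightarrow> int list list \<Rightarrow> bool" where
  "table_ok n N t sl cols \<longleftrightarrow> n \<le> N \<and> distinct (map fst t) \<and> distinct (map snd t) \<and>
    list_all (\<lambda>(k, c). length c = N \<and> list_all (\<lambda>x. 0 \<le> x) c \<and> list_all (\<lambda>x. x = 0) (drop n c)) t \<and>
    map (map_of t) sl = map Some (units n N) \<and>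
    length cols = n \<and> list_all (\<lambda>c. length c = N) cols \<and>
    generated [] t cols (units n N) \<and> reflection_closed t t cols (units n N) \<and> t \<noteq> []"

fun verify3 :: "table \<Rightarrow> ts \<Rightarrow> table tr \<Rightarrow> int list tr \<Rightarrow> ts tr \<Rightarrow> ts tr \<Rightarrow> simple_data_trie \<Rightarrow> node tr option \<Rightarrow> num list option \<Rightarrow> tree \<Rightarrow> bool" where
  "verify3 t F jt ct dt ut simple_data_trie None bso tr = False"
| "verify3 t F jt ct dt ut simple_data_trie (Some st) bso tr = cover t F jt ct dt ut simple_data_trie st bso E E tr"

definition verify2 :: "table \<Rightarrow> int list tr \<Rightarrow> ts tr \<Rightarrow> ts tr \<Rightarrow> simple_data_trie \<Rightarrow> num list \<Rightarrow> item list \<Rightarrow> num list option \<Rightarrow> tree \<Rightarrow> bool" where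
  "verify2 t ct dt ut simple_data_trie sl its bso tr =
    verify3 t (all_ids t) (off_parabolic_trie t ct sl) ct dt ut simple_data_trie (run_items t ct dt simple_data_trie sl (Some (update num.One (E, [], []) Lf)) its) bso tr"

definition verify1 :: "table \<Rightarrow> int list tr \<Rightarrow> num list \<Rightarrow> int list list \<Rightarrow> item list \<Rightarrow> num list option \<Rightarrow> tree \<Rightarrow> bool" where
  "verify1 t ct sl cols its bso tr = verify2 t ct (down_trie t t) (up_trie t t) (simple_trie t ct sl cols) sl its bso tr"

definition verify :: "table \<Rightarrow> num list \<Rightarrow> int list list \<Rightarrow> item list \<Rightarrow> num list option \<Rightarrow> tree \<Rightarrow> bool" where
  "verify t sl cols its bso tr = verify1 t (coord_trie t) sl cols its bso tr"

lemma reflects_into_iff: "reflects_into acc c cols us \<longleftrightarrow> (\<exists>j<length cols. j < length us \<and>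
    (c = us ! j \<or> vsub c (dot c (cols ! j)) (us ! j) \<in> snd ` set acc))"
proof (induction acc c cols us rule: reflects_into.induct)
  case (1 acc c col cols u us)
  then show ?case by (simp add: coeffs_eq_iff is_row_iff Ex_less_Suc2 disj_assoc)
qed auto

lemma reflections_in_iff: "reflections_in t c cols us \<longleftrightarrow> (\<forall>j<length cols. j < length us \<longrightarrow>
    (c = us ! j \<or> vsub c (dot c (cols ! j)) (us ! j) \<in> snd ` set t))"
proof (induction t c cols us rule: reflections_in.induct)
  case (1 t c col cols u us)
  then show ?case by (simp add: coeffs_eq_iff is_row_iff All_less_Suc2)
qed auto

lemma reflection_closed_iff: "reflection_closed t s cols us \<longleftrightarrow> (\<forall>(k, c)\<in>set s. reflections_in t c cols us)"
  by (induction s) auto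

context coord_base
begin

lemma refl_vec:
  assumes "wf c" "j < n"
  shows "rfl (\<alpha> j) (vec c) = vec (vsub c (dot c (cols ! j)) ((replicate N 0)[j := 1]))"
    "wf (vsub c (dot c (cols ! j)) ((replicate N 0)[j := 1]))"
proof -
  note u = sl_root[OF assms(2)]
  have wu: "wf ((replicate N 0)[j := 1])" using tab_wf[OF u(1)] .
  show "rfl (\<alpha> j) (vec c) = vec (vsub c (dot c (cols ! j)) ((replicate N 0)[j := 1]))"
    using vec_vsub[OF assms(1) wu] u(2) cartan_vec[OF assms] by (simp add: rfl_def)
  show "wf (vsub c (dot c (cols ! j)) ((replicate N 0)[j := 1]))" using wf_vsub[OF assms(1) wu] .
qed

lemma units_nth: "j < n \<Longrightarrow> units n N ! j = (replicate N 0)[j := 1]" "length (units n N) = n"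
  by (simp_all add: units_def)

lemma generated_roots:
  assumes "generated acc t cols (units n N)" "set t \<subseteq> set tab" "\<forall>(k, c)\<in>set acc. vec c \<in> \<Phi>"
  shows "\<forall>(k, c)\<in>set t. vec c \<in> \<Phi>"
  using assms
proof (induction t arbitrary: acc)
  case (Cons kc t)
  obtain k c where kc: "kc = (k, c)" by (cases kc)
  have wf: "wf c" using Cons.prems(2) kc tab_wf by auto
  have "reflects_into acc c cols (units n N)" using Cons.prems(1) kc by simp
  then obtain j where j0: "j < n" "c = units n N ! j \<or>
      vsub c (dot c (cols ! j)) (units n N ! j) \<in> snd ` set acc"
    unfolding reflects_into_iff len_cols by blast
  then have j: "j < n" "c = (replicate N 0)[j := 1] \<or>
      vsub c (dot c (cols ! j)) ((replicate N 0)[j := 1]) \<in> snd ` set acc"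
    using units_nth(1) by auto
  have aF: "\<alpha> j \<in> \<Phi>" using simple_Phi simple_mem j(1) by blast
  have "vec c \<in> \<Phi>"
    using j(2)
  proof
    assume "c = (replicate N 0)[j := 1]"
    then show ?thesis using sl_root(2)[OF j(1)] aF by simp
  next
    assume "vsub c (dot c (cols ! j)) ((replicate N 0)[j := 1]) \<in> snd ` set acc"
    then have "rfl (\<alpha> j) (vec c) \<in> \<Phi>" using refl_vec(1)[OF wf j(1)] Cons.prems(3) by force
    then show ?thesis using refl_root[OF aF] rfl_rfl[OF aF] by metis
  qed
  then show ?case using Cons.IH[of "(k, c) # acc"] Cons.prems kc by auto
qed simp

text \<open>One inclusion is \<open>generated_roots\<close>. For the other, a positive root that is
  not simple has positive Cartan number with some simple root; its reflection has smaller height, is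
  listed by induction, and reflecting back stays in the table.\<close>

lemma P_eq_tab:
  assumes g: "generated [] tab cols (units n N)" and c: "reflection_closed tab tab cols (units n N)"
  shows "P = vec ` snd ` set tab"
proof
  have "vec c \<in> P" if "(k, c) \<in> set tab" for k c
  proof -
    have "vec c \<in> \<Phi>" using generated_roots[OF g] that by auto
    moreover have "coord (vec c) \<delta> \<ge> 0" if "\<delta> \<in> \<Delta>" for \<delta>
      using that coord_vec tab_list[OF \<open>(k, c) \<in> set tab\<close>] nN unfolding simple_eq by fastforce
    ultimately show ?thesis by (simp add: positive_roots_def)
  qed
  then show "vec ` snd ` set tab \<subseteq> P" by auto
  have "\<And>x. x \<in> P \<Longrightarrow> ht \<Delta> x \<le> real m \<Longrightarrow> x \<in> vec ` snd ` set tab" for m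
  proof (induction m)
    case 0
    then show ?case using ht_pos[OF 0(1)] by simp
  next
    case (Suc m)
    show ?case
    proof (cases "x \<in> \<Delta>")
      case True
      then obtain i where "i < n" "x = \<alpha> i" unfolding simple_eq by auto
      then show ?thesis using sl_root[of i] by force
    next
      case False
      then obtain \<delta> where d: "\<delta> \<in> \<Delta>" "x - \<delta> \<in> P" "coord x \<delta> > 0" "x \<bullet> \<delta> > 0"
        using P_minus_simple[OF Suc.prems(1)] by blast
      obtain j where j: "j < n" "\<delta> = \<alpha> j" using d(1) unfolding simple_eq by auto
      have ne: "x \<noteq> \<delta>" using False d(1) by auto
      let ?y = "rfl \<delta> x"
      have y: "?y \<in> P" "?y \<noteq> \<delta>" using rfl_P[OF d(1) Suc.prems(1) ne] by auto
      have dF: "\<delta> \<in> \<Phi>" using simple_Phi[OF d(1)] .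
      have "cartan_number x \<delta> > 0" using d(4) root_inner_pos[OF dF] by (simp add: cartan_number_def)
      then have "cartan_number x \<delta> \<ge> 1"
        using cartan_Ints[OF dF P_root[OF Suc.prems(1)]] by (auto elim!: Ints_cases)
      moreover have "ht \<Delta> ?y = ht \<Delta> x - cartan_number x \<delta>"
      proof -
        have "ht \<Delta> (cartan_number x \<delta> *\<^sub>R \<delta>) = cartan_number x \<delta> * ht \<Delta> \<delta>"
          by (simp add: ht_def coord_scale sum_distrib_left)
        then show ?thesis by (simp add: rfl_def ht_diff ht_simple[OF d(1)])
      qed
      ultimately have "ht \<Delta> ?y \<le> real m" using Suc.prems(2) by simp
      then obtain k e where e: "(k, e) \<in> set tab" "?y = vec e" using Suc.IH[OF y(1)] by auto
      have "reflections_in tab e cols (units n N)" using c e(1) reflection_closed_iff by blast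
      then have "e = units n N ! j \<or> vsub e (dot e (cols ! j)) (units n N ! j) \<in> snd ` set tab"
        unfolding reflections_in_iff using j(1) len_cols units_nth(2) by simp
      moreover have "e \<noteq> units n N ! j" using y(2) e(2) units_nth(1)[OF j(1)] sl_root(2)[OF j(1)] j(2) by auto
      ultimately have m: "vsub e (dot e (cols ! j)) ((replicate N 0)[j := 1]) \<in> snd ` set tab"
        using units_nth(1)[OF j(1)] by simp
      have "x = rfl \<delta> (vec e)" using rfl_rfl[OF dF, of x] unfolding e(2) by simp
      also have "\<dots> = vec (vsub e (dot e (cols ! j)) ((replicate N 0)[j := 1]))"
        unfolding j(2) using refl_vec(1)[OF tab_wf[OF e(1)] j(1)] .
      finally show ?thesis using m by blast
    qed
  qed
  then show "P \<subseteq> vec ` snd ` set tab" using real_arch_simple by blast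
qed

end

context coord_system
begin

lemma verify_sound:
  assumes v: "verify tab sl cols its bso tr"
    and bso: "\<And>bs. bso = Some bs \<Longrightarrow> set bs \<subseteq> fst ` set tab" and R: "lower R"
  shows "covered bso R"
proof -
  obtain st where st: "run_items tab ct dt sp sl (Some init) its = Some st" "cover tab (all_ids tab) jt ct dt ut sp st bso E E tr"
    using v unfolding verify_def verify1_def verify2_def init_def
    by (cases "run_items tab ct dt sp sl (Some (update num.One (E, [], []) Lf)) its") auto
  show ?thesis
    using cover_sound[OF run_items_sound[OF inv_init inv_init st(1)] st(2) bso R] by blast
qed

end

lemma (in based_root_system) verified:
  assumes simple: "\<Delta> = \<alpha> ` {..<n}" "inj_on \<alpha> {..<n}"
    and cartan: "\<And>i j. i < n \<Longrightarrow> j < n \<Longrightarrow> of_int (cols ! j ! i) = cartan_number (\<alpha> i) (\<alpha> j)"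
    and pre: "table_ok n N tab sl cols"
  shows "coord_system \<Phi> \<Delta> \<alpha> n N tab sl cols"
proof -
  have sl: "map (map_of tab) sl = map Some (units n N)" using pre by (simp add: table_ok_def)
  then have len: "length sl = n" by (metis length_map units_def diff_zero length_upt)
  have slu: "map_of tab (sl ! i) = Some ((replicate N 0)[i := 1])" if "i < n" for i
  proof -
    have "map (map_of tab) sl ! i = map Some (units n N) ! i" using sl by simp
    then show ?thesis using that len by (simp add: units_def)
  qed
  interpret cb: coord_base \<Phi> \<Delta> \<alpha> n N tab sl cols
  proof
    fix k c assume "(k, c) \<in> set tab"
    then have a: "length c = N" "list_all (\<lambda>x. 0 \<le> x) c" "list_all (\<lambda>x. x = 0) (drop n c)"
      using pre by (auto simp: table_ok_def list_all_iff)
    have "c ! i = 0" if "n \<le> i" "i < N" for i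
    proof -
      have "\<forall>k<N - n. c ! (n + k) = 0" using a(1,3) by (simp add: list_all_length)
      from this[rule_format, of "i - n"] show ?thesis using that by simp
    qed
    then show "length c = N \<and> (\<forall>i<N. 0 \<le> c ! i \<and> (n \<le> i \<longrightarrow> c ! i = 0))"
      using a by (auto simp: list_all_length)
  qed (use assms len slu in \<open>auto simp: table_ok_def list_all_iff\<close>)
  show ?thesis
    by unfold_locales (use pre cb.P_eq_tab in \<open>auto simp: table_ok_def\<close>)
qed

section \<open>Counting lower sets\<close>

fun remove_ids1 :: "bool \<Rightarrow> num \<Rightarrow> num list \<Rightarrow> num list" where
  "remove_ids1 True u r = r" | "remove_ids1 False u r = u # r"

fun remove_ids :: "ts \<Rightarrow> num list \<Rightarrow> num list" where
  "remove_ids S [] = []" | "remove_ids S (u # us) = remove_ids1 (mem S u) u (remove_ids S us)"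

text \<open>The first list only bounds the depth of the recursion.\<close>

fun count_lower :: "ts tr \<Rightarrow> ts tr \<Rightarrow> num list \<Rightarrow> num list \<Rightarrow> int" where
  "count_lower dt ut fs [] = 1"
| "count_lower dt ut [] (x # us) = 0"
| "count_lower dt ut (f # fs) (x # us) =
    count_lower dt ut fs (remove_ids (option_uni (lookup ut x) E) us) + count_lower dt ut fs (remove_ids (option_uni (lookup dt x) E) us)"

fun down_union :: "ts tr \<Rightarrow> num list \<Rightarrow> ts" where
  "down_union dt [] = E" | "down_union dt (b # bs) = option_uni (lookup dt b) (down_union dt bs)"

definition count_lower3 :: "ts tr \<Rightarrow> ts tr \<Rightarrow> num list \<Rightarrow> int" where
  "count_lower3 dt ut us = count_lower dt ut us us"

definition count_lower2 :: "ts tr \<Rightarrow> ts tr \<Rightarrow> num list \<Rightarrow> num list \<Rightarrow> int" where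
  "count_lower2 dt ut ks bs = count_lower3 dt ut (remove_ids (down_union dt bs) ks)"

definition count_above :: "table \<Rightarrow> num list \<Rightarrow> int" where
  "count_above t bs = count_lower2 (down_trie t t) (up_trie t t) (map fst t) bs"

definition count_lower2' :: "ts tr \<Rightarrow> ts tr \<Rightarrow> num list \<Rightarrow> num \<Rightarrow> int" where
  "count_lower2' dt ut ks a = count_lower3 dt ut (remove_ids (option_uni (lookup ut a) E) ks)"

definition count_avoiding :: "table \<Rightarrow> num \<Rightarrow> int" where
  "count_avoiding t a = count_lower2' (down_trie t t) (up_trie t t) (map fst t) a"

lemma remove_ids_filter: "remove_ids S us = filter (\<lambda>u. \<not> mem S u) us"
proof (induction us)
  case (Cons u us)
  then show ?case by (cases "mem S u") auto
qed simp

context based_root_system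
begin

text \<open>Order ideals, that is down-sets of \<open>A\<close> in the root order. For
  \<open>A = P\<close> they are the lower sets, hence the complements of the ideals of the
  theorem.\<close>

definition ideals :: "'a set \<Rightarrow> 'a set set" where
  "ideals A = {S. S \<subseteq> A \<and> (\<forall>x\<in>S. \<forall>y\<in>A. le y x \<longrightarrow> y \<in> S)}"

lemma lower_ideals: "lower R \<longleftrightarrow> R \<in> ideals P"
proof
  assume R: "lower R"
  then have "R \<subseteq> P" by (simp add: lower_def)
  then show "R \<in> ideals P" unfolding ideals_def using lower_le[OF R] by blast
next
  assume R: "R \<in> ideals P"
  show "lower R"
    unfolding lower_def
  proof (intro conjI ballI impI)
    show "R \<subseteq> P" using R by (simp add: ideals_def)
    fix x y assume "x \<in> P" "y \<in> P" "x + y \<in> R"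
    then show "x \<in> R" using R le_add_right[of y x] by (auto simp: ideals_def)
  qed
qed

lemma ideals_avoiding: "x \<in> A \<Longrightarrow> {S\<in>ideals A. x \<notin> S} = ideals {y\<in>A. \<not> le x y}"
proof (intro equalityI subsetI)
  fix S assume "x \<in> A" "S \<in> {S\<in>ideals A. x \<notin> S}"
  then show "S \<in> ideals {y\<in>A. \<not> le x y}" by (auto simp: ideals_def)
next
  fix S assume x: "x \<in> A" and S: "S \<in> ideals {y\<in>A. \<not> le x y}"
  have "y \<in> S" if "z \<in> S" "y \<in> A" "le y z" for y z
  proof -
    have "\<not> le x z" using S that(1) by (auto simp: ideals_def)
    then have "\<not> le x y" using le_trans that(3) by blast
    then show ?thesis using S that by (auto simp: ideals_def)
  qed
  then show "S \<in> {S\<in>ideals A. x \<notin> S}" using S by (auto simp: ideals_def)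
qed

lemma card_ideals_above:
  assumes W: "W \<subseteq> A"
  shows "card {S\<in>ideals A. W \<subseteq> S} = card (ideals (A - {y\<in>A. \<exists>b\<in>W. le y b}))"
proof (rule bij_betw_same_card[OF bij_betwI])
  let ?D = "{y\<in>A. \<exists>b\<in>W. le y b}"
  have D: "?D \<subseteq> S" if "S \<in> {S\<in>ideals A. W \<subseteq> S}" for S using that by (auto simp: ideals_def)
  show "(\<lambda>S. S - ?D) \<in> {S\<in>ideals A. W \<subseteq> S} \<rightarrow> ideals (A - ?D)"
    by (auto simp: ideals_def)
  show "(\<lambda>S. S \<union> ?D) \<in> ideals (A - ?D) \<rightarrow> {S\<in>ideals A. W \<subseteq> S}"
  proof
    fix S assume S: "S \<in> ideals (A - ?D)"
    have "y \<in> S \<union> ?D" if "x \<in> S \<union> ?D" "y \<in> A" "le y x" for x y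
    proof (cases "y \<in> ?D")
      case False
      then have "x \<notin> ?D" using that(2,3) le_trans by blast
      then show ?thesis using S that False by (auto simp: ideals_def)
    qed simp
    moreover have "S \<union> ?D \<subseteq> A" using S by (auto simp: ideals_def)
    moreover have "W \<subseteq> ?D" using W le_refl by blast
    ultimately show "S \<union> ?D \<in> {S\<in>ideals A. W \<subseteq> S}" unfolding ideals_def by blast
  qed
  show "S - ?D \<union> ?D = S" if "S \<in> {S\<in>ideals A. W \<subseteq> S}" for S using D[OF that] by blast
  show "S \<union> ?D - ?D = S" if "S \<in> ideals (A - ?D)" for S using that by (auto simp: ideals_def)
qed

lemma finite_ideals: "finite A \<Longrightarrow> finite (ideals A)"
  by (rule finite_subset[of _ "Pow A"]) (auto simp: ideals_def)

text \<open>The recursion of \<open>count_lower\<close>: a down-set avoiding x contains nothing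
  above x, and one containing x contains everything below x, so in each case only the undecided
  elements remain.\<close>

lemma card_ideals:
  assumes "finite A" "x \<in> A"
  shows "card (ideals A) = card (ideals {y\<in>A. \<not> le x y}) + card (ideals {y\<in>A. \<not> le y x})"
proof -
  have "ideals A = {S\<in>ideals A. x \<notin> S} \<union> {S\<in>ideals A. {x} \<subseteq> S}" by auto
  then have "card (ideals A) = card {S\<in>ideals A. x \<notin> S} + card {S\<in>ideals A. {x} \<subseteq> S}"
    using finite_ideals[OF assms(1)] by (subst card_Un_disjoint[symmetric]) auto
  moreover have "A - {y\<in>A. \<exists>b\<in>{x}. le y b} = {y\<in>A. \<not> le y x}" by auto
  ultimately show ?thesis
    using ideals_avoiding[OF assms(2)] card_ideals_above[of "{x}" A] assms(2) by simp
qed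

end

context coord_system
begin

lemma up_mem: "k \<in> fst ` set tab \<Longrightarrow> x \<in> fst ` set tab \<Longrightarrow> mem (option_uni (lookup ut x) E) k \<longleftrightarrow> le (root x) (root k)"
proof -
  assume k: "k \<in> fst ` set tab" "x \<in> fst ` set tab"
  then obtain c where c: "(x, c) \<in> set tab" by auto
  then have l: "lookup ut x = Some (up_set tab c)" by (simp add: lookup_mkut tab_map_of)
  have "rs (up_set tab c) = {y\<in>P. le (root x) y}" using ut_rs[OF l] c root_tab tab_map_of by (metis option.inject)
  moreover have "root k \<in> P" using k vec_P root_tab by force
  ultimately show ?thesis using mem_rs'[OF k(1), of "up_set tab c"] l by (simp add: mem_uni)
qed

lemma down_mem: "k \<in> fst ` set tab \<Longrightarrow> x \<in> fst ` set tab \<Longrightarrow> mem (option_uni (lookup dt x) S) k \<longleftrightarrow> le (root k) (root x) \<or> mem S k"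
proof -
  assume k: "k \<in> fst ` set tab" "x \<in> fst ` set tab"
  then obtain c where c: "(x, c) \<in> set tab" by auto
  then have l: "lookup dt x = Some (down_set tab c)" by (simp add: lookup_mkdt tab_map_of)
  have "rs (down_set tab c) = {y\<in>P. le y (root x)}" using dt_rs[OF l] c root_tab tab_map_of by (metis option.inject)
  moreover have "root k \<in> P" using k vec_P root_tab by force
  ultimately show ?thesis using mem_rs'[OF k(1), of "down_set tab c"] l by (simp add: mem_uni)
qed

lemma down_union_mem: "k \<in> fst ` set tab \<Longrightarrow> set bs \<subseteq> fst ` set tab \<Longrightarrow>
    mem (down_union dt bs) k \<longleftrightarrow> (\<exists>b\<in>set bs. le (root k) (root b))"
  by (induction bs) (auto simp: down_mem)

lemma count_lower_ideals:
  "length us \<le> length fs \<Longrightarrow> set us \<subseteq> fst ` set tab \<Longrightarrow> count_lower dt ut fs us = int (card (ideals (root ` set us)))"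
proof (induction fs arbitrary: us)
  case Nil
  then show ?case by (simp add: ideals_def)
next
  case (Cons f fs)
  show ?case
  proof (cases us)
    case Nil
    then show ?thesis by (simp add: ideals_def)
  next
    case us: (Cons x us')
    let ?U = "remove_ids (option_uni (lookup ut x) E) us'" and ?D = "remove_ids (option_uni (lookup dt x) E) us'"
    have x: "x \<in> fst ` set tab" and s: "set us' \<subseteq> fst ` set tab" using Cons.prems us by auto
    have "length ?U \<le> length fs" "length ?D \<le> length fs"
      using Cons.prems(1) us by (auto simp: remove_ids_filter intro: order_trans[OF length_filter_le])
    then have "count_lower dt ut fs ?U = int (card (ideals (root ` set ?U)))" "count_lower dt ut fs ?D = int (card (ideals (root ` set ?D)))"
      using Cons.IH[of ?U] Cons.IH[of ?D] s unfolding remove_ids_filter by auto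
    moreover have "root ` set ?U = {y\<in>root ` set us. \<not> le (root x) y}"
    proof -
      have "\<forall>k\<in>set us'. mem (option_uni (lookup ut x) E) k = le (root x) (root k)" using up_mem[OF _ x] s by blast
      then show ?thesis unfolding us remove_ids_filter by auto
    qed
    moreover have "root ` set ?D = {y\<in>root ` set us. \<not> le y (root x)}"
    proof -
      have "\<forall>k\<in>set us'. mem (option_uni (lookup dt x) E) k = le (root k) (root x)"
        using down_mem[OF _ x, of _ E] s by (metis mem.simps(1) subsetD)
      then show ?thesis unfolding us remove_ids_filter by auto
    qed
    ultimately show ?thesis using card_ideals[of "root ` set us" "root x"] us by simp
  qed
qed

lemma root_ids: "root ` fst ` set tab = P"
proof (intro equalityI subsetI)
  fix x assume "x \<in> root ` fst ` set tab"
  then obtain k c where "(k, c) \<in> set tab" "x = root k" by auto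
  then show "x \<in> P" using root_tab vec_P by simp
next
  fix x assume "x \<in> P"
  then obtain k c where "(k, c) \<in> set tab" "x = root k" using P_root_tab by blast
  then show "x \<in> root ` fst ` set tab" by force
qed

lemma root_filter:
  assumes "\<And>k. k \<in> fst ` set tab \<Longrightarrow> mem S k \<longleftrightarrow> Q (root k)"
  shows "root ` set (remove_ids S (map fst tab)) = {y\<in>P. \<not> Q y}"
proof (intro equalityI subsetI)
  fix y assume "y \<in> root ` set (remove_ids S (map fst tab))"
  then obtain k where "k \<in> fst ` set tab" "\<not> mem S k" "y = root k" unfolding remove_ids_filter by auto
  then show "y \<in> {y\<in>P. \<not> Q y}" using assms root_ids by blast
next
  fix y assume y: "y \<in> {y\<in>P. \<not> Q y}"
  then obtain k where k: "k \<in> fst ` set tab" "y = root k" using root_ids by blast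
  then have "\<not> mem S k" using assms y by blast
  then have "k \<in> set (remove_ids S (map fst tab))" using k(1) unfolding remove_ids_filter by simp
  then show "y \<in> root ` set (remove_ids S (map fst tab))" using k(2) by blast
qed

lemma count_above_card:
  assumes "set bs \<subseteq> fst ` set tab"
  shows "count_above tab bs = int (card {R. lower R \<and> root ` set bs \<subseteq> R})"
proof -
  let ?us = "remove_ids (down_union dt bs) (map fst tab)" and ?W = "root ` set bs"
  have W: "?W \<subseteq> P" using assms root_ids by blast
  have "root ` set ?us = {y\<in>P. \<not> (\<exists>b\<in>?W. le y b)}"
    by (rule root_filter) (use down_union_mem[OF _ assms] in auto)
  also have "\<dots> = P - {y\<in>P. \<exists>b\<in>?W. le y b}" by auto
  finally have "root ` set ?us = P - {y\<in>P. \<exists>b\<in>?W. le y b}" .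
  moreover have "count_above tab bs = int (card (ideals (root ` set ?us)))"
    unfolding count_above_def count_lower2_def count_lower3_def by (rule count_lower_ideals) (auto simp: remove_ids_filter)
  ultimately show ?thesis using card_ideals_above[OF W] by (simp add: lower_ideals)
qed

lemma count_avoiding_card:
  assumes "a \<in> fst ` set tab"
  shows "count_avoiding tab a = int (card {R. lower R \<and> root a \<notin> R})"
proof -
  let ?us = "remove_ids (option_uni (lookup ut a) E) (map fst tab)"
  have aP: "root a \<in> P" using assms root_ids by blast
  have "root ` set ?us = {y\<in>P. \<not> le (root a) y}"
    by (rule root_filter) (rule up_mem[OF _ assms])
  moreover have "count_avoiding tab a = int (card (ideals (root ` set ?us)))"
    unfolding count_avoiding_def count_lower2'_def count_lower3_def by (rule count_lower_ideals) (auto simp: remove_ids_filter)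
  ultimately show ?thesis using ideals_avoiding[OF aP] by (simp add: lower_ideals)
qed

end

section \<open>The exceptional root systems\<close>

text \<open>The certificates were found by computer search. The simple roots are in Bourbaki's order. The tables and
  certificates of \<open>E6\<close> and \<open>E7\<close> are initial segments of those of \<open>E7\<close> and \<open>E8\<close>.\<close>

fun number :: "num \<Rightarrow> int list list \<Rightarrow> table" where
  "number k [] = []" | "number k (c # cs) = (k, c) # number (Num.inc k) cs"

definition rootsE6 :: "int list list" where
  "rootsE6 = [[1,0,0,0,0,0,0,0], [0,1,0,0,0,0,0,0], [0,0,1,0,0,0,0,0], [0,0,0,1,0,0,0,0], [0,0,0,0,1,0,0,0],
   [0,0,0,0,0,1,0,0], [1,0,1,0,0,0,0,0], [0,1,0,1,0,0,0,0], [0,0,1,1,0,0,0,0], [0,0,0,1,1,0,0,0], [0,0,0,0,1,1,0,0],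
   [1,0,1,1,0,0,0,0], [0,1,1,1,0,0,0,0], [0,1,0,1,1,0,0,0], [0,0,1,1,1,0,0,0], [0,0,0,1,1,1,0,0], [1,1,1,1,0,0,0,0],
   [1,0,1,1,1,0,0,0], [0,1,1,1,1,0,0,0], [0,1,0,1,1,1,0,0], [0,0,1,1,1,1,0,0], [1,1,1,1,1,0,0,0], [1,0,1,1,1,1,0,0],
   [0,1,1,2,1,0,0,0], [0,1,1,1,1,1,0,0], [1,1,1,2,1,0,0,0], [1,1,1,1,1,1,0,0], [0,1,1,2,1,1,0,0], [1,1,2,2,1,0,0,0],
   [1,1,1,2,1,1,0,0], [0,1,1,2,2,1,0,0], [1,1,2,2,1,1,0,0], [1,1,1,2,2,1,0,0], [1,1,2,2,2,1,0,0], [1,1,2,3,2,1,0,0],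
   [1,2,2,3,2,1,0,0]]"

definition rootsE7 :: "int list list" where
  "rootsE7 = rootsE6 @ [[0,0,0,0,0,0,1,0], [0,0,0,0,0,1,1,0], [0,0,0,0,1,1,1,0], [0,0,0,1,1,1,1,0],
   [0,1,0,1,1,1,1,0], [0,0,1,1,1,1,1,0], [1,0,1,1,1,1,1,0], [0,1,1,1,1,1,1,0], [1,1,1,1,1,1,1,0], [0,1,1,2,1,1,1,0],
   [1,1,1,2,1,1,1,0], [0,1,1,2,2,1,1,0], [1,1,2,2,1,1,1,0], [1,1,1,2,2,1,1,0], [0,1,1,2,2,2,1,0], [1,1,2,2,2,1,1,0],
   [1,1,1,2,2,2,1,0], [1,1,2,3,2,1,1,0], [1,1,2,2,2,2,1,0], [1,2,2,3,2,1,1,0], [1,1,2,3,2,2,1,0], [1,2,2,3,2,2,1,0],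
   [1,1,2,3,3,2,1,0], [1,2,2,3,3,2,1,0], [1,2,2,4,3,2,1,0], [1,2,3,4,3,2,1,0], [2,2,3,4,3,2,1,0]]"

definition rootsE8 :: "int list list" where
  "rootsE8 = rootsE7 @ [[0,0,0,0,0,0,0,1], [0,0,0,0,0,0,1,1], [0,0,0,0,0,1,1,1], [0,0,0,0,1,1,1,1],
   [0,0,0,1,1,1,1,1], [0,1,0,1,1,1,1,1], [0,0,1,1,1,1,1,1], [1,0,1,1,1,1,1,1], [0,1,1,1,1,1,1,1], [1,1,1,1,1,1,1,1],
   [0,1,1,2,1,1,1,1], [1,1,1,2,1,1,1,1], [0,1,1,2,2,1,1,1], [1,1,2,2,1,1,1,1], [1,1,1,2,2,1,1,1], [0,1,1,2,2,2,1,1],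
   [1,1,2,2,2,1,1,1], [1,1,1,2,2,2,1,1], [0,1,1,2,2,2,2,1], [1,1,2,3,2,1,1,1], [1,1,2,2,2,2,1,1], [1,1,1,2,2,2,2,1],
   [1,2,2,3,2,1,1,1], [1,1,2,3,2,2,1,1], [1,1,2,2,2,2,2,1], [1,2,2,3,2,2,1,1], [1,1,2,3,3,2,1,1], [1,1,2,3,2,2,2,1],
   [1,2,2,3,3,2,1,1], [1,2,2,3,2,2,2,1], [1,1,2,3,3,2,2,1], [1,2,2,4,3,2,1,1], [1,2,2,3,3,2,2,1], [1,1,2,3,3,3,2,1],
   [1,2,3,4,3,2,1,1], [1,2,2,4,3,2,2,1], [1,2,2,3,3,3,2,1], [2,2,3,4,3,2,1,1], [1,2,3,4,3,2,2,1], [1,2,2,4,3,3,2,1],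
   [2,2,3,4,3,2,2,1], [1,2,3,4,3,3,2,1], [1,2,2,4,4,3,2,1], [2,2,3,4,3,3,2,1], [1,2,3,4,4,3,2,1], [2,2,3,4,4,3,2,1],
   [1,2,3,5,4,3,2,1], [2,2,3,5,4,3,2,1], [1,3,3,5,4,3,2,1], [2,3,3,5,4,3,2,1], [2,2,4,5,4,3,2,1], [2,3,4,5,4,3,2,1],
   [2,3,4,6,4,3,2,1], [2,3,4,6,5,3,2,1], [2,3,4,6,5,4,2,1], [2,3,4,6,5,4,3,1], [2,3,4,6,5,4,3,2]]"

text \<open>The two stages end at the full positive systems of types D4 and E6, evaluated over
  parabolic parts of types A3 and D5.\<close>

definition certE6 :: "item list" where "certE6 = [Plain [Coat 2 [1] 1 1 [1],
    Coat 3 [2] 1 2 [2],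
    Coat 4 [3] 1 3 [3],
    Coat 5 [7] 2 3 [3,7],
    Coat 6 [8] 3 4 [4,8],
    Coat 7 [9] 4 4 [4,9],
    Coat 8 [12] 5 4 [4,9,12],
    Coat 9 [14] 6 5 [5,10,14],
    Coat 10 [13] 6 3 [3,9,13],
    Coat 11 [15] 7 5 [5,10,15],
    Coat 12 [12,15] 8 5 [5,10,15],
    Coat 13 [18] 8 5 [5,10,15,18],
    Coat 14 [17] 8 2 [2,8,13,17],
    Coat 15 [20] 9 6 [6,11,16,20],
    Coat 16 [13,14] 9 3 [3,9,13],
    Coat 17 [13,15] 10 5 [5,10,15],
    Coat 18 [12,21] 12 6 [6,11,16,21],
    Coat 19 [18,21] 13 6 [6,11,16,21],
    Coat 20 [23] 13 6 [6,11,16,21,23],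
    Coat 21 [17,18] 13 2 [2,8,13,17],
    Coat 22 [14,17] 14 5 [5,10,14],
    Coat 23 [20,21] 15 3 [3,9,15,21],
    Coat 24 [13,20] 15 3 [3,9,13],
    Coat 25 [13,21] 17 6 [6,11,16,21],
    Coat 26 [17,21] 18 2 [2,8,13,17],
    Coat 27 [17,18,21] 19 2 [2,8,13,17],
    Coat 28 [18,20,21] 19 2 [2,8,14,20],
    Coat 29 [13,23] 20 2 [2,8,13],
    Coat 30 [17,23] 20 2 [2,8,13,17],
    Coat 31 [20,23] 20 2 [2,8,14,20],
    Coat 32 [17,20] 22 6 [6,11,16,20]],
  Stage 33 [13,14,15] [1,3,3,3] [Coat 34 [14,15,17] 33 1 [1,7,12,17],
    Coat 35 [13,15,20] 33 6 [6,11,16,20],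
    Coat 36 [13,14,18] 33 1 [1,7,12,18],
    Coat 37 [13,14,21] 33 6 [6,11,16,21],
    Up 38 [19] 33 16 19 15 2,
    Coat 39 [14,17,21] 34 6 [6,11,16,21],
    Coat 40 [15,17,20] 34 6 [6,11,16,20],
    Up 41 [14,17,18] 34 22 18 15 1,
    Up 42 [17,19] 34 22 19 15 2,
    Up 43 [19,20] 35 24 19 15 2,
    Up 44 [13,20,21] 35 24 21 15 6,
    Coat 45 [13,14,23] 36 6 [6,11,16,21,23],
    Up 46 [19,21] 37 25 19 14 3,
    Up 47 [24] 38 33 24 19 4,
    Up 48 [17,19,21] 39 26 19 14 3,
    Up 49 [17,20,21] 39 26 20 14 6,
    Up 50 [17,18,20] 40 32 18 15 1,
    Coat 51 [14,17,18,21] 41 6 [6,11,16,21],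
    Coat 52 [14,17,23] 41 6 [6,11,16,21,23],
    Up 53 [17,18,19] 41 21 19 14 3,
    Up 54 [22] 53 42 22 18 2,
    Up 55 [17,24] 42 34 24 19 4,
    Up 56 [20,24] 43 35 24 19 4,
    Coat 57 [13,18,20,21] 44 1 [1,7,12,18],
    Coat 58 [13,20,23] 44 1 [1,7,12,18,23],
    Up 59 [19,20,21] 44 23 19 13 5,
    Up 60 [19,23] 45 29 19 14 3,
    Up 61 [21,24] 46 37 24 19 4,
    Up 62 [25] 59 46 25 20 3,
    Up 63 [17,21,24] 48 39 24 19 4,
    Up 64 [17,18,19,21] 51 27 19 14 3,
    Up 65 [17,20,23] 52 30 20 14 6,
    Up 66 [17,19,23] 52 30 19 14 3,
    Coat 67 [17,18,19,20] 53 6 [6,11,16,20],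
    Up 68 [17,18,24] 53 41 24 19 4,
    Coat 69 [21,22] 54 6 [6,11,16,21],
    Coat 70 [22,23] 54 6 [6,11,16,21,23],
    Coat 71 [20,22] 54 6 [6,11,16,20],
    Up 72 [22,24] 68 55 22 18 2,
    Up 73 [18,19,20,21] 57 28 19 13 5,
    Up 74 [19,20,23] 58 31 19 13 5,
    Coat 75 [17,19,20,21] 59 1 [1,7,12,17],
    Up 76 [20,21,24] 59 44 24 19 4,
    Up 77 [23,24] 60 45 24 19 4,
    Up 78 [23,25] 74 60 25 20 3,
    Up 79 [24,25] 76 61 25 20 3,
    Coat 80 [17,25] 62 1 [1,7,12,17],
    Up 81 [28] 79 62 28 24 6,
    Up 82 [17,18,21,24] 64 51 24 19 4,
    Mid 83 [17,18,20,21] 65 50 23 21 1,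
    Up 84 [17,23,24] 66 52 24 19 4,
    Up 85 [17,18,20,24] 67 50 24 19 4,
    Up 86 [26] 72 68 26 22 4,
    Coat 87 [22,23,24] 72 6 [6,11,16,21,23],
    Coat 88 [21,22,24] 72 6 [6,11,16,21],
    Coat 89 [20,22,24] 72 6 [6,11,16,20],
    Up 90 [29] 86 72 29 26 3,
    Up 91 [18,20,21,24] 73 57 24 19 4,
    Up 92 [20,23,24] 74 58 24 19 4,
    Up 93 [17,20,21,24] 75 49 24 19 4,
    Up 94 [23,24,25] 92 77 25 20 3,
    Up 95 [23,28] 94 78 28 24 6,
    Coat 96 [17,24,25] 79 1 [1,7,12,17],
    Up 97 [31] 81 79 31 28 5,
    Up 98 [17,28] 96 80 28 24 6,
    Up 99 [21,26] 88 82 26 22 4,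
    Up 100 [23,26] 87 84 26 22 4,
    Up 101 [20,26] 89 85 26 22 4,
    Up 102 [23,29] 100 87 29 26 3,
    Up 103 [21,29] 99 88 29 26 3,
    Coat 104 [20,29] 90 6 [6,11,16,20],
    Up 105 [23,31] 95 94 31 28 5,
    Coat 106 [17,31] 97 1 [1,7,12,17]] 47 11 [1,1,0,0,0,1,1,1] [2,8,13,14,19,24],
  Stage 107 [17,18,19,20,21] [1,4,4,4,4,4] [Up 108 [17,18,25] 107 64 25 20 3,
    Up 109 [20,21,22] 107 73 22 17 5,
    Up 110 [17,18,20,21,24] 107 83 24 19 4,
    Up 111 [22,25] 108 80 22 18 2,
    Up 112 [17,23,25] 108 80 23 18 6,
    Up 113 [20,22,23] 109 71 23 21 1,
    Up 114 [20,21,22,24] 110 91 22 17 5,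
    Up 115 [17,18,24,25] 110 82 25 20 3,
    Mid 116 [17,19,20,23] 112 66 25 20 3,
    Up 117 [22,23,25] 112 78 22 17 5,
    Up 118 [27] 117 113 27 25 1,
    Up 119 [22,24,25] 114 89 25 21 2,
    Up 120 [20,21,26] 114 110 26 22 4,
    Up 121 [17,18,28] 115 110 28 25 4,
    Up 122 [17,20,23,24] 116 65 24 19 4,
    Up 123 [25,26] 120 101 25 21 2,
    Up 124 [20,23,26] 120 101 23 21 1,
    Up 125 [22,28] 121 98 22 18 2,
    Up 126 [17,23,28] 121 98 23 18 6,
    Up 127 [17,23,24,25] 122 84 25 20 3,
    Up 128 [20,22,23,24] 122 92 22 17 5,
    Up 129 [26,28] 123 120 28 25 4,
    Up 130 [25,29] 123 119 29 26 3,
    Up 131 [28,29] 129 125 29 26 3,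
    Up 132 [22,31] 125 119 31 28 5,
    Up 133 [22,23,24,25] 127 94 22 17 5,
    Up 134 [26,31] 129 123 31 28 5,
    Down 135 [20,21,29] 131 130 28 25 4,
    Up 136 [29,31] 131 130 31 28 5,
    Mid 137 [17,18,31] 132 106 22 18 2,
    Up 138 [24,27] 133 119 27 23 2,
    Up 139 [20,23,29] 135 104 23 21 1,
    Up 140 [17,23,31] 137 106 23 18 6,
    Up 141 [27,28] 138 118 28 24 6,
    Up 142 [26,27] 138 118 26 24 1,
    Up 143 [23,25,29] 139 102 25 20 3,
    Up 144 [22,23,31] 140 105 22 17 5,
    Mid 145 [22,23,28] 141 125 27 23 2,
    Up 146 [27,31] 141 138 31 28 5,
    Mid 147 [23,25,26] 142 124 27 25 1,
    Up 148 [27,29] 142 138 29 26 3,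
    Up 149 [23,28,29] 143 139 28 25 4,
    Up 150 [23,26,31] 144 140 26 22 4,
    Mid 151 [23,26,28] 149 145 29 26 3,
    Up 152 [23,29,31] 149 143 31 28 5,
    Up 153 [27,28,29] 149 131 27 23 2,
    Up 154 [26,27,31] 150 134 27 23 2,
    Up 155 [26,27,28] 151 129 27 23 2,
    Up 156 [27,29,31] 152 136 27 23 2,
    Up 157 [29,30] 153 148 30 28 1,
    Up 158 [30,31] 154 150 30 27 4,
    Up 159 [30] 155 142 30 28 1,
    Up 160 [29,30,31] 156 152 30 27 4,
    Up 161 [32] 157 153 32 30 3,
    Up 162 [29,33] 160 157 33 31 1,
    Up 163 [33] 158 159 33 31 1,
    Up 164 [31,32] 160 158 32 29 6,
    Up 165 [32,33] 164 161 33 31 1,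
    Up 166 [34] 165 162 34 32 5,
    Up 167 [35] 166 165 35 34 4,
    Up 168 [36] 167 166 36 35 2] 168 97 [1,0,0,0,0,0,1,1] [1,7,12,17,18,22,23,26,27,29,30,32,33,34,35,36]]"

text \<open>The stages added here end at the positive system of D6 over D5, at the lower set
  generated by roots 29 and 48 over D4 + A1, at the union of the systems of D6 and E6 over D5, and
  at that of E7 over E6.\<close>

definition certE7 :: "item list" where "certE7 = certE6 @ [Plain [Coat 169 [13,15,41] 35 37 [37,38,39,40,41],
    Coat 170 [14,17,42] 39 37 [37,38,39,40,42],
    Coat 171 [19,41] 43 37 [37,38,39,40,41],
    Coat 172 [13,20,42] 44 37 [37,38,39,40,42],
    Coat 173 [13,21,41] 44 37 [37,38,39,40,41],
    Coat 174 [13,14,43] 45 37 [37,38,39,40,42,43],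
    Coat 175 [37,24] 47 37 [37],
    Coat 176 [17,19,42] 48 37 [37,38,39,40,42],
    Coat 177 [17,20,42] 49 37 [37,38,39,40,42],
    Coat 178 [17,18,41] 50 37 [37,38,39,40,41],
    Coat 179 [14,17,43] 52 37 [37,38,39,40,42,43],
    Coat 180 [24,41] 56 37 [37,38,39,40,41],
    Coat 181 [13,20,43] 58 37 [37,38,39,40,42,43],
    Coat 182 [19,21,41] 59 37 [37,38,39,40,41],
    Coat 183 [19,43] 60 37 [37,38,39,40,42,43],
    Coat 184 [25,41] 62 37 [37,38,39,40,41],
    Coat 185 [17,24,42] 63 37 [37,38,39,40,42],
    Coat 186 [17,18,19,42] 64 37 [37,38,39,40,42],
    Coat 187 [17,20,43] 65 37 [37,38,39,40,42,43],
    Coat 188 [17,23,41] 65 37 [37,38,39,40,41],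
    Coat 189 [17,19,43] 66 37 [37,38,39,40,42,43],
    Coat 190 [22,42] 69 37 [37,38,39,40,42],
    Coat 191 [22,43] 70 37 [37,38,39,40,42,43],
    Coat 192 [19,20,43] 74 37 [37,38,39,40,42,43],
    Coat 193 [17,19,20,42] 75 37 [37,38,39,40,42],
    Coat 194 [20,24,42] 76 37 [37,38,39,40,42],
    Coat 195 [21,24,41] 76 37 [37,38,39,40,41],
    Coat 196 [24,43] 77 37 [37,38,39,40,42,43],
    Coat 197 [24,25,42] 79 37 [37,38,39,40,42],
    Coat 198 [24,25,41] 79 37 [37,38,39,40,41],
    Coat 199 [42,28] 81 37 [37,38,39,40,42],
    Coat 200 [17,18,24,42] 82 37 [37,38,39,40,42],
    Coat 201 [17,18,21,41] 83 37 [37,38,39,40,41],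
    Coat 202 [17,24,43] 84 37 [37,38,39,40,42,43],
    Coat 203 [22,24,43] 87 37 [37,38,39,40,42,43],
    Coat 204 [22,24,42] 88 37 [37,38,39,40,42],
    Coat 205 [20,24,43] 92 37 [37,38,39,40,42,43],
    Coat 206 [17,20,24,42] 93 37 [37,38,39,40,42],
    Coat 207 [23,24,25,42] 94 37 [37,38,39,40,42],
    Coat 208 [24,25,43] 94 37 [37,38,39,40,42,43],
    Coat 209 [17,24,25,41] 96 37 [37,38,39,40,41],
    Coat 210 [42,31] 97 37 [37,38,39,40,42],
    Coat 211 [42,26] 99 37 [37,38,39,40,42],
    Coat 212 [26,43] 100 37 [37,38,39,40,42,43],
    Coat 213 [43,29] 102 37 [37,38,39,40,42,43],
    Coat 214 [42,29] 103 37 [37,38,39,40,42],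
    Coat 215 [17,18,19,20,42] 107 37 [37,38,39,40,42],
    Coat 216 [20,22,42] 109 37 [37,38,39,40,42],
    Coat 217 [17,18,20,24,42] 110 37 [37,38,39,40,42],
    Coat 218 [17,23,25,42] 112 37 [37,38,39,40,42],
    Coat 219 [22,23,41] 113 37 [37,38,39,40,41],
    Coat 220 [20,22,43] 113 37 [37,38,39,40,42,43],
    Coat 221 [20,22,24,42] 114 37 [37,38,39,40,42],
    Coat 222 [17,18,24,25,42] 115 37 [37,38,39,40,42],
    Coat 223 [17,19,20,43] 116 37 [37,38,39,40,42,43],
    Coat 224 [41,27] 118 37 [37,38,39,40,41],
    Coat 225 [20,42,26] 120 37 [37,38,39,40,42],
    Coat 226 [17,18,42,28] 121 37 [37,38,39,40,42],
    Coat 227 [17,20,24,43] 122 37 [37,38,39,40,42,43],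
    Coat 228 [23,41,26] 124 37 [37,38,39,40,41],
    Coat 229 [20,26,43] 124 37 [37,38,39,40,42,43],
    Coat 230 [22,41,28] 125 37 [37,38,39,40,41],
    Coat 231 [17,24,25,43] 127 37 [37,38,39,40,42,43],
    Coat 232 [20,22,24,43] 128 37 [37,38,39,40,42,43],
    Coat 233 [22,41,31] 132 37 [37,38,39,40,41],
    Coat 234 [41,26,31] 134 37 [37,38,39,40,41],
    Coat 235 [20,42,29] 135 37 [37,38,39,40,42],
    Coat 236 [41,29,31] 136 37 [37,38,39,40,41],
    Coat 237 [17,18,42,31] 137 37 [37,38,39,40,42],
    Coat 238 [24,41,27] 138 37 [37,38,39,40,41],
    Coat 239 [24,27,43] 138 37 [37,38,39,40,42,43],
    Coat 240 [23,41,29] 139 37 [37,38,39,40,41],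
    Coat 241 [20,43,29] 139 37 [37,38,39,40,42,43],
    Coat 242 [17,43,31] 140 37 [37,38,39,40,42,43],
    Coat 243 [27,43,28] 141 37 [37,38,39,40,42,43],
    Coat 244 [41,26,27] 142 37 [37,38,39,40,41],
    Coat 245 [23,25,42,29] 143 37 [37,38,39,40,42],
    Coat 246 [25,43,29] 143 37 [37,38,39,40,42,43],
    Coat 247 [22,43,31] 144 37 [37,38,39,40,42,43],
    Coat 248 [22,43,28] 145 37 [37,38,39,40,42,43],
    Coat 249 [27,43,29] 148 37 [37,38,39,40,42,43],
    Coat 250 [41,27,29] 148 37 [37,38,39,40,41],
    Coat 251 [23,42,28,29] 149 37 [37,38,39,40,42],
    Coat 252 [43,28,29] 149 37 [37,38,39,40,42,43],
    Coat 253 [23,42,29,31] 152 37 [37,38,39,40,42],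
    Coat 254 [41,27,28,29] 153 37 [37,38,39,40,41],
    Coat 255 [27,43,28,29] 153 37 [37,38,39,40,42,43],
    Coat 256 [41,26,27,31] 154 37 [37,38,39,40,41],
    Coat 257 [41,26,27,28] 155 37 [37,38,39,40,41],
    Coat 258 [41,27,29,31] 156 37 [37,38,39,40,41],
    Coat 259 [41,29,30] 157 37 [37,38,39,40,41],
    Coat 260 [41,30] 159 37 [37,38,39,40,41],
    Coat 261 [41,29,30,31] 160 37 [37,38,39,40,41],
    Coat 262 [43,32] 161 37 [37,38,39,40,42,43],
    Coat 263 [41,29,33] 162 37 [37,38,39,40,41],
    Coat 264 [41,33] 163 37 [37,38,39,40,41],
    Coat 265 [43,31,32] 164 37 [37,38,39,40,42,43],
    Coat 266 [41,32,33] 165 37 [37,38,39,40,41],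
    Coat 267 [41,34] 166 37 [37,38,39,40,41],
    Coat 268 [43,34] 166 37 [37,38,39,40,42,43],
    Coat 269 [41,35] 167 37 [37,38,39,40,41],
    Coat 270 [43,35] 167 37 [37,38,39,40,42,43],
    Coat 271 [41,36] 168 37 [37,38,39,40,41],
    Up 272 [13,41,42] 173 169 42 21 37,
    Up 273 [17,41,42] 177 170 41 20 37,
    Up 274 [19,41,42] 182 171 42 21 37,
    Up 275 [13,41,43] 181 174 41 20 37,
    Up 276 [17,19,41,42] 193 176 41 20 37,
    Up 277 [17,18,41,42] 201 178 42 21 37,
    Up 278 [17,41,43] 187 179 41 20 37,
    Up 279 [24,41,42] 195 180 42 21 37,
    Up 280 [19,41,43] 192 183 41 20 37,
    Up 281 [17,24,41,42] 206 185 41 20 37,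
    Up 282 [17,18,19,41,42] 215 186 41 20 37,
    Mid 283 [17,23,41,42] 278 188 43 42 1,
    Up 284 [17,19,41,43] 223 189 41 20 37,
    Up 285 [22,41,42] 216 190 41 20 37,
    Up 286 [22,41,43] 220 191 41 20 37,
    Up 287 [24,41,43] 205 196 41 20 37,
    Up 288 [17,18,24,41,42] 217 200 41 20 37,
    Up 289 [17,24,41,43] 227 202 41 20 37,
    Up 290 [22,24,41,43] 232 203 41 20 37,
    Up 291 [22,24,41,42] 221 204 41 20 37,
    Up 292 [41,42,26] 225 211 41 20 37,
    Up 293 [41,26,43] 229 212 41 20 37,
    Up 294 [41,43,29] 241 213 41 20 37,
    Up 295 [41,42,29] 235 214 41 20 37,
    Mid 296 [22,23,41,42] 286 219 43 42 1,
    Mid 297 [23,41,42,26] 293 228 43 42 1,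
    Mid 298 [23,41,42,29] 294 240 43 42 1,
    Coat 299 [13,23,41,42] 272 1 [1,7,12,18,23],
    Up 300 [25,41,42] 274 272 25 19 6,
    Up 301 [17,25,41,42] 276 273 25 19 6,
    Coat 302 [19,23,41,42] 274 1 [1,7,12,18,23],
    Up 303 [44] 300 274 44 25 37,
    Up 304 [25,41,43] 280 275 25 19 6,
    Up 305 [17,44] 301 276 44 25 37,
    Up 306 [17,25,41,43] 284 278 25 19 6,
    Coat 307 [23,24,41,42] 279 1 [1,7,12,18,23],
    Up 308 [43,44] 304 280 44 25 37,
    Mid 309 [17,19,23,41,42] 284 282 43 23 37,
    Up 310 [17,23,24,41,42] 309 283 24 19 4,
    Up 311 [17,23,25,41,42] 309 283 25 19 6,
    Up 312 [17,43,44] 306 284 44 25 37,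
    Mid 313 [22,23,24,41,42] 290 291 43 23 37,
    Up 314 [23,25,41,42] 302 299 25 19 6,
    Coat 315 [18,25,41,42] 300 1 [1,7,12,18],
    Mid 316 [17,18,25,41,42] 311 301 23 18 6,
    Coat 317 [18,44] 303 1 [1,7,12,18],
    Coat 318 [23,44] 303 1 [1,7,12,18,23],
    Up 319 [22,25,41,43] 306 304 22 17 5,
    Up 320 [41,27,43] 319 306 27 22 6,
    Up 321 [22,43,44] 312 308 22 17 5,
    Up 322 [22,23,25,41,42] 311 314 22 17 5,
    Up 323 [17,23,44] 311 218 44 41 3,
    Up 324 [27,43,44] 321 312 27 22 6,
    Down 325 [17,18,44] 312 323 43 23 37,
    Up 326 [22,25,41,42] 316 315 22 17 5,
    Up 327 [22,44] 325 317 22 17 5,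
    Up 328 [22,23,44] 323 318 22 17 5,
    Up 329 [45] 324 320 45 44 1,
    Mid 330 [41,42,27] 320 224 43 42 1,
    Up 331 [27,44] 328 323 27 22 6],
  Stage 332 [24,25,41,42] [1,3,5,5,5,5] [Coat 333 [18,24,25,41,42] 332 1 [1,7,12,18],
    Coat 334 [17,24,25,41,42] 332 1 [1,7,12,17],
    Coat 335 [23,24,25,41,42] 332 1 [1,7,12,18,23],
    Coat 336 [24,25,41,43] 332 1 [1,7,12,18,23,43],
    Up 337 [24,44] 332 198 44 42 2,
    Up 338 [41,42,28] 332 279 28 25 4,
    Up 339 [17,24,44] 334 209 44 42 2,
    Up 340 [17,41,42,28] 334 281 28 25 4,
    Up 341 [23,24,44] 335 207 44 41 3,
    Up 342 [23,41,42,28] 335 307 28 25 4,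
    Up 343 [24,43,44] 336 208 44 41 3,
    Up 344 [41,43,28] 336 287 28 25 4,
    Up 345 [28,44] 337 303 28 24 6,
    Up 346 [46] 345 338 46 44 4,
    Up 347 [41,42,31] 338 332 31 28 5,
    Up 348 [17,28,44] 339 305 28 24 6,
    Up 349 [17,46] 348 340 46 44 4,
    Up 350 [23,28,44] 341 318 28 24 6,
    Up 351 [23,41,42,31] 342 335 31 28 5,
    Up 352 [43,28,44] 343 308 28 24 6,
    Up 353 [41,43,31] 344 336 31 28 5,
    Up 354 [43,46] 352 344 46 44 4,
    Up 355 [44,31] 345 337 31 28 5,
    Coat 356 [17,41,42,31] 347 1 [1,7,12,17],
    Up 357 [31,46] 355 347 46 44 4,
    Up 358 [23,44,31] 350 341 31 28 5,
    Up 359 [23,31,46] 358 351 46 44 4,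
    Up 360 [43,44,31] 352 343 31 28 5,
    Up 361 [43,31,46] 360 353 46 44 4,
    Up 362 [43,48] 361 354 48 31 37,
    Coat 363 [17,44,31] 355 1 [1,7,12,17],
    Up 364 [48] 357 355 48 46 5,
    Up 365 [17,31,46] 363 356 46 44 4,
    Up 366 [51] 364 357 51 48 6,
    Up 367 [23,48] 359 358 48 46 5,
    Up 368 [23,51] 367 359 51 48 6,
    Up 369 [43,51] 362 361 51 48 6,
    Coat 370 [17,48] 364 1 [1,7,12,17],
    Up 371 [17,51] 370 365 51 48 6] 366 97 [1,0,0,0,0,0,1,1] [37,38,39,40,41,42,44,46,48,51],
  Stage 372 [17,18,24,25,41,42] [1,4,4,5,5,5,5] [Up 373 [17,18,24,44] 372 222 44 41 3,
    Up 374 [17,18,41,42,28] 372 288 28 25 4,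
    Up 375 [22,24,25,41,42] 372 333 22 17 5,
    Up 376 [22,24,44] 373 339 22 18 2,
    Up 377 [17,18,28,44] 374 226 44 41 3,
    Up 378 [17,23,41,42,28] 374 340 23 18 6,
    Up 379 [17,18,46] 377 374 46 44 4,
    Up 380 [17,23,28,44] 377 348 23 18 6,
    Up 381 [22,28,44] 377 348 22 18 2,
    Mid 382 [17,23,24,25,41,42] 378 310 28 25 4,
    Up 383 [17,23,46] 380 378 46 44 4,
    Up 384 [22,46] 379 349 22 18 2,
    Up 385 [17,43,46] 383 379 43 23 37,
    Mid 386 [17,23,24,44] 380 323 28 24 6,
    Up 387 [22,44,31] 381 376 31 28 5,
    Mid 388 [22,41,42,28] 381 230 44 42 2,
    Up 389 [22,23,24,25,41,42] 382 335 22 17 5,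
    Up 390 [26,46] 384 379 26 22 4,
    Up 391 [17,24,43,44] 386 373 43 23 37,
    Up 392 [22,23,24,44] 386 341 22 17 5,
    Mid 393 [17,18,44,31] 387 363 22 18 2,
    Mid 394 [22,41,42,31] 387 233 44 42 2,
    Up 395 [41,42,26,28] 388 374 26 22 4,
    Mid 396 [26,28,44] 390 395 46 44 4,
    Up 397 [29,46] 390 384 29 26 3,
    Mid 398 [17,24,25,41,43] 391 231 44 41 3,
    Up 399 [22,24,43,44] 391 343 22 17 5,
    Mid 400 [17,43,28,44] 385 391 46 28 37,
    Up 401 [24,27,44] 392 376 27 23 2,
    Mid 402 [17,18,41,42,31] 393 237 44 41 3,
    Up 403 [17,23,44,31] 393 363 23 18 6,
    Up 404 [41,42,26,31] 394 402 26 22 4,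
    Down 405 [25,41,42,26] 404 395 31 28 5,
    Down 406 [26,44] 390 396 46 28 37,
    Up 407 [28,44,29] 396 381 29 26 3,
    Down 408 [41,42,28,29] 397 407 46 44 4,
    Down 409 [44,29] 397 407 46 28 37,
    Up 410 [22,24,25,41,43] 398 336 22 17 5,
    Up 411 [17,41,43,28] 398 289 28 25 4,
    Mid 412 [24,41,42,27] 401 238 44 42 2,
    Up 413 [27,28,44] 401 331 28 24 6,
    Up 414 [17,18,31,46] 393 402 46 44 4,
    Up 415 [17,23,41,42,31] 402 356 23 18 6,
    Up 416 [17,23,31,46] 403 415 46 44 4,
    Up 417 [22,23,44,31] 403 358 22 17 5,
    Up 418 [26,44,31] 404 234 44 42 2,
    Up 419 [44,29,31] 407 409 31 28 5,
    Mid 420 [25,41,42,29] 408 295 28 25 4,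
    Up 421 [41,42,27,28] 412 330 28 24 6,
    Up 422 [27,44,31] 413 401 31 28 5,
    Mid 423 [22,23,28,44] 413 381 27 23 2,
    Up 424 [17,18,48] 414 379 48 31 37,
    Up 425 [22,31,46] 414 365 22 18 2,
    Up 426 [22,23,41,42,31] 415 351 22 17 5,
    Up 427 [26,31,46] 418 404 46 44 4,
    Mid 428 [41,42,29,31] 419 236 44 42 2,
    Up 429 [41,42,27,31] 421 412 31 28 5,
    Mid 430 [22,23,41,42,28] 421 378 27 22 6,
    Up 431 [22,48] 424 370 22 18 2,
    Up 432 [29,31,46] 427 425 29 26 3,
    Up 433 [23,41,42,26,31] 426 415 26 22 4,
    Up 434 [26,48] 427 418 48 46 5,
    Up 435 [23,41,42,26,28] 430 378 26 22 4,
    Up 436 [29,48] 434 431 29 26 3,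
    Down 437 [23,25,41,42,26] 433 435 31 28 5] 436 175 [1,0,0,0,0,1,0,1] [1,6,7,11,38,12,16,39,17,18,20,21,40,22,25,41,42,26,28,44,29,31,46,48],
  Stage 438 [41,42,26,27] [1,5,5,5,5,6,6] [Up 439 [41,26,27,43] 438 244 43 42 1,
    Up 440 [26,27,44] 438 244 44 42 2,
    Mid 441 [24,41,27,43] 439 320 26 24 1,
    Mid 442 [25,41,26,43] 439 293 27 25 1,
    Mid 443 [23,26,44] 440 406 27 23 2,
    Up 444 [27,44,29] 440 401 29 26 3,
    Up 445 [41,27,43,28] 441 320 28 24 6,
    Up 446 [24,27,43,44] 441 239 44 41 3,
    Up 447 [41,26,43,28] 442 293 28 25 4,
    Up 448 [26,43,44] 442 293 44 25 37,
    Up 449 [23,44,29] 443 392 29 26 3,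
    Mid 450 [41,42,27,29] 444 250 44 42 2,
    Up 451 [41,27,43,31] 445 441 31 28 5,
    Mid 452 [22,41,43,28] 445 411 27 22 6,
    Up 453 [27,43,28,44] 445 243 44 41 3,
    Up 454 [24,45] 446 401 45 43 2,
    Up 455 [27,43,44,31] 453 446 31 28 5,
    Up 456 [41,26,43,31] 447 442 31 28 5,
    Up 457 [43,44,29] 448 399 29 26 3,
    Mid 458 [23,25,41,42,29] 449 245 44 41 3,
    Up 459 [41,27,43,29] 450 250 43 42 1,
    Up 460 [22,41,43,31] 452 410 31 28 5,
    Up 461 [22,43,28,44] 452 248 44 41 3,
    Up 462 [28,45] 453 413 45 43 2,
    Up 463 [45,46] 462 454 46 28 37,
    Up 464 [45,31] 462 454 31 28 5,
    Up 465 [26,45] 454 329 26 24 1,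
    Down 466 [17,41,43,31] 456 460 26 22 4,
    Mid 467 [25,41,43,29] 457 246 44 41 3,
    Up 468 [23,41,42,28,29] 458 298 28 25 4,
    Up 469 [27,43,44,29] 459 249 44 41 3,
    Up 470 [22,43,44,31] 460 247 44 41 3,
    Up 471 [22,43,46] 461 399 46 28 37,
    Mid 472 [27,43,46] 463 471 45 27 37,
    Mid 473 [26,27,43,44] 465 439 45 44 1,
    Up 474 [29,45] 465 454 29 26 3,
    Up 475 [17,43,44,31] 466 242 44 41 3,
    Up 476 [41,43,28,29] 467 294 28 25 4,
    Up 477 [23,41,42,29,31] 468 458 31 28 5,
    Up 478 [23,28,44,29] 468 251 44 41 3,
    Mid 479 [22,23,46] 471 384 43 23 37,
    Up 480 [26,43,46] 471 385 26 22 4,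
    Down 481 [27,46] 463 472 45 43 2,
    Up 482 [17,43,31,46] 475 466 46 44 4,
    Up 483 [43,28,44,29] 476 252 44 41 3,
    Up 484 [41,43,29,31] 476 467 31 28 5,
    Up 485 [23,44,29,31] 477 253 44 41 3,
    Up 486 [27,28,44,29] 478 407 27 23 2,
    Mid 487 [23,26,28,44] 478 423 29 26 3,
    Up 488 [23,29,46] 478 468 46 44 4,
    Up 489 [23,26,46] 479 383 26 22 4,
    Mid 490 [26,43,28,44] 480 447 46 44 4,
    Up 491 [43,29,46] 480 471 29 26 3,
    Up 492 [17,43,48] 482 385 48 31 37,
    Up 493 [43,44,29,31] 483 457 31 28 5,
    Up 494 [43,29,31,46] 493 484 46 44 4,
    Up 495 [27,44,29,31] 485 419 27 23 2,
    Up 496 [23,29,31,46] 485 477 46 44 4,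
    Mid 497 [23,26,44,31] 485 417 29 26 3,
    Mid 498 [41,42,27,28,29] 486 254 44 42 2,
    Mid 499 [26,27,28,44] 486 413 29 26 3,
    Up 500 [27,29,46] 488 397 27 23 2,
    Up 501 [26,27,46] 489 390 27 23 2,
    Up 502 [26,43,44,31] 490 448 31 28 5,
    Up 503 [43,29,48] 494 491 48 31 37,
    Mid 504 [17,23,48] 492 424 43 23 37,
    Up 505 [22,43,48] 492 362 22 17 5,
    Up 506 [17,43,51] 492 482 51 48 6,
    Mid 507 [41,42,27,29,31] 495 258 44 42 2,
    Mid 508 [26,27,44,31] 495 422 29 26 3,
    Up 509 [27,29,31,46] 496 432 27 23 2,
    Up 510 [23,29,48] 496 485 48 46 5,
    Up 511 [23,26,31,46] 497 433 46 44 4,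
    Up 512 [41,42,29,30] 498 468 30 27 4,
    Mid 513 [41,42,26,27,28] 499 257 44 42 2,
    Up 514 [44,30] 499 413 30 26 6,
    Up 515 [29,30,46] 500 488 30 27 4,
    Up 516 [30,46] 501 489 30 27 4,
    Up 517 [26,43,31,46] 502 456 46 44 4,
    Mid 518 [26,43,48] 503 505 29 26 3,
    Up 519 [22,23,48] 504 367 22 17 5,
    Up 520 [17,23,51] 504 416 51 48 6,
    Mid 521 [22,43,31,46] 505 470 48 46 5,
    Down 522 [17,18,51] 506 520 43 23 37,
    Up 523 [22,43,51] 506 369 22 17 5,
    Up 524 [41,42,29,30,31] 507 477 30 27 4,
    Mid 525 [41,42,26,27,31] 508 256 44 42 2,
    Up 526 [44,30,31] 508 422 30 26 6,
    Up 527 [29,30,31,46] 509 496 30 27 4,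
    Up 528 [27,29,48] 509 495 48 46 5,
    Up 529 [29,30,48] 528 510 30 27 4,
    Mid 530 [23,26,48] 510 519 29 26 3,
    Up 531 [26,27,31,46] 511 427 27 23 2,
    Mid 532 [22,23,31,46] 511 416 26 22 4,
    Up 533 [41,43,29,30] 512 259 43 42 1,
    Up 534 [44,29,30] 512 259 44 42 2,
    Up 535 [41,42,30] 513 435 30 27 4,
    Up 536 [44,32] 534 514 32 29 6,
    Up 537 [46,32] 515 500 32 30 3,
    Up 538 [27,48] 519 431 27 23 2,
    Up 539 [22,23,51] 520 368 22 17 5,
    Up 540 [27,43,31,46] 521 482 27 22 6,
    Up 541 [22,51] 522 371 22 18 2,
    Up 542 [26,43,51] 523 506 26 22 4,
    Up 543 [27,43,51] 523 506 27 22 6,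
    Up 544 [44,29,30,31] 524 261 44 42 2,
    Up 545 [41,42,29,33] 524 507 33 30 5,
    Up 546 [41,42,30,31] 525 433 30 27 4,
    Up 547 [44,31,32] 544 526 32 29 6,
    Up 548 [30,31,46] 526 546 46 44 4,
    Up 549 [44,33] 526 508 33 30 5,
    Up 550 [31,46,32] 527 509 32 30 3,
    Up 551 [29,33,48] 529 528 33 30 5,
    Up 552 [32,48] 529 528 32 30 3,
    Mid 553 [26,27,48] 528 538 29 26 3,
    Up 554 [30,48] 553 530 30 27 4,
    Down 555 [27,31,46] 509 531 29 26 3,
    Mid 556 [41,27,43,28,29] 533 459 30 28 1,
    Up 557 [41,43,30] 535 260 43 42 1,
    Up 558 [41,42,32] 512 535 32 29 6,
    Up 559 [27,51] 538 555 51 48 6,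
    Up 560 [23,26,51] 539 520 26 22 4,
    Up 561 [27,43,48] 540 455 48 46 5,
    Up 562 [45,31,46] 540 555 45 43 2,
    Up 563 [26,51] 541 522 26 22 4,
    Up 564 [43,29,51] 542 523 29 26 3,
    Up 565 [45,51] 543 559 45 43 2,
    Up 566 [44,29,33] 544 495 33 30 5,
    Up 567 [29,46,33] 566 545 46 44 4,
    Up 568 [41,43,29,33] 545 263 43 42 1,
    Up 569 [41,42,33] 546 525 33 30 5,
    Up 570 [41,42,31,32] 524 546 32 29 6,
    Up 571 [30,51] 554 548 51 48 6,
    Up 572 [44,32,33] 566 549 32 29 6,
    Up 573 [46,33] 549 569 46 44 4,
    Up 574 [32,51] 552 550 51 48 6,
    Up 575 [33,48] 554 553 33 30 5,
    Up 576 [27,43,28,44,29] 556 255 44 41 3,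
    Up 577 [41,27,43,29,31] 556 459 31 28 5,
    Mid 578 [41,26,27,43,28] 557 439 30 28 1,
    Up 579 [41,43,32] 533 557 32 29 6,
    Mid 580 [26,27,51] 571 559 30 26 6,
    Up 581 [23,29,51] 560 539 29 26 3,
    Up 582 [45,48] 561 538 45 43 2,
    Up 583 [29,51] 563 541 29 26 3,
    Up 584 [44,34] 572 566 34 32 5,
    Up 585 [46,32,33] 567 573 32 29 6,
    Mid 586 [41,43,29,30,31] 568 533 33 31 1,
    Up 587 [41,42,32,33] 545 569 32 29 6,
    Up 588 [41,43,33] 569 264 43 42 1,
    Up 589 [33,51] 571 580 33 30 5,
    Mid 590 [29,30,51] 574 571 32 29 6,
    Down 591 [27,29,51] 574 590 32 30 3,
    Up 592 [27,43,44,29,31] 576 469 31 28 5,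
    Mid 593 [26,27,43,28,44] 576 453 29 26 3,
    Up 594 [28,29,45] 576 486 45 43 2,
    Up 595 [41,26,27,43,31] 578 439 31 28 5,
    Up 596 [43,44,32] 579 262 44 41 3,
    Mid 597 [41,42,34] 584 267 44 42 2,
    Up 598 [46,34] 585 550 34 33 3,
    Up 599 [41,42,35] 597 587 35 34 4,
    Up 600 [41,43,32,33] 587 266 43 42 1,
    Mid 601 [41,43,30,31] 588 557 33 31 1,
    Up 602 [29,33,51] 590 591 33 30 5,
    Mid 603 [26,27,43,44,31] 592 455 29 26 3,
    Up 604 [29,45,31] 592 495 45 43 2,
    Up 605 [26,28,45] 593 499 45 43 2,
    Up 606 [43,44,30] 593 453 30 26 6,
    Up 607 [29,45,46] 594 474 46 28 37,
    Up 608 [29,30,45] 594 474 30 28 1,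
    Up 609 [43,46,32] 596 579 46 44 4,
    Up 610 [45,32] 596 579 45 44 1,
    Mid 611 [43,44,29,30] 596 576 32 30 3,
    Up 612 [41,43,34] 597 267 43 42 1,
    Up 613 [46,35] 598 585 35 34 4,
    Up 614 [48,34] 598 584 48 46 5,
    Mid 615 [44,35] 613 599 46 44 4,
    Up 616 [41,43,35] 599 269 43 42 1,
    Mid 617 [41,43,31,32] 600 579 33 31 1,
    Up 618 [32,33,51] 602 589 32 29 6,
    Up 619 [43,44,30,31] 603 455 30 26 6,
    Up 620 [26,45,31] 603 508 45 43 2,
    Up 621 [26,45,46] 605 465 46 28 37,
    Up 622 [30,45] 605 465 30 28 1,
    Up 623 [43,30,46] 606 557 46 44 4,
    Mid 624 [27,43,29,46] 607 500 45 43 2,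
    Mid 625 [43,29,30,46] 609 624 32 30 3,
    Up 626 [45,46,32] 609 537 45 43 2,
    Up 627 [32,47] 626 610 47 46 1,
    Up 628 [43,44,34] 612 268 44 41 3,
    Up 629 [48,35] 613 615 48 46 5,
    Up 630 [46,36] 613 598 36 35 2,
    Up 631 [48,36] 629 614 36 35 2,
    Down 632 [32,33,48] 629 614 35 34 4,
    Up 633 [34,51] 614 598 51 48 6,
    Up 634 [44,36] 615 584 36 35 2,
    Up 635 [43,44,35] 616 270 44 41 3,
    Up 636 [43,44,31,32] 617 265 44 41 3,
    Up 637 [51,35] 633 618 35 34 4,
    Mid 638 [43,44,29,30,31] 636 619 32 29 6,
    Up 639 [43,30,31,46] 619 601 46 44 4,
    Up 640 [30,45,31] 619 526 45 43 2,
    Up 641 [43,44,33] 619 603 33 30 5,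
    Up 642 [45,33] 640 620 33 30 5,
    Mid 643 [26,27,43,46] 621 501 45 43 2,
    Up 644 [30,45,46] 621 463 30 26 6,
    Up 645 [47] 644 622 47 46 1,
    Up 646 [29,30,45,46] 625 515 45 43 2,
    Up 647 [49] 627 626 49 47 3,
    Mid 648 [29,47] 627 645 32 29 6,
    Mid 649 [43,44,32,33] 628 636 34 33 3,
    Up 650 [45,34] 628 612 45 44 1,
    Down 651 [41,42,36] 630 634 46 44 4,
    Up 652 [51,36] 631 630 51 48 6,
    Up 653 [43,46,35] 635 616 46 44 4,
    Up 654 [45,35] 635 616 45 44 1,
    Up 655 [43,31,46,32] 636 617 46 44 4,
    Up 656 [45,31,32] 636 547 45 43 2,
    Up 657 [29,30,45,31] 638 544 45 43 2,
    Up 658 [43,44,29,33] 638 592 33 30 5,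
    Up 659 [43,29,30,31,46] 638 586 46 44 4,
    Mid 660 [26,27,43,31,46] 639 517 30 27 4,
    Up 661 [30,45,31,46] 639 548 45 43 2,
    Up 662 [43,46,33] 641 588 46 44 4,
    Up 663 [43,46,32,33] 649 600 46 44 4,
    Up 664 [45,32,33] 649 600 45 44 1,
    Up 665 [45,36] 654 650 36 35 2,
    Down 666 [29,45,33] 650 664 34 32 5,
    Up 667 [41,43,36] 651 271 43 42 1,
    Up 668 [43,48,35] 653 635 48 46 5,
    Mid 669 [43,46,34] 653 663 35 34 4,
    Down 670 [27,43,29,31,46] 655 659 32 30 3,
    Up 671 [45,31,46,32] 655 550 45 43 2,
    Up 672 [43,29,46,33] 658 568 46 44 4,
    Up 673 [29,30,45,31,46] 659 527 45 43 2,
    Up 674 [26,27,43,48] 660 603 48 46 5,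
    Up 675 [26,45,31,46] 660 531 45 43 2,
    Up 676 [31,47] 661 639 47 45 4,
    Up 677 [45,46,33] 662 573 45 43 2,
    Up 678 [43,33,48] 662 641 48 46 5,
    Up 679 [45,46,32,33] 663 585 45 43 2,
    Up 680 [32,33,47] 679 664 47 46 1,
    Mid 681 [43,44,36] 665 667 45 44 1,
    Up 682 [43,46,36] 681 667 46 44 4,
    Up 683 [43,51,35] 668 653 51 48 6,
    Up 684 [43,48,34] 669 628 48 46 5,
    Up 685 [45,46,34] 669 598 45 43 2,
    Up 686 [27,43,29,48] 670 592 48 46 5,
    Up 687 [29,45,31,46] 670 509 45 43 2,
    Up 688 [31,32,47] 671 655 47 45 4,
    Up 689 [43,29,33,48] 672 658 48 46 5,
    Up 690 [29,45,46,33] 672 567 45 43 2,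
    Up 691 [29,31,47] 673 659 47 45 4,
    Up 692 [26,45,48] 674 553 45 43 2,
    Up 693 [43,30,48] 674 518 30 27 4,
    Up 694 [47,48] 676 645 48 31 37,
    Up 695 [33,47] 676 645 33 31 1,
    Up 696 [45,33,48] 677 642 48 46 5,
    Up 697 [43,33,51] 678 662 51 48 6,
    Up 698 [33,47,48] 696 678 47 45 4,
    Mid 699 [29,33,47] 680 695 32 29 6,
    Up 700 [43,48,36] 682 681 48 46 5,
    Up 701 [45,46,36] 682 630 45 43 2,
    Up 702 [43,51,36] 700 682 51 48 6,
    Up 703 [43,34,51] 684 669 51 48 6,
    Down 704 [43,32,33,48] 668 684 35 34 4,
    Up 705 [45,48,34] 684 614 45 43 2,
    Mid 706 [45,46,35] 701 685 36 35 2,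
    Up 707 [45,34,51] 705 685 51 48 6,
    Up 708 [47,34] 685 650 47 46 1,
    Up 709 [29,45,48] 686 528 45 43 2,
    Up 710 [43,29,30,48] 686 503 30 27 4,
    Up 711 [31,49] 688 671 49 47 3,
    Up 712 [29,45,33,48] 689 551 45 43 2,
    Up 713 [29,47,48] 691 648 48 31 37,
    Mid 714 [30,45,48] 696 692 33 30 5,
    Up 715 [43,30,51] 693 639 51 48 6,
    Up 716 [47,51] 694 676 51 48 6,
    Up 717 [50] 698 694 50 33 37,
    Up 718 [33,47,51] 698 695 51 48 6,
    Up 719 [45,33,51] 696 677 51 48 6,
    Down 720 [26,27,43,51] 697 715 33 30 5,
    Up 721 [45,48,36] 700 631 45 43 2,
    Up 722 [47,36] 701 665 47 46 1,
    Up 723 [45,51,36] 721 701 51 48 6,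
    Up 724 [47,51,36] 723 702 47 45 4,
    Down 725 [43,32,33,51] 683 703 35 34 4,
    Down 726 [43,32,48] 684 704 34 33 3,
    Up 727 [45,32,33,48] 704 632 45 43 2,
    Down 728 [45,32,48] 705 727 34 33 3,
    Mid 729 [45,48,35] 721 705 36 35 2,
    Up 730 [47,35] 706 654 47 46 1,
    Up 731 [45,51,35] 729 706 51 48 6,
    Up 732 [34,49] 708 685 49 47 3,
    Mid 733 [29,30,45,48] 728 709 32 30 3,
    Up 734 [48,49] 711 647 48 31 37,
    Up 735 [33,49] 711 647 33 31 1,
    Up 736 [29,33,47,48] 712 689 47 45 4,
    Mid 737 [32,47,48] 734 713 49 32 37,
    Up 738 [29,50] 736 713 50 33 37,
    Up 739 [30,45,51] 714 661 51 48 6,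
    Down 740 [26,45,51] 716 739 47 30 37,
    Up 741 [50,51] 718 716 50 33 37,
    Up 742 [53] 741 717 53 51 1,
    Up 743 [27,43,29,51] 720 543 29 26 3,
    Up 744 [47,48,36] 721 700 47 45 4,
    Up 745 [49,36] 722 701 49 47 3,
    Up 746 [50,36] 744 722 50 48 1,
    Up 747 [50,51,36] 724 723 50 47 5,
    Up 748 [49,51,36] 724 723 49 47 3,
    Up 749 [53,36] 747 724 53 50 6,
    Down 750 [43,32,51] 703 725 34 33 3,
    Down 751 [43,29,33,51] 703 725 34 32 5,
    Up 752 [45,32,33,51] 725 618 45 43 2,
    Up 753 [32,33,47,48] 727 704 47 45 4,
    Up 754 [45,32,51] 728 671 51 48 6,
    Up 755 [47,48,35] 729 668 47 45 4,
    Up 756 [50,35] 755 730 50 48 1,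
    Up 757 [49,35] 730 706 49 47 3,
    Up 758 [47,51,35] 755 730 51 48 6,
    Up 759 [50,51,35] 758 731 50 47 5,
    Up 760 [49,51,35] 758 731 49 47 3,
    Up 761 [49,51] 734 711 51 48 6,
    Up 762 [32,47,51] 737 688 51 48 6,
    Mid 763 [29,30,45,51] 754 739 32 29 6,
    Up 764 [29,45,51] 740 565 29 26 3,
    Mid 765 [43,29,30,51] 750 743 32 30 3,
    Up 766 [48,49,36] 744 721 49 47 3,
    Down 767 [47,48,34] 744 755 36 35 2,
    Up 768 [49,50,36] 766 745 50 48 1,
    Up 769 [52,36] 768 746 52 49 5,
    Down 770 [34,50] 746 756 36 35 2,
    Down 771 [34,50,51] 747 759 36 35 2,
    Down 772 [34,49,51] 748 760 36 35 2,
    Up 773 [29,45,33,51] 751 602 45 43 2,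
    Up 774 [32,33,47,51] 752 725 47 45 4,
    Up 775 [32,50] 753 680 50 48 1,
    Up 776 [48,49,35] 755 729 49 47 3,
    Up 777 [35,53] 759 756 53 51 1,
    Up 778 [49,50,35] 776 757 50 48 1,
    Mid 779 [47,34,51] 758 774 35 34 4,
    Down 780 [32,50,51] 759 771 35 34 4,
    Down 781 [33,49,51] 760 772 35 34 4,
    Up 782 [49,50,51] 781 761 50 33 37,
    Down 783 [29,47,51] 761 762 49 32 37,
    Down 784 [48,34,49] 766 776 36 35 2,
    Up 785 [36,54] 769 768 54 52 4,
    Down 786 [34,49,50] 768 778 36 35 2,
    Up 787 [56] 785 769 56 54 2,
    Up 788 [52] 786 770 52 49 5,
    Up 789 [34,53] 771 770 53 51 1,
    Down 790 [29,50,51] 771 780 34 32 5,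
    Up 791 [29,33,47,51] 773 751 47 45 4,
    Up 792 [32,53] 780 774 53 50 6,
    Up 793 [49,50] 775 738 49 32 37,
    Down 794 [33,48,49] 776 784 35 34 4,
    Up 795 [35,52] 778 776 52 50 3,
    Up 796 [54] 795 778 54 52 4,
    Up 797 [49,53] 782 781 53 50 6,
    Down 798 [29,53] 789 792 34 32 5] 652 97 [1,0,0,0,0,0,1,1] [1,37,7,38,12,39,17,18,40,22,23,41,42,26,27,44,29,30,46,32,33,48,34,51,35,36],
  Stage 799 [34,49,50,51] [1,5,7,9,9,9,9] [Up 800 [49,50,51,35] 799 782 35 34 4,
    Up 801 [51,52] 799 772 52 50 3,
    Up 802 [34,49,53] 799 786 53 51 1,
    Up 803 [49,50,51,36] 800 799 36 35 2,
    Up 804 [51,35,52] 800 760 52 50 3,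
    Up 805 [49,35,53] 800 778 53 51 1,
    Up 806 [51,52,36] 804 801 36 35 2,
    Up 807 [52,53] 801 788 53 51 1,
    Up 808 [51,54] 804 801 54 35 37,
    Up 809 [49,53,36] 805 802 36 35 2,
    Up 810 [55] 807 802 55 52 6,
    Up 811 [51,36,54] 806 803 54 52 4,
    Up 812 [35,52,53] 804 795 53 51 1,
    Up 813 [53,54] 812 805 54 52 4,
    Up 814 [35,55] 812 805 55 52 6,
    Up 815 [52,53,36] 806 769 53 51 1,
    Up 816 [51,56] 811 806 56 54 2,
    Up 817 [54,55] 813 808 55 53 3,
    Up 818 [53,36,54] 815 809 54 52 4,
    Up 819 [36,55] 815 809 55 52 6,
    Up 820 [36,54,55] 818 811 55 53 3,
    Up 821 [57] 817 813 57 55 4,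
    Up 822 [53,56] 818 813 56 36 37,
    Up 823 [55,56] 822 816 55 53 3,
    Up 824 [59] 821 817 59 57 5,
    Up 825 [36,57] 820 818 57 55 4,
    Up 826 [36,59] 825 820 59 57 5,
    Up 827 [56,57] 825 821 56 36 37,
    Up 828 [56,59] 827 823 59 57 5,
    Up 829 [58] 827 823 58 57 2,
    Up 830 [58,59] 828 826 58 56 6,
    Up 831 [60] 830 828 60 58 5,
    Up 832 [61] 831 830 61 60 4,
    Up 833 [62] 832 831 62 61 3,
    Up 834 [63] 833 832 63 62 1] 834 168 [0,0,0,0,0,0,1,1] [37,38,39,40,41,42,43,44,45,46,47,48,49,50,51,52,53,54,55,56,57,58,59,60,61,62,63]]"

text \<open>No further stage: layers over \<alpha>_8 on top of lower sets of E7, followed by modular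
  steps, supply all the nodes that the tree still refers to.\<close>

definition certE8 :: "item list" where "certE8 = certE7 @ [Plain [Coat 835 [13,20,70] 172 64 [64,65,66,67,68,70],
    Coat 836 [19,21,69] 182 64 [64,65,66,67,68,69],
    Coat 837 [25,69] 184 64 [64,65,66,67,68,69],
    Coat 838 [20,24,70] 194 64 [64,65,66,67,68,70],
    Coat 839 [24,25,70] 197 64 [64,65,66,67,68,70],
    Coat 840 [28,70] 199 64 [64,65,66,67,68,70],
    Coat 841 [70,31] 210 64 [64,65,66,67,68,70],
    Coat 842 [13,41,70] 272 64 [64,65,66,67,68,70],
    Coat 843 [19,42,69] 274 64 [64,65,66,67,68,69],
    Coat 844 [24,41,70] 279 64 [64,65,66,67,68,70],
    Coat 845 [25,42,69] 300 64 [64,65,66,67,68,69],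
    Coat 846 [24,25,41,70] 332 64 [64,65,66,67,68,70],
    Coat 847 [41,28,70] 338 64 [64,65,66,67,68,70],
    Coat 848 [41,70,31] 347 64 [64,65,66,67,68,70],
    Coat 849 [69,31,46] 357 64 [64,65,66,67,68,69],
    Coat 850 [69,48] 364 64 [64,65,66,67,68,69],
    Coat 851 [69,51] 366 64 [64,65,66,67,68,69],
    Up 852 [13,69,70] 842 835 69 41 64,
    Up 853 [19,69,70] 843 836 70 42 64,
    Up 854 [25,69,70] 845 837 70 42 64,
    Up 855 [24,69,70] 844 838 69 41 64,
    Up 856 [24,25,69,70] 846 839 69 41 64,
    Up 857 [28,69,70] 847 840 69 41 64,
    Up 858 [69,70,31] 848 841 69 41 64,
    Up 859 [44,69,70] 854 853 44 25 37,
    Up 860 [72] 859 854 72 44 64,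
    Up 861 [24,44,69,70] 856 855 44 25 37,
    Up 862 [24,72] 861 856 72 44 64,
    Up 863 [28,44,69,70] 861 859 28 24 6,
    Up 864 [28,72] 862 860 28 24 6,
    Up 865 [44,69,70,31] 863 861 31 28 5,
    Up 866 [69,70,46] 863 861 46 28 37,
    Up 867 [31,72] 864 862 31 28 5,
    Up 868 [46,72] 864 862 46 28 37,
    Up 869 [74] 868 864 74 46 64,
    Up 870 [69,70,31,46] 865 858 46 44 4,
    Up 871 [69,70,48] 870 866 48 31 37,
    Up 872 [69,70,51] 871 870 51 48 6,
    Up 873 [31,46,72] 870 849 72 70 2,
    Up 874 [72,48] 871 850 72 70 2,
    Up 875 [72,51] 872 851 72 70 2,
    Up 876 [31,74] 873 870 74 72 4,
    Up 877 [48,74] 874 871 74 72 4,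
    Up 878 [74,51] 875 872 74 72 4,
    Up 879 [76] 877 876 76 48 64,
    Up 880 [51,76] 878 875 76 74 5,
    Up 881 [79] 880 879 79 51 64,
    Up 882 [82] 881 880 82 79 37]]"

definition treeE6 :: tree where
  "treeE6 = Split 6 (Split 5 (Split 4 (Split 3 (Split 2 (Split 1 (Known 1) (Red 1)) (Red 2)) (Red 3)) (Split 3 (Red
   4) (Split 2 (Red 4) (Red 2)))) (Split 4 (Red 5) (Split 3 (Red 5) (Split 2 (Red 5) (Split 1 (Split 13 (Red 2)
   (Split 24 (Split 19 (Split 14 (Red 2) (Split 15 (Red 3) (Known 33))) (Known 38)) (Known 47))) (Split 12 (Red 1)
   (Split 13 (Red 1) (Split 24 (Split 19 (Split 14 (Red 2) (Split 15 (Red 1) (Split 17 (Red 1) (Split 18 (Red 1)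
   (Known 41))))) (Split 22 (Split 17 (Red 1) (Split 18 (Red 1) (Known 53))) (Known 54))) (Split 29 (Split 26 (Split
   22 (Split 17 (Red 1) (Split 18 (Red 1) (Known 68))) (Known 72)) (Known 86)) (Known 90)))))))))) (Split 5 (Red 6)
   (Split 4 (Red 5) (Split 3 (Red 6) (Split 2 (Red 6) (Split 1 (Split 13 (Red 2) (Split 16 (Red 6) (Split 24 (Split
   19 (Split 14 (Red 2) (Split 15 (Red 3) (Split 20 (Red 6) (Split 21 (Red 6) (Known 44))))) (Split 25 (Split 20
   (Red 6) (Split 21 (Red 6) (Known 59))) (Known 62))) (Split 31 (Split 28 (Split 25 (Split 20 (Red 6) (Split 21
   (Red 6) (Known 76))) (Known 79)) (Known 81)) (Known 97))))) (Split 12 (Red 1) (Split 13 (Red 1) (Split 16 (Red 6)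
   (Split 24 (Split 19 (Split 14 (Red 2) (Split 17 (Red 1) (Split 18 (Red 1) (Split 20 (Red 6) (Split 21 (Red 6)
   (Split 23 (Known 83) (Known 65))))))) (Split 22 (Split 25 (Split 17 (Red 1) (Split 18 (Red 1) (Split 20 (Red 6)
   (Split 21 (Red 6) (Split 23 (Known 107) (Known 116)))))) (Split 17 (Red 1) (Split 18 (Red 1) (Split 23 (Known
   108) (Known 112))))) (Split 25 (Split 20 (Red 6) (Split 21 (Red 6) (Split 23 (Known 109) (Known 113)))) (Split 23
   (Known 111) (Split 27 (Known 117) (Known 118)))))) (Split 29 (Split 31 (Split 26 (Split 28 (Split 22 (Split 25
   (Split 17 (Red 1) (Split 18 (Red 1) (Split 20 (Red 6) (Split 21 (Red 6) (Split 23 (Known 110) (Known 122))))))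
   (Split 17 (Red 1) (Split 18 (Red 1) (Split 23 (Known 115) (Known 127))))) (Split 25 (Split 20 (Red 6) (Split 21
   (Red 6) (Split 23 (Known 114) (Known 128)))) (Split 23 (Known 119) (Split 27 (Known 133) (Known 138))))) (Split
   22 (Split 17 (Red 1) (Split 18 (Red 1) (Split 23 (Known 121) (Known 126)))) (Split 23 (Known 125) (Split 27
   (Known 145) (Known 141))))) (Split 28 (Split 25 (Split 20 (Red 6) (Split 21 (Red 6) (Split 23 (Known 120) (Known
   124)))) (Split 23 (Known 123) (Split 27 (Known 147) (Known 142)))) (Split 27 (Split 23 (Known 129) (Known 151))
   (Split 30 (Known 155) (Known 159))))) (Split 26 (Split 22 (Split 17 (Red 1) (Split 18 (Red 1) (Split 23 (Known
   137) (Known 140)))) (Split 23 (Known 132) (Split 27 (Known 144) (Known 146)))) (Split 27 (Split 23 (Known 134)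
   (Known 150)) (Split 30 (Known 154) (Split 33 (Known 158) (Known 163)))))) (Split 31 (Split 28 (Split 25 (Split 20
   (Red 6) (Split 21 (Red 6) (Split 23 (Known 135) (Known 139)))) (Split 23 (Known 130) (Split 27 (Known 143) (Known
   148)))) (Split 27 (Split 23 (Known 131) (Known 149)) (Split 30 (Known 153) (Split 32 (Known 157) (Known 161)))))
   (Split 32 (Split 27 (Split 23 (Known 136) (Known 152)) (Split 30 (Known 156) (Split 33 (Known 160) (Known 162))))
   (Split 34 (Split 33 (Known 164) (Known 165)) (Split 35 (Known 166) (Split 36 (Known 167) (Known
   168))))))))))))))))"

definition treeE7 :: tree where
  "treeE7 = Split 37 treeE6 (Split 6 (Red 37) (Split 5 (Red 6) (Split 4 (Red 5) (Split 3 (Red 37) (Split 2 (Red 37)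
   (Split 1 (Split 13 (Red 2) (Split 16 (Red 37) (Split 39 (Red 37) (Split 24 (Split 19 (Split 14 (Red 2) (Split 15
   (Red 3) (Split 41 (Red 37) (Split 42 (Red 37) (Known 272))))) (Split 40 (Red 37) (Split 44 (Split 41 (Red 37)
   (Split 42 (Red 37) (Split 25 (Known 274) (Known 300)))) (Known 303)))) (Split 51 (Split 48 (Split 46 (Split 40
   (Red 37) (Split 44 (Split 41 (Red 37) (Split 42 (Red 37) (Split 28 (Split 25 (Known 279) (Known 332)) (Split 31
   (Known 338) (Known 347))))) (Split 28 (Known 337) (Split 31 (Known 345) (Known 355))))) (Split 31 (Known 346)
   (Known 357))) (Known 364)) (Known 366)))))) (Split 12 (Red 1) (Split 13 (Red 1) (Split 16 (Red 37) (Split 39 (Red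
   37) (Split 24 (Split 19 (Split 14 (Red 2) (Split 17 (Red 1) (Split 18 (Red 1) (Split 41 (Red 37) (Split 42 (Red
   37) (Split 23 (Known 277) (Split 43 (Known 283) (Known 278)))))))) (Split 22 (Split 17 (Red 1) (Split 18 (Red 1)
   (Split 40 (Red 37) (Split 44 (Split 41 (Red 37) (Split 42 (Red 37) (Split 25 (Split 23 (Known 282) (Split 43
   (Known 309) (Known 284))) (Split 23 (Known 316) (Split 43 (Known 311) (Known 306)))))) (Split 23 (Known 325)
   (Split 43 (Known 323) (Known 312))))))) (Split 40 (Red 37) (Split 44 (Split 41 (Red 37) (Split 42 (Red 37) (Split
   25 (Split 23 (Known 285) (Split 43 (Known 296) (Known 286))) (Split 27 (Split 23 (Known 326) (Split 43 (Known
   322) (Known 319))) (Split 43 (Known 330) (Known 320)))))) (Split 27 (Split 23 (Known 327) (Split 43 (Known 328)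
   (Known 321))) (Split 43 (Known 331) (Split 45 (Known 324) (Known 329)))))))) (Split 29 (Split 26 (Split 22 (Split
   17 (Red 1) (Split 18 (Red 1) (Split 51 (Split 48 (Split 46 (Split 40 (Red 37) (Split 44 (Split 41 (Red 37) (Split
   42 (Red 37) (Split 28 (Split 25 (Split 23 (Known 288) (Split 43 (Known 310) (Known 289))) (Split 23 (Known 372)
   (Split 43 (Known 382) (Known 398)))) (Split 31 (Split 23 (Known 374) (Split 43 (Known 378) (Known 411))) (Split
   23 (Known 402) (Split 43 (Known 415) (Known 466))))))) (Split 23 (Split 28 (Known 373) (Split 31 (Known 377)
   (Known 393))) (Split 43 (Split 28 (Known 386) (Split 31 (Known 380) (Known 403))) (Split 28 (Known 391) (Split 31
   (Known 400) (Known 475))))))) (Split 31 (Split 23 (Known 379) (Split 43 (Known 383) (Known 385))) (Split 23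
   (Known 414) (Split 43 (Known 416) (Known 482))))) (Split 23 (Known 424) (Split 43 (Known 504) (Known 492))))
   (Split 23 (Known 522) (Split 43 (Known 520) (Known 506)))))) (Split 51 (Split 48 (Split 46 (Split 40 (Red 37)
   (Split 44 (Split 41 (Red 37) (Split 42 (Red 37) (Split 28 (Split 25 (Split 23 (Known 291) (Split 43 (Known 313)
   (Known 290))) (Split 27 (Split 23 (Known 375) (Split 43 (Known 389) (Known 410))) (Split 43 (Known 412) (Known
   441)))) (Split 31 (Split 27 (Split 23 (Known 388) (Split 43 (Known 430) (Known 452))) (Split 43 (Known 421)
   (Known 445))) (Split 27 (Split 23 (Known 394) (Split 43 (Known 426) (Known 460))) (Split 43 (Known 429) (Known
   451))))))) (Split 27 (Split 23 (Split 28 (Known 376) (Split 31 (Known 381) (Known 387))) (Split 43 (Split 28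
   (Known 392) (Split 31 (Known 423) (Known 417))) (Split 28 (Known 399) (Split 31 (Known 461) (Known 470)))))
   (Split 43 (Split 28 (Known 401) (Split 31 (Known 413) (Known 422))) (Split 45 (Split 28 (Known 446) (Split 31
   (Known 453) (Known 455))) (Split 28 (Known 454) (Split 31 (Known 462) (Known 464)))))))) (Split 27 (Split 31
   (Split 23 (Known 384) (Split 43 (Known 479) (Known 471))) (Split 23 (Known 425) (Split 43 (Known 532) (Known
   521)))) (Split 31 (Split 43 (Known 481) (Split 45 (Known 472) (Known 463))) (Split 43 (Known 555) (Split 45
   (Known 540) (Known 562)))))) (Split 27 (Split 23 (Known 431) (Split 43 (Known 519) (Known 505))) (Split 43 (Known
   538) (Split 45 (Known 561) (Known 582))))) (Split 27 (Split 23 (Known 541) (Split 43 (Known 539) (Known 523)))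
   (Split 43 (Known 559) (Split 45 (Known 543) (Known 565)))))) (Split 51 (Split 48 (Split 46 (Split 40 (Red 37)
   (Split 44 (Split 41 (Red 37) (Split 42 (Red 37) (Split 27 (Split 28 (Split 25 (Split 23 (Known 292) (Split 43
   (Known 297) (Known 293))) (Split 23 (Known 405) (Split 43 (Known 437) (Known 442)))) (Split 31 (Split 23 (Known
   395) (Split 43 (Known 435) (Known 447))) (Split 23 (Known 404) (Split 43 (Known 433) (Known 456))))) (Split 43
   (Split 30 (Split 28 (Known 438) (Split 31 (Known 513) (Known 525))) (Split 31 (Known 535) (Split 33 (Known 546)
   (Known 569)))) (Split 30 (Split 28 (Known 439) (Split 31 (Known 578) (Known 595))) (Split 31 (Known 557) (Split
   33 (Known 601) (Known 588)))))))) (Split 43 (Split 31 (Split 27 (Split 23 (Split 28 (Known 406) (Known 396))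
   (Split 28 (Known 443) (Known 487))) (Split 28 (Known 440) (Split 30 (Known 499) (Known 514)))) (Split 27 (Split
   23 (Known 418) (Known 497)) (Split 30 (Known 508) (Split 33 (Known 526) (Known 549))))) (Split 31 (Split 28
   (Split 27 (Known 448) (Split 45 (Known 473) (Known 465))) (Split 30 (Split 27 (Known 490) (Split 45 (Known 593)
   (Known 605))) (Split 45 (Known 606) (Known 622)))) (Split 30 (Split 27 (Known 502) (Split 45 (Known 603) (Known
   620))) (Split 45 (Split 33 (Known 619) (Known 641)) (Split 33 (Known 640) (Known 642)))))))) (Split 30 (Split 27
   (Split 31 (Split 23 (Known 390) (Split 43 (Known 489) (Known 480))) (Split 23 (Known 427) (Split 43 (Known 511)
   (Known 517)))) (Split 31 (Split 43 (Known 501) (Split 45 (Known 643) (Known 621))) (Split 43 (Known 531) (Split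
   45 (Known 660) (Known 675))))) (Split 45 (Split 43 (Split 31 (Known 516) (Split 33 (Known 548) (Known 573)))
   (Split 31 (Known 623) (Split 33 (Known 639) (Known 662)))) (Split 47 (Split 31 (Known 644) (Split 33 (Known 661)
   (Known 677))) (Split 31 (Known 645) (Split 33 (Known 676) (Known 695))))))) (Split 30 (Split 27 (Split 23 (Known
   434) (Split 43 (Known 530) (Known 518))) (Split 43 (Known 553) (Split 45 (Known 674) (Known 692)))) (Split 45
   (Split 43 (Split 33 (Known 554) (Known 575)) (Split 33 (Known 693) (Known 678))) (Split 33 (Split 47 (Known 714)
   (Known 694)) (Split 47 (Known 696) (Split 50 (Known 698) (Known 717))))))) (Split 45 (Split 27 (Split 23 (Known
   563) (Split 43 (Known 560) (Known 542))) (Split 43 (Split 30 (Known 580) (Split 33 (Known 571) (Known 589)))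
   (Split 30 (Known 720) (Split 33 (Known 715) (Known 697))))) (Split 33 (Split 30 (Known 740) (Split 47 (Known 739)
   (Known 716))) (Split 50 (Split 47 (Known 719) (Known 718)) (Split 53 (Known 741) (Known 742))))))) (Split 51
   (Split 48 (Split 46 (Split 40 (Red 37) (Split 44 (Split 41 (Red 37) (Split 42 (Red 37) (Split 43 (Split 30 (Split
   28 (Split 23 (Split 25 (Known 295) (Known 420)) (Split 25 (Known 298) (Split 27 (Known 458) (Known 450)))) (Split
   31 (Split 23 (Known 408) (Split 27 (Known 468) (Known 498))) (Split 23 (Known 428) (Split 27 (Known 477) (Known
   507))))) (Split 34 (Split 32 (Split 31 (Known 512) (Split 33 (Known 524) (Known 545))) (Split 31 (Known 558)
   (Split 33 (Known 570) (Known 587)))) (Split 35 (Known 597) (Split 36 (Known 599) (Known 651))))) (Split 32 (Split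
   27 (Split 28 (Split 25 (Known 294) (Known 467)) (Split 31 (Known 476) (Known 484))) (Split 30 (Split 28 (Known
   459) (Split 31 (Known 556) (Known 577))) (Split 31 (Known 533) (Split 33 (Known 586) (Known 568))))) (Split 34
   (Split 31 (Known 579) (Split 33 (Known 617) (Known 600))) (Split 35 (Known 612) (Split 36 (Known 616) (Known
   667)))))))) (Split 43 (Split 32 (Split 31 (Split 27 (Split 23 (Split 28 (Known 409) (Known 407)) (Split 28 (Known
   449) (Known 478))) (Split 28 (Known 444) (Split 30 (Known 486) (Known 534)))) (Split 27 (Split 23 (Known 419)
   (Known 485)) (Split 30 (Known 495) (Split 33 (Known 544) (Known 566))))) (Split 34 (Split 31 (Known 536) (Split
   33 (Known 547) (Known 572))) (Split 35 (Known 584) (Split 36 (Known 615) (Known 634))))) (Split 32 (Split 31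
   (Split 28 (Split 27 (Known 457) (Split 45 (Known 469) (Known 474))) (Split 30 (Split 27 (Known 483) (Split 45
   (Known 576) (Known 594))) (Split 45 (Known 611) (Known 608)))) (Split 30 (Split 27 (Known 493) (Split 45 (Known
   592) (Known 604))) (Split 45 (Split 33 (Known 638) (Known 658)) (Split 33 (Known 657) (Known 666))))) (Split 45
   (Split 34 (Split 31 (Known 596) (Split 33 (Known 636) (Known 649))) (Split 35 (Known 628) (Split 36 (Known 635)
   (Known 681)))) (Split 34 (Split 31 (Known 610) (Split 33 (Known 656) (Known 664))) (Split 35 (Known 650) (Split
   36 (Known 654) (Known 665))))))))) (Split 45 (Split 32 (Split 27 (Split 31 (Split 23 (Known 397) (Split 43 (Known
   488) (Known 491))) (Split 23 (Known 432) (Split 43 (Known 496) (Known 494)))) (Split 43 (Split 30 (Split 31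
   (Known 500) (Known 509)) (Split 31 (Known 515) (Split 33 (Known 527) (Known 567)))) (Split 30 (Split 31 (Known
   624) (Known 670)) (Split 31 (Known 625) (Split 33 (Known 659) (Known 672)))))) (Split 43 (Split 34 (Split 31
   (Known 537) (Split 33 (Known 550) (Known 585))) (Split 35 (Known 598) (Split 36 (Known 613) (Known 630)))) (Split
   34 (Split 31 (Known 609) (Split 33 (Known 655) (Known 663))) (Split 35 (Known 669) (Split 36 (Known 653) (Known
   682)))))) (Split 47 (Split 33 (Split 31 (Split 30 (Known 607) (Split 32 (Known 646) (Known 626))) (Split 30
   (Known 687) (Split 32 (Known 673) (Known 671)))) (Split 34 (Split 32 (Known 690) (Known 679)) (Split 35 (Known
   685) (Split 36 (Known 706) (Known 701))))) (Split 34 (Split 31 (Split 32 (Known 648) (Split 49 (Known 627) (Known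
   647))) (Split 33 (Split 32 (Known 691) (Split 49 (Known 688) (Known 711))) (Split 32 (Known 699) (Split 49 (Known
   680) (Known 735))))) (Split 49 (Split 35 (Known 708) (Split 36 (Known 730) (Known 722))) (Split 35 (Known 732)
   (Split 36 (Known 757) (Known 745)))))))) (Split 47 (Split 43 (Split 32 (Split 27 (Split 23 (Known 436) (Known
   510)) (Split 30 (Known 528) (Split 33 (Known 529) (Known 551)))) (Split 34 (Split 33 (Known 552) (Known 632))
   (Split 35 (Known 614) (Split 36 (Known 629) (Known 631))))) (Split 45 (Split 32 (Split 30 (Split 27 (Known 503)
   (Known 686)) (Split 33 (Known 710) (Known 689))) (Split 34 (Split 33 (Known 726) (Known 704)) (Split 35 (Known
   684) (Split 36 (Known 668) (Known 700))))) (Split 34 (Split 32 (Split 30 (Known 709) (Split 33 (Known 733) (Known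
   712))) (Split 33 (Known 728) (Known 727))) (Split 35 (Known 705) (Split 36 (Known 729) (Known 721)))))) (Split 35
   (Split 49 (Split 32 (Split 33 (Known 713) (Split 50 (Known 736) (Known 738))) (Split 34 (Split 33 (Known 737)
   (Split 50 (Known 753) (Known 775))) (Split 50 (Known 767) (Known 770)))) (Split 34 (Split 33 (Known 734) (Split
   50 (Known 794) (Known 793))) (Split 50 (Known 784) (Split 52 (Known 786) (Known 788))))) (Split 52 (Split 49
   (Split 50 (Split 36 (Known 755) (Known 744)) (Split 36 (Known 756) (Known 746))) (Split 50 (Split 36 (Known 776)
   (Known 766)) (Split 36 (Known 778) (Known 768)))) (Split 36 (Split 54 (Known 795) (Known 796)) (Split 54 (Known
   769) (Split 56 (Known 785) (Known 787)))))))) (Split 53 (Split 47 (Split 43 (Split 32 (Split 27 (Split 23 (Known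
   583) (Known 581)) (Split 30 (Known 591) (Split 33 (Known 590) (Known 602)))) (Split 34 (Split 33 (Known 574)
   (Known 618)) (Split 35 (Known 633) (Split 36 (Known 637) (Known 652))))) (Split 45 (Split 32 (Split 30 (Split 27
   (Known 564) (Known 743)) (Split 33 (Known 765) (Known 751))) (Split 34 (Split 33 (Known 750) (Known 725)) (Split
   35 (Known 703) (Split 36 (Known 683) (Known 702))))) (Split 34 (Split 32 (Split 30 (Known 764) (Split 33 (Known
   763) (Known 773))) (Split 33 (Known 754) (Known 752))) (Split 35 (Known 707) (Split 36 (Known 731) (Known
   723)))))) (Split 35 (Split 49 (Split 32 (Split 33 (Known 783) (Split 50 (Known 791) (Known 790))) (Split 34
   (Split 33 (Known 762) (Split 50 (Known 774) (Known 780))) (Split 50 (Known 779) (Known 771)))) (Split 34 (Split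
   33 (Known 761) (Split 50 (Known 781) (Known 782))) (Split 50 (Known 772) (Split 52 (Known 799) (Known 801)))))
   (Split 52 (Split 49 (Split 50 (Split 36 (Known 758) (Known 724)) (Split 36 (Known 759) (Known 747))) (Split 50
   (Split 36 (Known 760) (Known 748)) (Split 36 (Known 800) (Known 803)))) (Split 36 (Split 54 (Known 804) (Known
   808)) (Split 54 (Known 806) (Split 56 (Known 811) (Known 816))))))) (Split 57 (Split 52 (Split 34 (Split 32
   (Known 798) (Split 49 (Known 792) (Known 797))) (Split 49 (Split 35 (Known 789) (Split 36 (Known 777) (Known
   749))) (Split 35 (Known 802) (Split 36 (Known 805) (Known 809))))) (Split 36 (Split 55 (Split 35 (Known 807)
   (Split 54 (Known 812) (Known 813))) (Split 35 (Known 810) (Split 54 (Known 814) (Known 817)))) (Split 55 (Split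
   54 (Known 815) (Split 56 (Known 818) (Known 822))) (Split 54 (Known 819) (Split 56 (Known 820) (Known 823))))))
   (Split 60 (Split 56 (Split 36 (Split 59 (Known 821) (Known 824)) (Split 59 (Known 825) (Known 826))) (Split 58
   (Split 59 (Known 827) (Known 828)) (Split 59 (Known 829) (Known 830)))) (Split 62 (Split 61 (Known 831) (Known
   832)) (Split 63 (Known 833) (Known 834)))))))))))))))))))"

text \<open>Lower sets without \<alpha>_8 are left to \<open>treeE7\<close>. Once all simple roots
  are present, the last splits ask for the two blocked pairs: without 1234 or 1345 the layer over
  \<alpha>_1 can be removed, without 245678 or 345678 the layer over \<alpha>_8.\<close>

definition treeE8 :: tree where
  "treeE8 = Split 64 treeE7 (Split 37 (Red 64) (Split 6 (Red 37) (Split 5 (Red 6) (Split 4 (Red 5) (Split 3 (Red 64)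
   (Split 2 (Red 64) (Split 1 (Split 13 (Red 2) (Split 16 (Red 64) (Split 39 (Red 64) (Split 66 (Red 64) (Split 24
   (Split 19 (Split 14 (Red 2) (Split 15 (Red 3) (Split 69 (Red 64) (Split 70 (Red 64) (Known 852))))) (Split 68
   (Red 64) (Split 72 (Split 69 (Red 64) (Split 70 (Red 64) (Split 25 (Known 853) (Split 44 (Known 854) (Known
   859))))) (Known 860)))) (Split 82 (Split 79 (Split 76 (Split 67 (Red 64) (Split 74 (Split 68 (Red 64) (Split 72
   (Split 69 (Red 64) (Split 70 (Red 64) (Split 31 (Split 28 (Split 25 (Known 855) (Split 44 (Known 856) (Known
   861))) (Split 44 (Known 857) (Split 46 (Known 863) (Known 866)))) (Split 46 (Split 44 (Known 858) (Known 865))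
   (Split 48 (Known 870) (Split 51 (Known 871) (Known 872))))))) (Split 31 (Split 28 (Known 862) (Split 46 (Known
   864) (Known 868))) (Split 48 (Split 46 (Known 867) (Known 873)) (Split 51 (Known 874) (Known 875)))))) (Split 48
   (Split 31 (Known 869) (Known 876)) (Split 51 (Known 877) (Known 878))))) (Split 51 (Known 879) (Known 880)))
   (Known 881)) (Known 882))))))) (Split 17 (Red 1) (Split 18 (Red 1) (Split 69 (Red 64) (Split 70 (Red 64)
   Bad)))))))))))"

text \<open>The checker expects the columns of the Cartan matrix. In type E the matrix is symmetric;
  for F4 and G2 the transposed matrices are written out.\<close>

definition colsE :: "int list list" where "colsE = cartan_matrix E8"

text \<open>The labels 37 and 64 belong to \<alpha>_7 and \<alpha>_8, the first roots listed after
  the 36 of E6 and the 63 of E7.\<close>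

definition simpleE :: "num list" where "simpleE = nums [1,2,3,4,5,6,37,64]"

text \<open>The roots 1234, 1345, 245678 and 345678, each the sum of the simple roots with these labels.\<close>

definition bad4 :: "num list" where "bad4 = nums [17,18,69,70]"

section \<open>Types F4 and G2\<close>

definition rootsF4 :: "int list list" where
  "rootsF4 = [[1,0,0,0], [0,1,0,0], [0,0,1,0], [0,0,0,1], [1,1,0,0], [0,1,1,0], [0,0,1,1], [1,1,1,0], [0,1,2,0],
   [0,1,1,1], [1,1,2,0], [1,1,1,1], [0,1,2,1], [1,2,2,0], [1,1,2,1], [0,1,2,2], [1,2,2,1], [1,1,2,2], [1,2,3,1],
   [1,2,2,2], [1,2,3,2], [1,2,4,2], [1,3,4,2], [2,3,4,2]]"

text \<open>Most stages have no steps and evaluate their own seed, which is cheap in rank 4. The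
  last two even use the empty parabolic part, so they enumerate all compatible sets.\<close>

definition certF4 :: "item list" where "certF4 = [Plain [Coat 2 [1] 1 1 [1],
    Coat 3 [2] 1 2 [2],
    Coat 4 [3] 1 3 [3],
    Coat 5 [1,3] 2 3 [3],
    Coat 6 [1,4] 2 4 [4],
    Coat 7 [5] 2 2 [2,5],
    Coat 8 [1,7] 5 4 [4,7],
    Coat 9 [4,5] 6 2 [2,5],
    Coat 10 [8] 7 3 [3,6,8]],
  Stage 11 [9] [1,3] [Coat 12 [8,9] 11 1 [1,5,8],
    Up 13 [11] 12 10 11 9 1,
    Up 14 [14] 13 12 14 11 2] 11 4 [1,1,0,1] [2,6,9],
  Stage 15 [16] [1,3,5] [] 15 11 [1,0,0,1] [4,7,10,13,16],
  Stage 16 [19] [1,4,5,7] [] 16 14 [0,0,0,1] [4,7,10,12,13,15,17,19],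
  Stage 17 [23] [1,5,7,10] [] 17 15 [1,0,0,0] [1,5,8,11,12,14,15,17,18,19,20,21,22,23],
  Stage 18 [24] [1,5,7,11] [] 18 15 [1,0,0,0] [1,5,8,11,12,14,15,17,18,19,20,21,22,23,24],
  Stage 19 [18] [1,4,5,6] [] 19 8 [0,1,0,0] [2,5,6,8,9,10,11,12,13,15,16,18],
  Stage 20 [14,16] [1,3,5,5] [] 20 11 [1,0,0,1] [1,4,5,7,8,10,11,13,14,16],
  Stage 21 [20] [1,5,6,7] [] 21 9 [0,0,1,0] [3,6,7,8,9,10,11,12,13,14,15,16,17,18,20],
  Stage 22 [17] [1,4,5,6] [] 22 7 [0,0,1,1] [3,4,6,7,8,9,10,11,12,13,14,15,17],
  Stage 23 [16,19] [1,5,5,7] [Up 24 [18,19] 23 16 18 16 1,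
    Up 25 [19,20] 24 23 20 18 2,
    Up 26 [21] 25 21 21 19 4,
    Mid 27 [22] 17 26 23 22 2] 23 11 [1,0,0,1] [1,4,5,7,8,10,11,12,13,14,15,16,17,19],
  Stage 28 [15] [1,4,4,5] [] 28 5 [0,1,0,1] [2,4,5,6,7,8,9,10,11,12,13,15],
  Stage 29 [14,15] [1,4,5,5] [] 29 5 [0,1,0,1] [2,4,5,6,7,8,9,10,11,12,13,14,15],
  Stage 30 [11,16] [1,3,4,5] [] 30 4 [1,1,0,1] [1,2,4,5,6,7,8,9,10,11,13,16],
  Stage 31 [14,18] [1,5,5,6] [] 31 5 [0,1,0,1] [2,4,5,6,7,8,9,10,11,12,13,14,15,16,18],
  Stage 32 [12,13,14] [1,4,4,5] [] 32 3 [1,0,1,1] [1,3,4,5,6,7,8,9,10,11,12,13,14],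
  Stage 33 [12,14,16] [1,4,5,5] [Up 34 [14,15,16] 33 20 15 12 3,
    Mid 35 [16,17] 23 34 19 17 3,
    Up 36 [17,18] 35 22 18 16 1] 33 3 [1,0,1,1] [1,3,4,5,6,7,8,9,10,11,12,13,14,16],
  Stage 37 [15,16] [1,4,5,5] [] 37 4 [1,1,0,1] [1,2,4,5,6,7,8,9,10,11,12,13,15,16],
  Stage 38 [11,12,13] [1,4,4,4] [] 38 1 [1,1,1,1] [1,2,3,4,5,6,7,8,9,10,11,12,13],
  Stage 39 [11,12,16] [1,4,4,5] [] 39 1 [1,1,1,1] [1,2,3,4,5,6,7,8,9,10,11,12,13,16]]"

definition treeF4 :: tree where
  "treeF4 = Split 4 (Split 3 (Split 2 (Split 1 (Known 1) (Red 1)) (Red 2)) (Split 2 (Red 3) (Split 1 (Split 9 (Red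
   2) (Known 11)) (Split 8 (Red 1) (Split 14 (Split 11 (Red 1) (Known 13)) (Known 14)))))) (Split 3 (Red 4) (Split 2
   (Red 3) (Split 1 (Split 9 (Red 2) (Split 10 (Red 4) (Split 13 (Red 4) (Split 16 (Red 4) (Known 15))))) (Split 8
   (Red 1) (Split 10 (Red 4) (Split 14 (Split 11 (Red 1) (Split 15 (Split 12 (Split 13 (Red 4) (Split 16 (Red 4)
   (Known 30))) (Split 13 (Red 4) (Split 16 (Known 38) (Known 39)))) (Split 16 (Known 28) (Split 18 (Known 37)
   (Known 19))))) (Split 19 (Split 17 (Split 15 (Split 12 (Split 13 (Red 4) (Split 16 (Red 4) (Known 20))) (Split 13
   (Red 4) (Split 16 (Known 32) (Known 33)))) (Split 16 (Known 29) (Split 18 (Known 34) (Known 31)))) (Split 18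
   (Split 16 (Known 22) (Known 35)) (Split 20 (Known 36) (Known 21)))) (Split 21 (Split 18 (Split 16 (Known 16)
   (Known 23)) (Split 20 (Known 24) (Known 25))) (Split 23 (Split 22 (Known 26) (Known 27)) (Split 24 (Known 17)
   (Known 18)))))))))))"

definition colsF4 :: "int list list" where "colsF4 = [[2,-1,0,0],[-1,2,-1,0],[0,-2,2,-1],[0,0,-1,2]]"

definition simpleF4 :: "num list" where "simpleF4 = nums [1,2,3,4]"

lemma preF4: "table_ok 4 4 (number num.One rootsF4) simpleF4 colsF4"
  by code_simp

lemma verifyF4: "verify (number num.One rootsF4) simpleF4 colsF4 certF4 None treeF4"
  by code_simp

definition rootsG2 :: "int list list" where
  "rootsG2 = [[1,0], [0,1], [1,1], [2,1], [3,1], [3,2]]"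

definition certG2 :: "item list" where "certG2 = [Plain [Coat 2 [1] 1 1 [1],
    Coat 3 [2] 1 2 [2]],
  Stage 4 [4] [1,3] [] 4 3 [1,0] [1,3,4],
  Stage 5 [5] [1,4] [Up 6 [6] 5 4 6 5 2] 5 2 [0,1] [2,3,4,5]]"

definition treeG2 :: tree where
  "treeG2 = Split 2 (Split 1 (Known 1) (Red 1)) (Split 1 (Red 2) (Split 4 (Red 1) (Split 6 (Split 5 (Known 4) (Known
   5)) (Known 6))))"

definition colsG2 :: "int list list" where "colsG2 = [[2,-3],[-1,2]]"

definition simpleG2 :: "num list" where "simpleG2 = nums [1,2]"

lemma preG2: "table_ok 2 2 (number num.One rootsG2) simpleG2 colsG2"
  by code_simp

lemma verifyG2: "verify (number num.One rootsG2) simpleG2 colsG2 certG2 None treeG2"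
  by code_simp

section \<open>Evaluation in types E6, E7 and E8\<close>

lemma preE6: "table_ok 6 8 (number num.One rootsE6) (take 6 simpleE) (take 6 colsE)"
  by code_simp

lemma verifyE6: "verify (number num.One rootsE6) (take 6 simpleE) (take 6 colsE) certE6 None treeE6"
  by code_simp

lemma preE7: "table_ok 7 8 (number num.One rootsE7) (take 7 simpleE) (take 7 colsE)"
  by code_simp

lemma verifyE7: "verify (number num.One rootsE7) (take 7 simpleE) (take 7 colsE) certE7 None treeE7"
  by code_simp

lemma preE8: "table_ok 8 8 (number num.One rootsE8) (take 8 simpleE) (take 8 colsE)"
  by code_simp

lemma verifyE8: "verify (number num.One rootsE8) (take 8 simpleE) (take 8 colsE) certE8 (Some bad4) treeE8"
  by code_simp

lemma count_aboveE8: "count_above (number num.One rootsE8) bad4 = 5366"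
  by code_simp

lemma count_avoidingE8: "count_avoiding (number num.One rootsE8) (tonum 3) = 858"
  by code_simp

lemma colsE_cartan:
  "list_all (\<lambda>i. list_all (\<lambda>j. take 6 colsE ! j ! i = cartan_matrix E6 ! i ! j) [0..<6]) [0..<6]"
  "list_all (\<lambda>i. list_all (\<lambda>j. take 7 colsE ! j ! i = cartan_matrix E7 ! i ! j) [0..<7]) [0..<7]"
  "list_all (\<lambda>i. list_all (\<lambda>j. take 8 colsE ! j ! i = cartan_matrix E8 ! i ! j) [0..<8]) [0..<8]"
  "list_all (\<lambda>i. list_all (\<lambda>j. colsF4 ! j ! i = cartan_matrix F4 ! i ! j) [0..<4]) [0..<4]"
  "list_all (\<lambda>i. list_all (\<lambda>j. colsG2 ! j ! i = cartan_matrix G2 ! i ! j) [0..<2]) [0..<2]"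
  by code_simp+

lemma bad4_ids: "set bad4 \<subseteq> fst ` set (number num.One rootsE8)" "tonum 3 \<in> fst ` set (number num.One rootsE8)"
proof -
  have "list_all (\<lambda>b. list_ex (\<lambda>k. b = fst k) (number num.One rootsE8)) (tonum 3 # bad4)" by code_simp
  then show "set bad4 \<subseteq> fst ` set (number num.One rootsE8)" "tonum 3 \<in> fst ` set (number num.One rootsE8)"
    by (auto simp: list_all_iff list_ex_iff image_iff)
qed

text \<open>This makes the two counted families disjoint: a lower set containing root 1234 also
  contains \<alpha>_3.\<close>

lemma alpha3_below: "mem (option_uni (lookup (down_trie (number num.One rootsE8) (number num.One rootsE8)) (hd bad4)) E) (tonum 3)"
  by code_simp

section \<open>From the certificates to the exceptional set\<close>

context based_root_system
begin

lemma coord_systemI: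
  assumes "\<And>i j. i < length as \<Longrightarrow> j < length as \<Longrightarrow> cartan_number (as ! i) (as ! j) = of_int (C ! i ! j)"
    and "distinct as" "set as = \<Delta>" "length as = n" "table_ok n N tab sl cols"
    and "list_all (\<lambda>i. list_all (\<lambda>j. cols ! j ! i = C ! i ! j) [0..<n]) [0..<n]"
  shows "coord_system \<Phi> \<Delta> (\<lambda>i. as ! i) n N tab sl cols"
proof (rule verified)
  show "\<Delta> = (\<lambda>i. as ! i) ` {..<n}" using assms(3,4) by (auto simp: set_conv_nth)
  show "inj_on (\<lambda>i. as ! i) {..<n}" using assms(2,4) by (simp add: inj_on_nth)
  show "of_int (cols ! j ! i) = cartan_number (as ! i) (as ! j)" if "i < n" "j < n" for i j
    using assms(1,4,6) that by (simp add: list_all_iff)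
qed (rule assms(5))

lemma good_verified:
  assumes "coord_system \<Phi> \<Delta> \<alpha> n N tab sl cols" "verify tab sl cols its None tr" "lower R"
  shows "good R"
proof -
  interpret c: coord_system \<Phi> \<Delta> \<alpha> n N tab sl cols by fact
  show ?thesis using c.verify_sound[OF assms(2) _ assms(3)] by (simp add: c.covered_def)
qed

text \<open>In type \<open>E8\<close> every lower set that is not good contains the roots in \<open>bad4\<close>. There are 5366 such lower sets, and
  858 others avoid the third simple root. As 5366 is at most 6178 and 5366 + 858 is at least 6178, the complements of the lower sets that are not
  good are part of a set of exactly 6178 ideals.\<close>

lemma exceptional_set:
  assumes "of_exceptional_type \<Delta> X"
  shows "\<exists>Exc. Exc \<subseteq> {I. root_ideal P I} \<and> (if X = E8 then card Exc = 6178 else Exc = {}) \<and>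
    (\<forall>I. root_ideal P I \<and> I \<notin> Exc \<longrightarrow> good (P - I))"
proof -
  obtain as where as: "distinct as" "set as = \<Delta>" "length as = length (cartan_matrix X)"
    "\<And>i j. i < length as \<Longrightarrow> j < length as \<Longrightarrow> cartan_number (as ! i) (as ! j) = of_int (cartan_matrix X ! i ! j)"
    using assms by (auto simp: of_exceptional_type_def)
  have I: "coord_system \<Phi> \<Delta> (\<lambda>i. as ! i) n N tab sl cols"
    if "length as = n" "table_ok n N tab sl cols"
      "list_all (\<lambda>i. list_all (\<lambda>j. cols ! j ! i = cartan_matrix X ! i ! j) [0..<n]) [0..<n]" for n N tab sl cols
    by (rule coord_systemI[OF _ as(1,2) that]) (rule as(4))
  have low: "lower (P - I)" if "root_ideal P I" for I
    using that lower_iff_ideal[of "P - I"] by (auto simp: root_ideal_def double_diff)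
  have all: ?thesis if "\<And>R. lower R \<Longrightarrow> good R" "X \<noteq> E8"
    using that low by (intro exI[of _ "{}"]) auto
  show ?thesis
  proof (cases X)
    case E6
    then have "coord_system \<Phi> \<Delta> (\<lambda>i. as ! i) 6 8 (number num.One rootsE6) (take 6 simpleE) (take 6 colsE)"
      using I[OF _ preE6] colsE_cartan(1) as(3) by simp
    then show ?thesis using all good_verified[OF _ verifyE6] E6 by simp
  next
    case E7
    then have "coord_system \<Phi> \<Delta> (\<lambda>i. as ! i) 7 8 (number num.One rootsE7) (take 7 simpleE) (take 7 colsE)"
      using I[OF _ preE7] colsE_cartan(2) as(3) by simp
    then show ?thesis using all good_verified[OF _ verifyE7] E7 by simp
  next
    case F4
    then have "coord_system \<Phi> \<Delta> (\<lambda>i. as ! i) 4 4 (number num.One rootsF4) simpleF4 colsF4"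
      using I[OF _ preF4] colsE_cartan(4) as(3) by simp
    then show ?thesis using all good_verified[OF _ verifyF4] F4 by simp
  next
    case G2
    then have "coord_system \<Phi> \<Delta> (\<lambda>i. as ! i) 2 2 (number num.One rootsG2) simpleG2 colsG2"
      using I[OF _ preG2] colsE_cartan(5) as(3) by simp
    then show ?thesis using all good_verified[OF _ verifyG2] G2 by simp
  next
    case E8
    then have cs: "coord_system \<Phi> \<Delta> (\<lambda>i. as ! i) 8 8 (number num.One rootsE8) (take 8 simpleE) (take 8 colsE)"
      using I[OF _ preE8] colsE_cartan(3) as(3) by simp
    interpret c: coord_system \<Phi> \<Delta> "\<lambda>i. as ! i" 8 8 "number num.One rootsE8" "take 8 simpleE" "take 8 colsE"
      by (rule cs)
    let ?A = "{R. lower R \<and> c.root ` set bad4 \<subseteq> R}" and ?B = "{R. lower R \<and> c.root (tonum 3) \<notin> R}"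
    let ?I = "{I. root_ideal P I}"
    define Bad where "Bad = {I. root_ideal P I \<and> \<not> good (P - I)}"
    have cA: "card ?A = 5366" using c.count_above_card[OF bad4_ids(1)] count_aboveE8 by simp
    have cB: "card ?B = 858" using c.count_avoiding_card[OF bad4_ids(2)] count_avoidingE8 by simp
    have cov: "c.root ` set bad4 \<subseteq> R" if "lower R" "\<not> good R" for R
      using c.verify_sound[OF verifyE8 _ that(1)] bad4_ids(1) that(2) unfolding c.covered_def by auto
    have finL: "finite {R. lower R}" using finite_ideals[OF finite_P] by (simp add: lower_ideals)
    have bij: "bij_betw (\<lambda>I. P - I) ?I {R. lower R}"
    proof (rule bij_betwI[where g = "\<lambda>R. P - R"])
      show "(\<lambda>I. P - I) \<in> ?I \<rightarrow> {R. lower R}" using low by blast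
      show "(\<lambda>R. P - R) \<in> {R. lower R} \<rightarrow> ?I"
        using lower_iff_ideal lower_P by blast
      show "P - (P - I) = I" if "I \<in> ?I" for I using that by (auto simp: root_ideal_def)
      show "P - (P - R) = R" if "R \<in> {R. lower R}" for R using that lower_P by blast
    qed
    have finI: "finite ?I" using bij finL by (simp add: bij_betw_finite)
    have BadI: "Bad \<subseteq> ?I" by (auto simp: Bad_def)
    have "card Bad \<le> card ?A"
    proof (rule card_inj_on_le)
      show "inj_on (\<lambda>I. P - I) Bad" using bij BadI by (auto simp: bij_betw_def intro: inj_on_subset)
      show "(\<lambda>I. P - I) ` Bad \<subseteq> ?A" using low cov by (auto simp: Bad_def)
      show "finite ?A" using finL by (rule rev_finite_subset) auto
    qed
    moreover have "card ?A + card ?B \<le> card ?I"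
    proof -
      have three: "c.root (tonum 3) \<in> R" if "R \<in> ?A" for R
      proof -
        have ids: "hd bad4 \<in> set bad4" by (simp add: bad4_def)
        have m: "le (c.root (tonum 3)) (c.root (hd bad4))"
          using alpha3_below c.down_mem[OF bad4_ids(2), of "hd bad4" E] bad4_ids(1) ids by auto
        have "c.root (tonum 3) \<in> P" using bad4_ids(2) c.root_ids by blast
        then show ?thesis using lower_le[of R "c.root (hd bad4)"] that m ids by auto
      qed
      have "finite ?A" "finite ?B" using finL by (auto elim: rev_finite_subset)
      then have "card ?A + card ?B = card (?A \<union> ?B)"
        using three by (subst card_Un_disjoint) auto
      also have "\<dots> \<le> card {R. lower R}" using finL by (intro card_mono) auto
      also have "\<dots> = card ?I" using bij_betw_same_card[OF bij] by simp
      finally show ?thesis .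
    qed
    ultimately have "card Bad \<le> 6178" "6178 \<le> card ?I" using cA cB by auto
    then obtain Exc where "Bad \<subseteq> Exc" "Exc \<subseteq> ?I" "card Exc = 6178"
      using exists_subset_between[OF _ _ BadI finI] by blast
    then show ?thesis using E8 by (intro exI[of _ Exc]) (auto simp: Bad_def)
  qed
qed

end

theorem theorem1p28:
  fixes \<Phi> \<Delta> P :: "'a::euclidean_space set" and X :: exceptional_type
  assumes "irreducible_root_system \<Phi>"
    and "simple_roots \<Phi> \<Delta>"
    and "of_exceptional_type \<Delta> X"
    and "P = positive_roots \<Phi> \<Delta>"
  shows "\<exists>Exc. Exc \<subseteq> {I. root_ideal P I} \<and>
           (if X = E8 then card Exc = 6178 else Exc = {}) \<and>
           (\<forall>I. root_ideal P I \<and> I \<notin> Exc \<longrightarrow>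
              ideal_poincare P I =
                (\<Prod>i = 1..height_count \<Delta> P I 1. \<Sum>k\<le>ideal_exponent \<Delta> P I i. monom 1 k))"
proof -
  interpret based_root_system \<Phi> \<Delta>
    by unfold_locales (use assms(1,2) in \<open>auto simp: irreducible_root_system_def\<close>)
  show ?thesis
    using exceptional_set[OF assms(3)] good_product unfolding assms(4) by metis
qed

end
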